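(* There exist absolute constants $C>0$ and $K\geq 1$ (independent of $\epsilon$, of $L$, and of the domain $\Omega$) such that the following holds for every planar convex domain $\Omega$ normalised as in the context, with length scale $L$, first Dirichlet eigenfunction $u$, and maximum point $(x^*,y^* )$ of $u$. For every $0<\epsilon\leq \tfrac12$ there exists a rectangle $R_{1-\epsilon}$, centred at $(x^*,y^* )$ and with axes parallel to the coordinate directions, such that $R_{1-\epsilon}\subset \Omega_{1-\epsilon}$, the dilation of $R_{1-\epsilon}$ about its centre by the factor $K$ contains $\Omega_{1-\epsilon}$, and, denoting by $I^{x}_{1-\epsilon}$ and $I^{y}_{1-\epsilon}$ the projections of $R_{1-\epsilon}$ onto the $x$- and $y$-axes respectively, $$C^{-1}\sqrt{\epsilon}\,L \leq \left|I_{1-\epsilon}^{x}\right| \leq C\sqrt{\epsilon}\,L, \qquad C^{-1}\sqrt{\epsilon} \leq \left|I_{1-\epsilon}^{y}\right| \leq C\sqrt{\epsilon}.$$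
   Context: Domain: $\Omega\subset\mathbb{R}^2$ is a bounded convex domain, normalised (by a rotation, dilation and translation) so that its projection onto the $y$-axis is the smallest among its projections onto all directions, and $$\Omega=\{(x,y)\in\mathbb{R}^2: x\in[a,b],\ f_1(x)\leq y\leq f_2(x)\},$$ where $f_1$ is convex and $f_2$ is concave on $[a,b]$, $\min_{[a,b]}f_1=0$ and $\max_{[a,b]}f_2=1$. No further regularity of $\partial\Omega$ is assumed. Length scale: let $h(x)=f_2(x)-f_1(x)$ (a concave function on $[a,b]$). $L$ is the largest value such that $h(x)\geq 1-L^{-2}$ for all $x\in I$, for some interval $I\subset[a,b]$ of length at least $L$. Eigenfunction: $\lambda$ is the first Dirichlet eigenvalue of $\Omega$ and $u$ the corresponding eigenfunction, $\Delta u=-\lambda u$ in $\Omega$, $u=0$ on $\partial\Omega$, normalised to be positive inside $\Omega$ with maximum value $1$, attained at $(x^*,y^* )$. Superlevel sets: $\Omega_c=\{(x,y)\in\Omega: u(x,y)\geq c\}$; these are convex since $u$ is log concave. For each $c$, $R_c$ denotes a rectangle (as provided by the John lemma) contained in $\Omega_c$ such that a dilation of $R_c$ about its centre, with dilation factor bounded by an absolute constant, contains $\Omega_c$. An absolute constant is one that does not depend on $\Omega$ or $L$. $|I|$ denotes the length of an interval $I$. *)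

theory Defs
  imports "HOL-Analysis.Analysis"
begin

text \<open>
  The plane is \<^typ>\<open>real \<times> real\<close>, whose norm and inner product are the Euclidean ones. Intervals
  are measured by \<^term>\<open>measure lborel\<close>; only bounded intervals occur.
\<close>

definition partial_x :: "(real \<times> real \<Rightarrow> real) \<Rightarrow> real \<times> real \<Rightarrow> real" where
  "partial_x u p = deriv (\<lambda>s. u (s, snd p)) (fst p)"

definition partial_y :: "(real \<times> real \<Rightarrow> real) \<Rightarrow> real \<times> real \<Rightarrow> real" where
  "partial_y u p = deriv (\<lambda>t. u (fst p, t)) (snd p)"

definition C1_on :: "(real \<times> real) set \<Rightarrow> (real \<times> real \<Rightarrow> real) \<Rightarrow> bool" where
  "C1_on S u \<longleftrightarrow> (\<forall>p\<in>S. u differentiable (at p))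
     \<and> continuous_on S (partial_x u) \<and> continuous_on S (partial_y u)"

definition C2_on :: "(real \<times> real) set \<Rightarrow> (real \<times> real \<Rightarrow> real) \<Rightarrow> bool" where
  "C2_on S u \<longleftrightarrow> C1_on S u \<and> C1_on S (partial_x u) \<and> C1_on S (partial_y u)"

definition laplacian :: "(real \<times> real \<Rightarrow> real) \<Rightarrow> real \<times> real \<Rightarrow> real" where
  "laplacian u p = partial_x (partial_x u) p + partial_y (partial_y u) p"

text \<open>
  Dirichlet eigenfunctions are taken in the classical sense: continuous up to the boundary and
  twice continuously differentiable inside. On a bounded convex domain, where every boundary point
  is regular, these are exactly the weak eigenfunctions. Since \<open>\<Omega>\<close> may contain boundary points,
  the open domain is \<^term>\<open>interior \<Omega>\<close>. Values of \<open>u\<close> outside \<^term>\<open>closure \<Omega>\<close> are irrelevant.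
\<close>

definition dirichlet_eigenfunction ::
    "(real \<times> real) set \<Rightarrow> real \<Rightarrow> (real \<times> real \<Rightarrow> real) \<Rightarrow> bool" where
  "dirichlet_eigenfunction \<Omega> ev u \<longleftrightarrow>
     continuous_on (closure \<Omega>) u \<and> C2_on (interior \<Omega>) u
     \<and> (\<forall>p\<in>interior \<Omega>. laplacian u p = - ev * u p)
     \<and> (\<forall>p\<in>frontier \<Omega>. u p = 0)
     \<and> (\<exists>p\<in>interior \<Omega>. u p \<noteq> 0)"

definition dirichlet_eigenvalue :: "(real \<times> real) set \<Rightarrow> real \<Rightarrow> bool" where
  "dirichlet_eigenvalue \<Omega> ev \<longleftrightarrow> (\<exists>u. dirichlet_eigenfunction \<Omega> ev u)"

definition first_dirichlet_eigenvalue :: "(real \<times> real) set \<Rightarrow> real \<Rightarrow> bool" where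
  "first_dirichlet_eigenvalue \<Omega> ev \<longleftrightarrow>
     dirichlet_eigenvalue \<Omega> ev \<and> (\<forall>\<mu>. dirichlet_eigenvalue \<Omega> \<mu> \<longrightarrow> ev \<le> \<mu>)"

definition normalised_first_eigenfunction ::
    "(real \<times> real) set \<Rightarrow> (real \<times> real \<Rightarrow> real) \<Rightarrow> real \<times> real \<Rightarrow> bool" where
  "normalised_first_eigenfunction \<Omega> u pmax \<longleftrightarrow>
     (\<exists>ev. first_dirichlet_eigenvalue \<Omega> ev \<and> dirichlet_eigenfunction \<Omega> ev u)
     \<and> (\<forall>p\<in>interior \<Omega>. 0 < u p)
     \<and> pmax \<in> \<Omega> \<and> u pmax = 1 \<and> (\<forall>p\<in>\<Omega>. u p \<le> 1)"

definition superlevel :: "(real \<times> real) set \<Rightarrow> (real \<times> real \<Rightarrow> real) \<Rightarrow> real \<Rightarrow> (real \<times> real) set" where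
  "superlevel \<Omega> u c = {p \<in> \<Omega>. c \<le> u p}"

definition projection_length :: "real \<times> real \<Rightarrow> (real \<times> real) set \<Rightarrow> real" where
  "projection_length v S = measure lborel ((\<lambda>p. p \<bullet> v) ` S)"

text \<open>
  \<open>f1\<close> and \<open>f2\<close> are not assumed continuous at \<open>a\<close> and \<open>b\<close>, so \<open>\<Omega>\<close> need not be closed. The
  condition \<open>f1 \<le> f2\<close> says that \<open>[a, b]\<close> is the projection of \<open>\<Omega>\<close> onto the \<open>x\<close>-axis.
\<close>

definition normalised_domain ::
    "(real \<times> real) set \<Rightarrow> real \<Rightarrow> real \<Rightarrow> (real \<Rightarrow> real) \<Rightarrow> (real \<Rightarrow> real) \<Rightarrow> bool" where
  "normalised_domain \<Omega> a b f1 f2 \<longleftrightarrow>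
     a < b \<and> convex_on {a..b} f1 \<and> concave_on {a..b} f2
     \<and> (\<forall>x\<in>{a..b}. f1 x \<le> f2 x)
     \<and> \<Omega> = {(x, y). x \<in> {a..b} \<and> f1 x \<le> y \<and> y \<le> f2 x}
     \<and> (\<exists>x\<in>{a..b}. f1 x = 0) \<and> (\<forall>x\<in>{a..b}. 0 \<le> f1 x)
     \<and> (\<exists>x\<in>{a..b}. f2 x = 1) \<and> (\<forall>x\<in>{a..b}. f2 x \<le> 1)
     \<and> (\<forall>v. norm v = 1 \<longrightarrow> projection_length (0, 1) \<Omega> \<le> projection_length v \<Omega>)"

text \<open>
  The interval \<open>I\<close> need not be closed; this makes the largest value exist even when the height
  function \<open>f2 - f1\<close> jumps at an endpoint of \<open>[a, b]\<close>.
\<close>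

definition admissible_length ::
    "real \<Rightarrow> real \<Rightarrow> (real \<Rightarrow> real) \<Rightarrow> (real \<Rightarrow> real) \<Rightarrow> real \<Rightarrow> bool" where
  "admissible_length a b f1 f2 L \<longleftrightarrow> 0 < L \<and>
     (\<exists>I. is_interval I \<and> I \<subseteq> {a..b} \<and> L \<le> measure lborel I
        \<and> (\<forall>x\<in>I. 1 - 1 / L\<^sup>2 \<le> f2 x - f1 x))"

definition length_scale ::
    "real \<Rightarrow> real \<Rightarrow> (real \<Rightarrow> real) \<Rightarrow> (real \<Rightarrow> real) \<Rightarrow> real \<Rightarrow> bool" where
  "length_scale a b f1 f2 L \<longleftrightarrow> admissible_length a b f1 f2 L
     \<and> (\<forall>L'. admissible_length a b f1 f2 L' \<longrightarrow> L' \<le> L)"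

definition axis_rectangle :: "real \<times> real \<Rightarrow> (real \<times> real) set \<Rightarrow> bool" where
  "axis_rectangle c R \<longleftrightarrow> (\<exists>w>0. \<exists>h>0. R = cbox (c - (w, h)) (c + (w, h)))"

definition dilation :: "real \<times> real \<Rightarrow> real \<Rightarrow> (real \<times> real) set \<Rightarrow> (real \<times> real) set" where
  "dilation c K S = (\<lambda>p. c + K *\<^sub>R (p - c)) ` S"

end

theory Submission
 imports Defs
begin

text \<open>
 The ground state \<open>u\<close> is log-concave, so both inclusions follow once minus the Hessian of \<open>ln u\<close> is
 comparable to \<open>diag (1 / L^2, 1)\<close> on a rectangle of size comparable to \<open>L\<close> by \<open>1\<close> around the maximum.
 Everything rests on the maximum principle: minus a second derivative of \<open>ln u\<close>, times \<open>u\<close>, is a supersolution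
 of a Helmholtz equation, so a lower bound at one point propagates along chains of discs.
 For bounded \<open>L\<close> such a point lies on every ray from the maximum, since \<open>ln u\<close> decreases from \<open>0\<close>.
 For large \<open>L\<close> barriers show that \<open>u\<close> lives within distance of order \<open>L\<close> of the maximum and is comparable
 to the distance to the boundary in a tube of length of order \<open>L\<close>. The decay of \<open>u\<close> at the far end
 makes the flux of the Wronskian of \<open>u\<close> and its unit translate, which is almost monotone in \<open>x\<close>,
 at least of order \<open>1 / L^2\<close> at the maximum. This forces \<open>- (ln u)_xx\<close> to be of that order at some point
 nearby. The mixed derivative \<open>(ln u)_xy\<close> is small compared with \<open>1 / L\<close>, and \<open>- (ln u)_yy\<close> is of order \<open>1\<close>
 because the trace of the Hessian is at most \<open>- k\<close>.
\<close>

text \<open>The bound for -(ln u)_xx at the maximum has order 1 / L^2, and its source, the decay of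
  \<open>u\<close>, lies at distance of order L. A chain of discs of bounded size over that distance
  would lose a factor exponential in L. The flux carries the information without such a loss: up to
  truncation it is divergence-free, since \<open>u\<close> and its translate solve the same
  equation, and nonnegative by log-concavity. Chains are used over bounded distances only.

  At the boundary only continuity of \<open>u\<close> is known. So the flux is truncated to where
  the translate exceeds \<open>de\<close>, with an error of order \<open>de\<close>, and boundary
  behaviour is read off from explicit barriers.

  L enters through two effects that balance: a rectangle of length about L and height about 1 - 2 /
  L^2 inside the domain gives k <= pi^2 + 100 / L^2, while maximality of L costs the slices 1 / (4 *
  L^2) of height at distance 2 * L from a full vertical chord, and \<open>m\<close> times that at
  distance 2 * L * m. Beyond 100 * L this loss outweighs the excess of k over pi^2, and
  \<open>u\<close> decays at rate 5 / L.\<close>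

abbreviation px where "px \<equiv> partial_x"
abbreviation py where "py \<equiv> partial_y"

section \<open>Pointwise second derivatives and the maximum principle\<close>

text \<open>A relation rather than nested \<open>deriv\<close> terms: it carries existence together
  with the values, so sums, products and compositions need no side conditions. The slope has to
  exist near \<open>t\<close> for its derivative at \<open>t\<close> to make sense.\<close>

definition sd2 :: "(real => real) => real => real => real => bool" where
 "sd2 g t b a \<longleftrightarrow> (\<exists>g'. (\<forall>\<^sub>F s in nhds t. (g has_real_derivative g' s) (at s)) & g' t = b
   & (g' has_real_derivative a) (at t))"

lemma sd2I:
 assumes "!!s. (g has_real_derivative g' s) (at s)" "(g' has_real_derivative a) (at t)" "g' t = b"
 shows "sd2 g t b a"
 unfolding sd2_def using assms by (intro exI[of _ g']) auto

lemma sd2I_open: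
 assumes "open S" "t \<in> S" "!!s. s \<in> S ==> (g has_real_derivative g' s) (at s)"
  "(g' has_real_derivative a) (at t)" "g' t = b"
 shows "sd2 g t b a"
 unfolding sd2_def using assms eventually_nhds_in_open[OF assms(1,2)]
 by (intro exI[of _ g']) (auto elim: eventually_mono)

lemma sd2_const: "sd2 (%_. c) t 0 0"
 by (rule sd2I[where g' = "%_. 0"]) auto

lemma sd2_add:
 assumes "sd2 f t b a" "sd2 g t d c"
 shows "sd2 (%s. f s + g s) t (b + d) (a + c)"
proof -
 obtain f' g' where *: "\<forall>\<^sub>F s in nhds t. (f has_real_derivative f' s) (at s)" "f' t = b"
   "(f' has_real_derivative a) (at t)" "\<forall>\<^sub>F s in nhds t. (g has_real_derivative g' s) (at s)"
   "g' t = d" "(g' has_real_derivative c) (at t)"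
  using assms unfolding sd2_def by auto
 have "\<forall>\<^sub>F s in nhds t. ((%s. f s + g s) has_real_derivative (f' s + g' s)) (at s)"
  using *(1,4) by eventually_elim (auto intro: DERIV_add)
 with * show ?thesis unfolding sd2_def
  by (intro exI[of _ "%s. f' s + g' s"]) (auto intro!: derivative_eq_intros)
qed

lemma sd2_mult:
 assumes "sd2 f t b a" "sd2 g t d c"
 shows "sd2 (%s. f s * g s) t (b * g t + f t * d) (a * g t + 2 * b * d + f t * c)"
proof -
 obtain f' g' where *: "\<forall>\<^sub>F s in nhds t. (f has_real_derivative f' s) (at s)" "f' t = b"
   "(f' has_real_derivative a) (at t)" "\<forall>\<^sub>F s in nhds t. (g has_real_derivative g' s) (at s)"
   "g' t = d" "(g' has_real_derivative c) (at t)"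
  using assms unfolding sd2_def by auto
 have 1: "\<forall>\<^sub>F s in nhds t. ((%s. f s * g s) has_real_derivative (f' s * g s + f s * g' s)) (at s)"
  using *(1,4) by eventually_elim (auto intro!: derivative_eq_intros)
 have "(f has_real_derivative b) (at t)" "(g has_real_derivative d) (at t)"
  using eventually_nhds_x_imp_x[OF *(1)] eventually_nhds_x_imp_x[OF *(4)] * by auto
 then have "((%s. f' s * g s + f s * g' s) has_real_derivative (a * g t + 2 * b * d + f t * c)) (at t)"
  using * by (auto intro!: derivative_eq_intros simp: algebra_simps)
 with 1 * show ?thesis unfolding sd2_def
  by (intro exI[of _ "%s. f' s * g s + f s * g' s"]) auto
qed

lemma sd2_cmult: "sd2 f t b a ==> sd2 (%s. c * f s) t (c * b) (c * a)"
 using sd2_mult[OF sd2_const[of c]] by fastforce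

lemma sd2_compose:
 assumes f: "sd2 f t b a" and F: "sd2 F (f t) d c"
 shows "sd2 (%s. F (f s)) t (d * b) (c * b^2 + d * a)"
proof -
 obtain f' F' where *: "\<forall>\<^sub>F s in nhds t. (f has_real_derivative f' s) (at s)" "f' t = b"
   "(f' has_real_derivative a) (at t)" "\<forall>\<^sub>F s in nhds (f t). (F has_real_derivative F' s) (at s)"
   "F' (f t) = d" "(F' has_real_derivative c) (at (f t))"
  using assms unfolding sd2_def by auto
 have ft: "(f has_real_derivative b) (at t)" using eventually_nhds_x_imp_x[OF *(1)] * by auto
 then have "filterlim f (nhds (f t)) (nhds t)"
  using DERIV_isCont isCont_def continuous_at tendsto_at_iff_tendsto_nhds by blast
 then have "\<forall>\<^sub>F s in nhds t. (F has_real_derivative F' (f s)) (at (f s))"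
  using *(4) by (rule eventually_compose_filterlim[rotated])
 with *(1) have 1: "\<forall>\<^sub>F s in nhds t. ((%s. F (f s)) has_real_derivative (F' (f s) * f' s)) (at s)"
  by eventually_elim (auto intro: DERIV_chain2)
 have "((%s. F' (f s)) has_real_derivative c * b) (at t)"
  using DERIV_chain2[OF *(6) ft] .
 then have "((%s. F' (f s) * f' s) has_real_derivative (c * b^2 + d * a)) (at t)"
  using * by (auto intro!: derivative_eq_intros simp: power2_eq_square algebra_simps)
 with 1 * show ?thesis unfolding sd2_def
  by (intro exI[of _ "%s. F' (f s) * f' s"]) auto
qed

lemma sd2_affine:
 assumes "sd2 f (m * t + c) b a"
 shows "sd2 (%s. f (m * s + c)) t (m * b) (m^2 * a)"
proof -
 have "sd2 (%s. m * s + c) t m 0"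
  by (rule sd2I[where g' = "%_. m"]) (auto intro!: derivative_eq_intros)
 from sd2_compose[OF this assms] show ?thesis by (simp add: mult.commute)
qed

lemma sd2_local_max:
 assumes "sd2 g t b a" and max: "\<forall>\<^sub>F s in nhds t. g s <= g t"
 shows "b = 0" "a <= 0"
proof -
 obtain g' where *: "\<forall>\<^sub>F s in nhds t. (g has_real_derivative g' s) (at s)" "g' t = b"
   "(g' has_real_derivative a) (at t)" using assms unfolding sd2_def by auto
 obtain d where d: "d > 0" "!!s. dist s t < d ==> g s <= g t & (g has_real_derivative g' s) (at s)"
  using eventually_conj[OF max *(1)] unfolding eventually_nhds_metric by auto
 have "(g has_real_derivative b) (at t)" using d(2)[of t] d(1) * by auto
 from DERIV_local_max[OF this d(1)] d(2) show b: "b = 0" by (auto simp: dist_real_def)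
 show "a <= 0"
 proof (rule ccontr)
  assume "\<not> a <= 0"
  then obtain e where e: "e > 0" "!!h. h > 0 ==> h < e ==> g' t < g' (t + h)"
   using DERIV_pos_inc_right[OF *(3)] by auto
  define m where "m = min d e / 2"
  have m: "m > 0" "m < d" "m < e" using d(1) e(1) by (auto simp: m_def)
  obtain z where z: "t < z" "z < t + m" "g (t + m) - g t = (t + m - t) * g' z"
   using MVT2[of t "t + m" g g'] d(2) m by (force simp: dist_real_def)
  have "g' z > 0" using e(2)[of "z - t"] z m * b by auto
  then have "m * g' z > 0" using m(1) by simp
  then have "g (t + m) > g t" using z(3) by simp
  with d(2)[of "t + m"] m show False by (auto simp: dist_real_def)
 qed
qed

text \<open>\<open>grad_lap f p a b l\<close>: at \<open>p\<close> the slices of \<open>f\<close> are twice differentiable, with gradient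
 \<open>(a, b)\<close> and Laplacian \<open>l\<close>.\<close>

definition grad_lap :: "(real * real => real) => real * real => real => real => real => bool" where
 "grad_lap f p a b l \<longleftrightarrow> (\<exists>m n. sd2 (%s. f (s, snd p)) (fst p) a m
   & sd2 (%t. f (fst p, t)) (snd p) b n & l = m + n)"

lemma grad_lapI:
 assumes "sd2 (%s. f (s, y)) x a m" "sd2 (%t. f (x, t)) y b n"
 shows "grad_lap f (x, y) a b (m + n)"
 unfolding grad_lap_def using assms by auto

lemma grad_lap_const: "grad_lap (%_. c) p 0 0 0"
 unfolding grad_lap_def using sd2_const by fastforce

lemma grad_lap_add:
 assumes "grad_lap f p a b l" "grad_lap g p a' b' l'"
 shows "grad_lap (%q. f q + g q) p (a + a') (b + b') (l + l')"
proof -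
 obtain m n m' n' where "sd2 (%s. f (s, snd p)) (fst p) a m" "sd2 (%t. f (fst p, t)) (snd p) b n" "l = m + n"
  "sd2 (%s. g (s, snd p)) (fst p) a' m'" "sd2 (%t. g (fst p, t)) (snd p) b' n'" "l' = m' + n'"
  using assms unfolding grad_lap_def by auto
 then show ?thesis unfolding grad_lap_def
  by (intro exI[of _ "m + m'"] exI[of _ "n + n'"]) (auto intro: sd2_add)
qed

lemma grad_lap_mult:
 assumes "grad_lap f p a b l" "grad_lap g p a' b' l'"
 shows "grad_lap (%q. f q * g q) p (a * g p + f p * a') (b * g p + f p * b')
  (l * g p + 2 * (a * a' + b * b') + f p * l')"
proof -
 obtain m n m' n' where "sd2 (%s. f (s, snd p)) (fst p) a m" "sd2 (%t. f (fst p, t)) (snd p) b n" "l = m + n"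
  "sd2 (%s. g (s, snd p)) (fst p) a' m'" "sd2 (%t. g (fst p, t)) (snd p) b' n'" "l' = m' + n'"
  using assms unfolding grad_lap_def by auto
 then show ?thesis unfolding grad_lap_def
  using sd2_mult[of "%s. f (s, snd p)" "fst p" a m "%s. g (s, snd p)" a' m']
   sd2_mult[of "%s. f (fst p, s)" "snd p" b n "%s. g (fst p, s)" b' n']
  by (intro exI[of _ "m * g p + 2 * a * a' + f p * m'"] exI[of _ "n * g p + 2 * b * b' + f p * n'"])
    (auto simp: algebra_simps)
qed

lemma grad_lap_cmult: "grad_lap f p a b l ==> grad_lap (%q. c * f q) p (c * a) (c * b) (c * l)"
 using grad_lap_mult[OF grad_lap_const[of c]] by fastforce

lemma grad_lap_minus: "grad_lap f p a b l ==> grad_lap (%q. - f q) p (- a) (- b) (- l)"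
 using grad_lap_cmult[of f p a b l "-1"] by simp

lemma grad_lap_diff:
 "grad_lap f p a b l ==> grad_lap g p a' b' l' ==> grad_lap (%q. f q - g q) p (a - a') (b - b') (l - l')"
 using grad_lap_add[OF _ grad_lap_minus, of f p a b l g a' b' l'] by simp

lemma grad_lap_compose:
 assumes "grad_lap f p a b l" "sd2 F (f p) d c"
 shows "grad_lap (%q. F (f q)) p (d * a) (d * b) (c * (a^2 + b^2) + d * l)"
proof -
 obtain m n where "sd2 (%s. f (s, snd p)) (fst p) a m" "sd2 (%t. f (fst p, t)) (snd p) b n" "l = m + n"
  using assms unfolding grad_lap_def by auto
 then show ?thesis unfolding grad_lap_def
  using sd2_compose[of "%s. f (s, snd p)" "fst p" a m F d c]
   sd2_compose[of "%s. f (fst p, s)" "snd p" b n F d c] assms(2)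
  by (intro exI[of _ "c * a^2 + d * m"] exI[of _ "c * b^2 + d * n"]) (auto simp: algebra_simps)
qed

lemma grad_lap_shift:
 assumes "grad_lap f (p + c) a b l"
 shows "grad_lap (%q. f (q + c)) p a b l"
proof -
 obtain m n where *: "sd2 (%s. f (s, snd p + snd c)) (fst p + fst c) a m"
   "sd2 (%t. f (fst p + fst c, t)) (snd p + snd c) b n" "l = m + n"
  using assms unfolding grad_lap_def by auto
 show ?thesis unfolding grad_lap_def
  using sd2_affine[of "%s. f (s, snd p + snd c)" 1 "fst p" "fst c" a m]
   sd2_affine[of "%s. f (fst p + fst c, s)" 1 "snd p" "snd c" b n] *
  by (intro exI[of _ m] exI[of _ n]) (auto simp: plus_prod_def)
qed

lemma grad_lap_reflect:
 assumes "grad_lap f (c - p) a b l"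
 shows "grad_lap (%q. f (c - q)) p (- a) (- b) l"
proof -
 obtain m n where *: "sd2 (%s. f (s, snd c - snd p)) (fst c - fst p) a m"
   "sd2 (%t. f (fst c - fst p, t)) (snd c - snd p) b n" "l = m + n"
  using assms unfolding grad_lap_def by auto
 show ?thesis unfolding grad_lap_def
  using sd2_affine[of "%s. f (s, snd c - snd p)" "-1" "fst p" "fst c" a m]
   sd2_affine[of "%s. f (fst c - fst p, s)" "-1" "snd p" "snd c" b n] *
  by (intro exI[of _ m] exI[of _ n]) (auto simp: minus_prod_def)
qed

lemma grad_lap_mirror:
 assumes "grad_lap f (c - x, y) a b l"
 shows "grad_lap (%q. f (c - fst q, snd q)) (x, y) (- a) b l"
proof -
 obtain m n where *: "sd2 (%s. f (s, y)) (c - x) a m"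
   "sd2 (%t. f (c - x, t)) y b n" "l = m + n"
  using assms unfolding grad_lap_def by auto
 show ?thesis unfolding grad_lap_def
  using sd2_affine[of "%s. f (s, y)" "-1" x c a m] *
  by (intro exI[of _ m] exI[of _ n]) auto
qed

lemma grad_lap_swap:
 assumes "grad_lap f (y, x) a b l"
 shows "grad_lap (%q. f (snd q, fst q)) (x, y) b a l"
 using assms unfolding grad_lap_def by (auto simp: add.commute)

lemma grad_lap_local_max:
 assumes "grad_lap f p a b l" and max: "\<forall>\<^sub>F q in nhds p. f q <= f p"
 shows "a = 0" "b = 0" "l <= 0"
proof -
 obtain m n where *: "sd2 (%s. f (s, snd p)) (fst p) a m" "sd2 (%t. f (fst p, t)) (snd p) b n" "l = m + n"
  using assms unfolding grad_lap_def by auto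
 have "((%s. (s, snd p)) \<longlongrightarrow> (fst p, snd p)) (nhds (fst p))"
    "((%s. (fst p, s)) \<longlongrightarrow> (fst p, snd p)) (nhds (snd p))"
  by (intro tendsto_Pair filterlim_ident tendsto_const)+
 then have "filterlim (%s. (s, snd p)) (nhds p) (nhds (fst p))"
    "filterlim (%s. (fst p, s)) (nhds p) (nhds (snd p))" by simp_all
 from this[THEN filterlim_iff[THEN iffD1], rule_format, OF max]
 have 1: "\<forall>\<^sub>F s in nhds (fst p). f (s, snd p) <= f (fst p, snd p)"
  "\<forall>\<^sub>F s in nhds (snd p). f (fst p, s) <= f (fst p, snd p)" by auto
 from sd2_local_max[OF *(1)] sd2_local_max[OF *(2)] 1 *(3)
 show "a = 0" "b = 0" "l <= 0" by force+
qed

text \<open>Sub- and supersolutions of \<open>\<Delta>w + m w = 0\<close> at a point, in the sense of touching by functions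
 with second derivatives.\<close>

definition subsol :: "real => (real * real => real) => real * real => bool" where
 "subsol m w p \<longleftrightarrow> (\<exists>s a b l. (\<forall>\<^sub>F q in nhds p. s q <= w q) & s p = w p & grad_lap s p a b l & - m * w p <= l)"

definition supersol :: "real => (real * real => real) => real * real => bool" where
 "supersol m w p \<longleftrightarrow> (\<exists>s a b l. (\<forall>\<^sub>F q in nhds p. w q <= s q) & s p = w p & grad_lap s p a b l & l <= - m * w p)"

definition strict_supersol :: "real => (real * real => real) => real * real => bool" where
 "strict_supersol m w p \<longleftrightarrow> (\<exists>s a b l. (\<forall>\<^sub>F q in nhds p. w q <= s q) & s p = w p & grad_lap s p a b l & l < - m * w p)"

lemma subsolI: "grad_lap w p a b l ==> - m * w p <= l ==> subsol m w p"
 unfolding subsol_def by (intro exI[of _ w]) auto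

lemma supersolI: "grad_lap w p a b l ==> l <= - m * w p ==> supersol m w p"
 unfolding supersol_def by (intro exI[of _ w]) auto

lemma strict_supersolI: "grad_lap w p a b l ==> l < - m * w p ==> strict_supersol m w p"
 unfolding strict_supersol_def by (intro exI[of _ w]) auto

text \<open>Suppose \<open>w / Z\<close> has a maximum \<open>t > 1\<close>. There the test
  functions below \<open>w\<close> and above \<open>t * Z\<close> touch, so their difference has a
  local maximum, while its Laplacian is positive: the terms in \<open>m\<close> cancel because
  \<open>w = t * Z\<close>. Dividing by a positive strict supersolution is what admits
  \<open>m > 0\<close>, where the plain principle fails; \<open>m\<close> may even vary with the
  point.\<close>

lemma maximum_principle:
 fixes w Z :: "real * real => real"
 assumes K: "compact K" and w: "continuous_on K w" and Z: "continuous_on K Z"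
  and pos: "!!p. p \<in> K ==> 0 < Z p" and bd: "!!p. p \<in> K - U ==> w p <= Z p"
  and U: "open U" "U \<subseteq> K"
  and tch: "!!p. p \<in> U ==> Z p < w p ==> \<exists>m. subsol m w p & strict_supersol m Z p"
  and p: "p \<in> K"
 shows "w p <= Z p"
proof (rule ccontr)
 assume np: "\<not> w p <= Z p"
 have "continuous_on K (%q. w q / Z q)" using w Z pos by (intro continuous_on_divide) (auto, force)
 then obtain p0 where p0: "p0 \<in> K" "!!q. q \<in> K ==> w q / Z q <= w p0 / Z p0"
  using continuous_attains_sup[OF K, of "%q. w q / Z q"] p by blast
 define t where "t = w p0 / Z p0"
 have "w p / Z p > 1" using np pos[OF p] by (simp add: field_simps)
 then have t: "t > 1" using p0(2)[OF p] by (simp add: t_def)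
 have wt: "w p0 = t * Z p0" using pos[OF p0(1)] by (simp add: t_def field_simps)
 with t pos[OF p0(1)] have gt: "Z p0 < w p0" by simp
 then have p0U: "p0 \<in> U" using bd[of p0] p0(1) by force
 obtain s sg a b ls a' b' lg m where *: "\<forall>\<^sub>F q in nhds p0. s q <= w q" "\<forall>\<^sub>F q in nhds p0. Z q <= sg q"
   "s p0 = w p0" "sg p0 = Z p0" "grad_lap s p0 a b ls" "grad_lap sg p0 a' b' lg" "- m * w p0 <= ls" "lg < - m * Z p0"
  using tch[OF p0U gt] unfolding subsol_def strict_supersol_def by blast
 have "\<forall>\<^sub>F q in nhds p0. q \<in> U" using U p0U by (simp add: eventually_nhds_in_open)
 with *(1,2) have "\<forall>\<^sub>F q in nhds p0. s q - t * sg q <= s p0 - t * sg p0"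
 proof eventually_elim
  case (elim q)
  then have q: "q \<in> K" using U by auto
  have "w q <= t * Z q" using p0(2)[OF q] pos[OF q] by (simp add: t_def field_simps)
  also have "... <= t * sg q" using elim t by simp
  finally show ?case using elim * wt by simp
 qed
 then have "ls - t * lg <= 0"
  using grad_lap_local_max(3)[OF grad_lap_diff[OF *(5) grad_lap_cmult[OF *(6), of t]]] by simp
 moreover have "t * lg < t * (- m * Z p0)" using *(8) t by (intro mult_strict_left_mono) auto
 ultimately show False using *(7) wt by (simp add: algebra_simps)
qed

section \<open>Solutions of the Helmholtz equation\<close>

abbreviation has_grad :: "(real * real => real) => real * real => real => real => bool" where
 "has_grad f p a b \<equiv> (f has_derivative (%h. fst h * a + snd h * b)) (at p)"

lemma has_grad_line:
 assumes "has_grad f (p + t *\<^sub>R e) a b"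
 shows "((%t. f (p + t *\<^sub>R e)) has_real_derivative (fst e * a + snd e * b)) (at t)"
proof -
 have "((%t. p + t *\<^sub>R e) has_derivative (%h. h *\<^sub>R e)) (at t)"
  by (auto intro!: derivative_eq_intros)
 from has_derivative_compose[OF this assms]
 show ?thesis unfolding has_field_derivative_def
  by (rule has_derivative_eq_rhs) (auto simp: algebra_simps)
qed

lemma has_grad_x:
 assumes "has_grad f (x, y) a b"
 shows "((%s. f (s, y)) has_real_derivative a) (at x)"
 using has_grad_line[where p = "(0, y)" and t = x and e = "(1, 0)"] assms by fastforce

lemma has_grad_y:
 assumes "has_grad f (x, y) a b"
 shows "((%s. f (x, s)) has_real_derivative b) (at y)"
 using has_grad_line[where p = "(x, 0)" and t = y and e = "(0, 1)"] assms by fastforce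

lemma has_grad_partials:
 assumes "has_grad f p a b"
 shows "px f p = a" "py f p = b"
 using has_grad_x[of f a b "fst p" "snd p"] has_grad_y[of f a b "fst p" "snd p"] assms
 by (auto simp: partial_x_def partial_y_def DERIV_imp_deriv)

lemma has_grad_cong:
 assumes "has_grad f p a b" "open S" "p \<in> S" "!!q. q \<in> S ==> f q = g q"
 shows "has_grad g p a b"
 using has_derivative_transform_within_open[OF assms(1-3)] assms(4) by auto

lemma has_grad_cont: "has_grad f p a b ==> continuous (at p) f"
 by (rule has_derivative_continuous)

lemma C1_onI:
 assumes "!!p. p \<in> S ==> has_grad f p (a p) (b p)" "continuous_on S a" "continuous_on S b"
 shows "C1_on S f"
proof -
 have "!!p. p \<in> S ==> px f p = a p & py f p = b p" using has_grad_partials assms(1) by blast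
 then have "continuous_on S (px f)" "continuous_on S (py f)"
  using assms(2,3) by (auto cong: continuous_on_cong)
 with assms(1) show ?thesis unfolding C1_on_def differentiable_def by blast
qed

lemma C1_onD:
 assumes "C1_on S f" "p \<in> S"
 shows "has_grad f p (px f p) (py f p)"
proof -
 obtain D where D: "(f has_derivative D) (at p)"
  using assms unfolding C1_on_def differentiable_def by blast
 interpret D: bounded_linear D using D by (rule has_derivative_bounded_linear)
 have "D h = fst h * D (1, 0) + snd h * D (0, 1)" for h
 proof -
  have "h = fst h *\<^sub>R (1, 0) + snd h *\<^sub>R (0, 1)" by (simp add: prod_eq_iff)
  then have "D h = D (fst h *\<^sub>R (1, 0) + snd h *\<^sub>R (0, 1))" by simp
  also have "... = fst h * D (1, 0) + snd h * D (0, 1)" unfolding D.add D.scaleR by simp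
  finally show ?thesis .
 qed
 then have "D = (%h. fst h * D (1, 0) + snd h * D (0, 1))" by (rule ext)
 from has_derivative_eq_rhs[OF D this] have "has_grad f p (D (1, 0)) (D (0, 1))" .
 with has_grad_partials[OF this] show ?thesis by simp
qed

definition helm :: "(real * real) set => real => (real * real => real) => bool" where
 "helm S k u \<longleftrightarrow> open S & C2_on S u & (\<forall>p\<in>S. laplacian u p = - k * u p)"

lemma helmI:
 assumes S: "open S" and u: "!!p. p \<in> S ==> has_grad u p (a p) (b p)"
  and a: "!!p. p \<in> S ==> has_grad a p (a1 p) (a2 p)" and b: "!!p. p \<in> S ==> has_grad b p (b1 p) (b2 p)"
  and c: "continuous_on S a1" "continuous_on S a2" "continuous_on S b1" "continuous_on S b2"
  and l: "!!p. p \<in> S ==> a1 p + b2 p = - k * u p"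
 shows "helm S k u"
proof -
 have pa: "px u p = a p" "py u p = b p" if "p \<in> S" for p
  using has_grad_partials[OF u[OF that]] .
 have ga: "has_grad (px u) p (a1 p) (a2 p)" "has_grad (py u) p (b1 p) (b2 p)" if "p \<in> S" for p
  by (rule has_grad_cong[OF a[OF that] S that], simp add: pa)
    (rule has_grad_cong[OF b[OF that] S that], simp add: pa)
 have "continuous_on S a" "continuous_on S b"
  using a b by (auto intro!: continuous_at_imp_continuous_on has_grad_cont)
 then have "C2_on S u" unfolding C2_on_def
  using C1_onI[OF u] C1_onI[OF ga(1)] C1_onI[OF ga(2)] c by blast
 moreover have "laplacian u p = - k * u p" if "p \<in> S" for p
  using l[OF that] has_grad_partials[OF ga(1)[OF that]] has_grad_partials[OF ga(2)[OF that]]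
  by (simp add: laplacian_def)
 ultimately show ?thesis using S by (simp add: helm_def)
qed

lemma helmD:
 assumes "helm S k u"
 shows "open S" "p \<in> S ==> has_grad u p (px u p) (py u p)"
  "p \<in> S ==> has_grad (px u) p (px (px u) p) (py (px u) p)"
  "p \<in> S ==> has_grad (py u) p (px (py u) p) (py (py u) p)"
  "continuous_on S (px (px u))" "continuous_on S (py (px u))"
  "continuous_on S (px (py u))" "continuous_on S (py (py u))"
  "p \<in> S ==> px (px u) p + py (py u) p = - k * u p"
  "continuous_on S u" "continuous_on S (px u)" "continuous_on S (py u)"
proof -
 have *: "C1_on S u" "C1_on S (px u)" "C1_on S (py u)"
  using assms by (auto simp: helm_def C2_on_def)
 show "open S" "p \<in> S ==> has_grad u p (px u p) (py u p)"
  "p \<in> S ==> has_grad (px u) p (px (px u) p) (py (px u) p)"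
  "p \<in> S ==> has_grad (py u) p (px (py u) p) (py (py u) p)"
  using assms C1_onD[OF *(1), of p] C1_onD[OF *(2), of p] C1_onD[OF *(3), of p]
  by (simp_all add: helm_def)
 show "continuous_on S u"
  using C1_onD[OF *(1)] by (auto intro!: continuous_at_imp_continuous_on has_grad_cont)
 show "continuous_on S (px (px u))" "continuous_on S (py (px u))"
  "continuous_on S (px (py u))" "continuous_on S (py (py u))"
  "p \<in> S ==> px (px u) p + py (py u) p = - k * u p"
  "continuous_on S (px u)" "continuous_on S (py u)"
  using *[unfolded C1_on_def] assms[unfolded helm_def laplacian_def] by blast+
qed

lemma helm_subset: "helm S k u ==> open T ==> T \<subseteq> S ==> helm T k u"
 unfolding helm_def C2_on_def C1_on_def by (blast intro: continuous_on_subset)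

lemma helm_grad_lap:
 assumes u: "helm S k u" and p: "p \<in> S"
 shows "grad_lap u p (px u p) (py u p) (- k * u p)"
proof -
 obtain x y where xy: "p = (x, y)" by (cases p)
 note d = helmD[OF u]
 have o: "open ((%s. (s, y)) -` S)" "open ((%s. (x, s)) -` S)"
  by (auto intro!: open_vimage d(1) continuous_intros)
 have "sd2 (%s. u (s, y)) x (px u p) (px (px u) p)"
  by (rule sd2I_open[OF o(1), where g' = "%s. px u (s, y)"])
   (use p xy in "auto intro!: has_grad_x[OF d(2)] has_grad_x[OF d(3)]")
 moreover have "sd2 (%s. u (x, s)) y (py u p) (py (py u) p)"
  by (rule sd2I_open[OF o(2), where g' = "%s. py u (x, s)"])
   (use p xy in "auto intro!: has_grad_y[OF d(2)] has_grad_y[OF d(4)]")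
 ultimately have "grad_lap u (x, y) (px u p) (py u p)
   (px (px u) p + py (py u) p)" by (rule grad_lapI)
 then show ?thesis by (simp only: d(9)[OF p] xy[symmetric])
qed

lemma has_grad_lincomb:
 assumes "has_grad u p a b" "has_grad w p a' b'"
 shows "has_grad (%q. c * u q + d * w q) p (c * a + d * a') (c * b + d * b')"
 by (rule has_derivative_eq_rhs, (rule derivative_intros assms)+) (auto simp: algebra_simps)

lemma helm_lincomb:
 assumes "helm S k u" "helm S k w"
 shows "helm S k (%q. c * u q + d * w q)"
proof -
 note d = helmD[OF assms(1)] and e = helmD[OF assms(2)]
 show ?thesis
 proof (rule helmI[OF d(1)])
  show "has_grad (%q. c * u q + d * w q) p (c * px u p + d * px w p)
   (c * py u p + d * py w p)" if "p \<in> S" for p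
   by (rule has_grad_lincomb[OF d(2)[OF that] e(2)[OF that]])
  show "has_grad (%p. c * px u p + d * px w p) p
   (c * px (px u) p + d * px (px w) p)
   (c * py (px u) p + d * py (px w) p)" if "p \<in> S" for p
   by (rule has_grad_lincomb[OF d(3)[OF that] e(3)[OF that]])
  show "has_grad (%p. c * py u p + d * py w p) p
   (c * px (py u) p + d * px (py w) p)
   (c * py (py u) p + d * py (py w) p)" if "p \<in> S" for p
   by (rule has_grad_lincomb[OF d(4)[OF that] e(4)[OF that]])
  show "c * px (px u) p + d * px (px w) p
   + (c * py (py u) p + d * py (py w) p) = - k * (c * u p + d * w p)"
   if "p \<in> S" for p
  proof -
   have "c * (px (px u) p + py (py u) p)
    + d * (px (px w) p + py (py w) p) = c * (- k * u p) + d * (- k * w p)"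
    using d(9)[OF that] e(9)[OF that] by simp
   then show ?thesis by (simp add: algebra_simps)
  qed
 qed (intro continuous_intros d(5-8) e(5-8))+
qed

text \<open>Signs \<open>r1\<close> and \<open>r2\<close> of square 1 leave both pure second
  derivatives unchanged, so translations and axis reflections are treated at once.\<close>

lemma helm_affine:
 fixes r1 r2 :: real
 assumes u: "helm S k u" and r: "r1^2 = 1" "r2^2 = 1" and T: "T = {q. (r1 * fst q, r2 * snd q) + c \<in> S}"
 defines "A \<equiv> %q. (r1 * fst q, r2 * snd q) + c"
 shows "helm T k (%q. u (A q))" "!!q. q \<in> T ==> px (%q. u (A q)) q = r1 * px u (A q)"
  "!!q. q \<in> T ==> py (%q. u (A q)) q = r2 * py u (A q)"
proof -
 have cA: "continuous_on X A" for X unfolding A_def by (intro continuous_intros)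
 have TA: "T = A -` S" unfolding T A_def by auto
 have oT: "open T" unfolding TA using open_vimage[OF helmD(1)[OF u], of A] cA[of UNIV] by (simp add: continuous_on_eq_continuous_at)
 have chain: "has_grad (%q. f (A q)) q (r1 * a) (r2 * b)" if "has_grad f (A q) a b" for f q a b
 proof -
  have "(A has_derivative (%h. (r1 * fst h, r2 * snd h))) (at q)"
   unfolding A_def by (auto intro!: derivative_eq_intros has_derivative_Pair)
  from has_derivative_compose[OF this that] show ?thesis
   by (rule has_derivative_eq_rhs) (auto simp: algebra_simps)
 qed
 have inS: "q \<in> T ==> A q \<in> S" for q by (simp add: TA)
 have cc: "continuous_on S f ==> continuous_on T (%q. f (A q))" for f :: "real * real => real"
  using continuous_on_compose2[OF _ cA[of T]] inS by blast
 have 1: "has_grad (%q. u (A q)) q (r1 * px u (A q)) (r2 * py u (A q))" if "q \<in> T" for q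
  using chain[OF helmD(2)[OF u inS[OF that]]] .
 have 2: "has_grad (%q. c' * f (A q)) q (c' * (r1 * a)) (c' * (r2 * b))" if "has_grad f (A q) a b" for f q a b c'
  using has_grad_lincomb[OF chain[OF that] chain[OF that], of c' 0] by simp
 show "helm T k (%q. u (A q))"
 proof (rule helmI[OF oT 1 2[OF helmD(3)[OF u inS]] 2[OF helmD(4)[OF u inS]]])
  show "r1 * (r1 * px (px u) (A p)) + r2 * (r2 * py (py u) (A p)) = - k * u (A p)"
   if "p \<in> T" for p
   using helmD(9)[OF u inS[OF that]] r by (simp add: power2_eq_square mult.assoc[symmetric])
 qed (auto intro!: continuous_intros cc helmD(5-8)[OF u])
 show "!!q. q \<in> T ==> px (%q. u (A q)) q = r1 * px u (A q)"
  "!!q. q \<in> T ==> py (%q. u (A q)) q = r2 * py u (A q)"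
  using has_grad_partials[OF 1] by auto
qed

lemma helm_shift:
 assumes "helm S k u"
 shows "helm {q. q + c \<in> S} k (%q. u (q + c))"
  "!!q. q + c \<in> S ==> px (%q. u (q + c)) q = px u (q + c)"
  "!!q. q + c \<in> S ==> py (%q. u (q + c)) q = py u (q + c)"
proof -
 have *: "(1 * fst q, 1 * snd q) + c = q + c" for q :: "real * real" by simp
 note H = helm_affine[OF assms, of 1 1 "{q. q + c \<in> S}" c, unfolded *, OF power_one power_one refl]
 show "helm {q. q + c \<in> S} k (%q. u (q + c))" by (rule H(1))
 show "px (%q. u (q + c)) q = px u (q + c)" if "q + c \<in> S" for q
  using H(2)[of q] that by simp
 show "py (%q. u (q + c)) q = py u (q + c)" if "q + c \<in> S" for q
  using H(3)[of q] that by simp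
qed

lemma helm_swap:
 assumes u: "helm S k u" and T: "T = {q. prod.swap q \<in> S}"
 shows "helm T k (%q. u (prod.swap q))"
  "!!q. q \<in> T ==> px (%q. u (prod.swap q)) q = py u (prod.swap q)"
  "!!q. q \<in> T ==> py (%q. u (prod.swap q)) q = px u (prod.swap q)"
proof -
 have cA: "continuous_on X prod.swap" for X :: "(real * real) set"
  unfolding prod.swap_def by (intro continuous_intros)
 have TA: "T = prod.swap -` S" unfolding T by auto
 have oT: "open T" unfolding TA using open_vimage[OF helmD(1)[OF u] cA] .
 have chain: "has_grad (%q. f (prod.swap q)) q b a" if "has_grad f (prod.swap q) a b" for f q a b
 proof -
  have "(prod.swap has_derivative (%h. (snd h, fst h))) (at q)"
   unfolding prod.swap_def by (auto intro!: derivative_eq_intros has_derivative_Pair)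
  from has_derivative_compose[OF this that] show ?thesis
   by (rule has_derivative_eq_rhs) (auto simp: algebra_simps)
 qed
 have inS: "q \<in> T ==> prod.swap q \<in> S" for q by (simp add: TA)
 have cc: "continuous_on S f ==> continuous_on T (%q. f (prod.swap q))" for f :: "real * real => real"
  using continuous_on_compose2[OF _ cA[of T]] inS by blast
 have 1: "has_grad (%q. u (prod.swap q)) q (py u (prod.swap q)) (px u (prod.swap q))" if "q \<in> T" for q
  using chain[OF helmD(2)[OF u inS[OF that]]] .
 show "helm T k (%q. u (prod.swap q))"
 proof (rule helmI[OF oT 1 chain[OF helmD(4)[OF u inS]] chain[OF helmD(3)[OF u inS]]])
  show "py (py u) (prod.swap p) + px (px u) (prod.swap p) = - k * u (prod.swap p)"
   if "p \<in> T" for p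
   using helmD(9)[OF u inS[OF that]] by simp
 qed (auto intro!: cc helmD(5-8)[OF u])
 show "!!q. q \<in> T ==> px (%q. u (prod.swap q)) q = py u (prod.swap q)"
  "!!q. q \<in> T ==> py (%q. u (prod.swap q)) q = px u (prod.swap q)"
  using has_grad_partials[OF 1] by auto
qed

section \<open>Gradient estimates and smoothness\<close>

text \<open>The barrier y^2 / r^2 + 4 x / r - 3 x^2 / r^2 is nonnegative on the side x = 0, at least
  1 on the three other sides, below 4 inside, and has Laplacian -4 / r^2; so
  \<open>k * r^2 <= 1\<close> makes it a supersolution. On the axis it is at most 4 x / r, which is
  a Lipschitz bound at a flat wall.\<close>

lemma half_square_bound:
 fixes f :: "real * real => real"
 assumes r: "0 < r" and k: "0 <= k" "k * r^2 <= 1" and M: "0 <= M"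
  and cont: "continuous_on ({0..r} \<times> {-r..r}) f"
  and ub: "!!x y. 0 <= x ==> x <= r ==> \<bar>y\<bar> <= r ==> f (x, y) <= M"
  and zero: "!!y. \<bar>y\<bar> <= r ==> f (0, y) <= 0"
  and sub: "!!p. p \<in> {0<..<r} \<times> {-r<..<r} ==> 0 < f p ==> subsol k f p"
  and x: "0 <= x" "x <= r"
 shows "f (x, 0) <= 4 * M * x / r"
proof -
 define A where "A = 4 * x / r - 3 * x^2 / r^2"
 have ineq: "f (x, 0) <= (M + e) * (A + e)" if e: "0 < e" "e < 1" for e
 proof -
  define N where "N = M + e"
  have N: "0 < N" using M e by (simp add: N_def)
  define Z where "Z = (%p::real\<times>real. N * ((snd p)^2 / r^2 + 4 * fst p / r - 3 * (fst p)^2 / r^2 + e))"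
  define K where "K = {0..r} \<times> {-r..r}"
  have Zp: "Z (a, b) \<ge> N * (b^2 / r^2 + a / r + e)" if "0 <= a" "a <= r" for a b
  proof -
   have "a / r * (a / r) <= 1 * (a / r)" using that r by (intro mult_right_mono) auto
   then have "a^2 / r^2 <= a / r" by (simp add: power2_eq_square)
   then show ?thesis using N by (auto simp: Z_def intro!: mult_left_mono)
  qed
  have "f (x, 0) <= Z (x, 0)"
  proof (rule maximum_principle[where K = K and U = "{0<..<r} \<times> {-r<..<r}"])
   show "compact K" by (auto simp: K_def intro: compact_Times)
   show "continuous_on K f" using cont by (simp add: K_def)
   show "continuous_on K Z" unfolding Z_def using r by (intro continuous_intros) auto
   show "0 < Z p" if pK: "p \<in> K" for p
   proof -
    obtain a b where p: "p = (a, b)" "0 <= a" "a <= r" using pK by (cases p) (auto simp: K_def)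
    have "0 < N * (b^2 / r^2 + a / r + e)" using N e p r by (intro mult_pos_pos add_nonneg_pos) auto
    with Zp[OF p(2,3), of b] p show ?thesis by simp
   qed
   show "f p <= Z p" if p: "p \<in> K - {0<..<r} \<times> {-r<..<r}" for p
   proof -
    obtain a b where ab: "p = (a, b)" "0 <= a" "a <= r" "\<bar>b\<bar> <= r" using p by (cases p) (auto simp: K_def)
    consider "a = 0" | "a = r" | "\<bar>b\<bar> = r" using p ab by (auto simp: K_def)
    then show ?thesis
    proof cases
     case 1
     have "0 <= N * (b^2 / r^2 + a / r + e)" using N e ab r by (intro mult_nonneg_nonneg) auto
     then show ?thesis using Zp[OF ab(2,3), of b] zero[OF ab(4)] ab 1 by simp
    next
     case 2
     have "N * 1 <= N * (b^2 / r^2 + a / r + e)" using N e r 2 by (intro mult_left_mono) auto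
     then show ?thesis using Zp[OF ab(2,3), of b] ub[OF ab(2-4)] ab e by (simp add: N_def)
    next
     case 3
     then have "b^2 = r^2" by (metis power2_abs)
     then have "N * 1 <= N * (b^2 / r^2 + a / r + e)" using N e r ab by (intro mult_left_mono) auto
     then show ?thesis using Zp[OF ab(2,3), of b] ub[OF ab(2-4)] ab e by (simp add: N_def)
    qed
   qed
   show "open ({0<..<r} \<times> {-r<..<r})" by (intro open_Times) auto
   show "{0<..<r} \<times> {-r<..<r} \<subseteq> K" by (auto simp: K_def)
   show "(x, 0) \<in> K" using x r by (auto simp: K_def)
   fix p assume p: "p \<in> {0<..<r} \<times> {-r<..<r}" and gt: "Z p < f p"
   obtain a b where ab: "p = (a, b)" "0 < a" "a < r" "- r < b" "b < r" using p by (cases p) auto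
   have "0 < N * (b^2 / r^2 + a / r + e)" using N e ab r by (intro mult_pos_pos add_nonneg_pos) auto
   then have pos: "0 < Z p" using Zp[of a b] ab by simp
   then have "0 < f p" using gt by simp
   note sub = sub[OF p this]
   have "grad_lap Z (a, b) (N * (4 / r - 6 * a / r^2)) (N * (2 * b / r^2)) (N * (- 6 / r^2) + N * (2 / r^2))"
    unfolding Z_def
    by (rule grad_lapI;
      rule sd2I[where g' = "%s. N * (4 / r - 6 * s / r^2)"] sd2I[where g' = "%s. N * (2 * s / r^2)"])
     (use r in "auto intro!: derivative_eq_intros simp: field_simps")
   moreover have "N * (- 6 / r^2) + N * (2 / r^2) < - k * Z p"
   proof -
    have "b^2 <= r^2" using ab by (simp add: abs_le_square_iff[symmetric])
    moreover have "4 * a / r - 3 * a^2 / r^2 = 4 / 3 - 3 * (a / r - 2 / 3)^2"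
     by (simp add: power2_eq_square algebra_simps)
    moreover have "0 <= 3 * (a / r - 2 / 3)^2" by simp
    moreover have "b^2 / r^2 <= 1" using \<open>b\<^sup>2 <= r^2\<close> r by simp
    ultimately have "b^2 / r^2 + 4 * a / r - 3 * a^2 / r^2 + e < 4"
     using e by linarith
    then have "N * (b^2 / r^2 + 4 * a / r - 3 * a^2 / r^2 + e) < N * 4" using N by (intro mult_strict_left_mono)
    then have "Z p < N * 4" using ab by (simp add: Z_def)
    then have "(k * r^2) * Z p < 4 * N" using k pos
     by (smt (verit) mult_left_le_one_le mult.commute r zero_le_mult_iff zero_le_power2)
    then show ?thesis using r by (simp add: field_simps)
   qed
   ultimately have "strict_supersol k Z p" using ab(1) by (intro strict_supersolI) auto
   with sub show "\<exists>m. subsol m f p & strict_supersol m Z p" by blast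
  qed
  then show ?thesis by (simp add: Z_def A_def N_def)
 qed
 \<comment> \<open>The slack \<open>e\<close> made the barrier strictly positive and its factor
   nonzero; it now tends to 0.\<close>
 have "((%e. (M + e) * (A + e)) \<longlongrightarrow> (M + 0) * (A + 0)) (at_right 0)"
  by (intro tendsto_intros)
 moreover have "\<forall>\<^sub>F e in at_right 0. f (x, 0) <= (M + e) * (A + e)"
  unfolding eventually_at_right_field using ineq by (intro exI[of _ 1]) auto
 ultimately have "f (x, 0) <= M * A"
  using tendsto_lowerbound[of _ _ "at_right 0"] by fastforce
 also have "... <= M * (4 * x / r)" using M by (intro mult_left_mono) (auto simp: A_def)
 finally show ?thesis by (simp add: algebra_simps)
qed

definition square :: "real * real => real => (real * real) set" where
 "square p r = cbox (p - (r, r)) (p + (r, r))"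

lemma mem_square: "q \<in> square p r \<longleftrightarrow> \<bar>fst q - fst p\<bar> <= r & \<bar>snd q - snd p\<bar> <= r"
 by (cases p; cases q) (auto simp: square_def abs_le_iff)

lemma square_prod_eq: "square p r = {fst p - r..fst p + r} \<times> {snd p - r..snd p + r}"
 by (auto simp: mem_square abs_le_iff)

text \<open>The part of \<open>u\<close> that is odd across the vertical line through
  \<open>p\<close> solves the same equation, vanishes on that line and has the same
  \<open>x\<close>-derivative at \<open>p\<close>, so \<open>half_square_bound\<close> applies to
  it.\<close>

lemma partial_x_le_aux:
 assumes u: "helm S k u" and r: "0 < r" and k: "0 <= k" "k * r^2 <= 1" and sq: "square p r \<subseteq> S"
  and M: "!!q. q \<in> square p r ==> \<bar>u q\<bar> <= M"
 shows "px u p <= 4 * M / r"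
proof -
 obtain x0 y0 where p: "p = (x0, y0)" by (cases p)
 define f where "f = (%q. (u (fst q + x0, snd q + y0) - u (x0 - fst q, snd q + y0)) / 2)"
 have pS: "p \<in> S" using sq r by (auto simp: mem_square)
 have in1: "(a + x0, b + y0) \<in> square p r" "(x0 - a, b + y0) \<in> square p r" if "\<bar>a\<bar> <= r" "\<bar>b\<bar> <= r" for a b
  using that p by (auto simp: mem_square)
 have M0: "0 <= M" using M[of p] r by (force simp: mem_square)
 have bound: "f (x, 0) <= 4 * M * x / r" if "0 <= x" "x <= r" for x
 proof (rule half_square_bound[OF r k M0 _ _ _ _ that])
  have "continuous_on S u" using u by (rule helmD)
  then have c: "continuous_on ({0..r} \<times> {-r..r}) (%q. u (g q))"
   if "continuous_on ({0..r} \<times> {-r..r}) g" "!!a b. \<bar>a\<bar> <= r ==> \<bar>b\<bar> <= r ==> g (a, b) \<in> square p r" for g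
   using that(1) by (rule continuous_on_compose2) (use that(2) sq in "auto simp: abs_le_iff")
  show "continuous_on ({0..r} \<times> {-r..r}) f" unfolding f_def
   by (intro continuous_on_divide continuous_on_diff c) (auto intro!: continuous_intros in1)
  show "f (x, y) <= M" if "0 <= x" "x <= r" "\<bar>y\<bar> <= r" for x y
   using M[OF in1(1)[of x y]] M[OF in1(2)[of x y]] that by (auto simp: f_def)
  show "f (0, y) <= 0" for y by (simp add: f_def)
  fix q assume q: "q \<in> {0<..<r} \<times> {-r<..<r}"
  obtain a b where ab: "q = (a, b)" "\<bar>a\<bar> <= r" "\<bar>b\<bar> <= r" using q by (cases q) auto
  have "q + (x0, y0) \<in> S" "(x0 - a, b + y0) \<in> S" using in1[OF ab(2,3)] sq ab by auto
  note g1 = grad_lap_shift[OF helm_grad_lap[OF u this(1)]]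
   and g2 = helm_grad_lap[OF u this(2)]
  have "grad_lap (%q. u (q + (0, y0))) (x0 - a, b) (px u (x0 - a, b + y0)) (py u (x0 - a, b + y0))
   (- k * u (x0 - a, b + y0))" using g2 by (intro grad_lap_shift) simp
  from grad_lap_mirror[OF this] ab(1)
  have "grad_lap (%q. u ((x0 - fst q, snd q) + (0, y0))) q (- px u (x0 - a, b + y0))
   (py u (x0 - a, b + y0)) (- k * u (x0 - a, b + y0))" by simp
  from grad_lap_cmult[OF grad_lap_diff[OF g1 this], of "1/2"]
  have "\<exists>a' b'. grad_lap f q a' b' (1 / 2 * (- k * u (q + (x0, y0)) - - k * u (x0 - a, b + y0)))"
   by (force simp: f_def plus_prod_def diff_divide_distrib)
  moreover have "1 / 2 * (- k * u (q + (x0, y0)) - - k * u (x0 - a, b + y0)) = - k * f q"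
   using ab by (simp add: f_def algebra_simps)
  ultimately show "subsol k f q" using subsolI by fastforce
 qed
 have d: "((%s. u (s, y0)) has_real_derivative px u p) (at x0)"
  using has_grad_x helmD(2)[OF u pS] p by blast
 have "((%s. u (s + x0, y0)) has_real_derivative px u p) (at 0)"
  using DERIV_shift[of "%s. u (s, y0)" "px u p" 0 x0] d by simp
 moreover have "((%s. u (x0 - s, y0)) has_real_derivative px u p * (-1)) (at 0)"
  by (rule DERIV_chain2[where f = "%s. u (s, y0)"]) (use d in "auto intro!: derivative_eq_intros")
 ultimately have "((%s. f (s, 0)) has_real_derivative px u p) (at 0)"
  unfolding f_def by (auto intro!: derivative_eq_intros)
 then have "((%s. f (s, 0) / s) \<longlongrightarrow> px u p) (at_right 0)"
  unfolding DERIV_def by (auto simp: f_def intro: filterlim_mono at_le)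
 moreover have "\<forall>\<^sub>F s in at_right 0. f (s, 0) / s <= 4 * M / r"
  unfolding eventually_at_right_field using bound r
  by (intro exI[of _ r]) (auto simp: field_simps)
 ultimately show ?thesis by (rule tendsto_upperbound) auto
qed

lemma partial_x_bound:
 assumes u: "helm S k u" and r: "0 < r" and k: "0 <= k" "k * r^2 <= 1" and sq: "square p r \<subseteq> S"
  and M: "!!q. q \<in> square p r ==> \<bar>u q\<bar> <= M"
 shows "\<bar>px u p\<bar> <= 4 * M / r"
proof -
 have h: "helm S k (%q. (-1) * u q + 0 * u q)" using helm_lincomb[OF u u] .
 have "p \<in> S" using sq r by (auto simp: mem_square)
 from has_grad_partials[OF has_grad_lincomb[OF helmD(2)[OF u this] helmD(2)[OF u this]], of "-1" 0]
 have "px (%q. (-1) * u q + 0 * u q) p = - px u p" by simp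
 then show ?thesis using partial_x_le_aux[OF u r k sq M] partial_x_le_aux[OF h r k sq, of M] M by simp
qed

lemma partial_y_bound:
 assumes u: "helm S k u" and r: "0 < r" and k: "0 <= k" "k * r^2 <= 1" and sq: "square p r \<subseteq> S"
  and M: "!!q. q \<in> square p r ==> \<bar>u q\<bar> <= M"
 shows "\<bar>py u p\<bar> <= 4 * M / r"
proof -
 note s = helm_swap[OF u refl]
 have sw: "q \<in> square (prod.swap p) r ==> prod.swap q \<in> square p r" for q by (auto simp: mem_square)
 have "p \<in> S" using sq r by (auto simp: mem_square)
 then have "px (%q. u (prod.swap q)) (prod.swap p) = py u p" using s(2)[of "prod.swap p"] by simp
 moreover have "\<bar>px (%q. u (prod.swap q)) (prod.swap p)\<bar> <= 4 * M / r"
  by (rule partial_x_bound[OF s(1) r k]) (use sw sq M in auto)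
 ultimately show ?thesis by simp
qed

lemma mem_square_lin:
 "q \<in> square p r \<longleftrightarrow> fst p <= fst q + r & fst q <= fst p + r & snd p <= snd q + r & snd q <= snd p + r"
 by (auto simp: mem_square abs_le_iff)

definition open_square :: "real * real => real => (real * real) set" where
 "open_square p r = {fst p - r<..<fst p + r} \<times> {snd p - r<..<snd p + r}"

lemma mem_open_square:
 "q \<in> open_square p r \<longleftrightarrow> fst p < fst q + r & fst q < fst p + r & snd p < snd q + r & snd q < snd p + r"
 by (cases q) (auto simp: open_square_def)

lemma open_square: "open (open_square p r)" "convex (open_square p r)" "open_square p r \<subseteq> square p r"
 by (auto simp: open_square_def square_prod_eq intro!: open_Times convex_Times)

text \<open>The difference quotients in \<open>x\<close> solve the same equation and are at most
  \<open>4 * M / r\<close> by the mean value theorem. The gradient estimate on a square of half the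
  size is applied to them and passed to the limit. That \<open>px u\<close> is itself a solution is
  established only later, from this bound.\<close>

lemma second_partials_bound:
 assumes u: "helm S k u" and r: "0 < r" and k: "0 <= k" "k * r^2 <= 1" and sq: "square p (2 * r) \<subseteq> S"
  and M: "!!q. q \<in> square p (2 * r) ==> \<bar>u q\<bar> <= M"
 shows "\<bar>px (px u) p\<bar> <= 32 * M / r^2" "\<bar>px (py u) p\<bar> <= 32 * M / r^2"
proof -
 obtain x0 y0 where p: "p = (x0, y0)" by (cases p)
 note d = helmD[OF u]
 have pS: "p \<in> S" using sq r by (auto simp: mem_square)
 have ux: "\<bar>px u q\<bar> <= 4 * M / r" if "q \<in> square p r" for q
  by (rule partial_x_bound[OF u r k]) (use that sq M in "auto simp: mem_square_lin subset_iff")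
 have M0: "0 <= 4 * M / r" using ux[of p] r by (force simp: mem_square)
 define D where "D = (%h q. (1 / h) * u (q + (h, 0)) + (- 1 / h) * u q)"
 define T where "T = (%h. {q. q + (h, 0) \<in> S} \<inter> S)"
 have DT: "helm (T h) k (D h)" for h
 proof -
  have "open {q. q + (h, 0) \<in> S}" using helm_shift(1)[OF u, of "(h, 0)"] helmD(1) by blast
  then have "open (T h)" unfolding T_def using d(1) by (intro open_Int)
  then show ?thesis unfolding D_def
   by (intro helm_lincomb) (auto intro: helm_subset[OF helm_shift(1)[OF u]] helm_subset[OF u] simp: T_def)
 qed
 have Dpart: "px (D h) p = (px u (p + (h, 0)) - px u p) / h"
  "py (D h) p = (py u (p + (h, 0)) - py u p) / h"
  "\<bar>px (D h) p\<bar> <= 32 * M / r^2" "\<bar>py (D h) p\<bar> <= 32 * M / r^2"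
  if h: "0 < h" "h <= r / 2" for h
 proof -
  have sqT: "square p (r / 2) \<subseteq> T h"
  proof
   fix q assume "q \<in> square p (r / 2)"
   then have "q + (h, 0) \<in> square p (2 * r)" "q \<in> square p (2 * r)"
    using r h by (auto simp: mem_square_lin)
   with sq show "q \<in> T h" by (auto simp: T_def)
  qed
  then have pT: "p \<in> T h" using r by (auto simp: mem_square)
  then have pS: "p + (h, 0) \<in> S" "p \<in> S" by (auto simp: T_def)
  note s = helm_shift[OF u, where c = "(h, 0)"]
  have "has_grad (%q. u (q + (h, 0))) p (px u (p + (h, 0))) (py u (p + (h, 0)))"
   using helmD(2)[OF s(1), of p] s(2)[OF pS(1)] s(3)[OF pS(1)] pS by simp
  from has_grad_partials[OF has_grad_lincomb[OF this d(2)[OF pS(2)]], of "1 / h" "- 1 / h"]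
  show "px (D h) p = (px u (p + (h, 0)) - px u p) / h"
   "py (D h) p = (py u (p + (h, 0)) - py u p) / h"
   by (auto simp: D_def diff_divide_distrib)
  have b: "\<bar>D h q\<bar> <= 4 * M / r" if q: "q \<in> square p (r / 2)" for q
  proof -
   obtain a b where ab: "q = (a, b)" by (cases q)
   have in': "(z, b) \<in> square p r" if "a <= z" "z <= a + h" for z
    using q h ab that by (auto simp: mem_square_lin)
   then have inS: "(z, b) \<in> S" if "a <= z" "z <= a + h" for z
    using that sq r by (fastforce simp: mem_square_lin)
   obtain z where z: "a < z" "z < a + h" "u (a + h, b) - u (a, b) = (a + h - a) * px u (z, b)"
    using MVT2[of a "a + h" "%s. u (s, b)" "%s. px u (s, b)"] h
     has_grad_x[OF d(2)[OF inS]] by auto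
   have "D h q = (u (a + h, b) - u (a, b)) / h" using ab by (simp add: D_def diff_divide_distrib)
   also have "... = px u (z, b)" using z h by simp
   finally show ?thesis using ux[OF in'[of z]] z by simp
  qed
  have r2: "0 < r / 2" "k * (r / 2)^2 <= 1" using r k by (auto simp: power_divide)
  have "4 * (4 * M / r) / (r / 2) = 32 * M / r^2" by (simp add: power2_eq_square)
  with partial_x_bound[OF DT[of h] r2(1) k(1) r2(2) sqT b] partial_y_bound[OF DT[of h] r2(1) k(1) r2(2) sqT b]
  show "\<bar>px (D h) p\<bar> <= 32 * M / r^2" "\<bar>py (D h) p\<bar> <= 32 * M / r^2" by auto
 qed
 have lim: "\<bar>a\<bar> <= 32 * M / r^2" if "has_grad f p a b"
  and "!!h. 0 < h ==> h <= r / 2 ==> \<bar>(f (p + (h, 0)) - f p) / h\<bar> <= 32 * M / r^2" for f a b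
 proof -
  have "((%s. f (s, y0)) has_real_derivative a) (at x0)" using that(1) p has_grad_x by blast
  then have "((%h. (f (p + (h, 0)) - f p) / h) \<longlongrightarrow> a) (at_right 0)"
   unfolding DERIV_def using p by (auto intro: filterlim_mono at_le)
  then have "((%h. \<bar>(f (p + (h, 0)) - f p) / h\<bar>) \<longlongrightarrow> \<bar>a\<bar>) (at_right 0)" by (rule tendsto_rabs)
  moreover have "\<forall>\<^sub>F h in at_right 0. \<bar>(f (p + (h, 0)) - f p) / h\<bar> <= 32 * M / r^2"
   unfolding eventually_at_right_field using that(2) r by (intro exI[of _ "r / 2"]) auto
  ultimately show ?thesis by (rule tendsto_upperbound) auto
 qed
 show "\<bar>px (px u) p\<bar> <= 32 * M / r^2"
  by (rule lim[OF d(3)[OF pS]]) (metis Dpart(1,3))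
 show "\<bar>px (py u) p\<bar> <= 32 * M / r^2"
  by (rule lim[OF d(4)[OF pS]]) (metis Dpart(2,4))
qed

lemma second_partials_bound':
 assumes u: "helm S k u" and r: "0 < r" and k: "0 <= k" "k * r^2 <= 1" and sq: "square p (2 * r) \<subseteq> S"
  and M: "!!q. q \<in> square p (2 * r) ==> \<bar>u q\<bar> <= M"
 shows "\<bar>py (px u) p\<bar> <= 32 * M / r^2" "\<bar>py (py u) p\<bar> <= 32 * M / r^2"
proof -
 define T where "T = {q. prod.swap q \<in> S}"
 define v where "v = (%q. u (prod.swap q))"
 note s = helm_swap[OF u T_def, folded v_def]
 note d = helmD[OF u]
 have pS: "p \<in> S" using sq r by (auto simp: mem_square)
 define p' where "p' = prod.swap p"
 have p': "p' \<in> T" "prod.swap p' = p" using pS by (auto simp: T_def p'_def)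
 have chain: "has_grad (%q. f (prod.swap q)) q b a" if "has_grad f (prod.swap q) a b" for f q a b
 proof -
  have "(prod.swap has_derivative (%h. (snd h, fst h))) (at q)"
   unfolding prod.swap_def by (auto intro!: derivative_eq_intros has_derivative_Pair)
  from has_derivative_compose[OF this that] show ?thesis
   by (rule has_derivative_eq_rhs) (auto simp: algebra_simps)
 qed
 have 1: "has_grad (px v) p' (py (py u) p) (px (py u) p)"
  by (rule has_grad_cong[OF chain helmD(1)[OF s(1)] p'(1)]) (use d(4)[OF pS] p' s(2) in auto)
 have 2: "has_grad (py v) p' (py (px u) p) (px (px u) p)"
  by (rule has_grad_cong[OF chain helmD(1)[OF s(1)] p'(1)]) (use d(3)[OF pS] p' s(3) in auto)
 have 3: "square p' (2 * r) \<subseteq> T" "!!q. q \<in> square p' (2 * r) ==> \<bar>v q\<bar> <= M"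
  using sq M by (auto simp: p'_def T_def v_def mem_square subset_iff)
 show "\<bar>py (px u) p\<bar> <= 32 * M / r^2" "\<bar>py (py u) p\<bar> <= 32 * M / r^2"
  using second_partials_bound[OF s(1) r k 3] unfolding has_grad_partials(1)[OF 1] has_grad_partials(1)[OF 2] by auto
qed

section \<open>Uniform limits of gradients and interior regularity\<close>

lemma has_grad_limit:
 assumes T: "open T" "convex T" and f: "!!n q. q \<in> T ==> has_grad (f n) q (a n q) (b n q)"
  and a: "uniform_limit T a A sequentially" and b: "uniform_limit T b B sequentially"
  and g: "!!q. q \<in> T ==> (%n. f n q) \<longlonglongrightarrow> g q" and q: "q \<in> T"
 shows "has_grad g q (A q) (B q)"
proof -
 have "\<exists>g'. \<forall>x\<in>T. (%n. f n x) \<longlonglongrightarrow> g' x & (g' has_derivative (%h. fst h * A x + snd h * B x)) (at x within T)"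
 proof (rule has_derivative_sequence[where f = f and f' = "%n x h. fst h * a n x + snd h * b n x"
    and g' = "%x h. fst h * A x + snd h * B x" and l = "g q", OF T(2) _ _ q g[OF q]])
  show "(f n has_derivative (%h. fst h * a n x + snd h * b n x)) (at x within T)" if "x \<in> T" for n x
   using f[OF that] by (rule has_derivative_at_withinI)
  fix e :: real assume "e > 0"
  then have "\<forall>\<^sub>F n in sequentially. \<forall>x\<in>T. dist (a n x) (A x) < e / 2"
   "\<forall>\<^sub>F n in sequentially. \<forall>x\<in>T. dist (b n x) (B x) < e / 2"
   using a b unfolding uniform_limit_iff by (meson half_gt_zero)+
  then show "\<forall>\<^sub>F n in sequentially. \<forall>x\<in>T. \<forall>h. norm (fst h * a n x + snd h * b n x - (fst h * A x + snd h * B x)) <= e * norm h"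
  proof eventually_elim
   case (elim n)
   show ?case
   proof (intro ballI allI)
    fix x and h :: "real * real" assume x: "x \<in> T"
    have "norm (fst h * a n x + snd h * b n x - (fst h * A x + snd h * B x))
     = \<bar>fst h * (a n x - A x) + snd h * (b n x - B x)\<bar>" by (simp add: algebra_simps)
    also have "... <= \<bar>fst h\<bar> * \<bar>a n x - A x\<bar> + \<bar>snd h\<bar> * \<bar>b n x - B x\<bar>"
     by (metis abs_mult abs_triangle_ineq)
    also have "... <= norm h * (e / 2) + norm h * (e / 2)"
     using elim x norm_fst_le[of "fst h" "snd h"] norm_snd_le[of "snd h" "fst h"]
     by (intro add_mono mult_mono) (auto simp: dist_real_def less_imp_le)
    finally show "norm (fst h * a n x + snd h * b n x - (fst h * A x + snd h * B x)) <= e * norm h"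
     by (simp add: algebra_simps)
   qed
  qed
 qed
 then obtain g' where "\<forall>x\<in>T. (%n. f n x) \<longlonglongrightarrow> g' x
   & (g' has_derivative (%h. fst h * A x + snd h * B x)) (at x within T)" by (elim exE)
 note g' = bspec[OF this]
 have "has_grad g' q (A q) (B q)" using conjunct2[OF g'[OF q]] T(1) q by (simp only: at_within_open)
 then show ?thesis
  by (rule has_grad_cong[OF _ T(1) q]) (rule LIMSEQ_unique[OF conjunct1[OF g'] g])
qed

lemma uniform_limit_exists:
 fixes f :: "nat => 'a => real"
 assumes "!!e. e > 0 ==> \<exists>N. \<forall>m\<ge>N. \<forall>n\<ge>N. \<forall>x\<in>T. \<bar>f m x - f n x\<bar> <= e"
 shows "\<exists>g. uniform_limit T f g sequentially"
proof -
 have "uniformly_Cauchy_on T f" unfolding uniformly_Cauchy_on_def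
 proof (intro allI impI)
  fix e :: real assume "e > 0"
  then obtain N where N: "!!m n x. m \<ge> N ==> n \<ge> N ==> x \<in> T ==> \<bar>f m x - f n x\<bar> <= e / 2"
   using assms[of "e / 2"] by auto
  show "\<exists>M. \<forall>x\<in>T. \<forall>m\<ge>M. \<forall>n\<ge>M. dist (f m x) (f n x) < e"
   using N \<open>e > 0\<close> by (intro exI[of _ N]) (force simp: dist_real_def)
 qed
 then show ?thesis using uniformly_convergent_eq_Cauchy uniformly_convergent_on_def by blast
qed

lemma helm_local:
 assumes "open S" "!!p. p \<in> S ==> \<exists>T. p \<in> T & T \<subseteq> S & helm T k w"
 shows "helm S k w"
proof -
 have *: "\<exists>T. p \<in> T & open T & T \<subseteq> S & helm T k w" if "p \<in> S" for p
  using assms(2)[OF that] helmD(1) by blast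
 have c: "continuous_on S f" if "!!T. helm T k w ==> continuous_on T f" for f :: "real * real => real"
  unfolding continuous_on_eq_continuous_at[OF assms(1)]
  using * that by (metis continuous_on_eq_continuous_at)
 show ?thesis
  by (rule helmI[OF assms(1), of w "px w" "py w" "px (px w)" "py (px w)"
     "px (py w)" "py (py w)"])
   (use * c helmD in "metis (no_types, lifting)")+
qed

text \<open>The difference quotients converge to the partial derivative, and the bounds on second
 derivatives make the first and second derivatives of the quotients converge uniformly.\<close>

lemma helm_partial_x_aux:
 assumes u: "helm S k u" and k: "0 <= k" and p: "p \<in> S"
 shows "\<exists>T. p \<in> T & T \<subseteq> S & helm T k (px u) & (\<forall>q\<in>T. py (px u) q = px (py u) q)"
proof -
 note d = helmD[OF u]
 obtain e where e: "0 < e" "cball p e \<subseteq> S" using d(1) p open_contains_cball by blast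
 obtain r where r: "0 < r" "8 * r <= e" "k * r^2 <= 1"
 proof -
  define r where "r = min (e / 8) (1 / (1 + k))"
  have r0: "0 < r" "r <= e / 8" "r <= 1 / (1 + k)" using e k by (auto simp: r_def)
  have "r <= 1" using r0(3) k by (smt (verit) divide_le_eq_1_pos)
  then have "k * r^2 <= k * r" using k r0 by (simp add: power2_eq_square mult_left_le mult_left_mono)
  also have "... <= (1 + k) * r" using r0 by (simp add: algebra_simps)
  also have "... <= 1" using r0(3) k by (simp add: field_simps)
  finally show ?thesis using r0 that by simp
 qed
 have sqS: "square p (4 * r) \<subseteq> S"
 proof
  fix q assume "q \<in> square p (4 * r)"
  then have "\<bar>fst p - fst q\<bar> <= 4 * r" "\<bar>snd p - snd q\<bar> <= 4 * r" by (auto simp: mem_square abs_minus_commute)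
  then have "dist p q <= 8 * r"
   using norm_triangle_ineq[of "(fst (p - q), 0)" "(0, snd (p - q))"] by (auto simp: dist_norm norm_Pair minus_prod_def)
  then show "q \<in> S" using e r by auto
 qed
 then have sqS': "q \<in> S" if "q \<in> square p (4 * r)" for q using that by blast
 define h where "h = (%n. r * inverse (real (Suc n)))"
 have h: "0 < h n" "h n <= r" for n using r by (auto simp: h_def field_simps mult_nonneg_nonneg)
 have hlim: "h \<longlonglongrightarrow> 0" unfolding h_def using tendsto_mult[OF tendsto_const[of r] LIMSEQ_inverse_real_of_nat] by simp
 define f where "f = (%n q. (1 / h n) * u (q + (h n, 0)) + (- 1 / h n) * u q)"
 define B where "B = open_square p (3 * r)"
 have B: "open B" "B \<subseteq> square p (3 * r)" unfolding B_def by (rule open_square)+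
 have inS: "q \<in> S & q + (h n, 0) \<in> S" if "q \<in> square p (3 * r)" for q n
  using that h[of n] r by (intro conjI sqS') (auto simp: mem_square_lin)
 note sh = helm_shift[OF u, where c = "(h n, 0)" for n]
 have fB: "helm B k (f n)" for n unfolding f_def
  using B inS by (intro helm_lincomb helm_subset[OF sh(1)] helm_subset[OF u]) auto
 have unif: "\<exists>N. \<forall>n\<ge>N. \<forall>q\<in>square p (3 * r). \<bar>f n q - px u q\<bar> <= e" if "e > 0" for e
 proof -
  have "uniformly_continuous_on (square p (4 * r)) (px u)"
   by (rule compact_uniformly_continuous[OF continuous_on_subset[OF d(11) sqS]]) (simp add: square_def)
  then obtain de where de: "0 < de" "!!q q'. q \<in> square p (4 * r) ==> q' \<in> square p (4 * r) ==> dist q' q < de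
    ==> dist (px u q') (px u q) < e"
   unfolding uniformly_continuous_on_def using \<open>e > 0\<close> by blast
  obtain N where N: "!!n. n \<ge> N ==> h n < de"
   using order_tendstoD(2)[OF hlim de(1)] by (auto simp: eventually_sequentially)
  have "\<bar>f n q - px u q\<bar> <= e" if n: "n \<ge> N" and q: "q \<in> square p (3 * r)" for n q
  proof -
   obtain a b where ab: "q = (a, b)" by (cases q)
   have in': "(z, b) \<in> square p (4 * r)" if "a <= z" "z <= a + h n" for z
    using q h[of n] ab that by (auto simp: mem_square_lin)
   obtain z where z: "a < z" "z < a + h n" "u (a + h n, b) - u (a, b) = (a + h n - a) * px u (z, b)"
    using MVT2[of a "a + h n" "%s. u (s, b)" "%s. px u (s, b)"] h(1)[of n]
     has_grad_x[OF d(2)[OF sqS'[OF in']]] by auto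
   have "f n q = (u (a + h n, b) - u (a, b)) / h n" using ab by (simp add: f_def diff_divide_distrib)
   also have "... = px u (z, b)" using z h[of n] by simp
   finally show ?thesis
    using de(2)[of "(a, b)" "(z, b)"] in'[of z] in'[of a] z h(1)[of n] N[OF n] ab by (auto simp: dist_real_def dist_prod_def)
  qed
  then show ?thesis by blast
 qed
 define T where "T = open_square p r"
 have T: "open T" "convex T" "p \<in> T" using r open_square by (auto simp: T_def mem_open_square)
 have TB: "square q (2 * (r / 2)) \<subseteq> B" "square q (r / 2) \<subseteq> B" "q \<in> B" if "q \<in> T" for q
  using that r by (auto simp: T_def B_def mem_square_lin mem_open_square)
 have TS: "q \<in> S" if "q \<in> T" for q using TB(3)[OF that] B inS by blast
 have k2: "k * (r / 2)^2 <= 1" using r k by (auto simp: power_divide)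
 have diff: "helm B k (%q. 1 * f m q + (-1) * f n q)" for m n by (rule helm_lincomb fB)+
 \<comment> \<open>The operator \<open>g\<close> is linear on the quotients and bounded by their
   supremum over \<open>B\<close>, so uniform convergence on \<open>B\<close> yields a uniform
   Cauchy sequence on \<open>T\<close>. It is instantiated with all six first and second
   derivatives.\<close>
 have Cauchy: "\<exists>N. \<forall>m\<ge>N. \<forall>n\<ge>N. \<forall>q\<in>T. \<bar>g (f m) q - g (f n) q\<bar> <= e"
  if "e > 0" and g: "!!w q M. helm B k w ==> q \<in> T ==> (!!q. q \<in> B ==> \<bar>w q\<bar> <= M) ==> \<bar>g w q\<bar> <= C * M"
   "!!m n q. q \<in> T ==> g (%q. 1 * f m q + (-1) * f n q) q = g (f m) q - g (f n) q" and C: "C > 0" for g e C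
 proof -
  obtain N where N: "!!n q. n \<ge> N ==> q \<in> B ==> \<bar>f n q - px u q\<bar> <= e / (2 * C)"
   using unif[of "e / (2 * C)"] \<open>e > 0\<close> C B by auto
  have "\<bar>g (f m) q - g (f n) q\<bar> <= e" if "m \<ge> N" "n \<ge> N" "q \<in> T" for m n q
  proof -
   have "\<bar>1 * f m q + (-1) * f n q\<bar> <= e / C" if "q \<in> B" for q
   proof -
    have "\<bar>f m q - f n q\<bar> <= e / (2 * C) + e / (2 * C)" using N[OF \<open>m \<ge> N\<close> that] N[OF \<open>n \<ge> N\<close> that] by linarith
    then show ?thesis by (simp add: field_simps)
   qed
   from g(1)[OF diff \<open>q \<in> T\<close> this] g(2)[OF \<open>q \<in> T\<close>] C show ?thesis by simp
  qed
  then show ?thesis by blast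
 qed
 have lin: "px (%q. 1 * f m q + (-1) * f n q) q = px (f m) q - px (f n) q"
  "py (%q. 1 * f m q + (-1) * f n q) q = py (f m) q - py (f n) q" if "q \<in> B" for m n q
  using has_grad_partials[OF has_grad_lincomb[OF helmD(2)[OF fB that] helmD(2)[OF fB that], of 1 m "-1" n]] by auto
 have lin2: "px (px (%q. 1 * f m q + (-1) * f n q)) q = px (px (f m)) q - px (px (f n)) q"
  "py (px (%q. 1 * f m q + (-1) * f n q)) q = py (px (f m)) q - py (px (f n)) q"
  "px (py (%q. 1 * f m q + (-1) * f n q)) q = px (py (f m)) q - px (py (f n)) q"
  "py (py (%q. 1 * f m q + (-1) * f n q)) q = py (py (f m)) q - py (py (f n)) q"
  if "q \<in> B" for m n q
  using has_grad_partials[OF has_grad_cong[OF has_grad_lincomb[OF helmD(3)[OF fB that] helmD(3)[OF fB that], of 1 m "-1" n] B(1) that, of "px (%q. 1 * f m q + (-1) * f n q)"]]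
   has_grad_partials[OF has_grad_cong[OF has_grad_lincomb[OF helmD(4)[OF fB that] helmD(4)[OF fB that], of 1 m "-1" n] B(1) that, of "py (%q. 1 * f m q + (-1) * f n q)"]]
   lin by simp_all
 have r2: "0 < r / 2" using r by simp
 define C where "C = max (4 / (r / 2)) (32 / (r / 2)^2)"
 have C: "0 < C" using r by (simp add: C_def less_max_iff_disj)
 have bd: "\<bar>px w q\<bar> <= C * M" "\<bar>py w q\<bar> <= C * M" "\<bar>px (px w) q\<bar> <= C * M"
   "\<bar>py (px w) q\<bar> <= C * M" "\<bar>px (py w) q\<bar> <= C * M" "\<bar>py (py w) q\<bar> <= C * M"
  if w: "helm B k w" and q: "q \<in> T" and M: "!!q. q \<in> B ==> \<bar>w q\<bar> <= M" for w q M
 proof -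
  have M0: "0 <= M" using M[OF TB(3)[OF q]] by simp
  have le: "4 * M / (r / 2) <= C * M" "32 * M / (r / 2)^2 <= C * M"
   using mult_right_mono[OF _ M0, of "4 / (r / 2)" C] mult_right_mono[OF _ M0, of "32 / (r / 2)^2" C] by (auto simp: C_def)
  have Mq: "\<bar>w z\<bar> <= M" if "z \<in> square q (2 * (r / 2))" for z using M TB(1)[OF q] that by blast
  have Mq': "\<bar>w z\<bar> <= M" if "z \<in> square q (r / 2)" for z using M TB(2)[OF q] that by blast
  show "\<bar>px w q\<bar> <= C * M" using partial_x_bound[OF w r2 k k2 TB(2)[OF q] Mq'] le by simp
  show "\<bar>py w q\<bar> <= C * M" using partial_y_bound[OF w r2 k k2 TB(2)[OF q] Mq'] le by simp
  show "\<bar>px (px w) q\<bar> <= C * M" "\<bar>px (py w) q\<bar> <= C * M"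
   using second_partials_bound[OF w r2 k k2 TB(1)[OF q] Mq] le by auto
  show "\<bar>py (px w) q\<bar> <= C * M" "\<bar>py (py w) q\<bar> <= C * M"
   using second_partials_bound'[OF w r2 k k2 TB(1)[OF q] Mq] le by auto
 qed
 obtain a where a: "uniform_limit T (%n. px (f n)) a sequentially"
  using uniform_limit_exists[OF Cauchy[where g = px, OF _ bd(1) lin(1)[OF TB(3)] C]] by blast
 obtain b where b: "uniform_limit T (%n. py (f n)) b sequentially"
  using uniform_limit_exists[OF Cauchy[where g = py, OF _ bd(2) lin(2)[OF TB(3)] C]] by blast
 obtain a1 where a1: "uniform_limit T (%n. px (px (f n))) a1 sequentially"
  using uniform_limit_exists[OF Cauchy[where g = "%w. px (px w)", OF _ bd(3) lin2(1)[OF TB(3)] C]] by blast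
 obtain a2 where a2: "uniform_limit T (%n. py (px (f n))) a2 sequentially"
  using uniform_limit_exists[OF Cauchy[where g = "%w. py (px w)", OF _ bd(4) lin2(2)[OF TB(3)] C]] by blast
 obtain b1 where b1: "uniform_limit T (%n. px (py (f n))) b1 sequentially"
  using uniform_limit_exists[OF Cauchy[where g = "%w. px (py w)", OF _ bd(5) lin2(3)[OF TB(3)] C]] by blast
 obtain b2 where b2: "uniform_limit T (%n. py (py (f n))) b2 sequentially"
  using uniform_limit_exists[OF Cauchy[where g = "%w. py (py w)", OF _ bd(6) lin2(4)[OF TB(3)] C]] by blast
 have fl: "(%n. f n q) \<longlonglongrightarrow> px u q" if qT: "q \<in> T" for q
 proof (rule LIMSEQ_I)
  fix e :: real assume "0 < e"
  then obtain N where "!!n. n \<ge> N ==> \<bar>f n q - px u q\<bar> <= e / 2"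
   using unif[of "e / 2"] TB(3)[OF qT] B(2) by auto
  then show "\<exists>N. \<forall>n\<ge>N. norm (f n q - px u q) < e" using \<open>0 < e\<close> by (intro exI[of _ N]) force
 qed
 have g1: "has_grad (px u) q (a q) (b q)" if "q \<in> T" for q
  by (rule has_grad_limit[OF T(1,2) helmD(2)[OF fB TB(3)] a b fl that])
 have g2: "has_grad a q (a1 q) (a2 q)" if "q \<in> T" for q
  by (rule has_grad_limit[OF T(1,2) helmD(3)[OF fB TB(3)] a1 a2 tendsto_uniform_limitI[OF a] that])
 have g3: "has_grad b q (b1 q) (b2 q)" if "q \<in> T" for q
  by (rule has_grad_limit[OF T(1,2) helmD(4)[OF fB TB(3)] b1 b2 tendsto_uniform_limitI[OF b] that])
 have TB': "T \<subseteq> B" using TB(3) by blast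
 have lap: "a1 q + b2 q = - k * px u q" if q: "q \<in> T" for q
 proof -
  have "(%n. px (px (f n)) q + py (py (f n)) q) \<longlonglongrightarrow> a1 q + b2 q"
   using tendsto_uniform_limitI[OF a1 q] tendsto_uniform_limitI[OF b2 q] by (rule tendsto_add)
  moreover have "(%n. px (px (f n)) q + py (py (f n)) q) \<longlonglongrightarrow> - k * px u q"
   unfolding helmD(9)[OF fB TB(3)[OF q]] by (rule tendsto_mult[OF tendsto_const fl[OF q]])
  ultimately show ?thesis by (rule LIMSEQ_unique)
 qed
 have cl: "continuous_on T g" if "uniform_limit T F g sequentially" "!!n. continuous_on B (F n)" for F and g :: "real * real => real"
  by (rule uniform_limit_theorem[OF _ that(1)]) (auto intro!: always_eventually continuous_on_subset[OF that(2) TB'])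
 have "helm T k (px u)"
  by (rule helmI[OF T(1) g1 g2 g3 cl[OF a1] cl[OF a2] cl[OF b1] cl[OF b2] lap]) (assumption | rule helmD(5-8)[OF fB])+
 \<comment> \<open>The \<open>y\<close>-derivative of a quotient in \<open>x\<close> is the quotient
   of \<open>py u\<close>. Its limit, computed in both ways, identifies the two mixed
   derivatives.\<close>
 moreover have "py (px u) q = px (py u) q" if q: "q \<in> T" for q
 proof -
  obtain x y where xy: "q = (x, y)" by (cases q)
  have "((%s. py u (s, y)) has_real_derivative px (py u) q) (at x)"
   using has_grad_x d(4)[OF TS[OF q]] xy by blast
  then have "((%s. (py u (x + s, y) - py u (x, y)) / s) \<longlongrightarrow> px (py u) q) (at 0)"
   unfolding DERIV_def .
  moreover have "filterlim h (at 0) sequentially"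
   using hlim h(1) by (simp add: filterlim_at less_imp_neq[THEN not_sym] eventually_sequentially)
  ultimately have "(%n. (py u (x + h n, y) - py u (x, y)) / h n) \<longlonglongrightarrow> px (py u) q"
   by (rule filterlim_compose)
  moreover have "py (f n) q = (py u (x + h n, y) - py u (x, y)) / h n" for n
  proof -
   have qs: "q + (h n, 0) \<in> S" "q \<in> S" using inS TB(3)[OF q] B by blast+
   have "has_grad (%q. u (q + (h n, 0))) q (px u (q + (h n, 0))) (py u (q + (h n, 0)))"
    using helmD(2)[OF helm_shift(1)[OF u], of q "(h n, 0)"] sh(2)[OF qs(1)] sh(3)[OF qs(1)] qs by simp
   from has_grad_partials(2)[OF has_grad_lincomb[OF this d(2)[OF qs(2)]], of "1 / h n" "- 1 / h n"]
   show ?thesis by (simp add: f_def xy diff_divide_distrib)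
  qed
  ultimately have "(%n. py (f n) q) \<longlonglongrightarrow> px (py u) q" by simp
  with tendsto_uniform_limitI[OF b q] have "b q = px (py u) q" by (rule LIMSEQ_unique)
  with has_grad_partials[OF g1[OF q]] show ?thesis by simp
 qed
 ultimately show ?thesis using T(3) TS by blast
qed

lemma helm_partial_x:
 assumes "helm S k u" "0 <= k"
 shows "helm S k (px u)"
 by (rule helm_local[OF helmD(1)[OF assms(1)]]) (use helm_partial_x_aux[OF assms] in blast)

lemma partials_commute:
 assumes "helm S k u" "0 <= k" "p \<in> S"
 shows "py (px u) p = px (py u) p"
 using helm_partial_x_aux[OF assms] by blast

lemma helm_cong:
 assumes "helm S k u" "!!p. p \<in> S ==> u p = w p"
 shows "helm S k w"
proof -
 note d = helmD[OF assms(1)]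
 have "has_grad w p (px u p) (py u p)" if "p \<in> S" for p
  by (rule has_grad_cong[OF d(2)[OF that] d(1) that assms(2)])
 from helmI[OF d(1) this d(3,4,5,6,7,8)] d(9) assms(2) show ?thesis by simp
qed

lemma helm_partial_y:
 assumes u: "helm S k u" and "0 <= k"
 shows "helm S k (py u)"
proof -
 define T where "T = {q. prod.swap q \<in> S}"
 have S: "S = {q. prod.swap q \<in> T}" by (auto simp: T_def)
 note s = helm_swap[OF u T_def]
 have "helm S k (%q. px (%q. u (prod.swap q)) (prod.swap q))"
  by (rule helm_swap(1)[OF helm_partial_x[OF s(1) assms(2)] S])
 then show ?thesis by (rule helm_cong) (use s(2) in "auto simp: T_def")
qed

section \<open>Lower bounds for supersolutions and the Harnack inequality\<close>

lemma dist_prod_sq: "(dist p q)^2 = (fst q - fst p)^2 + (snd q - snd p)^2" for p q :: "real * real"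
 by (simp add: dist_prod_def dist_real_def power2_commute)

lemma sd2_inverse_square:
 assumes "(s::real)^2 + c > 0" "c \<ge> 0"
 shows "sd2 (%s. 1 / (s^2 + c)) s (- 2 * s / (s^2 + c)^2) ((6 * s^2 - 2 * c) / (s^2 + c) ^ 3)"
proof (rule sd2I_open[of "{t. t\<^sup>2 + c > 0}" _ _ "%s. - 2 * s / (s^2 + c)^2"])
 show "open {t::real. t\<^sup>2 + c > 0}" by (intro open_Collect_less continuous_intros)
 show "s \<in> {t. t\<^sup>2 + c > 0}" using assms by simp
 show "((%s. 1 / (s^2 + c)) has_real_derivative - 2 * s / (s^2 + c)^2) (at s)" if "s \<in> {t. t\<^sup>2 + c > 0}" for s :: real
  using that by (auto intro!: derivative_eq_intros simp: power2_eq_square)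
 have "((%s. - 2 * s / (s^2 + c)^2) has_real_derivative (- 2 * (s^2 + c)^2 - (- 2 * s) * (2 * (s^2 + c) * (2 * s))) / ((s^2 + c)^2 * (s^2 + c)^2)) (at s)"
  using assms by (intro DERIV_divide) (auto intro!: derivative_eq_intros)
 moreover have "(- 2 * (s^2 + c)^2 - (- 2 * s) * (2 * (s^2 + c) * (2 * s))) / ((s^2 + c)^2 * (s^2 + c)^2)
  = (6 * s^2 - 2 * c) / (s^2 + c) ^ 3"
 proof -
  define A where "A = s^2 + c"
  have "(- 2 * A^2 - (- 2 * s) * (2 * A * (2 * s))) = A * (6 * s^2 - 2 * c)"
   by (simp add: A_def power2_eq_square algebra_simps)
  moreover have "A^2 * A^2 = A * A ^ 3" by (simp add: power2_eq_square power3_eq_cube)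
  ultimately show ?thesis using assms(1) by (simp add: A_def[symmetric])
 qed
 ultimately show "((%s. - 2 * s / (s^2 + c)^2) has_real_derivative (6 * s^2 - 2 * c) / (s^2 + c) ^ 3) (at s)" by simp
qed simp

text \<open>Unlike the logarithm, the inverse square of the distance is strictly subharmonic in the
  plane; the surplus pays for a zeroth order term in \<open>annulus_lower\<close>.\<close>

lemma grad_lap_inverse_square:
 fixes q p :: "real * real"
 assumes "p ~= q"
 shows "\<exists>a b. grad_lap (%p. 1 / (dist q p)^2) p a b (4 / (dist q p) ^ 4)"
proof -
 define c where "c = (snd p - snd q)^2"
 define d where "d = (fst p - fst q)^2"
 have pos: "d + c > 0" using assms by (cases p; cases q) (auto simp: c_def d_def sum_power2_gt_zero_iff)
 have 1: "sd2 (%s. 1 / (s^2 + c)) (1 * fst p + - fst q) (- 2 * (fst p - fst q) / (d + c)^2) ((6 * d - 2 * c) / (d + c) ^ 3)"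
  using sd2_inverse_square[of "fst p - fst q" c] pos by (simp add: d_def c_def)
 have 2: "sd2 (%s. 1 / (s^2 + d)) (1 * snd p + - snd q) (- 2 * (snd p - snd q) / (d + c)^2) ((6 * c - 2 * d) / (d + c) ^ 3)"
  using sd2_inverse_square[of "snd p - snd q" d] pos by (simp add: d_def c_def add.commute)
 have "grad_lap (%p. 1 / (dist q p)^2) (fst p, snd p) (- 2 * (fst p - fst q) / (d + c)^2) (- 2 * (snd p - snd q) / (d + c)^2)
   ((6 * d - 2 * c) / (d + c) ^ 3 + (6 * c - 2 * d) / (d + c) ^ 3)"
  using sd2_affine[OF 1] sd2_affine[OF 2] by (intro grad_lapI) (simp_all add: dist_prod_sq c_def d_def add.commute)
 moreover have "(6 * d - 2 * c) / (d + c) ^ 3 + (6 * c - 2 * d) / (d + c) ^ 3 = 4 / (d + c)^2"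
 proof -
  have "(6 * d - 2 * c) / (d + c) ^ 3 + (6 * c - 2 * d) / (d + c) ^ 3 = ((d + c) * 4) / ((d + c) * (d + c)^2)"
   by (simp add: add_divide_distrib[symmetric] power2_eq_square power3_eq_cube algebra_simps)
  also have "... = 4 / (d + c)^2" by (rule mult_divide_mult_cancel_left) (use pos in simp)
  finally show ?thesis .
 qed
 moreover have "(dist q p) ^ 4 = (d + c)^2" using dist_prod_sq[of q p] by (simp add: c_def d_def power4_eq_xxxx power2_eq_square mult.assoc)
 ultimately show ?thesis by auto
qed

text \<open>The barrier is at most \<open>m\<close> on the inner circle and 0 on the outer one. Its
  Laplacian is a multiple of 4 / rho^4, which exceeds (4 / R^2) (1 / rho^2 - 1 / R^2); so it is a
  subsolution for the constant 4 / R^2, and \<open>C <= 4 / R^2\<close>.\<close>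

lemma annulus_lower:
 fixes f :: "real * real => real"
 assumes r: "0 < r" "r < R" and C: "0 <= C" "C * R^2 <= 4" and m: "0 <= m"
  and cont: "continuous_on (cball q R) f" and nn: "!!p. p \<in> cball q R ==> 0 <= f p"
  and sup: "!!p. r < dist q p ==> dist q p < R ==> supersol (- C) f p"
  and low: "!!p. dist q p = r ==> m <= f p" and p: "r <= dist q p" "dist q p <= R"
 shows "m * r^2 * (1 / (dist q p)^2 - 1 / R^2) <= f p"
proof -
 define b where "b = (%p. m * r^2 * (1 / (dist q p)^2 - 1 / R^2))"
 define K where "K = cball q R - ball q r"
 define U where "U = ball q R - cball q r"
 have "b p <= f p + e" if e: "e > 0" for e
 proof (rule maximum_principle[where K = K and U = U and Z = "%p. f p + e"])
  show "compact K" unfolding K_def by (intro compact_diff) auto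
  show "continuous_on K b" unfolding b_def using r by (intro continuous_intros) (auto simp: K_def)
  show "continuous_on K (%p. f p + e)" using continuous_on_subset[OF cont, of K] by (intro continuous_intros) (auto simp: K_def)
  show "0 < f p + e" if "p \<in> K" for p using nn[of p] that e by (auto simp: K_def)
  show "open U" by (auto simp: U_def)
  show "U \<subseteq> K" by (auto simp: U_def K_def)
  show "p \<in> K" using p by (auto simp: K_def)
  show "b z <= f z + e" if zK: "z \<in> K - U" for z
  proof -
   consider "dist q z = R" | "dist q z = r" using zK by (force simp: K_def U_def)
   then show ?thesis
   proof cases
    case 1 then show ?thesis using nn[of z] e by (simp add: b_def)
   next
    case 2
    have "b z = m * (1 - r^2 / R^2)" using 2 r by (simp add: b_def field_simps)
    also have "... <= m" using m by (simp add: mult_left_le)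
    finally show ?thesis using low[OF 2] e by simp
   qed
  qed
  fix z assume z: "z \<in> U" and gt: "f z + e < b z"
  define \<rho> where "\<rho> = dist q z"
  have \<rho>: "r < \<rho>" "\<rho> < R" using z by (auto simp: U_def \<rho>_def)
  have zq: "z ~= q" using \<rho> r by (auto simp: \<rho>_def)
  obtain a a' where "grad_lap (%p. 1 / (dist q p)^2) z a a' (4 / \<rho> ^ 4)" unfolding \<rho>_def using grad_lap_inverse_square[OF zq] by blast
  from grad_lap_cmult[OF grad_lap_diff[OF this grad_lap_const[of "1 / R^2"]], of "m * r^2"]
  have "grad_lap b z (m * r^2 * (a - 0)) (m * r^2 * (a' - 0)) (m * r^2 * (4 / \<rho> ^ 4 - 0))" unfolding b_def .
  moreover have "- (- (4 / R^2)) * b z <= m * r^2 * (4 / \<rho> ^ 4 - 0)"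
  proof -
   have "1 / R^2 * (1 / \<rho>^2 - 1 / R^2) <= 1 / \<rho>^2 * (1 / \<rho>^2)"
    using \<rho> r by (intro mult_mono) (auto intro!: divide_left_mono power_mono mult_pos_pos)
   then have "m * r^2 * (4 * (1 / R^2 * (1 / \<rho>^2 - 1 / R^2))) <= m * r^2 * (4 * (1 / \<rho>^2 * (1 / \<rho>^2)))"
    using m by (intro mult_left_mono) auto
   then show ?thesis by (simp add: b_def \<rho>_def power4_eq_xxxx power2_eq_square algebra_simps)
  qed
  ultimately have "subsol (- (4 / R^2)) b z" by (rule subsolI)
  moreover have "strict_supersol (- (4 / R^2)) (%p. f p + e) z"
  proof -
   obtain s a b l where s: "\<forall>\<^sub>F q in nhds z. f q <= s q" "s z = f z" "grad_lap s z a b l" "l <= - (- C) * f z"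
    using sup[of z] \<rho> unfolding \<rho>_def supersol_def by blast
   have fz: "0 <= f z" using nn \<rho> by (auto simp: \<rho>_def)
   have "C <= 4 / R^2" using C r by (simp add: field_simps)
   then have "C * f z <= 4 / R^2 * f z" using fz by (rule mult_right_mono)
   also have "... < 4 / R^2 * (f z + e)" using e r by (intro mult_strict_left_mono) auto
   finally have "l + 0 < - (- (4 / R^2)) * (f z + e)" using s(4) by simp
   then show ?thesis unfolding strict_supersol_def
    using s grad_lap_add[OF s(3) grad_lap_const[of e]]
    by (intro exI[of _ "%q. s q + e"] exI) auto
  qed
  ultimately show "\<exists>m. subsol m b z & strict_supersol m (%p. f p + e) z" by (intro exI conjI)
 qed
 then have "b p <= f p" by (rule field_le_epsilon)
 then show ?thesis by (simp only: b_def)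
qed

text \<open>At distance \<open>2 * r\<close> the barrier with outer radius \<open>3 * r\<close>
  still has 1/4 - 1/9 = 5/36 of \<open>m\<close>, more than an eighth.\<close>

lemma chain_step:
 fixes f :: "real * real => real"
 assumes r: "0 < r" and C: "0 <= C" "C * (3 * r)^2 <= 4" and m: "0 <= m"
  and cont: "continuous_on (cball q (3 * r)) f" and nn: "!!p. p \<in> cball q (3 * r) ==> 0 <= f p"
  and sup: "!!p. p \<in> cball q (3 * r) ==> supersol (- C) f p"
  and low: "!!p. p \<in> cball q r ==> m <= f p" and p: "dist q p <= 2 * r"
 shows "m / 8 <= f p"
proof (cases "dist q p <= r")
 case True
 then show ?thesis using low[of p] m by auto
next
 case False
 have "m * r^2 * (1 / (dist q p)^2 - 1 / (3 * r)^2) <= f p"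
  by (rule annulus_lower[OF r _ C m cont nn]) (use r low sup p False in auto)
 moreover have "m / 8 <= m * r^2 * (1 / (dist q p)^2 - 1 / (3 * r)^2)"
 proof -
  have "(dist q p)^2 <= (2 * r)^2" using p r by (intro power_mono) auto
  then have "1 / (2 * r)^2 <= 1 / (dist q p)^2" using False r by (intro divide_left_mono) (auto simp: zero_less_mult_iff)
  then have "r^2 * (1 / (2 * r)^2 - 1 / (3 * r)^2) <= r^2 * (1 / (dist q p)^2 - 1 / (3 * r)^2)" by (intro mult_left_mono) auto
  moreover have "r^2 * (1 / (2 * r)^2 - 1 / (3 * r)^2) = 5 / 36" using r by (simp add: power_mult_distrib field_simps)
  ultimately have "1 / 8 <= r^2 * (1 / (dist q p)^2 - 1 / (3 * r)^2)" by simp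
  from mult_left_mono[OF this m] show ?thesis by (simp add: mult.assoc)
 qed
 ultimately show ?thesis by linarith
qed

lemma chain_lower:
 fixes f :: "real * real => real"
 assumes r: "0 < r" and C: "0 <= C" "C * (3 * r)^2 <= 4" and m: "0 <= m"
  and G: "!!z. z \<in> closed_segment a b ==> cball z (3 * r) \<subseteq> G"
  and cont: "continuous_on G f" and nn: "!!p. p \<in> G ==> 0 <= f p"
  and sup: "!!p. p \<in> G ==> supersol (- C) f p"
  and low: "!!p. p \<in> cball a r ==> m <= f p" and n: "dist a b <= real n * r" and p: "p \<in> cball b r"
 shows "m / 8 ^ n <= f p"
proof (cases "n = 0")
 case True
 then show ?thesis using n low p by simp
next
 case False
 define z where "z = (%i. a + (real i / real n) *\<^sub>R (b - a))"
 have zseg: "z i \<in> closed_segment a b" if "i <= n" for i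
  using that False unfolding in_segment by (intro exI[of _ "real i / real n"]) (auto simp: z_def algebra_simps)
 have step: "dist (z i) (z (Suc i)) <= r" for i
 proof -
  have "z i - z (Suc i) = (- 1 / real n) *\<^sub>R (b - a)"
   by (simp add: z_def scaleR_left_diff_distrib[symmetric] diff_divide_distrib[symmetric])
  then have "dist (z i) (z (Suc i)) = dist a b / real n" by (simp add: dist_norm norm_minus_commute)
  then show ?thesis using n False by (simp only: divide_le_eq mult.commute) simp
 qed
 have "\<forall>p\<in>cball (z i) r. m / 8 ^ i <= f p" if "i <= n" for i using that
 proof (induction i)
  case 0 then show ?case using low by (simp add: z_def)
 next
  case (Suc i)
  have s: "cball (z i) (3 * r) \<subseteq> G" using G zseg Suc by simp
  show ?case
  proof
   fix p assume p: "p \<in> cball (z (Suc i)) r"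
   have "dist (z i) p <= 2 * r" using p step[of i] dist_triangle[of "z i" p "z (Suc i)"] by simp
   then have "m / 8 ^ i / 8 <= f p"
    by (intro chain_step[OF r C _ continuous_on_subset[OF cont s] _ _ _, of "m / 8 ^ i"]) (use Suc s nn sup m in auto)
   then show "m / 8 ^ Suc i <= f p" by (simp add: mult.commute)
  qed
 qed
 from this[of n] p False show ?thesis by (simp add: z_def)
qed

text \<open>A chain of equal discs inside \<open>G\<close> leads from a point where \<open>f\<close>
  is positive to the zero \<open>z\<close>; finitely many factors 1/8 cannot annihilate a positive
  bound.\<close>

lemma strong_maximum_principle:
 fixes f :: "real * real => real"
 assumes G: "open G" "convex G" and C: "0 <= C" and cont: "continuous_on G f"
  and nn: "!!p. p \<in> G ==> 0 <= f p" and sup: "!!p. p \<in> G ==> supersol (- C) f p"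
  and z: "z \<in> G" "f z = 0" and a: "a \<in> G"
 shows "f a = 0"
proof (rule ccontr)
 assume "f a ~= 0"
 then have fa: "f a > 0" using nn[OF a] by simp
 have seg: "closed_segment a z \<subseteq> G" by (rule closed_segment_subset[OF a z(1) G(2)])
 obtain e where e: "e > 0" "!!w. w \<in> closed_segment a z ==> cball w e \<subseteq> G"
 proof -
  obtain e where e: "e > 0" "(\<Union>w\<in>closed_segment a z. ball w e) \<subseteq> G"
   using compact_subset_open_imp_ball_epsilon_subset[OF compact_segment G(1) seg] .
  have "cball w (e / 2) \<subseteq> ball w e" for w :: "real * real" using e(1) by auto
  then show ?thesis using e that[of "e / 2"] by fastforce
 qed
 have "isCont f a" using cont a G(1) continuous_on_eq_continuous_at by blast
 then obtain d where d0: "d > 0" "\<forall>p. dist p a < d --> dist (f p) (f a) < f a / 2"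
  using fa unfolding continuous_at_eps_delta by (meson half_gt_zero)
 have d: "d > 0" "!!p. dist p a < d ==> f a / 2 <= f p"
 proof -
  fix p assume "dist p a < d"
  then have "\<bar>f p - f a\<bar> < f a / 2" using d0(2)[rule_format, of p] by (simp add: dist_real_def)
  then show "f a / 2 <= f p" by linarith
 qed (rule d0)
 define t where "t = 1 / (1 + C)"
 have t: "0 < t" "t <= 1" "(1 + C) * t = 1" using C by (auto simp: t_def)
 define r where "r = min (d / 2) (min (e / 3) (t / 3))"
 have r: "0 < r" "r <= d / 2" "3 * r <= e" "3 * r <= t" using d(1) e(1) t(1) by (auto simp: r_def min_def)
 have "C * (3 * r)^2 <= C * (3 * r * 1)" using C r t unfolding power2_eq_square by (intro mult_left_mono) auto
 also have "... <= (1 + C) * (3 * r)" using r by (simp add: algebra_simps)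
 also have "... <= (1 + C) * t" using r(4) C by (intro mult_left_mono) auto
 finally have Cr: "C * (3 * r)^2 <= 4" using t by simp
 obtain n where n: "dist a z <= real n * r" using r(1) reals_Archimedean3 less_imp_le by blast
 have "f a / 2 / 8 ^ n <= f z"
 proof (rule chain_lower[OF r(1) C Cr _ _ cont nn sup _ n])
  show "cball w (3 * r) \<subseteq> G" if "w \<in> closed_segment a z" for w
   using e(2)[OF that] r(3) by (meson order_trans subset_cball)
  show "f a / 2 <= f p" if "p \<in> cball a r" for p using d(2)[of p] that r(2) d(1) by (auto simp: dist_commute)
 qed (use fa r in auto)
 with z fa show False by (simp add: field_simps)
qed

lemma lipschitz_segment:
 assumes g: "!!z. z \<in> closed_segment p q ==> has_grad f z (a z) (b z)"
  and B: "!!z. z \<in> closed_segment p q ==> \<bar>a z\<bar> <= A" "!!z. z \<in> closed_segment p q ==> \<bar>b z\<bar> <= B"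
 shows "\<bar>f q - f p\<bar> <= A * \<bar>fst q - fst p\<bar> + B * \<bar>snd q - snd p\<bar>"
proof -
 have in': "p + t *\<^sub>R (q - p) \<in> closed_segment p q" if "0 <= t" "t <= 1" for t
  using that unfolding in_segment by (intro exI[of _ t]) (auto simp: algebra_simps)
 have "((%t. f (p + t *\<^sub>R (q - p))) has_real_derivative
   (fst (q - p) * a (p + t *\<^sub>R (q - p)) + snd (q - p) * b (p + t *\<^sub>R (q - p)))) (at t)" if "0 <= t" "t <= 1" for t
  by (rule has_grad_line[OF g[OF in'[OF that]]])
 from MVT2[OF zero_less_one this] obtain t where t: "0 < t" "t < 1"
  "f (p + 1 *\<^sub>R (q - p)) - f (p + 0 *\<^sub>R (q - p)) = (1 - 0) *
   (fst (q - p) * a (p + t *\<^sub>R (q - p)) + snd (q - p) * b (p + t *\<^sub>R (q - p)))" by blast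
 have "\<bar>f q - f p\<bar> = \<bar>fst (q - p) * a (p + t *\<^sub>R (q - p)) + snd (q - p) * b (p + t *\<^sub>R (q - p))\<bar>" using t by simp
 also have "... <= \<bar>fst (q - p)\<bar> * \<bar>a (p + t *\<^sub>R (q - p))\<bar> + \<bar>snd (q - p)\<bar> * \<bar>b (p + t *\<^sub>R (q - p))\<bar>"
  by (metis abs_mult abs_triangle_ineq)
 also have "... <= \<bar>fst (q - p)\<bar> * A + \<bar>snd (q - p)\<bar> * B"
  using in'[of t] t B by (intro add_mono mult_left_mono) auto
 finally show ?thesis by (simp add: mult.commute)
qed

lemma helm_supersol:
 assumes "helm S k w" "p \<in> S" "0 <= k" "0 <= w p"
 shows "supersol 0 w p"
 using helm_grad_lap[OF assms(1,2)] assms by (intro supersolI) auto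

lemma square_subset_cball: "square p r \<subseteq> cball p (2 * r)"
proof
 fix q assume "q \<in> square p r"
 then have "\<bar>fst p - fst q\<bar> <= r" "\<bar>snd p - snd q\<bar> <= r" by (auto simp: mem_square abs_minus_commute)
 then show "q \<in> cball p (2 * r)"
  using norm_triangle_ineq[of "(fst (p - q), 0)" "(0, snd (p - q))"] by (auto simp: dist_norm norm_Pair minus_prod_def)
qed

text \<open>At a maximum of \<open>(\<rho> - |p - p\<^sub>1|)\<^sup>2 w p\<close> the gradient estimate gives a ball on which \<open>w\<close> stays
 large; its radius enters \<open>annulus_lower\<close> exactly through the maximised quantity.\<close>

lemma harnack:
 assumes w: "helm S k w" and k: "0 <= k" "k * \<rho>^2 <= 64" and \<rho>: "0 < \<rho>" and S: "cball p1 (4 * \<rho>) \<subseteq> S"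
  and nn: "!!p. p \<in> cball p1 (4 * \<rho>) ==> 0 <= w p" and p: "p \<in> cball p1 \<rho>"
 shows "w p1 / 2 ^ 22 <= w p"
proof (cases "w p1 = 0")
 case True
 then show ?thesis using nn[of p] p \<rho> by auto
next
 case False
 then have w1: "0 < w p1" using nn[of p1] \<rho> by simp
 have cw: "continuous_on (cball p1 (4 * \<rho>)) w" using continuous_on_subset[OF helmD(10)[OF w] S] .
 define g where "g = (%p. (\<rho> - dist p1 p)\<^sup>2 * w p)"
 have "continuous_on (cball p1 \<rho>) g" unfolding g_def
  using \<rho> by (intro continuous_intros continuous_on_subset[OF cw]) auto
 then obtain q where q: "q \<in> cball p1 \<rho>" "!!z. z \<in> cball p1 \<rho> ==> g z <= g q"
  using continuous_attains_sup[of "cball p1 \<rho>" g] \<rho> by (auto simp: mem_cball)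
 define d where "d = \<rho> - dist p1 q"
 have g1: "\<rho>^2 * w p1 <= d^2 * w q" using q(2)[of p1] \<rho> by (simp add: g_def d_def)
 moreover have "0 < \<rho>^2 * w p1" using w1 \<rho> by simp
 ultimately have "d ~= 0" by (auto intro: ccontr)
 then have d: "0 < d" "d <= \<rho>" using q(1) by (auto simp: d_def)
 have wq: "0 < w q" using g1 \<open>0 < \<rho>^2 * w p1\<close> by (smt (verit) zero_less_mult_iff zero_le_power2)
 \<comment> \<open>On this disc the weight \<open>\<rho> - dist p1 z\<close> is at least half its
   value at \<open>q\<close>, so maximality of \<open>g\<close> allows at most a factor
   four.\<close>
 have near: "w z <= 4 * w q" "z \<in> S" "0 <= w z" if z: "dist q z <= d / 2" for z
 proof -
  have 1: "d / 2 <= \<rho> - dist p1 z" using dist_triangle[of p1 z q] z by (simp add: d_def field_simps)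
  then have z': "z \<in> cball p1 \<rho>" using d by simp
  then show "z \<in> S" "0 <= w z" using S nn[of z] \<rho> by auto
  have "(d / 2)^2 * w z <= (\<rho> - dist p1 z)^2 * w z" using 1 d \<open>0 <= w z\<close> by (intro mult_right_mono power_mono) auto
  also have "... <= d^2 * w q" using q(2)[OF z'] by (simp add: g_def d_def)
  finally show "w z <= 4 * w q" using d by (simp add: power_divide)
 qed
 have grad: "\<bar>px w z\<bar> <= 128 * w q / d" "\<bar>py w z\<bar> <= 128 * w q / d" "z \<in> S" if z: "dist q z <= d / 8" for z
 proof -
  have sq: "dist q y <= d / 2" if "y \<in> square z (d / 8)" for y
   using subsetD[OF square_subset_cball that] z d dist_triangle[of q y z] by simp
  have r: "0 < d / 8" "k * (d / 8)^2 <= 1"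
  proof -
   have "k * d^2 <= k * \<rho>^2" using k d by (intro mult_left_mono power_mono) auto
   then show "k * (d / 8)^2 <= 1" using k by (simp add: power_divide)
  qed (use d in auto)
  have "\<bar>w y\<bar> <= 4 * w q" if "y \<in> square z (d / 8)" for y using near[OF sq[OF that]] by simp
  from partial_x_bound[OF w r(1) k(1) r(2) _ this] partial_y_bound[OF w r(1) k(1) r(2) _ this]
  show "\<bar>px w z\<bar> <= 128 * w q / d" "\<bar>py w z\<bar> <= 128 * w q / d"
   using near(2)[OF sq] by (auto simp: subset_iff)
  show "z \<in> S" using near(2)[of z] z d by simp
 qed
 have low: "w q / 2 <= w z" if z: "dist q z <= d / 512" for z
 proof -
  have "closed_segment q z \<subseteq> cball q (d / 512)" using z d by (intro closed_segment_subset) auto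
  then have seg: "dist q y <= d / 8" if "y \<in> closed_segment q z" for y using that d by fastforce
  have "\<bar>w z - w q\<bar> <= 128 * w q / d * \<bar>fst z - fst q\<bar> + 128 * w q / d * \<bar>snd z - snd q\<bar>"
   by (rule lipschitz_segment[where a = "px w" and b = "py w"]) (use seg grad helmD(2)[OF w] in auto)
  also have "... <= 128 * w q / d * (d / 512) + 128 * w q / d * (d / 512)"
   using z d wq dist_fst_le[of q z] dist_snd_le[of q z]
   by (intro add_mono mult_left_mono) (auto simp: dist_real_def abs_minus_commute)
  also have "... = w q / 2" using d by simp
  finally show ?thesis by linarith
 qed
 define r where "r = d / 512"
 have r: "0 < r" "r < 3 * \<rho>" using d \<rho> by (auto simp: r_def)
 have sub: "cball q (3 * \<rho>) \<subseteq> cball p1 (4 * \<rho>)"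
 proof
  fix z assume "z \<in> cball q (3 * \<rho>)"
  then show "z \<in> cball p1 (4 * \<rho>)" using q(1) dist_triangle[of p1 z q] by simp
 qed
 show ?thesis
 proof (cases "dist q p <= r")
  case True
  have "d^2 * w q <= \<rho>^2 * w q" using d wq by (intro mult_right_mono power_mono) auto
  with g1 have "\<rho>^2 * w p1 <= \<rho>^2 * w q" by linarith
  then have "w p1 <= w q" using \<rho> by simp
  with low[of p] True w1 show ?thesis by (simp add: r_def)
 next
  case False
  have dp: "dist q p <= 2 * \<rho>" using p q(1) dist_triangle[of q p p1] by (simp add: dist_commute)
  have "w q / 2 * r^2 * (1 / (dist q p)^2 - 1 / (3 * \<rho>)^2) <= w p"
  proof (rule annulus_lower[OF r, of 0])
   show "continuous_on (cball q (3 * \<rho>)) w" using continuous_on_subset[OF cw sub] .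
   show "supersol (- 0) w z" if "dist q z < 3 * \<rho>" for z
    using helm_supersol[OF w _ k(1), of z] nn[of z] that sub S by force
   show "0 <= w z" if "z \<in> cball q (3 * \<rho>)" for z using that sub nn by blast
  qed (use low False dp wq \<rho> in "auto simp: r_def")
  moreover have "w p1 / 2 ^ 22 <= w q / 2 * r^2 * (1 / (dist q p)^2 - 1 / (3 * \<rho>)^2)"
  proof -
   have "(dist q p)^2 <= (2 * \<rho>)^2" using dp by (intro power_mono) auto
   then have "1 / (2 * \<rho>)^2 <= 1 / (dist q p)^2" using False r \<rho> by (intro divide_left_mono) (auto simp: zero_less_mult_iff)
   moreover have "5 / (36 * \<rho>^2) = 1 / (2 * \<rho>)^2 - 1 / (3 * \<rho>)^2" using \<rho> by (simp add: power_mult_distrib field_simps)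
   ultimately have "5 / (36 * \<rho>^2) <= 1 / (dist q p)^2 - 1 / (3 * \<rho>)^2" by linarith
   then have "w q / 2 * r^2 * (5 / (36 * \<rho>^2)) <= w q / 2 * r^2 * (1 / (dist q p)^2 - 1 / (3 * \<rho>)^2)"
    using wq by (intro mult_left_mono) auto
   \<comment> \<open>Here 18874368 is 36 * 2^19: the factor \<open>r^2 / 2\<close> gives d^2 / 2^19,
     and 5/36 exceeds 2^(-3), which leads to 2^(-22).\<close>
   moreover have "w q / 2 * r^2 * (5 / (36 * \<rho>^2)) = d^2 * w q / \<rho>^2 * (5 / 18874368)"
    by (simp add: r_def power_divide mult.commute)
   moreover have "w p1 <= d^2 * w q / \<rho>^2" using g1 \<rho> by (simp add: field_simps)
   moreover have "w p1 / 2 ^ 22 = w p1 / 4194304" by simp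
   moreover have "a <= Z" if "Y <= Z" "Y = X * (5 / 18874368)" "b <= X" "a = b / 4194304" "0 < b" for a b X Y Z :: real
    using that by linarith
   ultimately show ?thesis using w1 by blast
  qed
  ultimately show ?thesis by linarith
 qed
qed

section \<open>Log-concavity of the ground state\<close>

lemma continuous_on_Sup_compact:
 fixes H :: "'a::metric_space => 'b::metric_space => real"
 assumes A: "compact A" and Z: "compact Z" "Z ~= {}" and H: "continuous_on (A \<times> Z) (%p. H (fst p) (snd p))"
 shows "continuous_on A (%x. SUP z\<in>Z. H x z)"
proof -
 have uc: "uniformly_continuous_on (A \<times> Z) (%p. H (fst p) (snd p))"
  using H A Z by (intro compact_uniformly_continuous compact_Times)
 have bdd: "bdd_above (H x ` Z)" if "x \<in> A" for x
 proof -
  have "continuous_on Z (%z. H (fst (x, z)) (snd (x, z)))"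
   by (rule continuous_on_compose2[OF H]) (use that in "auto intro!: continuous_intros")
  then have "compact (H x ` Z)" using Z by (intro compact_continuous_image) auto
  then show ?thesis by (simp add: bounded_imp_bdd_above compact_imp_bounded)
 qed
 have le: "(SUP z\<in>Z. H x z) <= (SUP z\<in>Z. H y z) + e"
  if "x \<in> A" "y \<in> A" "!!z. z \<in> Z ==> H x z <= H y z + e" for x y e
 proof (rule cSUP_least[OF Z(2)])
  fix z assume z: "z \<in> Z"
  show "H x z <= (SUP z\<in>Z. H y z) + e"
   using that(3)[OF z] cSUP_upper[OF z bdd[OF that(2)]] by linarith
 qed
 show ?thesis unfolding continuous_on_iff
 proof (intro ballI allI impI)
  fix x e assume x: "x \<in> A" and e: "(e::real) > 0"
  obtain d where d: "d > 0" "!!p q. p \<in> A \<times> Z ==> q \<in> A \<times> Z ==> dist q p < d ==>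
    dist (H (fst q) (snd q)) (H (fst p) (snd p)) < e / 2"
   using uc[unfolded uniformly_continuous_on_def, rule_format, of "e / 2"] e by auto
  have "dist (SUP z\<in>Z. H y z) (SUP z\<in>Z. H x z) < e" if y: "y \<in> A" "dist y x < d" for y
  proof -
   have "\<bar>H y z - H x z\<bar> < e / 2" if "z \<in> Z" for z
    using d(2)[of "(x, z)" "(y, z)"] x y that by (simp add: dist_Pair_Pair dist_real_def)
   then have "H y z <= H x z + e / 2" "H x z <= H y z + e / 2" if "z \<in> Z" for z using that
    by (smt (verit))+
   with le[OF x y(1), of "e / 2"] le[OF y(1) x, of "e / 2"] e
   have "\<bar>(SUP z\<in>Z. H y z) - (SUP z\<in>Z. H x z)\<bar> <= e / 2" by (smt (verit))
   then show ?thesis using e by (simp add: dist_real_def)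
  qed
  then show "\<exists>d>0. \<forall>x'\<in>A. dist x' x < d --> dist (SUP z\<in>Z. H x' z) (SUP z\<in>Z. H x z) < e"
   using d(1) by blast
 qed
qed

lemma sd2_sqrt:
 assumes "0 < P"
 shows "sd2 sqrt P (1 / (2 * sqrt P)) (- (1 / (4 * P * sqrt P)))"
proof (rule sd2I_open[of "{0<..}" _ _ "%s. 1 / (2 * sqrt s)"])
 show "(sqrt has_real_derivative 1 / (2 * sqrt s)) (at s)" if "s \<in> {0<..}" for s
  using that by (auto intro!: derivative_eq_intros simp: field_simps)
 have "((%s. 1 / (2 * sqrt s)) has_real_derivative (0 * (2 * sqrt P) - 1 * (2 * (inverse (sqrt P) / 2))) / ((2 * sqrt P) * (2 * sqrt P))) (at P)"
  using assms by (intro DERIV_divide) (auto intro!: derivative_eq_intros)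
 moreover have "(0 * (2 * sqrt P) - 1 * (2 * (inverse (sqrt P) / 2))) / ((2 * sqrt P) * (2 * sqrt P)) = - (1 / (4 * P * sqrt P))"
  using assms by (simp add: field_simps)
 ultimately show "((%s. 1 / (2 * sqrt s)) has_real_derivative - (1 / (4 * P * sqrt P))) (at P)" by simp
qed (use assms in auto)

lemma sd2_sin: "sd2 (%t. sin (c * t)) t (c * cos (c * t)) (- c\<^sup>2 * sin (c * t))"
 by (rule sd2I[where g' = "%t. c * cos (c * t)"]) (auto intro!: derivative_eq_intros simp: power2_eq_square)

lemma grad_lap_linear: "grad_lap (%x. \<nu> \<bullet> (x - z) + \<eta>) p (fst \<nu>) (snd \<nu>) 0"
proof -
 have "grad_lap (%x. \<nu> \<bullet> (x - z) + \<eta>) (fst p, snd p) (fst \<nu>) (snd \<nu>) (0 + 0)"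
  by (intro grad_lapI sd2I[where g' = "%_. fst \<nu>"] sd2I[where g' = "%_. snd \<nu>"])
   (auto intro!: derivative_eq_intros simp: inner_prod_def)
 then show ?thesis by simp
qed

lemma supporting_line:
 fixes G :: "(real * real) set"
 assumes "open G" "convex G" "z \<notin> G"
 obtains \<nu> where "norm \<nu> = 1" "!!p. p \<in> G ==> 0 < \<nu> \<bullet> (p - z)"
proof (cases "G = {}")
 case True
 then show ?thesis using that[of "(1, 0)"] by simp
next
 case False
 obtain a b where ab: "a ~= 0" "!!x. x \<in> {z} ==> a \<bullet> x <= b" "!!x. x \<in> G ==> b <= a \<bullet> x"
  using separating_hyperplane_sets[of "{z}" G] assms False by auto
 have pos: "0 < a \<bullet> (p - z)" if p: "p \<in> G" for p
 proof (rule ccontr)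
  assume "\<not> 0 < a \<bullet> (p - z)"
  then have le: "a \<bullet> p <= b" using ab(2) by (simp add: inner_diff_right)
  obtain e where e: "e > 0" "ball p e \<subseteq> G" using assms(1) p open_contains_ball by blast
  define y where "y = p - (e / (2 * norm a)) *\<^sub>R a"
  have "y \<in> G" using e ab(1) by (intro subsetD[OF e(2)]) (simp add: y_def dist_norm)
  then have "b <= a \<bullet> y" using ab(3) by blast
  moreover have "a \<bullet> y < a \<bullet> p" using e ab(1) by (simp add: y_def inner_diff_right)
  ultimately show False using le by simp
 qed
 have "norm (a /\<^sub>R norm a) = 1" using ab(1) by simp
 then show ?thesis using that[of "a /\<^sub>R norm a"] pos ab(1) by simp
qed

text \<open>\<open>G\<close> is the open domain and \<open>u\<close> is extended by zero. The
  extension is continuous on the plane, which gives products such as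
  \<open>u (x + z) * u (x - z)\<close> a meaning for every \<open>z\<close>.\<close>

locale ground =
 fixes G :: "(real * real) set" and k :: real and u :: "real * real => real" and pm :: "real * real"
 assumes oG: "open G" and cG: "convex G" and bG: "bounded G" and hu: "helm G k u"
  and cu: "continuous_on UNIV u" and pos: "!!p. p \<in> G ==> 0 < u p" and zero: "!!p. p \<notin> G ==> u p = 0"
  and le1: "!!p. u p <= 1" and pm: "pm \<in> G" "u pm = 1"
begin

lemma cuS: "continuous_on S u"
 using cu continuous_on_subset by blast

lemma u_nonneg: "0 <= u p"
 using pos[of p] zero[of p] by (cases "p \<in> G") auto

lemma k_nonneg: "0 <= k"
 using grad_lap_local_max(3)[OF helm_grad_lap[OF hu pm(1)]] le1 pm(2) by simp

text \<open>Take the supporting line at a nearest point \<open>z\<close> of the complement. The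
  projection of any point of \<open>G\<close> to this line lies outside \<open>G\<close>, so the
  distance to the complement is at most the distance to the line, with equality at \<open>p\<close>.
  Thus the boundary distance is touched from above by affine functions.\<close>

lemma infdist_compl:
 assumes "p \<in> G"
 obtains z \<nu> where "z \<notin> G" "norm \<nu> = 1" "\<nu> \<bullet> (p - z) = infdist p (- G)" "!!q. q \<in> G ==> infdist q (- G) <= \<nu> \<bullet> (q - z)"
  "!!q. q \<in> G ==> 0 < \<nu> \<bullet> (q - z)"
proof -
 have ne: "- G ~= {}" using bG by (metis Compl_empty_eq double_compl not_bounded_UNIV)
 obtain z where z: "z \<in> - G" "infdist p (- G) = dist p z"
  using infdist_attains_inf[of "- G" p] oG ne by (auto simp: closed_Compl)
 obtain \<nu> where \<nu>: "norm \<nu> = 1" "!!q. q \<in> G ==> 0 < \<nu> \<bullet> (q - z)"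
  using supporting_line[OF oG cG, of z] z by auto
 have le: "infdist q (- G) <= \<nu> \<bullet> (q - z)" if "q \<in> G" for q
 proof -
  define y where "y = q - (\<nu> \<bullet> (q - z)) *\<^sub>R \<nu>"
  have "\<nu> \<bullet> \<nu> = 1" using \<nu>(1) by (simp add: norm_eq_1)
  then have "\<nu> \<bullet> (y - z) = 0" by (simp add: y_def inner_diff_right)
  then have "y \<notin> G" using \<nu>(2)[of y] by auto
  then have "infdist q (- G) <= dist q y" by (intro infdist_le) auto
  also have "... = \<nu> \<bullet> (q - z)" using \<nu> that by (simp add: y_def dist_norm less_imp_le)
  finally show ?thesis .
 qed
 have "\<nu> \<bullet> (p - z) <= norm \<nu> * norm (p - z)" by (rule norm_cauchy_schwarz)
 then have "\<nu> \<bullet> (p - z) = infdist p (- G)" using le[OF assms] z \<nu>(1) by (simp add: dist_norm)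
 with z \<nu> le show ?thesis by (intro that) auto
qed

lemma infdist_pos: "p \<in> G ==> 0 < infdist p (- G)"
 by (rule infdist_compl[of p]) (assumption, metis)

lemma infdist_ball: "ball p (infdist p (- G)) \<subseteq> G"
proof
 fix q assume "q \<in> ball p (infdist p (- G))"
 then show "q \<in> G" using infdist_le[of q "- G" p] by (auto simp: dist_commute)
qed

text \<open>The boundary distance need not be differentiable, but the affine function from
  \<open>infdist_compl\<close> touches it from above at \<open>p\<close>. The sine is increasing
  below pi / 2 and preserves this order, and for the affine function its Laplacian is
  explicit.\<close>

lemma boundary_layer_supersol:
 assumes p: "p \<in> G" and c: "0 < c" "k < c^2" and \<eta>: "0 < \<eta>" "c * (infdist p (- G) + \<eta>) < pi / 2"
 shows "strict_supersol k (%x. sin (c * (infdist x (- G) + \<eta>))) p"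
proof -
 obtain z \<nu> where z: "z \<notin> G" "norm \<nu> = 1" "\<nu> \<bullet> (p - z) = infdist p (- G)"
  "!!q. q \<in> G ==> infdist q (- G) <= \<nu> \<bullet> (q - z)" using infdist_compl[OF p] by metis
 define s where "s = (%x. sin (c * (\<nu> \<bullet> (x - z) + \<eta>)))"
 have sp: "s p = sin (c * (infdist p (- G) + \<eta>))" using z(3) by (simp add: s_def)
 have spos: "0 < s p" unfolding sp using \<eta> c infdist_nonneg[of p "- G"]
  by (intro sin_gt_zero mult_pos_pos) (use pi_gt_zero in linarith)+
 have gl: "grad_lap s p (c * cos (c * (\<nu> \<bullet> (p - z) + \<eta>)) * fst \<nu>) (c * cos (c * (\<nu> \<bullet> (p - z) + \<eta>)) * snd \<nu>)
   (- c\<^sup>2 * sin (c * (\<nu> \<bullet> (p - z) + \<eta>)) * ((fst \<nu>)^2 + (snd \<nu>)^2) + c * cos (c * (\<nu> \<bullet> (p - z) + \<eta>)) * 0)"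
  unfolding s_def by (rule grad_lap_compose[OF grad_lap_linear sd2_sin])
 have "(fst \<nu>)^2 + (snd \<nu>)^2 = 1" using z(2) by (cases \<nu>) (simp add: norm_Pair)
 then have l: "- c\<^sup>2 * sin (c * (\<nu> \<bullet> (p - z) + \<eta>)) * ((fst \<nu>)^2 + (snd \<nu>)^2) + c * cos (c * (\<nu> \<bullet> (p - z) + \<eta>)) * 0 < - k * s p"
  using c(2) spos by (simp add: s_def)
 have "open {x. c * (\<nu> \<bullet> (x - z) + \<eta>) < pi / 2}" by (intro open_Collect_less continuous_intros)
 then have "open (G \<inter> {x. c * (\<nu> \<bullet> (x - z) + \<eta>) < pi / 2})" using oG by (intro open_Int)
 then have "\<forall>\<^sub>F x in nhds p. x \<in> G \<inter> {x. c * (\<nu> \<bullet> (x - z) + \<eta>) < pi / 2}"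
  using p z(3) \<eta> by (intro eventually_nhds_in_open) auto
 then have "\<forall>\<^sub>F x in nhds p. sin (c * (infdist x (- G) + \<eta>)) <= s x"
 proof eventually_elim
  case (elim x)
  have "0 <= c * (infdist x (- G) + \<eta>)" using c \<eta> infdist_nonneg[of x "- G"] by simp
  moreover have "c * (infdist x (- G) + \<eta>) <= c * (\<nu> \<bullet> (x - z) + \<eta>)" using z(4)[of x] elim c by simp
  ultimately show ?case using elim pi_gt_zero unfolding s_def Int_iff mem_Collect_eq
   by (intro sin_monotone_2pi_le) linarith+
 qed
 then show ?thesis unfolding strict_supersol_def
  by (intro exI conjI) (assumption, rule sp, rule gl, use l sp in simp)
qed

definition radius :: real where "radius = (SOME B. 0 < B & G \<subseteq> cball 0 B)"

lemma radius: "0 < radius" "G \<subseteq> cball 0 radius"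
proof -
 obtain B where "0 < B" "\<forall>x\<in>G. norm x <= B" using bG bounded_pos by blast
 then have "0 < B & G \<subseteq> cball 0 B" by auto
 then have "0 < radius & G \<subseteq> cball 0 radius" unfolding radius_def by (rule someI)
 then show "0 < radius" "G \<subseteq> cball 0 radius" by auto
qed

lemma prod_zero:
 assumes "x \<notin> G \<or> radius < norm z"
 shows "u (x + z) * u (x - z) = 0"
proof (rule ccontr)
 assume "u (x + z) * u (x - z) ~= 0"
 then have in': "x + z \<in> G" "x - z \<in> G" using zero[of "x + z"] zero[of "x - z"] by auto
 have "x = (1 / 2) *\<^sub>R (x + z) + (1 / 2) *\<^sub>R (x - z)" by (simp add: algebra_simps scaleR_left.add[symmetric])
 then have "x \<in> G" using convexD[OF cG in', of "1/2" "1/2"] by simp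
 moreover have "norm z <= radius"
 proof -
  have "norm ((x + z) - (x - z)) <= norm (x + z) + norm (x - z)" by (rule norm_triangle_ineq4)
  moreover have "(x + z) - (x - z) = 2 *\<^sub>R z" by (simp add: scaleR_2)
  moreover have "norm (x + z) <= radius" "norm (x - z) <= radius" using in' radius(2) by auto
  ultimately show ?thesis by simp
 qed
 ultimately show False using assms by simp
qed

text \<open>The largest geometric mean of two values of \<open>u\<close> with midpoint
  \<open>x\<close>; by \<open>prod_zero\<close> the ball captures all relevant \<open>z\<close>.
  Midpoint log-concavity of \<open>u\<close> says exactly that this envelope does not exceed
  \<open>u\<close>.\<close>

definition hat :: "real * real => real" where
 "hat x = sqrt (SUP z\<in>cball 0 radius. u (x + z) * u (x - z))"

lemma hat_attained: "\<exists>z\<in>cball 0 radius. hat x = sqrt (u (x + z) * u (x - z)) & (\<forall>y. u (x + y) * u (x - y) <= u (x + z) * u (x - z))"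
proof -
 have "continuous_on (cball 0 radius) (%z. u (x + z) * u (x - z))"
  by (intro continuous_intros continuous_on_compose2[OF cu]) auto
 from continuous_attains_sup[OF compact_cball _ this] radius(1)
 obtain z where z: "z \<in> cball 0 radius" "!!y. y \<in> cball 0 radius ==> u (x + y) * u (x - y) <= u (x + z) * u (x - z)"
  by (auto simp: not_less)
 have "(SUP z\<in>cball 0 radius. u (x + z) * u (x - z)) = u (x + z) * u (x - z)"
  using z by (intro cSup_eq_maximum) auto
 moreover have "u (x + y) * u (x - y) <= u (x + z) * u (x - z)" for y
 proof (cases "y \<in> cball 0 radius")
  case False
  then have "u (x + y) * u (x - y) = 0" using prod_zero[of x y] by simp
  then show ?thesis using mult_nonneg_nonneg[OF u_nonneg u_nonneg, of "x + z" "x - z"] by linarith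
 qed (use z in blast)
 ultimately show ?thesis using z(1) unfolding hat_def by metis
qed

lemma hat_ge: "sqrt (u (x + y) * u (x - y)) <= hat x"
 using hat_attained[of x] by (metis real_sqrt_le_iff)

lemma hat_outside: "x \<notin> G ==> hat x = 0"
 using hat_attained[of x] prod_zero[of x] by force

lemma hat_le1: "hat x <= 1"
proof -
 obtain z where "hat x = sqrt (u (x + z) * u (x - z))" using hat_attained by blast
 moreover have "u (x + z) * u (x - z) <= 1 * 1" using le1 u_nonneg by (intro mult_mono) auto
 ultimately show ?thesis by simp
qed

lemma hat_cont: "continuous_on (cball 0 B) hat"
 unfolding hat_def
 by (intro continuous_on_real_sqrt continuous_on_Sup_compact)
   (use radius(1) in "auto intro!: continuous_intros continuous_on_compose2[OF cu]")

text \<open>Stationarity in \<open>z\<close> equates the logarithmic gradients at \<open>x + z\<close> and \<open>x - z\<close>, and then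
 \<open>sqrt (u (x + z) u (x - z))\<close> solves the same equation at \<open>x\<close> as \<open>u\<close>.\<close>

lemma hat_minorant:
 assumes "x \<in> G"
 shows "\<exists>s a b. (\<forall>y. s y <= hat y) & s x = hat x & grad_lap s x a b (- k * hat x)"
proof -
 obtain z where z: "hat x = sqrt (u (x + z) * u (x - z))" "!!y. u (x + y) * u (x - y) <= u (x + z) * u (x - z)"
  using hat_attained[of x] by blast
 have "0 < u x * u x" using pos[OF assms] by simp
 then have P: "0 < u (x + z) * u (x - z)" using z(2)[of 0] by simp
 then have in': "x + z \<in> G" "x - z \<in> G" using zero[of "x + z"] zero[of "x - z"] by (metis less_irrefl mult_zero_left mult_zero_right)+
 define u1 where "u1 = u (x + z)"
 define u2 where "u2 = u (x - z)"
 have u12: "0 < u1" "0 < u2" using pos in' by (auto simp: u1_def u2_def)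
 obtain a1 b1 where g1: "grad_lap u (x + z) a1 b1 (- k * u1)" unfolding u1_def using helm_grad_lap[OF hu in'(1)] by blast
 obtain a2 b2 where g2: "grad_lap u (x - z) a2 b2 (- k * u2)" unfolding u2_def using helm_grad_lap[OF hu in'(2)] by blast
 have "grad_lap (%y. u (x + y) * u (x - y)) z (a1 * u (x - z) + u (x + z) * (- a2)) (b1 * u (x - z) + u (x + z) * (- b2))
   (- k * u1 * u (x - z) + 2 * (a1 * (- a2) + b1 * (- b2)) + u (x + z) * (- k * u2))"
  using grad_lap_shift[of u z x] g1 grad_lap_reflect[OF g2]
  by (intro grad_lap_mult) (auto simp: add.commute)
 from grad_lap_local_max(1,2)[OF this] z(2)
 have st: "a1 * u2 = u1 * a2" "b1 * u2 = u1 * b2" by (auto simp: u1_def u2_def)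
 define s where "s = (%y. sqrt (u (y + z) * u (y + (- z))))"
 define Q where "Q = u1 * u2"
 have Q: "0 < Q" "Q = u (x + z) * u (x + (- z))" using P by (auto simp: Q_def u1_def u2_def)
 define A where "A = a1 * u2 + u1 * a2"
 define B where "B = b1 * u2 + u1 * b2"
 define l where "l = - k * u1 * u2 + 2 * (a1 * a2 + b1 * b2) + u1 * (- k * u2)"
 have "grad_lap (%y. u (y + z) * u (y + (- z))) x A B l"
  using grad_lap_mult[OF grad_lap_shift[OF g1] grad_lap_shift[of u x "- z"], of a2 b2 "- k * u2"] g2
  by (simp add: A_def B_def l_def u1_def u2_def)
 from grad_lap_compose[OF this, of sqrt] sd2_sqrt[OF Q(1)]
 have gs: "grad_lap s x (1 / (2 * sqrt Q) * A) (1 / (2 * sqrt Q) * B)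
   (- (1 / (4 * Q * sqrt Q)) * (A^2 + B^2) + 1 / (2 * sqrt Q) * l)"
  unfolding s_def Q(2) by blast
 have "A^2 + B^2 = 4 * Q * (a1 * a2 + b1 * b2)"
 proof -
  have "A = 2 * (a1 * u2)" "A = 2 * (u1 * a2)" "B = 2 * (b1 * u2)" "B = 2 * (u1 * b2)" using st by (auto simp: A_def B_def)
  then have "A * A = 2 * (a1 * u2) * (2 * (u1 * a2))" "B * B = 2 * (b1 * u2) * (2 * (u1 * b2))" by metis+
  then show ?thesis by (simp add: Q_def power2_eq_square algebra_simps)
 qed
 moreover have "l = - 2 * k * Q + 2 * (a1 * a2 + b1 * b2)" by (simp add: l_def Q_def)
 moreover have "- (1 / (4 * Q * sqrt Q)) * (4 * Q * S) + 1 / (2 * sqrt Q) * (- 2 * k * Q + 2 * S) = - k * (Q / sqrt Q)" for S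
  using Q(1) by (simp add: field_simps)
 ultimately have "- (1 / (4 * Q * sqrt Q)) * (A^2 + B^2) + 1 / (2 * sqrt Q) * l = - k * (Q / sqrt Q)" by metis
 moreover have "Q / sqrt Q = hat x" using z(1) Q by (simp add: real_div_sqrt)
 ultimately have "grad_lap s x (1 / (2 * sqrt Q) * A) (1 / (2 * sqrt Q) * B) (- k * hat x)" using gs by metis
 moreover have "s y <= hat y" for y using hat_ge[of y z] by (simp add: s_def)
 moreover have "s x = hat x" using z(1) by (simp add: s_def)
 ultimately show ?thesis by blast
qed

text \<open>Let \<open>t\<close> be the maximum of \<open>hat / u\<close>. Both functions vanish at
  the boundary, so \<open>t\<close> is taken over a compact inner set \<open>D\<close>, and the
  bound is extended over the remaining layer by comparison with \<open>t * u\<close> plus a small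
  multiple of the sine from \<open>boundary_layer_supersol\<close>. Then \<open>t * u - hat\<close>
  is nonnegative and superharmonic with a zero, hence vanishes also at \<open>pm\<close>, where
  \<open>hat <= 1 = u\<close>. So \<open>t <= 1\<close>.\<close>

lemma hat_le: "hat x <= u x"
proof -
 define c where "c = sqrt (k + 1)"
 have c: "0 < c" "k < c^2" using k_nonneg by (auto simp: c_def)
 define d where "d = (%x. infdist x (- G))"
 define de where "de = min (d pm) (pi / (8 * c))"
 have de: "0 < de" "de <= d pm" "de <= pi / (8 * c)" using infdist_pos[OF pm(1)] c pi_gt_zero by (auto simp: de_def d_def)
 have dec: "c * (de + de) < pi / 2"
 proof -
  have "c * de <= pi / 8" using de(3) c by (simp add: field_simps)
  then show ?thesis using pi_gt_zero unfolding distrib_left by linarith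
 qed
 define D where "D = {x \<in> cball 0 radius. de <= d x}"
 have cd: "continuous_on S d" for S unfolding d_def by (intro continuous_intros)
 have dG: "x \<in> G" if "0 < d x" for x using that infdist_zero[of x "- G"] unfolding d_def by (metis ComplI less_irrefl)
 have "closed {x. de <= d x}" by (intro closed_Collect_le cd continuous_intros)
 then have cD: "compact D" unfolding D_def Collect_conj_eq Collect_mem_eq by (intro compact_Int_closed) auto
 have DG: "D \<subseteq> G" using dG de by (auto simp: D_def)
 have "continuous_on D (%x. hat x / u x)"
  using DG pos by (intro continuous_on_divide cuS continuous_on_subset[OF hat_cont[of radius]]) (auto simp: D_def less_imp_neq[THEN not_sym] subset_iff)
 moreover have "pm \<in> D" using de pm radius by (auto simp: D_def)
 ultimately obtain m where m: "m \<in> D" "!!x. x \<in> D ==> hat x / u x <= hat m / u m"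
  using continuous_attains_sup[OF cD, of "%x. hat x / u x"] by blast
 define t where "t = hat m / u m"
 have mG: "m \<in> G" using m(1) DG by blast
 have inner_le: "hat x <= t * u x" if "x \<in> D" for x
  using m(2)[OF that] pos[of x] DG that by (auto simp: t_def field_simps)
 have t0: "0 <= t" using pos[OF mG] hat_ge[of m 0] u_nonneg[of m] by (simp add: t_def)
 have layer: "hat x <= t * u x + e" if e: "0 < e" and x: "x \<in> cball 0 radius" "d x <= de" for x e
 proof -
  define S where "S = (%x. sin (c * (d x + de)))"
  define K where "K = {x \<in> cball 0 radius. d x <= de}"
  define U where "U = G \<inter> {x. d x < de}"
  have Spos: "0 < S x" if "x \<in> K" for x
  proof -
   have "c * (d x + de) <= c * (de + de)" using that c by (simp add: K_def)
   moreover have "0 < c * (d x + de)" using c de infdist_nonneg[of x "- G"] by (intro mult_pos_pos) (auto simp: d_def)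
   ultimately show ?thesis using dec pi_gt_zero unfolding S_def by (intro sin_gt_zero) auto
  qed
  have "hat x <= t * u x + e * S x"
  proof (rule maximum_principle[where K = K and U = U])
   have "closed {x. d x <= de}" by (intro closed_Collect_le cd continuous_intros)
   then show "compact K" unfolding K_def Collect_conj_eq Collect_mem_eq by (intro compact_Int_closed) auto
   show "continuous_on K hat" by (rule continuous_on_subset[OF hat_cont[of radius]]) (auto simp: K_def)
   show "continuous_on K (%x. t * u x + e * S x)" unfolding S_def by (intro continuous_intros cuS cd)
   show "0 < t * u x + e * S x" if "x \<in> K" for x using t0 u_nonneg[of x] e Spos[OF that] by (simp add: add_nonneg_pos)
   have "open {x. d x < de}" by (intro open_Collect_less cd continuous_intros)
   then show "open U" unfolding U_def using oG by auto
   show "U \<subseteq> K" using radius(2) by (auto simp: U_def K_def)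
   show "x \<in> K" using x by (simp add: K_def)
   show "hat y <= t * u y + e * S y" if y: "y \<in> K - U" for y
   proof (cases "y \<in> G")
    case True
    then have "y \<in> D" using y by (auto simp: K_def U_def D_def)
    then show ?thesis using inner_le[of y] Spos[of y] y e by (simp add: add_increasing2)
   next
    case False
    then show ?thesis using hat_outside[of y] Spos[of y] y e t0 u_nonneg[of y] by simp
   qed
   fix y assume y: "y \<in> U"
   then have yG: "y \<in> G" and yd: "d y < de" by (auto simp: U_def)
   obtain s a b where s: "\<forall>y. s y <= hat y" "s y = hat y" "grad_lap s y a b (- k * hat y)" using hat_minorant[OF yG] by blast
   have "subsol k hat y" unfolding subsol_def
    by (intro exI conjI) (rule always_eventually[OF s(1)], rule s(2), rule s(3), rule order_refl)
   moreover have "strict_supersol k (%x. t * u x + e * S x) y"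
   proof -
    have "c * (d y + de) <= c * (de + de)" using yd c(1) by (intro mult_left_mono) auto
    with dec have "c * (infdist y (- G) + de) < pi / 2" by (simp add: d_def)
    from boundary_layer_supersol[OF yG c de(1) this] obtain s a b l where
     s: "\<forall>\<^sub>F q in nhds y. S q <= s q" "s y = S y" "grad_lap s y a b l" "l < - k * S y"
     unfolding strict_supersol_def S_def d_def by blast
    have "\<forall>\<^sub>F q in nhds y. t * u q + e * S q <= t * u q + e * s q" using s(1) by eventually_elim (use e in auto)
    moreover have "t * (- k * u y) + e * l < - k * (t * u y + e * S y)" using mult_strict_left_mono[OF s(4) e] by (simp add: algebra_simps)
    ultimately show ?thesis unfolding strict_supersol_def
     by (intro exI conjI) (assumption, simp add: s(2),
      rule grad_lap_add[OF grad_lap_cmult[OF helm_grad_lap[OF hu yG], of t] grad_lap_cmult[OF s(3), of e]], assumption)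
   qed
   ultimately show "\<exists>m. subsol m hat y & strict_supersol m (%x. t * u x + e * S x) y" by (intro exI conjI)
  qed
  also have "... <= t * u x + e * 1" using e by (intro add_left_mono mult_left_mono) (auto simp: S_def)
  finally show ?thesis by simp
 qed
 have le: "hat x <= t * u x" if "x \<in> G" for x
 proof (cases "x \<in> D")
  case False
  then have x: "x \<in> cball 0 radius" "d x <= de" using that radius by (auto simp: D_def)
  show ?thesis by (rule field_le_epsilon) (rule layer[OF _ x])
 qed (rule inner_le)
 have "t * u pm - hat pm = 0"
 proof (rule strong_maximum_principle[OF oG cG order_refl, where f = "%x. t * u x - hat x" and z = m])
  show "continuous_on G (%x. t * u x - hat x)"
   using radius by (intro continuous_intros cuS continuous_on_subset[OF hat_cont[of radius]])
  show "0 <= t * u x - hat x" if "x \<in> G" for x using le[OF that] by simp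
  show "t * u m - hat m = 0" using pos[OF mG] by (simp add: t_def)
  show "supersol (- 0) (%x. t * u x - hat x) x" if x: "x \<in> G" for x
  proof -
   obtain s a b where s: "\<forall>y. s y <= hat y" "s x = hat x" "grad_lap s x a b (- k * hat x)" using hat_minorant[OF x] by blast
   have "t * (- k * u x) - (- k * hat x) <= 0" using mult_left_mono[OF le[OF x] k_nonneg] by (simp add: algebra_simps)
   moreover have "\<forall>\<^sub>F q in nhds x. t * u q - hat q <= t * u q - s q" using s(1) by (intro always_eventually) auto
   ultimately show ?thesis unfolding supersol_def
    by (intro exI conjI) (assumption, simp add: s(2),
     rule grad_lap_diff[OF grad_lap_cmult[OF helm_grad_lap[OF hu x], of t] s(3)], simp)
  qed
 qed (use mG pm in auto)
 then have "t <= 1" using hat_le1[of pm] pm by simp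
 show ?thesis
 proof (cases "x \<in> G")
  case True
  have "t * u x <= 1 * u x" using \<open>t <= 1\<close> u_nonneg by (rule mult_right_mono)
  then show ?thesis using le[OF True] by simp
 qed (simp add: hat_outside zero)
qed

lemma midpoint_log_concave: "u (x + z) * u (x - z) <= (u x)^2"
proof -
 have "sqrt (u (x + z) * u (x - z)) <= u x" using hat_ge[of x z] hat_le[of x] by linarith
 from power_mono[OF this, of 2] show ?thesis using u_nonneg by simp
qed

end

section \<open>The Hessian form of the logarithm\<close>

definition dirD :: "real * real => (real * real => real) => real * real => real" where
 "dirD e w p = fst e * px w p + snd e * py w p"

lemma helm_dirD: "helm S k w ==> 0 <= k ==> helm S k (dirD e w)"
 unfolding dirD_def by (intro helm_lincomb helm_partial_x helm_partial_y)

lemma dirD_line: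
 assumes "helm S k w" "p + t *\<^sub>R e \<in> S"
 shows "((%t. w (p + t *\<^sub>R e)) has_real_derivative dirD e w (p + t *\<^sub>R e)) (at t)"
 using has_grad_line[OF helmD(2)[OF assms]] by (simp add: dirD_def)

text \<open>\<open>Phi e w p / w p\<close> is minus the second derivative of \<open>ln w\<close> in the direction \<open>e\<close>.\<close>

definition Phi :: "real * real => (real * real => real) => real * real => real" where
 "Phi e w p = (dirD e w p)^2 / w p - dirD e (dirD e w) p"

text \<open>For a positive semidefinite matrix A and a vector v, the difference trace A * <A v, v> -
  |A v|^2 equals det A * |v|^2.\<close>

lemma psd_apply_le:
 fixes a b c x y :: real
 assumes "!!x y. 0 <= a * x^2 + 2 * b * x * y + c * y^2"
 shows "(a * x + b * y)^2 + (b * x + c * y)^2 <= (a + c) * (a * x^2 + 2 * b * x * y + c * y^2)" "b^2 <= a * c"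
proof -
 have ac: "0 <= a" "0 <= c" using assms[of 1 0] assms[of 0 1] by auto
 show 1: "b^2 <= a * c"
 proof (cases "a = 0")
  case True
  have "0 <= 2 * b * (- b * (c + 1)) * 1 + c * 1^2 \<or> b = 0" using assms[of "- b * (c + 1)" 1] True by auto
  moreover have "2 * b * (- b * (c + 1)) * 1 + c * 1^2 = c - 2 * b^2 * (c + 1)" by (simp add: power2_eq_square algebra_simps)
  moreover have "0 <= a * (- (c + 1) / b)^2 + 2 * b * (- (c + 1) / b) * 1 + c * 1^2" by (rule assms)
  ultimately have "b = 0" using True ac by (cases "b = 0") auto
  then show ?thesis using True by simp
 next
  case False
  have "0 <= a * (- b / a)^2 + 2 * b * (- b / a) * 1 + c * 1^2" by (rule assms)
  also have "... = c - b^2 / a" using False by (simp add: power2_eq_square field_simps)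
  finally show ?thesis using False ac by (simp add: field_simps)
 qed
 have "(a + c) * (a * x^2 + 2 * b * x * y + c * y^2) - ((a * x + b * y)^2 + (b * x + c * y)^2) = (a * c - b^2) * (x^2 + y^2)"
  by (simp add: power2_eq_square algebra_simps)
 moreover have "0 <= (a * c - b^2) * (x^2 + y^2)" using 1 by simp
 ultimately show "(a * x + b * y)^2 + (b * x + c * y)^2 <= (a + c) * (a * x^2 + 2 * b * x * y + c * y^2)" by linarith
qed

lemma sd2_inverse:
 assumes "(x::real) ~= 0"
 shows "sd2 inverse x (- (inverse x)\<^sup>2) (2 * (inverse x) ^ 3)"
proof (rule sd2I_open[of "- {0}" _ _ "%s. - (inverse s)\<^sup>2"])
 show "(inverse has_real_derivative - (inverse s)\<^sup>2) (at s)" if "s \<in> - {0}" for s :: real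
  using that by (auto intro!: derivative_eq_intros simp: power2_eq_square)
 show "((%s. - (inverse s)\<^sup>2) has_real_derivative 2 * (inverse x) ^ 3) (at x)"
  using assms by (auto intro!: derivative_eq_intros simp: power2_eq_square power3_eq_cube)
qed (use assms in auto)

text \<open>Here \<open>a\<close> stands for \<open>dirD e u\<close>, \<open>b\<close> for its
  derivative along \<open>e\<close>, and \<open>i\<close> for \<open>1 / u\<close>. Apart from
  \<open>- k\<close> times the function itself, all terms combine into the square of u times the
  gradient of a / u.\<close>

lemma Phi_laplacian_identity:
 fixes u i :: real
 assumes "u * i = 1"
 shows "(- k * a * a + 2 * (ax * ax + ay * ay) + a * (- k * a)) * i
    + 2 * ((ax * a + a * ax) * (- i\<^sup>2 * ux) + (ay * a + a * ay) * (- i\<^sup>2 * uy))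
    + a * a * (2 * i ^ 3 * (ux^2 + uy^2) + - i\<^sup>2 * (- k * u)) - - k * b
   = - k * (a * a * i - b) + 2 * i * ((ax - a * i * ux)^2 + (ay - a * i * uy)^2)"
 using assms by algebra

context ground
begin

text \<open>For \<open>c^2 > k\<close> the sine of \<open>c * (l + \<eta>)\<close> is a strict
  supersolution that has risen to 1, hence above \<open>u\<close>, when its argument is pi / 2; the
  comparison takes place on the near side of that line. Then sin t <= t, and \<open>c\<close> and
  \<open>\<eta>\<close> tend to \<open>sqrt k\<close> and 0.\<close>

lemma half_plane_bound:
 assumes \<nu>: "norm \<nu> = 1" "!!p. p \<in> G ==> 0 < \<nu> \<bullet> (p - z)" and q: "q \<in> G"
 shows "u q <= sqrt k * (\<nu> \<bullet> (q - z))"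
proof -
 define l where "l = (%x. \<nu> \<bullet> (x - z))"
 have le: "u q <= c * (l q + \<eta>)" if c: "0 < c" "k < c^2" and \<eta>: "0 < \<eta>" for c \<eta>
 proof (cases "c * (l q + \<eta>) <= pi / 2")
  case False
  then show ?thesis using le1[of q] pi_gt3 by simp
 next
  case True
  define Z where "Z = (%x. sin (c * (\<nu> \<bullet> (x - z) + \<eta>)))"
  define K where "K = {x \<in> closure G. c * (l x + \<eta>) <= pi / 2}"
  define U where "U = G \<inter> {x. c * (l x + \<eta>) < pi / 2}"
  have cl: "continuous_on S l" for S unfolding l_def by (intro continuous_intros)
  have l0: "0 <= l x" if "x \<in> closure G" for x
  proof -
   have "closed {x. 0 <= l x}" by (intro closed_Collect_le cl continuous_intros)
   then have "closure G \<subseteq> {x. 0 <= l x}" using \<nu>(2) by (intro closure_minimal) (auto simp: l_def less_imp_le)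
   then show ?thesis using that by auto
  qed
  have Zp: "0 < Z x" if "x \<in> K" for x
  proof -
   have "0 < c * (l x + \<eta>)" using c \<eta> l0[of x] that by (intro mult_pos_pos) (auto simp: K_def)
   then show ?thesis using that pi_gt_zero unfolding Z_def K_def l_def by (intro sin_gt_zero) auto
  qed
  have "u q <= Z q"
  proof (rule maximum_principle[where K = K and U = U])
   have "closed {x. c * (l x + \<eta>) <= pi / 2}" by (intro closed_Collect_le continuous_intros cl)
   moreover have "compact (closure G)" using bG by (simp add: compact_closure)
   ultimately show "compact K" unfolding K_def Collect_conj_eq Collect_mem_eq by (intro compact_Int_closed)
   show "continuous_on K u" by (rule cuS)
   show "continuous_on K Z" unfolding Z_def by (intro continuous_intros)
   show "open U" unfolding U_def using oG by (intro open_Int open_Collect_less continuous_intros cl)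
   show "U \<subseteq> K" using closure_subset[of G] by (auto simp: U_def K_def)
   show "q \<in> K" using q True closure_subset[of G] by (auto simp: K_def)
   show "u x <= Z x" if x: "x \<in> K - U" for x
   proof (cases "x \<in> G")
    case True
    then have "c * (\<nu> \<bullet> (x - z) + \<eta>) = pi / 2" using x by (auto simp: K_def U_def l_def)
    then have "Z x = 1" unfolding Z_def by (simp only: sin_pi_half)
    then show ?thesis using le1 by simp
   next
    case False
    then show ?thesis using zero[of x] Zp[of x] x by simp
   qed
   fix x assume x: "x \<in> U"
   then have xG: "x \<in> G" by (simp add: U_def)
   have "subsol k u x" by (rule subsolI[OF helm_grad_lap[OF hu xG]]) simp
   moreover have "strict_supersol k Z x"
   proof (rule strict_supersolI)
    show "grad_lap Z x (c * cos (c * (\<nu> \<bullet> (x - z) + \<eta>)) * fst \<nu>) (c * cos (c * (\<nu> \<bullet> (x - z) + \<eta>)) * snd \<nu>)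
     (- c\<^sup>2 * sin (c * (\<nu> \<bullet> (x - z) + \<eta>)) * ((fst \<nu>)^2 + (snd \<nu>)^2) + c * cos (c * (\<nu> \<bullet> (x - z) + \<eta>)) * 0)"
     unfolding Z_def by (rule grad_lap_compose[OF grad_lap_linear sd2_sin])
    have "(fst \<nu>)^2 + (snd \<nu>)^2 = 1" using \<nu>(1) by (cases \<nu>) (simp add: norm_Pair)
    moreover have "0 < Z x" using Zp \<open>U \<subseteq> K\<close> x by blast
    ultimately show "- c\<^sup>2 * sin (c * (\<nu> \<bullet> (x - z) + \<eta>)) * ((fst \<nu>)^2 + (snd \<nu>)^2) + c * cos (c * (\<nu> \<bullet> (x - z) + \<eta>)) * 0 < - k * Z x"
     using c(2) by (simp add: Z_def)
   qed
   ultimately show "\<exists>m. subsol m u x & strict_supersol m Z x" by (intro exI conjI)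
  qed (rule Zp)
  also have "Z q <= c * (l q + \<eta>)" unfolding Z_def l_def
   using c \<eta> \<nu>(2)[OF q] by (intro sin_x_le_x mult_nonneg_nonneg) auto
  finally show ?thesis .
 qed
 have "((%e. (sqrt k + e) * (l q + e)) \<longlongrightarrow> (sqrt k + 0) * (l q + 0)) (at_right 0)" by (intro tendsto_intros)
 moreover have "\<forall>\<^sub>F e in at_right 0. u q <= (sqrt k + e) * (l q + e)"
  unfolding eventually_at_right_field
 proof (intro exI[of _ 1] conjI allI impI)
  fix e :: real assume e: "0 < e" "e < 1"
  have "k = (sqrt k)^2" using k_nonneg by simp
  also have "... < (sqrt k + e)^2" using e k_nonneg by (intro power_strict_mono) auto
  finally show "u q <= (sqrt k + e) * (l q + e)" using e k_nonneg by (intro le) (auto simp: add_nonneg_pos)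
 qed simp
 ultimately have "u q <= (sqrt k + 0) * (l q + 0)" by (rule tendsto_lowerbound) simp
 then show ?thesis by (simp add: l_def)
qed

lemma u_le_dist:
 assumes "z \<notin> G"
 shows "u q <= sqrt k * dist q z"
proof (cases "q \<in> G")
 case True
 obtain \<nu> where \<nu>: "norm \<nu> = 1" "!!p. p \<in> G ==> 0 < \<nu> \<bullet> (p - z)" using supporting_line[OF oG cG assms] by blast
 have "u q <= sqrt k * (\<nu> \<bullet> (q - z))" by (rule half_plane_bound[OF \<nu> True])
 also have "\<nu> \<bullet> (q - z) <= dist q z" using norm_cauchy_schwarz[of \<nu> "q - z"] \<nu>(1) by (simp add: dist_norm)
 finally show ?thesis using k_nonneg by (simp add: mult_left_mono)
qed (simp add: zero k_nonneg)

lemma k_pos: "0 < k"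
proof -
 have "\<exists>z. z \<notin> G" using bG not_bounded_UNIV by (metis UNIV_eq_I)
 then obtain z where "z \<notin> G" ..
 from u_le_dist[OF this, of pm] pm have "k ~= 0" by auto
 then show ?thesis using k_nonneg by simp
qed

lemma u_le_infdist: "u q <= sqrt k * infdist q (- G)"
proof (cases "q \<in> G")
 case True
 obtain z \<nu> where z: "z \<notin> G" "norm \<nu> = 1" "\<nu> \<bullet> (q - z) = infdist q (- G)" "!!q. q \<in> G ==> 0 < \<nu> \<bullet> (q - z)"
  using infdist_compl[OF True] by metis
 from half_plane_bound[OF z(2,4) True] z(3) show ?thesis by simp
qed (simp add: zero k_nonneg infdist_nonneg)

lemma cball_subset_of_level:
 assumes "c <= u q" "sqrt k * r < c"
 shows "cball q r \<subseteq> G"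
proof
 fix z assume z: "z \<in> cball q r"
 show "z \<in> G"
 proof (rule ccontr)
  assume "z \<notin> G"
  then have "u q <= sqrt k * dist q z" by (rule u_le_dist)
  also have "... <= sqrt k * r" using z k_nonneg by (intro mult_left_mono) auto
  finally show False using assms by simp
 qed
qed

text \<open>If \<open>k\<close> exceeded the first eigenvalue of the rectangle, every
  \<open>s * u\<close> with \<open>s > 0\<close> would be a positive strict supersolution of the
  rectangle's equation and dominate the product of sines, which vanishes on the sides. At the centre
  this fails for s = 1/2.\<close>

lemma eigenvalue_le_rectangle:
 assumes ab: "0 < \<alpha>" "0 < \<beta>" and sub: "{x0..x0 + \<alpha>} \<times> {y0..y0 + \<beta>} \<subseteq> G"
 shows "k <= (pi / \<alpha>)^2 + (pi / \<beta>)^2"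
proof (rule ccontr)
 assume "\<not> ?thesis"
 then have k: "(pi / \<alpha>)^2 + (pi / \<beta>)^2 < k" by simp
 define f where "f = (%p. sin (pi / \<alpha> * (fst p - x0)) * sin (pi / \<beta> * (snd p - y0)))"
 define K where "K = {x0..x0 + \<alpha>} \<times> {y0..y0 + \<beta>}"
 define U where "U = {x0<..<x0 + \<alpha>} \<times> {y0<..<y0 + \<beta>}"
 define c where "c = (x0 + \<alpha> / 2, y0 + \<beta> / 2)"
 have fc: "f c = 1" using ab by (simp add: f_def c_def)
 have "f c <= s * u c" if s: "0 < s" for s
 proof (rule maximum_principle[where K = K and U = U])
  show "compact K" by (auto simp: K_def intro: compact_Times)
  show "continuous_on K f" unfolding f_def by (intro continuous_intros)
  show "continuous_on K (%p. s * u p)" by (intro continuous_intros cuS)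
  show "0 < s * u p" if "p \<in> K" for p using pos[of p] that sub s by (auto simp: K_def)
  show "open U" unfolding U_def by (intro open_Times) auto
  show "U \<subseteq> K" by (auto simp: U_def K_def)
  show "c \<in> K" using ab by (auto simp: c_def K_def)
  show "f p <= s * u p" if p: "p \<in> K - U" for p
  proof -
   obtain x y where xy: "p = (x, y)" by (cases p)
   then have "x = x0 \<or> x = x0 + \<alpha> \<or> y = y0 \<or> y = y0 + \<beta>" using p by (auto simp: K_def U_def)
   then have "f p = 0" using ab xy by (auto simp: f_def)
   then show ?thesis using u_nonneg[of p] s by simp
  qed
  fix p assume p: "p \<in> U"
  obtain x y where xy: "p = (x, y)" by (cases p)
  have pG: "p \<in> G" using p sub by (auto simp: U_def)
  have A: "sd2 (%s. sin (c * (s - d))) t (c * cos (c * (t - d))) (- c\<^sup>2 * sin (c * (t - d)))" for c d t :: real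
   by (rule sd2I[where g' = "%s. c * cos (c * (s - d))"]) (auto intro!: derivative_eq_intros simp: power2_eq_square)
  define s1 where "s1 = sin (pi / \<alpha> * (x - x0))"
  define s2 where "s2 = sin (pi / \<beta> * (y - y0))"
  have fp: "f p = s1 * s2" by (simp add: f_def s1_def s2_def xy)
  have "grad_lap f (x, y) (s2 * (pi / \<alpha> * cos (pi / \<alpha> * (x - x0)))) (s1 * (pi / \<beta> * cos (pi / \<beta> * (y - y0))))
   (s2 * (- (pi / \<alpha>)\<^sup>2 * s1) + s1 * (- (pi / \<beta>)\<^sup>2 * s2))"
   using sd2_cmult[OF A, of s2 "pi / \<alpha>" x0 x] sd2_cmult[OF A, of s1 "pi / \<beta>" y0 y]
   by (intro grad_lapI) (simp_all add: f_def s1_def s2_def mult.commute)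
  then have "subsol ((pi / \<alpha>)^2 + (pi / \<beta>)^2) f p" unfolding xy[symmetric]
   by (rule subsolI) (simp add: fp algebra_simps)
  moreover have "strict_supersol ((pi / \<alpha>)^2 + (pi / \<beta>)^2) (%p. s * u p) p"
   using mult_strict_right_mono[OF k mult_pos_pos[OF s pos[OF pG]]]
   by (intro strict_supersolI[OF grad_lap_cmult[OF helm_grad_lap[OF hu pG]]]) (simp add: algebra_simps)
  ultimately show "\<exists>m. subsol m f p & strict_supersol m (%p. s * u p) p" by (intro exI conjI)
 qed
 from this[of "1/2"] fc le1[of c] show False by simp
qed

text \<open>If \<open>k\<close> were smaller, the ground state of a slightly wider slab would be a
  positive strict supersolution on the closure of \<open>G\<close>, and \<open>u\<close> would lie
  below every positive multiple of it.\<close>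

lemma slab_le_eigenvalue:
 assumes H: "0 < H" and sub: "!!p. p \<in> G ==> y1 < snd p & snd p < y1 + H"
 shows "(pi / H)^2 <= k"
proof (rule ccontr)
 assume "\<not> ?thesis"
 then have k: "k < (pi / H)^2" by simp
 have "sqrt k < pi / H" using k H by (simp add: real_less_lsqrt)
 then obtain c where c: "sqrt k < c" "c < pi / H" using dense by blast
 have c0: "0 < c" using c k_nonneg by (smt (verit) real_sqrt_ge_zero)
 have "k = (sqrt k)^2" using k_nonneg by simp
 also have "... < c^2" using c k_nonneg by (intro power_strict_mono) auto
 finally have ck: "k < c^2" .
 define \<eta> where "\<eta> = (pi / c - H) / 2"
 have "c * H < pi" using c(2) H by (simp add: field_simps)
 then have \<eta>: "0 < \<eta>" "c * (H + \<eta>) < pi" using c0 by (auto simp: \<eta>_def field_simps)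
 define Z where "Z = (%p::real\<times>real. sin (c * (snd p - y1 + \<eta>)))"
 have cl: "y1 <= snd p & snd p <= y1 + H" if "p \<in> closure G" for p
 proof -
  have "closed {p::real\<times>real. y1 <= snd p & snd p <= y1 + H}" by (intro closed_Collect_conj closed_Collect_le continuous_intros)
  then have "closure G \<subseteq> {p. y1 <= snd p & snd p <= y1 + H}" using sub by (intro closure_minimal) (auto simp: less_imp_le)
  then show ?thesis using that by auto
 qed
 have Zp: "0 < Z p" if "p \<in> closure G" for p
 proof -
  have "0 < c * (snd p - y1 + \<eta>)" using c0 \<eta> cl[OF that] by (intro mult_pos_pos) auto
  moreover have "c * (snd p - y1 + \<eta>) <= c * (H + \<eta>)" using c0 cl[OF that] by (intro mult_left_mono) auto
  ultimately show ?thesis unfolding Z_def using \<eta> by (intro sin_gt_zero) auto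
 qed
 have "u pm <= s * Z pm" if s: "0 < s" for s
 proof (rule maximum_principle[where K = "closure G" and U = G])
  show "compact (closure G)" using bG by (simp add: compact_closure)
  show "continuous_on (closure G) u" by (rule cuS)
  show "continuous_on (closure G) (%p. s * Z p)" unfolding Z_def by (intro continuous_intros)
  show "0 < s * Z p" if "p \<in> closure G" for p using Zp[OF that] s by simp
  show "u p <= s * Z p" if "p \<in> closure G - G" for p using that zero[of p] Zp[of p] s by simp
  show "pm \<in> closure G" using pm closure_subset by blast
  fix p assume p: "p \<in> G"
  obtain x y where xy: "p = (x, y)" by (cases p)
  have A: "sd2 (%t. s * sin (c * (t - y1 + \<eta>))) y (s * (c * cos (c * (y - y1 + \<eta>)))) (s * (- c\<^sup>2 * sin (c * (y - y1 + \<eta>))))"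
   by (rule sd2I[where g' = "%t. s * (c * cos (c * (t - y1 + \<eta>)))"]) (auto intro!: derivative_eq_intros simp: power2_eq_square)
  have "grad_lap (%p. s * Z p) (x, y) 0 (s * (c * cos (c * (y - y1 + \<eta>)))) (0 + s * (- c\<^sup>2 * sin (c * (y - y1 + \<eta>))))"
   by (rule grad_lapI) (use A sd2_const in "auto simp: Z_def")
  then have "strict_supersol k (%p. s * Z p) p"
   using xy ck Zp[of p] p closure_subset[of G] s by (intro strict_supersolI) (auto simp: Z_def subset_iff)
  moreover have "subsol k u p" by (rule subsolI[OF helm_grad_lap[OF hu p]]) simp
  ultimately show "\<exists>m. subsol m u p & strict_supersol m (%p. s * Z p) p" by (intro exI conjI)
 qed (use oG closure_subset in auto)
 from this[of "1/2"] pm show False by (auto simp: Z_def) (smt (verit) sin_le_one)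
qed

text \<open>If the square has size \<open>r = d / 3\<close>, a third of the boundary distance,
  \<open>u_le_infdist\<close> gives \<open>u <= 5 * sqrt k * r\<close> on it; otherwise
  \<open>sqrt k * r = 1\<close> and \<open>u <= 1\<close> suffices. Both cases feed the same bound
  into the gradient estimate, so it holds up to the boundary.\<close>

lemma partial_bound:
 assumes p: "p \<in> G"
 shows "\<bar>px u p\<bar> <= 20 * sqrt k" "\<bar>py u p\<bar> <= 20 * sqrt k"
proof -
 define d where "d = infdist p (- G)"
 have d: "0 < d" "ball p d \<subseteq> G" using infdist_pos[OF p] infdist_ball by (auto simp: d_def)
 define r where "r = min (d / 3) (1 / sqrt k)"
 have r: "0 < r" "r <= d / 3" "r <= 1 / sqrt k" using d k_pos by (auto simp: r_def)
 have kr: "k * r^2 <= 1"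
 proof -
  have "(sqrt k * r)^2 <= 1^2" using r k_pos by (intro power_mono) (auto simp: field_simps)
  then show ?thesis using k_pos by (simp add: power_mult_distrib)
 qed
 have "cball p (2 * r) \<subseteq> cball p (2 * d / 3)" using r by (intro subset_cball) simp
 with square_subset_cball[of p r] have sq: "square p r \<subseteq> cball p (2 * d / 3)" by blast
 then have sqG: "square p r \<subseteq> G" using d by (force simp: subset_iff)
 have b: "\<bar>u q\<bar> <= 5 * sqrt k * r" if q: "q \<in> square p r" for q
 proof (cases "r = d / 3")
  case True
  have "u q <= sqrt k * infdist q (- G)" by (rule u_le_infdist)
  also have "infdist q (- G) <= infdist p (- G) + dist q p" by (rule infdist_triangle)
  also have "... <= 5 * r" using sq q True by (auto simp: d_def dist_commute)
  finally show ?thesis using k_pos u_nonneg[of q] by (simp add: mult_left_mono mult_right_mono algebra_simps)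
 next
  case False
  then have "sqrt k * r = 1" using k_pos by (auto simp: r_def min_def split: if_splits)
  then show ?thesis using u_nonneg[of q] le1[of q] by (simp add: mult.assoc)
 qed
 have "4 * (5 * sqrt k * r) / r = 20 * sqrt k" using r by simp
 with partial_x_bound[OF hu r(1) k_nonneg kr sqG b] partial_y_bound[OF hu r(1) k_nonneg kr sqG b]
 show "\<bar>px u p\<bar> <= 20 * sqrt k" "\<bar>py u p\<bar> <= 20 * sqrt k" by auto
qed

section \<open>Concavity of the logarithm along lines\<close>

lemma ln_line:
 assumes "p + t *\<^sub>R e \<in> G"
 shows "((%t. ln (u (p + t *\<^sub>R e))) has_real_derivative dirD e u (p + t *\<^sub>R e) / u (p + t *\<^sub>R e)) (at t)"
  "((%t. dirD e u (p + t *\<^sub>R e) / u (p + t *\<^sub>R e)) has_real_derivative - (Phi e u (p + t *\<^sub>R e) / u (p + t *\<^sub>R e))) (at t)"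
proof -
 note d1 = dirD_line[OF hu assms] and d2 = dirD_line[OF helm_dirD[OF hu k_nonneg] assms, of e]
 have "0 < u (p + t *\<^sub>R e)" using pos[OF assms] .
 then show "((%t. ln (u (p + t *\<^sub>R e))) has_real_derivative dirD e u (p + t *\<^sub>R e) / u (p + t *\<^sub>R e)) (at t)"
  "((%t. dirD e u (p + t *\<^sub>R e) / u (p + t *\<^sub>R e)) has_real_derivative - (Phi e u (p + t *\<^sub>R e) / u (p + t *\<^sub>R e))) (at t)"
  using d1 d2 by (auto intro!: derivative_eq_intros simp: Phi_def field_simps power2_eq_square)
qed

text \<open>By midpoint log-concavity \<open>g t + g (- t)\<close> has a local maximum at 0; its
  second derivative there is twice that of \<open>g\<close>.\<close>

lemma Phi_nonneg:
 assumes p: "p \<in> G"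
 shows "0 <= Phi e u p"
proof -
 define g where "g = (%t. ln (u (p + t *\<^sub>R e)))"
 define S where "S = (%t. p + t *\<^sub>R e) -` G"
 have oS: "open S" unfolding S_def by (intro open_vimage oG continuous_intros)
 have "0 \<in> S" using p by (simp add: S_def)
 have s1: "sd2 g 0 (dirD e u p / u p) (- (Phi e u p / u p))"
 proof (rule sd2I_open[OF oS, where g' = "%t. dirD e u (p + t *\<^sub>R e) / u (p + t *\<^sub>R e)"])
  show "(g has_real_derivative dirD e u (p + t *\<^sub>R e) / u (p + t *\<^sub>R e)) (at t)" if "t \<in> S" for t
   using ln_line(1)[of p t e] that by (simp add: S_def g_def)
  show "((%t. dirD e u (p + t *\<^sub>R e) / u (p + t *\<^sub>R e)) has_real_derivative - (Phi e u p / u p)) (at 0)"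
   using ln_line(2)[of p 0 e] p by simp
 qed (use p in "auto simp: S_def")
 have "sd2 (%t. g (-1 * t + 0)) 0 (-1 * (dirD e u p / u p)) ((-1)^2 * (- (Phi e u p / u p)))"
  by (rule sd2_affine) (use s1 in simp)
 from sd2_add[OF s1 this]
 have "sd2 (%t. g t + g (- t)) 0 0 (- (Phi e u p / u p) - Phi e u p / u p)" by simp
 moreover have "\<forall>\<^sub>F t in nhds 0. g t + g (- t) <= g 0 + g (- 0)"
 proof -
  have "open (S \<inter> (%t. - t) -` S)" using oS by (intro open_Int open_vimage) (auto intro!: continuous_intros)
  then have "\<forall>\<^sub>F t in nhds 0. t \<in> S \<inter> (%t. - t) -` S" using p by (intro eventually_nhds_in_open) (auto simp: S_def)
  then show ?thesis
  proof eventually_elim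
   case (elim t)
   then have G: "p + t *\<^sub>R e \<in> G" "p - t *\<^sub>R e \<in> G" by (auto simp: S_def)
   have "g t + g (- t) = ln (u (p + t *\<^sub>R e) * u (p - t *\<^sub>R e))" using pos[OF G(1)] pos[OF G(2)] by (simp add: g_def ln_mult)
   also have "... <= ln ((u p)^2)" using midpoint_log_concave[of p "t *\<^sub>R e"] pos[OF G(1)] pos[OF G(2)] pos[OF p] by (subst ln_le_cancel_iff) auto
   finally show ?case using pos[OF p] by (simp add: g_def ln_realpow)
  qed
 qed
 ultimately have "- (Phi e u p / u p) - Phi e u p / u p <= 0" by (rule sd2_local_max(2))
 then show ?thesis using pos[OF p] by (simp add: zero_le_divide_iff)
qed

lemma line_in_G:
 assumes "p \<in> G" "p + b *\<^sub>R e \<in> G" "0 <= t" "t <= b"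
 shows "p + t *\<^sub>R e \<in> G"
proof (cases "b = 0")
 case False
 have "(1 - t / b) *\<^sub>R p + (t / b) *\<^sub>R (p + b *\<^sub>R e) \<in> G"
  using assms False by (intro convexD[OF cG]) auto
 moreover have "(1 - t / b) *\<^sub>R p + (t / b) *\<^sub>R (p + b *\<^sub>R e) = p + t *\<^sub>R e"
  using False by (simp add: algebra_simps)
 ultimately show ?thesis by simp
qed (use assms in auto)

lemma slope_antimono:
 assumes "p \<in> G" "p + b *\<^sub>R e \<in> G" "0 <= b"
 shows "dirD e u (p + b *\<^sub>R e) / u (p + b *\<^sub>R e) <= dirD e u p / u p"
proof -
 define g where "g = (%t. - (dirD e u (p + t *\<^sub>R e) / u (p + t *\<^sub>R e)))"
 have "g 0 <= g b"
 proof (rule DERIV_nonneg_imp_nondecreasing[OF assms(3)])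
  fix t assume "0 <= t" "t <= b"
  then have G: "p + t *\<^sub>R e \<in> G" by (rule line_in_G[OF assms(1,2)])
  have "(g has_real_derivative - (- (Phi e u (p + t *\<^sub>R e) / u (p + t *\<^sub>R e)))) (at t)"
   unfolding g_def by (rule DERIV_minus[OF ln_line(2)[OF G]])
  then show "\<exists>y. (g has_real_derivative y) (at t) & 0 <= y" using Phi_nonneg[OF G, of e] pos[OF G] by (force simp: less_imp_le)
 qed
 then show ?thesis by (simp add: g_def)
qed

lemma ln_slope:
 assumes "p \<in> G" "p + b *\<^sub>R e \<in> G" "0 <= b"
 shows "ln (u (p + b *\<^sub>R e)) - ln (u p) <= b * (dirD e u p / u p)"
  "b * (dirD e u (p + b *\<^sub>R e) / u (p + b *\<^sub>R e)) <= ln (u (p + b *\<^sub>R e)) - ln (u p)"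
proof -
 have *: "ln (u (p + b *\<^sub>R e)) - ln (u p) <= b * (dirD e u p / u p)
  & b * (dirD e u (p + b *\<^sub>R e) / u (p + b *\<^sub>R e)) <= ln (u (p + b *\<^sub>R e)) - ln (u p)" if "0 < b"
 proof -
  have d: "((%t. ln (u (p + t *\<^sub>R e))) has_real_derivative dirD e u (p + t *\<^sub>R e) / u (p + t *\<^sub>R e)) (at t)"
   if "0 <= t" "t <= b" for t using ln_line(1)[OF line_in_G[OF assms(1,2) that]] .
  from MVT2[OF that this] obtain t where t: "0 < t" "t < b"
   "ln (u (p + b *\<^sub>R e)) - ln (u p) = b * (dirD e u (p + t *\<^sub>R e) / u (p + t *\<^sub>R e))" by auto
  have G: "p + t *\<^sub>R e \<in> G" using line_in_G[OF assms(1,2)] t by simp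
  have e: "p + b *\<^sub>R e = (p + t *\<^sub>R e) + (b - t) *\<^sub>R e" by (simp add: algebra_simps)
  have "dirD e u (p + t *\<^sub>R e) / u (p + t *\<^sub>R e) <= dirD e u p / u p" using slope_antimono[OF assms(1) G] t by simp
  moreover have "dirD e u (p + b *\<^sub>R e) / u (p + b *\<^sub>R e) <= dirD e u (p + t *\<^sub>R e) / u (p + t *\<^sub>R e)"
   using slope_antimono[OF G, of "b - t" e] t assms(2) unfolding e[symmetric] by simp
  ultimately show ?thesis unfolding t(3) using that by (intro conjI mult_left_mono) auto
 qed
 show "ln (u (p + b *\<^sub>R e)) - ln (u p) <= b * (dirD e u p / u p)" using * assms(3) by (cases "b = 0") auto
 show "b * (dirD e u (p + b *\<^sub>R e) / u (p + b *\<^sub>R e)) <= ln (u (p + b *\<^sub>R e)) - ln (u p)" using * assms(3) by (cases "b = 0") auto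
qed

lemma Phi_form:
 assumes p: "p \<in> G"
 shows "Phi (x, y) u p = Phi (1, 0) u p * x^2
  + 2 * (px u p * py u p / u p - py (px u) p) * x * y + Phi (0, 1) u p * y^2"
proof -
 note d = helmD[OF hu]
 have D1: "dirD (x', y') u = (%q. x' * px u q + y' * py u q)" for x' y'
  by (simp add: fun_eq_iff dirD_def)
 have D2: "dirD (x, y) (dirD (x', y') u) p = x * (x' * px (px u) p + y' * px (py u) p)
   + y * (x' * py (px u) p + y' * py (py u) p)" for x y x' y'
  using has_grad_partials[OF has_grad_lincomb[OF d(3)[OF p] d(4)[OF p], of x' y']] unfolding D1 by (simp add: dirD_def)
 show ?thesis using pos[OF p] partials_commute[OF hu k_nonneg p] unfolding Phi_def D2
  by (simp add: dirD_def field_simps power2_eq_square)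
qed

lemma Phi_trace:
 assumes p: "p \<in> G"
 shows "Phi (1, 0) u p + Phi (0, 1) u p = k * u p + ((px u p)^2 + (py u p)^2) / u p"
proof -
 have "dirD (1, 0) w = px w" "dirD (0, 1) w = py w" for w by (auto simp: dirD_def)
 then show ?thesis using helmD(9)[OF hu p] by (simp add: Phi_def add_divide_distrib)
qed

lemma cross_le:
 assumes p: "p \<in> G"
 shows "(px u p * py u p / u p - py (px u) p)^2 <= Phi (1, 0) u p * Phi (0, 1) u p"
 by (rule psd_apply_le(2)) (unfold Phi_form[OF p, symmetric], rule Phi_nonneg[OF p])

text \<open>Let M be the matrix of the quadratic form \<open>Phi\<close>. The square in
  \<open>Phi_laplacian_identity\<close> is then 2 |M e|^2 / u, which \<open>psd_apply_le\<close>
  bounds by 2 (trace M / u) times \<open>Phi e u\<close>; and trace M / u is k plus the squared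
  gradient of \<open>ln u\<close>.\<close>

lemma Phi_supersol:
 assumes p: "p \<in> G" and C: "2 * (k + ((px u p)^2 + (py u p)^2) / (u p)^2) <= C"
 shows "supersol (- C) (Phi e u) p"
proof -
 obtain x y where e: "e = (x, y)" by (cases e)
 note d = helmD[OF hu]
 define a where "a = dirD e u"
 define b where "b = dirD e a"
 have ha: "helm G k a" "helm G k b" unfolding a_def b_def by (intro helm_dirD hu k_nonneg)+
 define ux where "ux = px u p"
 define uy where "uy = py u p"
 define ax where "ax = px a p"
 define ay where "ay = py a p"
 define i where "i = inverse (u p)"
 have up: "0 < u p" "u p * i = 1" using pos[OF p] by (auto simp: i_def)
 have g1: "grad_lap (%q. inverse (u q)) p (- i\<^sup>2 * ux) (- i\<^sup>2 * uy) (2 * i ^ 3 * (ux^2 + uy^2) + - i\<^sup>2 * (- k * u p))"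
  unfolding i_def ux_def uy_def by (rule grad_lap_compose[OF helm_grad_lap[OF hu p] sd2_inverse]) (use up in simp)
 have ga: "grad_lap a p ax ay (- k * a p)" unfolding ax_def ay_def by (rule helm_grad_lap[OF ha(1) p])
 have gb: "grad_lap b p (px b p) (py b p) (- k * b p)" by (rule helm_grad_lap[OF ha(2) p])
 define X where "X = ax - a p * i * ux"
 define Y where "Y = ay - a p * i * uy"
 define l where "l = - k * Phi e u p + 2 * i * (X^2 + Y^2)"
 have "\<exists>a1 b1. grad_lap (Phi e u) p a1 b1 l"
 proof -
  from grad_lap_diff[OF grad_lap_mult[OF grad_lap_mult[OF ga ga] g1] gb]
  have 1: "\<exists>a1 b1. grad_lap (%q. a q * a q * inverse (u q) - b q) p a1 b1
   ((- k * a p * a p + 2 * (ax * ax + ay * ay) + a p * (- k * a p)) * i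
    + 2 * ((ax * a p + a p * ax) * (- i\<^sup>2 * ux) + (ay * a p + a p * ay) * (- i\<^sup>2 * uy))
    + a p * a p * (2 * i ^ 3 * (ux^2 + uy^2) + - i\<^sup>2 * (- k * u p)) - - k * b p)"
   unfolding i_def by blast
  have 2: "(%q. a q * a q * inverse (u q) - b q) = Phi e u"
   by (simp add: fun_eq_iff Phi_def a_def b_def power2_eq_square divide_inverse)
  have 3: "(- k * a p * a p + 2 * (ax * ax + ay * ay) + a p * (- k * a p)) * i
    + 2 * ((ax * a p + a p * ax) * (- i\<^sup>2 * ux) + (ay * a p + a p * ay) * (- i\<^sup>2 * uy))
    + a p * a p * (2 * i ^ 3 * (ux^2 + uy^2) + - i\<^sup>2 * (- k * u p)) - - k * b p = l"
  proof -
   have P: "Phi e u p = a p * a p * i - b p" by (simp add: Phi_def a_def b_def power2_eq_square divide_inverse i_def)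
   show ?thesis unfolding l_def P X_def Y_def by (rule Phi_laplacian_identity[OF up(2)])
  qed
  show ?thesis using 1 unfolding 2 3 .
 qed
 then obtain a1 b1 where gl: "grad_lap (Phi e u) p a1 b1 l" by blast
 define A where "A = Phi (1, 0) u p"
 define B where "B = px u p * py u p / u p - py (px u) p"
 define D where "D = Phi (0, 1) u p"
 have form: "Phi (s, t) u p = A * s^2 + 2 * B * s * t + D * t^2" for s t
  unfolding A_def B_def D_def by (rule Phi_form[OF p])
 have hx: "X = - (A * x + B * y)" "Y = - (B * x + D * y)"
 proof -
  have D1: "dirD (1, 0) w = px w" "dirD (0, 1) w = py w" for w by (auto simp: dirD_def)
  have "ax = x * px (px u) p + y * px (py u) p"
   "ay = x * py (px u) p + y * py (py u) p"
   using has_grad_partials[OF has_grad_lincomb[OF d(3)[OF p] d(4)[OF p], of x y]] by (simp_all add: ax_def ay_def a_def dirD_def[abs_def] e)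
  moreover have "a p = x * ux + y * uy" by (simp add: a_def dirD_def e ux_def uy_def)
  ultimately show "X = - (A * x + B * y)" "Y = - (B * x + D * y)"
   using partials_commute[OF hu k_nonneg p]
   by (simp_all add: X_def Y_def A_def B_def D_def Phi_def D1 ux_def uy_def i_def divide_inverse power2_eq_square algebra_simps)
 qed
 have "X^2 + Y^2 = (A * x + B * y)^2 + (B * x + D * y)^2" unfolding hx by (simp only: power2_minus)
 also have "... <= (A + D) * (A * x^2 + 2 * B * x * y + D * y^2)"
  by (rule psd_apply_le(1)) (unfold form[symmetric], rule Phi_nonneg[OF p])
 also have "... = (A + D) * Phi e u p" unfolding e form ..
 finally have XY: "X^2 + Y^2 <= (A + D) * Phi e u p" .
 have ph: "0 <= Phi e u p" by (rule Phi_nonneg[OF p])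
 have i0: "0 < i" using up by (simp add: i_def)
 have "2 * i * (X^2 + Y^2) <= 2 * i * ((A + D) * Phi e u p)" using XY i0 by (intro mult_left_mono) auto
 also have "... = 2 * (i * (A + D)) * Phi e u p" by simp
 also have "i * (A + D) = k + ((px u p)^2 + (py u p)^2) / (u p)^2"
  using Phi_trace[OF p] up(1) by (simp add: A_def D_def i_def field_simps power2_eq_square)
 also have "2 * (k + ((px u p)^2 + (py u p)^2) / (u p)^2) * Phi e u p <= C * Phi e u p" using C ph by (rule mult_right_mono)
 finally have "l <= - (- C) * Phi e u p" using k_nonneg ph by (simp add: l_def add_increasing2) (smt (verit) mult_nonneg_nonneg)
 with gl show ?thesis by (rule supersolI)
qed

end

section \<open>From Hessian bounds to rectangles\<close>

lemma abs_mult_le: "\<bar>a\<bar> <= A ==> \<bar>b\<bar> <= B ==> \<bar>a * b\<bar> <= A * (B::real)"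
 unfolding abs_mult by (rule mult_mono') auto

lemma dirD_bound:
 assumes w: "helm S k w" and r: "0 < r" and k: "0 <= k" "k * r^2 <= 1" and sq: "cball p (2 * r) \<subseteq> S"
  and M: "!!q. q \<in> cball p (2 * r) ==> \<bar>w q\<bar> <= M" and e: "norm e <= 1"
 shows "\<bar>dirD e w p\<bar> <= 8 * M / r"
proof -
 have sub: "square p r \<subseteq> S" using square_subset_cball[of p r] sq by blast
 have M': "\<bar>w q\<bar> <= M" if "q \<in> square p r" for q using square_subset_cball[of p r] that M by blast
 have e1: "\<bar>fst e\<bar> <= 1" "\<bar>snd e\<bar> <= 1" using e norm_fst_le[of "fst e" "snd e"] norm_snd_le[of "snd e" "fst e"] by auto
 have "\<bar>fst e * px w p\<bar> <= 1 * (4 * M / r)" "\<bar>snd e * py w p\<bar> <= 1 * (4 * M / r)"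
  by (rule abs_mult_le[OF e1(1) partial_x_bound[OF w r k sub M']], assumption)
    (rule abs_mult_le[OF e1(2) partial_y_bound[OF w r k sub M']], assumption)
 moreover have "8 * M / r = 4 * M / r + 4 * M / r" by simp
 ultimately show ?thesis unfolding dirD_def by linarith
qed

lemma has_grad_Phi:
 assumes u: "helm S k u" and k: "0 <= k" and p: "p \<in> S" and up: "u p ~= 0"
 shows "has_grad (Phi e u) p
   (2 * dirD e u p * px (dirD e u) p / u p - (dirD e u p)^2 * px u p / (u p)^2 - px (dirD e (dirD e u)) p)
   (2 * dirD e u p * py (dirD e u) p / u p - (dirD e u p)^2 * py u p / (u p)^2 - py (dirD e (dirD e u)) p)"
proof -
 have h: "helm S k (dirD e u)" "helm S k (dirD e (dirD e u))" by (intro helm_dirD u k)+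
 note d = helmD(2)[OF u p] helmD(2)[OF h(1) p] helmD(2)[OF h(2) p]
 have "((%p. (dirD e u p)\<^sup>2 / u p - dirD e (dirD e u) p) has_derivative (%h.
   (- (dirD e u p)\<^sup>2 * (inverse (u p) * (fst h * px u p + snd h * py u p) * inverse (u p))
   + (2 * (fst h * px (dirD e u) p + snd h * py (dirD e u) p) * dirD e u p) / u p)
   - (fst h * px (dirD e (dirD e u)) p + snd h * py (dirD e (dirD e u)) p))) (at p)"
  by (rule derivative_eq_intros d up refl | simp add: power2_eq_square)+
 then show ?thesis unfolding Phi_def[abs_def]
  by (rule has_derivative_eq_rhs) (use up in "auto simp: fun_eq_iff field_simps power2_eq_square")
qed

context ground
begin

lemma Phi_scale:
 assumes p: "p \<in> G"
 shows "Phi (t *\<^sub>R e) u p = t^2 * Phi e u p"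
proof -
 obtain x y where e: "e = (x, y)" by (cases e)
 have "Phi (t * x, t * y) u p = t^2 * Phi (x, y) u p"
  unfolding Phi_form[OF p, of "t * x"] Phi_form[OF p, of x] by (simp add: power2_eq_square algebra_simps)
 then show ?thesis by (simp add: e)
qed

lemma grad_pm: "dirD e u pm = 0"
 using grad_lap_local_max(1,2)[OF helm_grad_lap[OF hu pm(1)]] le1 pm(2) by (simp add: dirD_def)

text \<open>Two integrations starting at the maximum, where both \<open>ln u\<close> and its slope
  vanish.\<close>

lemma ln_along:
 assumes t: "0 <= t" and in': "pm + t *\<^sub>R e \<in> G"
  and bd: "!!s. 0 <= s ==> s <= t ==> m * u (pm + s *\<^sub>R e) <= Phi e u (pm + s *\<^sub>R e) & Phi e u (pm + s *\<^sub>R e) <= M * u (pm + s *\<^sub>R e)"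
 shows "- (M * t^2) <= 2 * ln (u (pm + t *\<^sub>R e))" "2 * ln (u (pm + t *\<^sub>R e)) <= - (m * t^2)"
proof -
 have G: "pm + s *\<^sub>R e \<in> G" if "0 <= s" "s <= t" for s using line_in_G[OF pm(1) in' that] .
 define v where "v = (%s. dirD e u (pm + s *\<^sub>R e) / u (pm + s *\<^sub>R e))"
 have up: "0 < u (pm + s *\<^sub>R e)" if "0 <= s" "s <= t" for s using pos[OF G[OF that]] .
 have psi: "m <= Phi e u (pm + s *\<^sub>R e) / u (pm + s *\<^sub>R e)" "Phi e u (pm + s *\<^sub>R e) / u (pm + s *\<^sub>R e) <= M"
  if "0 <= s" "s <= t" for s using bd[OF that] up[OF that] by (auto simp: field_simps)
 have v: "- (M * s) <= v s & v s <= - (m * s)" if s: "0 <= s" "s <= t" for s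
 proof -
  have d: "((%r. v r + c * r) has_real_derivative - (Phi e u (pm + r *\<^sub>R e) / u (pm + r *\<^sub>R e)) + c) (at r)" if "0 <= r" "r <= s" for r c
   unfolding v_def using that s by (intro DERIV_add ln_line(2) DERIV_cmult_Id G) auto
  have "v 0 + M * 0 <= v s + M * s"
   by (rule DERIV_nonneg_imp_nondecreasing[OF s(1)]) (use d psi s in force)
  moreover have "v s + m * s <= v 0 + m * 0"
   by (rule DERIV_nonpos_imp_nonincreasing[OF s(1)]) (use d psi s in force)
  ultimately show ?thesis using grad_pm by (simp add: v_def)
 qed
 have d: "((%r. 2 * ln (u (pm + r *\<^sub>R e)) + c * r^2) has_real_derivative 2 * v r + c * (2 * r)) (at r)" if "0 <= r" "r <= t" for r c
  unfolding v_def by (intro DERIV_add DERIV_cmult ln_line(1) G that) (auto intro!: derivative_eq_intros)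
 have "2 * ln (u (pm + 0 *\<^sub>R e)) + M * 0^2 <= 2 * ln (u (pm + t *\<^sub>R e)) + M * t^2"
  by (rule DERIV_nonneg_imp_nondecreasing[OF t]) (use d v in force)
 then show "- (M * t^2) <= 2 * ln (u (pm + t *\<^sub>R e))" using pm(2) by simp
 have "2 * ln (u (pm + t *\<^sub>R e)) + m * t^2 <= 2 * ln (u (pm + 0 *\<^sub>R e)) + m * 0^2"
  by (rule DERIV_nonpos_imp_nonincreasing[OF t]) (use d v in force)
 then show "2 * ln (u (pm + t *\<^sub>R e)) <= - (m * t^2)" using pm(2) by simp
qed

text \<open>The factor \<open>u p\<close> on both sides appears because \<open>Phi\<close> is u
  times minus the Hessian of \<open>ln u\<close>. The same constant \<open>c\<close> fixes the
  extent in both directions, in units of \<open>L\<close> and 1.\<close>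

definition hessian_tube :: "real => real => real => real => bool" where
 "hessian_tube L c m M \<longleftrightarrow> 0 < c & 0 < m & 0 < M &
  (\<forall>p. \<bar>fst p - fst pm\<bar> <= c * L & \<bar>snd p - snd pm\<bar> <= c --> p \<in> G &
   (\<forall>x y. m * (x^2 / L^2 + y^2) * u p <= Phi (x, y) u p & Phi (x, y) u p <= M * (x^2 / L^2 + y^2) * u p))"

lemma hessian_tube_ln:
 assumes H: "hessian_tube L c m M" and L: "0 < L" and st: "\<bar>s\<bar> <= c * L" "\<bar>t\<bar> <= c"
 shows "pm + (s, t) \<in> G" "- (M * (s^2 / L^2 + t^2)) <= 2 * ln (u (pm + (s, t)))"
  "2 * ln (u (pm + (s, t))) <= - (m * (s^2 / L^2 + t^2))"
proof -
 have in': "pm + r *\<^sub>R (s, t) \<in> G & (\<forall>x y. m * (x^2 / L^2 + y^2) * u (pm + r *\<^sub>R (s, t)) <= Phi (x, y) u (pm + r *\<^sub>R (s, t))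
   & Phi (x, y) u (pm + r *\<^sub>R (s, t)) <= M * (x^2 / L^2 + y^2) * u (pm + r *\<^sub>R (s, t)))" if "0 <= r" "r <= 1" for r
 proof -
  have "\<bar>r * s\<bar> <= 1 * (c * L)" "\<bar>r * t\<bar> <= 1 * c" using that st unfolding abs_mult by (intro mult_mono; simp)+
  then show ?thesis using H unfolding hessian_tube_def
   by (elim conjE allE[of _ "pm + r *\<^sub>R (s, t)"]) simp
 qed
 have G: "pm + 1 *\<^sub>R (s, t) \<in> G" using in'[of 1] by simp
 then show "pm + (s, t) \<in> G" by simp
 show "- (M * (s^2 / L^2 + t^2)) <= 2 * ln (u (pm + (s, t)))" "2 * ln (u (pm + (s, t))) <= - (m * (s^2 / L^2 + t^2))"
  using ln_along[OF zero_le_one G conjI[OF in'[THEN conjunct2, rule_format, THEN conjunct1] in'[THEN conjunct2, rule_format, THEN conjunct2]]]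
  by (simp_all only: power_one mult_1_right scaleR_one)
qed

end

context ground
begin

text \<open>The point may lie outside the tube. Shrink it towards \<open>pm\<close> by a factor
  \<open>r\<close> that brings it inside: concavity keeps \<open>ln u\<close> at least
  \<open>- 2 * r * \<epsilon>\<close>, whereas the Hessian bound gives
  \<open>m * (r * N)^2 <= 4 * (r * \<epsilon>)\<close>. Taking \<open>r = 1\<close> inside the tube
  gives a multiple of \<open>sqrt \<epsilon>\<close>, and \<open>r = c / N\<close> outside gives a
  multiple of \<open>\<epsilon>\<close>, which is smaller.\<close>

lemma superlevel_near:
 assumes H: "hessian_tube L c m M" and L: "0 < L" and e: "0 < \<epsilon>" "\<epsilon> <= 1 / 2"
  and in': "pm + (s, t) \<in> G" and lev: "1 - \<epsilon> <= u (pm + (s, t))"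
 shows "max (\<bar>s\<bar> / L) \<bar>t\<bar> <= (2 / sqrt m + 4 / (m * c)) * sqrt \<epsilon>"
proof -
 define N where "N = max (\<bar>s\<bar> / L) \<bar>t\<bar>"
 have pos': "0 < c" "0 < m" using H by (auto simp: hessian_tube_def)
 have N: "\<bar>s\<bar> <= N * L" "\<bar>t\<bar> <= N" "0 <= N" using L by (auto simp: N_def field_simps max_def)
 have ln: "- 2 * \<epsilon> <= ln (u (pm + (s, t)))"
 proof -
  have "- (2 * \<epsilon>) <= ln (1 - \<epsilon>)" using ln_one_minus_pos_lower_bound[of \<epsilon>] e
  proof -
   have "\<epsilon>^2 <= \<epsilon> * (1 / 2)" using e unfolding power2_eq_square by (intro mult_left_mono) auto
   then show ?thesis using ln_one_minus_pos_lower_bound[of \<epsilon>] e by linarith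
  qed
  also have "... <= ln (u (pm + (s, t)))" using lev e by simp
  finally show ?thesis by simp
 qed
 have key: "m * (r * N)^2 <= 4 * (r * \<epsilon>)" if r: "0 < r" "r <= 1" and rN: "r * N <= c" for r
 proof -
  have st: "\<bar>r * s\<bar> <= c * L" "\<bar>r * t\<bar> <= c"
  proof -
   have "r * \<bar>s\<bar> <= r * (N * L)" "r * \<bar>t\<bar> <= r * N" using N r by (intro mult_left_mono; simp)+
   moreover have "r * N * L <= c * L" using rN L by (intro mult_right_mono) auto
   moreover have "\<bar>r * s\<bar> = r * \<bar>s\<bar>" "\<bar>r * t\<bar> = r * \<bar>t\<bar>" using r by (auto simp: abs_mult)
   ultimately show "\<bar>r * s\<bar> <= c * L" "\<bar>r * t\<bar> <= c" using rN by (simp_all only: mult.assoc)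
  qed
  have "(r * N)^2 <= (r * s)^2 / L^2 + (r * t)^2"
  proof (cases "N = \<bar>t\<bar>")
   case True then show ?thesis using L by (simp add: power_mult_distrib)
  next
   case False
   then have "N = \<bar>s\<bar> / L" by (auto simp: N_def max_def split: if_splits)
   then show ?thesis by (simp add: power_mult_distrib power_divide)
  qed
  then have "m * (r * N)^2 <= m * ((r * s)^2 / L^2 + (r * t)^2)" using pos' by (intro mult_left_mono) auto
  also have "... <= - (2 * ln (u (pm + (r * s, r * t))))" using hessian_tube_ln(3)[OF H L st] by simp
  also have "... <= 4 * (r * \<epsilon>)"
  proof -
   have G1: "pm + r *\<^sub>R (s, t) \<in> G" using line_in_G[OF pm(1), of 1 "(s, t)" r] in' r by simp
   have eq: "pm + (s, t) = (pm + r *\<^sub>R (s, t)) + (1 - r) *\<^sub>R (s, t)" by (simp add: algebra_simps prod_eq_iff)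
   define v where "v = dirD (s, t) u (pm + r *\<^sub>R (s, t)) / u (pm + r *\<^sub>R (s, t))"
   define A where "A = ln (u (pm + (s, t)))"
   define B where "B = ln (u (pm + r *\<^sub>R (s, t)))"
   have "A - B <= (1 - r) * v"
    unfolding v_def A_def B_def eq by (rule ln_slope(1)[OF G1 in'[unfolded eq]]) (use r in simp)
   then have 1: "r * (A - B) <= r * ((1 - r) * v)" using r by (intro mult_left_mono) auto
   have "r * v <= B" using ln_slope(2)[OF pm(1) G1] r pm(2) by (simp add: v_def B_def)
   then have "(1 - r) * (r * v) <= (1 - r) * B" using r by (intro mult_left_mono) auto
   with 1 have "r * A <= B" by (simp add: algebra_simps)
   then have "r * ln (u (pm + (s, t))) <= ln (u (pm + r *\<^sub>R (s, t)))" by (simp add: A_def B_def)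
   moreover have "r * (- 2 * \<epsilon>) <= r * ln (u (pm + (s, t)))"
    by (rule mult_left_mono[OF ln]) (use r in linarith)
   ultimately have "r * (- 2 * \<epsilon>) <= ln (u (pm + (r * s, r * t)))" unfolding scaleR_Pair real_scaleR_def by (rule order_trans[rotated])
   then show ?thesis by linarith
  qed
  finally show ?thesis .
 qed
 show ?thesis unfolding N_def[symmetric]
 proof (cases "N <= c")
  case True
  have "m * N^2 <= 4 * \<epsilon>" using key[of 1] True by simp
  then have "N^2 <= (2 / sqrt m * sqrt \<epsilon>)^2" using pos' e by (simp add: power_mult_distrib power_divide field_simps)
  then have "N <= 2 / sqrt m * sqrt \<epsilon>" by (rule power2_le_imp_le) (use pos' e in simp)
  moreover have "0 <= 4 / (m * c) * sqrt \<epsilon>" using pos' e by simp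
  ultimately show "N <= (2 / sqrt m + 4 / (m * c)) * sqrt \<epsilon>" by (simp add: distrib_right)
 next
  case False
  define r where "r = c / N"
  have r: "0 < r" "r <= 1" "r * N = c" using False pos' by (auto simp: r_def)
  have "m * c^2 <= 4 * (r * \<epsilon>)" using key[OF r(1,2)] r(3) by simp
  then have "m * c * N <= 4 * \<epsilon>" using False pos' by (simp add: r_def field_simps power2_eq_square)
  then have "N <= 4 / (m * c) * \<epsilon>" using pos' by (simp add: field_simps)
  also have "... <= 4 / (m * c) * sqrt \<epsilon>"
  proof (rule mult_left_mono)
   show "\<epsilon> <= sqrt \<epsilon>" using e by (intro real_le_rsqrt) (simp add: power2_eq_square mult_left_le)
  qed (use pos' in simp)
  finally have "N <= 4 / (m * c) * sqrt \<epsilon>" .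
  moreover have "0 <= 2 / sqrt m * sqrt \<epsilon>" using pos' e by simp
  ultimately show "N <= (2 / sqrt m + 4 / (m * c)) * sqrt \<epsilon>" by (simp add: distrib_right)
 qed
qed

lemma superlevel_rectangle:
 assumes H: "hessian_tube L c m M" and L: "0 < L" and e: "0 < \<epsilon>" "\<epsilon> <= 1 / 2"
  and d: "0 < d" "d <= c" "M * d^2 <= 1" and st: "\<bar>s\<bar> <= d * sqrt \<epsilon> * L" "\<bar>t\<bar> <= d * sqrt \<epsilon>"
 shows "pm + (s, t) \<in> G" "1 - \<epsilon> <= u (pm + (s, t))"
proof -
 have "sqrt \<epsilon> <= 1" using e by simp
 then have ds: "d * sqrt \<epsilon> <= c" using mult_left_mono[of "sqrt \<epsilon>" 1 d] d by linarith
 have st': "\<bar>s\<bar> <= c * L" "\<bar>t\<bar> <= c" using st ds L mult_right_mono[OF ds, of L] by linarith+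
 show G: "pm + (s, t) \<in> G" using hessian_tube_ln(1)[OF H L st'] .
 have "\<bar>s / L\<bar> <= d * sqrt \<epsilon>" using st L by (simp add: field_simps)
 then have "(s / L)^2 <= (d * sqrt \<epsilon>)^2" "t^2 <= (d * sqrt \<epsilon>)^2" using st by (metis abs_ge_zero power2_abs power_mono)+
 then have "s^2 / L^2 + t^2 <= 2 * (d^2 * \<epsilon>)" using e by (simp add: power_divide power_mult_distrib)
 moreover have "0 < M" using H by (simp add: hessian_tube_def)
 ultimately have "M * (s^2 / L^2 + t^2) <= M * (2 * (d^2 * \<epsilon>))" by (intro mult_left_mono) auto
 also have "... = 2 * (M * d^2 * \<epsilon>)" by simp
 also have "... <= 2 * (1 * \<epsilon>)" using d e by (intro mult_left_mono mult_right_mono) auto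
 finally have "- \<epsilon> <= ln (u (pm + (s, t)))" using hessian_tube_ln(2)[OF H L st'] by simp
 also have "ln (u (pm + (s, t))) <= u (pm + (s, t)) - 1" using pos[OF G] by (rule ln_le_minus_one)
 finally show "1 - \<epsilon> <= u (pm + (s, t))" by simp
qed

section \<open>Domains of bounded length\<close>

text \<open>Where \<open>u\<close> is at least 1/2, the disc of radius
  \<open>40 * r = 1 / (4 * \<kappa>)\<close> lies in \<open>G\<close> by \<open>u_le_dist\<close>.
  This leaves room for three successive gradient estimates, each shrinking the disc by
  \<open>2 * r\<close>, and the slope bound \<open>20 * \<kappa>\<close> keeps
  \<open>u >= 1/4\<close> on the disc of radius \<open>r\<close>.\<close>

lemma interior_bounds:
 assumes K: "1 <= \<kappa>" "sqrt k <= \<kappa>" and q: "1 / 2 <= u q" and e: "norm e <= 1"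
  and r: "r = 1 / (160 * \<kappa>)" and z: "dist q z <= r"
 shows "z \<in> G" "1 / 4 <= u z" "supersol (- (26000 * \<kappa>^2)) (Phi e u) z" "Phi e u z <= 5 * (8 / r)^2"
  "\<bar>Phi e u z - Phi e u q\<bar> <= 50 * (8 / r) ^ 3 * dist q z"
proof -
 have r0: "0 < r" using K by (simp add: r)
 have kr: "k * r^2 <= 1"
 proof -
  have "(sqrt k * r)^2 <= 1^2" using K k_nonneg by (intro power_mono) (auto simp: r field_simps)
  then show ?thesis using k_nonneg by (simp add: power_mult_distrib)
 qed
 have "sqrt k * (40 * r) <= \<kappa> * (40 * r)" using K r0 by (intro mult_right_mono) auto
 also have "... = 1 / 4" using K by (simp add: r)
 finally have GG: "cball q (40 * r) \<subseteq> G" using q by (intro cball_subset_of_level) auto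
 have cb: "cball y s \<subseteq> cball q (t + s)" if "y \<in> cball q t" for y :: "real * real" and s t
 proof
  fix x assume "x \<in> cball y s" then show "x \<in> cball q (t + s)" using that dist_triangle[of q x y] by simp
 qed
 have Dst: "\<bar>dirD f w y\<bar> <= 8 * B / r" if w: "helm G k w" and B: "!!x. x \<in> cball q (t + 2 * r) ==> \<bar>w x\<bar> <= B"
  and t: "t + 2 * r <= 40 * r" and f: "norm f <= 1" and y: "y \<in> cball q t" for f w y B t
  by (rule dirD_bound[OF w r0 k_nonneg kr _ _ f])
    (use cb[OF y, of "2 * r"] B GG subset_cball[OF t, of q] in blast)+
 have u1: "\<bar>u x\<bar> <= 1" for x using le1 u_nonneg[of x] by simp
 have b1: "\<bar>dirD f u y\<bar> <= 8 / r" if "norm f <= 1" "y \<in> cball q (9 * r)" for f y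
  using Dst[OF hu u1, of "9 * r" f y] that r0 by simp
 have b2: "\<bar>dirD f (dirD e u) y\<bar> <= (8 / r)^2" if "norm f <= 1" "y \<in> cball q (7 * r)" for f y
  using Dst[OF helm_dirD[OF hu k_nonneg], of "7 * r" e "8 / r" f y] b1[OF e] that r0 by (simp add: power2_eq_square)
 have b3: "\<bar>dirD f (dirD e (dirD e u)) y\<bar> <= (8 / r) ^ 3" if "norm f <= 1" "y \<in> cball q (5 * r)" for f y
  using Dst[OF helm_dirD[OF helm_dirD[OF hu k_nonneg] k_nonneg], of "5 * r" e e "(8 / r)^2" f y] b2[OF e] that r0
  by (simp add: power2_eq_square power3_eq_cube)
 have D1: "dirD (1, 0) w = px w" "dirD (0, 1) w = py w" for w by (auto simp: dirD_def)
 have n1: "norm (1::real, 0::real) <= 1" "norm (0::real, 1::real) <= 1" by auto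
 have inG: "y \<in> G" if "y \<in> cball q r" for y
  using subsetD[OF subset_cball[of r "40 * r" q] that] GG r0 by auto
 have pb: "\<bar>px u y\<bar> <= 20 * \<kappa>" "\<bar>py u y\<bar> <= 20 * \<kappa>" if "y \<in> cball q r" for y
  using partial_bound[OF inG[OF that]] K by linarith+
 have lip: "\<bar>f z' - f q\<bar> <= 2 * B * dist q z'" if "z' \<in> cball q r" "!!y. y \<in> cball q r ==> has_grad f y (a y) (b y)"
   "!!y. y \<in> cball q r ==> \<bar>a y\<bar> <= B" "!!y. y \<in> cball q r ==> \<bar>b y\<bar> <= B" for f a b B z'
 proof -
  have seg: "closed_segment q z' \<subseteq> cball q r" using that(1) r0 by (intro closed_segment_subset) auto
  have B0: "0 <= B" using that(3)[of q] r0 by (force simp: mem_cball)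
  have "\<bar>f z' - f q\<bar> <= B * \<bar>fst z' - fst q\<bar> + B * \<bar>snd z' - snd q\<bar>"
   by (rule lipschitz_segment[where a = a and b = b]) (use seg that in blast)+
  also have "... <= B * dist q z' + B * dist q z'"
   using B0 dist_fst_le[of q z'] dist_snd_le[of q z'] by (intro add_mono mult_left_mono) (auto simp: dist_real_def abs_minus_commute)
  finally show ?thesis by simp
 qed
 have low: "1 / 4 <= u y" if y: "y \<in> cball q r" for y
 proof -
  have "\<bar>u y - u q\<bar> <= 2 * (20 * \<kappa>) * dist q y"
   by (rule lip[OF y helmD(2)[OF hu inG] pb])
  also have "... <= 2 * (20 * \<kappa>) * r" using y K by (intro mult_left_mono) auto
  also have "... = 1 / 4" using K by (simp add: r)
  finally show ?thesis using q by linarith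
 qed
 have z': "z \<in> cball q r" using z by simp
 show zG: "z \<in> G" by (rule inG[OF z'])
 show uz: "1 / 4 <= u z" by (rule low[OF z'])
 show "supersol (- (26000 * \<kappa>^2)) (Phi e u) z"
 proof (rule Phi_supersol[OF zG])
  define X where "X = ((px u z)^2 + (py u z)^2) / (u z)^2"
  have "k <= \<kappa>^2" using K k_nonneg by (simp add: sqrt_le_D)
  moreover have "(px u z)^2 <= (20 * \<kappa>)^2" "(py u z)^2 <= (20 * \<kappa>)^2"
   using pb[OF z'] by (metis abs_ge_zero power2_abs power_mono)+
  moreover have "(1 / 4)^2 <= (u z)^2" using uz by (intro power_mono) auto
  then have "X <= 16 * ((px u z)^2 + (py u z)^2)"
   unfolding X_def using uz divide_left_mono[of "(1 / 4)^2" "(u z)^2" "(px u z)^2 + (py u z)^2"]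
   by (simp add: power_divide algebra_simps)
  moreover have "(20 * \<kappa>)^2 = 400 * \<kappa>^2" by (simp add: power_mult_distrib)
  moreover have "0 <= \<kappa>^2" by simp
  \<comment> \<open>\<open>k\<close> contributes 1 and \<open>X\<close> at most 16 * 2 * 400 in
    units of \<open>\<kappa>^2\<close>, so 2 * 12801 = 25602 is enough.\<close>
  ultimately have "2 * (k + X) <= 26000 * \<kappa>^2" by argo
  then show "2 * (k + ((px u z)^2 + (py u z)^2) / (u z)^2) <= 26000 * \<kappa>^2" by (simp only: X_def)
 qed
 have A: "\<bar>dirD e u y\<bar> <= 8 / r" "\<bar>dirD e (dirD e u) y\<bar> <= (8 / r)^2" if "y \<in> cball q r" for y
  using b1[OF e] b2[OF e] that r0 by auto
 have Asq: "(dirD e u y)^2 <= (8 / r)^2" if "y \<in> cball q r" for y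
  using A(1)[OF that] by (metis abs_ge_zero power2_abs power_mono)
 have "(dirD e u z)^2 / u z <= (8 / r)^2 / (1 / 4)" using Asq[OF z'] uz by (intro frac_le) auto
 then show "Phi e u z <= 5 * (8 / r)^2" using A(2)[OF z'] unfolding Phi_def by (simp add: abs_le_iff)
 have gb: "\<bar>2 * dirD e u y * d1 / u y - (dirD e u y)^2 * d2 / (u y)^2 - d3\<bar> <= 15 * (8 / r) ^ 3 + 10 * (8 / r) ^ 3"
  if y: "y \<in> cball q r" and d: "\<bar>d1\<bar> <= (8 / r)^2" "\<bar>d2\<bar> <= 20 * \<kappa>" "\<bar>d3\<bar> <= (8 / r) ^ 3" for y d1 d2 d3
 proof -
  define R where "R = 8 / r"
  have R: "0 < R" "20 * \<kappa> <= R / 64" using r0 K by (auto simp: R_def r)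
  have i: "\<bar>inverse (u y)\<bar> <= 4" using low[OF y] by (simp add: field_simps)
  have D: "\<bar>dirD e u y\<bar> <= R" and d1: "\<bar>d1\<bar> <= R^2" and d2: "\<bar>d2\<bar> <= R / 64" and d3: "\<bar>d3\<bar> <= R ^ 3"
   using A(1)[OF y] d R by (simp_all add: R_def)
  have "\<bar>2 * (dirD e u y * d1 * inverse (u y))\<bar> <= 2 * (R * R^2 * 4)"
   using abs_mult_le[OF abs_mult_le[OF D d1] i] by simp
  moreover have "\<bar>dirD e u y * dirD e u y * d2 * (inverse (u y) * inverse (u y))\<bar> <= R * R * (R / 64) * (4 * 4)"
   by (rule abs_mult_le[OF abs_mult_le[OF abs_mult_le[OF D D] d2] abs_mult_le[OF i i]])
  moreover have "2 * dirD e u y * d1 / u y - (dirD e u y)^2 * d2 / (u y)^2 - d3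
    = 2 * (dirD e u y * d1 * inverse (u y)) - dirD e u y * dirD e u y * d2 * (inverse (u y) * inverse (u y)) - d3"
   by (simp add: power2_eq_square divide_inverse)
  moreover have "2 * (R * R^2 * 4) = 8 * R ^ 3" "R * R * (R / 64) * (4 * 4) = R ^ 3 / 4"
   by (simp_all add: power2_eq_square power3_eq_cube)
  ultimately have "\<bar>2 * dirD e u y * d1 / u y - (dirD e u y)^2 * d2 / (u y)^2 - d3\<bar> <= 8 * R ^ 3 + R ^ 3 / 4 + R ^ 3"
   using d3 by linarith
  moreover have "0 < R ^ 3" using R by simp
  ultimately show ?thesis unfolding R_def[symmetric] by linarith
 qed
 have "\<bar>Phi e u z - Phi e u q\<bar> <= 2 * (25 * (8 / r) ^ 3) * dist q z"
 proof (rule lip[OF z' has_grad_Phi[OF hu k_nonneg inG]])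
  fix y assume y: "y \<in> cball q r"
  then have y5: "y \<in> cball q (5 * r)" "y \<in> cball q (7 * r)" using r0 by auto
  show "u y ~= 0" using low[OF y] by simp
  show "\<bar>2 * dirD e u y * px (dirD e u) y / u y - (dirD e u y)^2 * px u y / (u y)^2 - px (dirD e (dirD e u)) y\<bar> <= 25 * (8 / r) ^ 3"
   using gb[OF y b2[OF n1(1) y5(2), unfolded D1] pb(1)[OF y] b3[OF n1(1) y5(1), unfolded D1]] by simp
  show "\<bar>2 * dirD e u y * py (dirD e u) y / u y - (dirD e u y)^2 * py u y / (u y)^2 - py (dirD e (dirD e u)) y\<bar> <= 25 * (8 / r) ^ 3"
   using gb[OF y b2[OF n1(2) y5(2), unfolded D1] pb(2)[OF y] b3[OF n1(2) y5(1), unfolded D1]] by simp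
 qed
 then show "\<bar>Phi e u z - Phi e u q\<bar> <= 50 * (8 / r) ^ 3 * dist q z" by simp
qed

end

context ground
begin

lemma cont_Phi: "continuous_on G (Phi e u)"
 using has_grad_cont[OF has_grad_Phi[OF hu k_nonneg]] pos
 by (intro continuous_at_imp_continuous_on) (metis less_irrefl)

lemma u_ray_antimono:
 assumes "0 <= s" "s <= t" "pm + t *\<^sub>R e \<in> G"
 shows "u (pm + t *\<^sub>R e) <= u (pm + s *\<^sub>R e)"
proof -
 have s: "pm + s *\<^sub>R e \<in> G" by (rule line_in_G[OF pm(1) assms(3,1,2)])
 have eq: "pm + t *\<^sub>R e = (pm + s *\<^sub>R e) + (t - s) *\<^sub>R e" by (simp add: algebra_simps)
 have "dirD e u (pm + s *\<^sub>R e) / u (pm + s *\<^sub>R e) <= 0"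
  using slope_antimono[OF pm(1) s assms(1)] grad_pm by simp
 then have "(t - s) * (dirD e u (pm + s *\<^sub>R e) / u (pm + s *\<^sub>R e)) <= 0"
  using assms by (intro mult_nonneg_nonpos) auto
 then have "ln (u (pm + t *\<^sub>R e)) <= ln (u (pm + s *\<^sub>R e))"
  using ln_slope(1)[OF s assms(3)[unfolded eq]] assms(2) unfolding eq[symmetric] by linarith
 then show ?thesis using pos[OF s] pos[OF assms(3)] by simp
qed

text \<open>On the ray \<open>u\<close> falls from 1 to 1/2 at some parameter \<open>t <= D\<close>.
  The slope of \<open>ln u\<close> is 0 at the start and at most \<open>- ln 2 / t\<close> at the
  end, so the mean value theorem finds a second derivative of size \<open>ln 2 / t^2\<close> in
  between, where monotonicity still gives \<open>u >= 1/2\<close>.\<close>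

lemma ray_Phi_point:
 assumes D: "!!p. p \<in> G ==> dist pm p <= D" "1 <= D" and e: "norm e = 1"
 obtains s where "0 <= s" "s <= D" "pm + s *\<^sub>R e \<in> G" "1 / 2 <= u (pm + s *\<^sub>R e)" "1 / (4 * D^2) <= Phi e u (pm + s *\<^sub>R e)"
proof -
 have "pm + (D + 1) *\<^sub>R e \<notin> G" using D(1)[of "pm + (D + 1) *\<^sub>R e"] D(2) e by (auto simp: dist_norm)
 then have z: "u (pm + (D + 1) *\<^sub>R e) = 0" by (rule zero)
 have "continuous_on {0..D+1} (%t. u (pm + t *\<^sub>R e))"
  by (rule continuous_on_compose2[OF cu]) (auto intro!: continuous_intros)
 then obtain t where t: "0 <= t" "t <= D + 1" "u (pm + t *\<^sub>R e) = 1 / 2"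
  using IVT2'[of "%t. u (pm + t *\<^sub>R e)" "D + 1" "1 / 2" 0] z D(2) pm by auto
 have G: "pm + t *\<^sub>R e \<in> G" using zero[of "pm + t *\<^sub>R e"] t(3) by auto
 have tD: "t <= D" using D(1)[OF G] t(1) e by (simp add: dist_norm)
 have t0: "0 < t" using t pm by (cases "t = 0") auto
 define v where "v = (%t. dirD e u (pm + t *\<^sub>R e) / u (pm + t *\<^sub>R e))"
 have "t * v t <= - ln 2" using ln_slope(2)[OF pm(1) G t(1)] pm(2) unfolding v_def t(3) by (simp add: ln_div)
 then have vt: "v t <= - ln 2 / t" using t0 by (simp add: field_simps)
 have d: "(v has_real_derivative - (Phi e u (pm + s *\<^sub>R e) / u (pm + s *\<^sub>R e))) (at s)" if "0 <= s" "s <= t" for s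
  unfolding v_def by (rule ln_line(2)[OF line_in_G[OF pm(1) G that]])
 from MVT2[OF t0 this] obtain s where s: "0 < s" "s < t"
  "v t - v 0 = (t - 0) * - (Phi e u (pm + s *\<^sub>R e) / u (pm + s *\<^sub>R e))" by auto
 have v0: "v 0 = 0" using grad_pm by (simp add: v_def)
 have sG: "pm + s *\<^sub>R e \<in> G" using line_in_G[OF pm(1) G] s by simp
 have us: "1 / 2 <= u (pm + s *\<^sub>R e)" using u_ray_antimono[OF _ _ G, of s] s t by simp
 define X where "X = Phi e u (pm + s *\<^sub>R e) / u (pm + s *\<^sub>R e)"
 have "ln 2 / t <= t * X" using vt s(3) v0 by (simp add: X_def)
 then have "ln 2 <= t^2 * X" using t0 by (simp add: field_simps power2_eq_square)
 also have "... <= D^2 * X" using tD t0 Phi_nonneg[OF sG, of e] us unfolding X_def by (intro mult_right_mono power_mono) auto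
 finally have "ln 2 <= D^2 * X" .
 moreover have "1 / 2 <= ln (2::real)" using ln2_ge_two_thirds by simp
 ultimately have "1 / (2 * D^2) <= X" using D(2) by (simp add: field_simps)
 also have "X <= Phi e u (pm + s *\<^sub>R e) / (1 / 2)" unfolding X_def
  using us Phi_nonneg[OF sG, of e] by (intro divide_left_mono) auto
 finally have "1 / (4 * D^2) <= Phi e u (pm + s *\<^sub>R e)" using D(2) by (simp add: field_simps)
 with sG us s tD show ?thesis by (intro that[of s]) auto
qed

text \<open>For each direction the point of \<open>ray_Phi_point\<close> lies on the ray from
  \<open>pm\<close>, and \<open>Phi\<close> in that direction is carried back along it, through
  points with \<open>u >= 1/2\<close>. The radius \<open>r2\<close> lets the tripled discs fit into
  those of \<open>interior_bounds\<close>, and the Lipschitz bound of \<open>Phi\<close> over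
  \<open>r2\<close> costs at most half of \<open>1 / (4 * D^2)\<close>; \<open>n\<close> counts the
  discs.\<close>

lemma hessian_tube_bounded:
 assumes K: "1 <= \<kappa>" "sqrt k <= \<kappa>" and D: "!!p. p \<in> G ==> dist pm p <= D" "1 <= D"
  and r: "r = 1 / (160 * \<kappa>)" and r2: "r2 = min (r / 3) (1 / (8 * D^2 * (50 * (8 / r) ^ 3)))"
  and n: "n = nat \<lceil>D / r2\<rceil>"
 shows "hessian_tube 1 (r2 / 2) (1 / (8 * D^2) / 8 ^ n) (20 * (8 / r)^2)"
proof -
 have r0: "0 < r" using K by (simp add: r)
 have r20: "0 < r2" "r2 <= r / 3" "r2 * (50 * (8 / r) ^ 3) <= 1 / (8 * D^2)"
 proof -
  have Q: "0 < 50 * (8 / r) ^ 3" "0 < 8 * D^2" using r0 D(2) by auto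
  then show "0 < r2" "r2 <= r / 3" using r0 unfolding r2 by (auto intro!: divide_pos_pos mult_pos_pos)
  have "r2 <= 1 / (8 * D^2) / (50 * (8 / r) ^ 3)" unfolding r2 by simp
  then show "r2 * (50 * (8 / r) ^ 3) <= 1 / (8 * D^2)" using Q(1) by (simp only: pos_le_divide_eq)
 qed
 have key: "1 / (8 * D^2) / 8 ^ n <= Phi e u p & Phi e u p <= 5 * (8 / r)^2 & p \<in> G & 1 / 4 <= u p"
  if e: "norm e = 1" and p: "p \<in> cball pm r2" for e p
 proof -
  have e': "norm e <= 1" using e by simp
  obtain s where s: "0 <= s" "s <= D" "pm + s *\<^sub>R e \<in> G" "1 / 2 <= u (pm + s *\<^sub>R e)" "1 / (4 * D^2) <= Phi e u (pm + s *\<^sub>R e)"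
   using ray_Phi_point[OF D e] by blast
  define q where "q = pm + s *\<^sub>R e"
  have seg: "1 / 2 <= u z" if "z \<in> closed_segment q pm" for z
  proof -
   obtain t where t: "0 <= t" "t <= 1" "z = (1 - t) *\<^sub>R q + t *\<^sub>R pm" using \<open>z \<in> closed_segment q pm\<close> unfolding in_segment by auto
   have "z = pm + ((1 - t) * s) *\<^sub>R e" by (simp add: t(3) q_def algebra_simps)
   moreover have "(1 - t) * s <= 1 * s" using t s by (intro mult_right_mono) auto
   ultimately show ?thesis using u_ray_antimono[OF _ _ s(3), of "(1 - t) * s"] t s by simp
  qed
  define S where "S = {z. \<exists>q'\<in>closed_segment q pm. dist q' z <= r}"
  have ib: "z \<in> G" "1 / 4 <= u z" "supersol (- (26000 * \<kappa>^2)) (Phi e u) z" "Phi e u z <= 5 * (8 / r)^2" if "z \<in> S" for z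
  proof -
   obtain q' where q': "q' \<in> closed_segment q pm" "dist q' z <= r" using \<open>z \<in> S\<close> unfolding S_def by blast
   show "z \<in> G" "1 / 4 <= u z" "supersol (- (26000 * \<kappa>^2)) (Phi e u) z" "Phi e u z <= 5 * (8 / r)^2"
    using interior_bounds(1-4)[OF K seg[OF q'(1)] e' r q'(2)] .
  qed
  have pS: "p \<in> S" unfolding S_def using p r20 r0 by (intro CollectI bexI[of _ pm]) auto
  have "1 / (8 * D^2) / 8 ^ n <= Phi e u p"
  proof (rule chain_lower[OF r20(1), of "26000 * \<kappa>^2" _ q pm S])
   have "26000 * \<kappa>^2 * (3 * r2)^2 <= 26000 * \<kappa>^2 * r^2" using r20 by (intro mult_left_mono power_mono) auto
   also have "... <= 4" using K by (simp add: r power_mult_distrib power_divide)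
   finally show "26000 * \<kappa>^2 * (3 * r2)^2 <= 4" .
   show "cball z (3 * r2) \<subseteq> S" if "z \<in> closed_segment q pm" for z
    using that r20 unfolding S_def by force
   show "continuous_on S (Phi e u)" using ib(1) by (intro continuous_on_subset[OF cont_Phi]) auto
   show "dist q pm <= real n * r2"
   proof -
    have "D / r2 <= real n" unfolding n by linarith
    then have "D <= real n * r2" using r20(1) by (simp add: field_simps)
    then show ?thesis using s e by (simp add: q_def dist_norm)
   qed
   show "1 / (8 * D^2) <= Phi e u z" if z: "z \<in> cball q r2" for z
   proof -
    have "\<bar>Phi e u z - Phi e u q\<bar> <= 50 * (8 / r) ^ 3 * dist q z"
     by (rule interior_bounds(5)[OF K _ e' r]) (use s z r20 r0 in "auto simp: q_def")
    also have "... <= 50 * (8 / r) ^ 3 * r2" using z r0 by (intro mult_left_mono) auto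
    also have "... <= 1 / (8 * D^2)" using r20(3) by (simp add: mult.commute)
    finally have "Phi e u q - 1 / (8 * D^2) <= Phi e u z" by linarith
    moreover have "1 / (4 * D^2) = 1 / (8 * D^2) + 1 / (8 * D^2)" by simp
    ultimately show ?thesis using s(5) unfolding q_def[symmetric] by linarith
   qed
  qed (use p ib Phi_nonneg in auto)
  with ib[OF pS] show ?thesis by auto
 qed
 have D0: "0 < D^2" using D(2) by simp
 show ?thesis unfolding hessian_tube_def
 proof (intro conjI allI impI)
  fix p assume "\<bar>fst p - fst pm\<bar> <= r2 / 2 * 1 & \<bar>snd p - snd pm\<bar> <= r2 / 2"
  then have "p \<in> square pm (r2 / 2)" by (simp add: mem_square)
  then have p: "p \<in> cball pm r2" using square_subset_cball[of pm "r2 / 2"] by auto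
  show pG: "p \<in> G" using key[of "(1, 0)"] p by simp
  fix x y :: real
  define N where "N = sqrt (x^2 + y^2)"
  have N2: "N^2 = x^2 + y^2" by (simp add: N_def)
  have "\<exists>e. norm e = 1 & (x, y) = N *\<^sub>R e"
  proof (cases "N = 0")
   case True
   then have "x = 0" "y = 0" by (auto simp: N_def real_sqrt_eq_zero_cancel_iff add_nonneg_eq_0_iff)
   then show ?thesis using True by (intro exI[of _ "(1, 0)"]) (simp add: zero_prod_def)
  next
   case False
   have "norm ((1 / N) *\<^sub>R (x, y)) = \<bar>1 / N\<bar> * N" unfolding norm_scaleR by (simp add: norm_Pair N_def)
   also have "... = 1" using False by (simp add: N_def)
   finally have "norm ((1 / N) *\<^sub>R (x, y)) = 1" .
   moreover have "(x, y) = N *\<^sub>R ((1 / N) *\<^sub>R (x, y))" using False by simp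
   ultimately show ?thesis by blast
  qed
  then obtain e where e: "norm e = 1" "(x, y) = N *\<^sub>R e" by blast
  have P: "Phi (x, y) u p = (x^2 + y^2) * Phi e u p" unfolding e(2) Phi_scale[OF pG] N2 ..
  have nn: "0 <= x^2 + y^2" by simp
  note kp = key[OF e(1) p]
  have "1 / (8 * D^2) / 8 ^ n * u p <= 1 / (8 * D^2) / 8 ^ n * 1" using le1[of p] D0 by (intro mult_left_mono) auto
  with kp have "1 / (8 * D^2) / 8 ^ n * u p <= Phi e u p" by linarith
  from mult_left_mono[OF this nn]
  show "1 / (8 * D^2) / 8 ^ n * (x^2 / 1^2 + y^2) * u p <= Phi (x, y) u p" unfolding P by (simp add: algebra_simps)
  have "5 * (8 / r)^2 * 1 <= 5 * (8 / r)^2 * (4 * u p)" using kp by (intro mult_left_mono) auto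
  with kp have "Phi e u p <= 20 * (8 / r)^2 * u p" by linarith
  from mult_left_mono[OF this nn]
  show "Phi (x, y) u p <= 20 * (8 / r)^2 * (x^2 / 1^2 + y^2) * u p" unfolding P by (simp add: algebra_simps)
 qed (use r20 r0 D0 in auto)
qed

lemma hessian_tube_rescale:
 assumes H: "hessian_tube l c m M" and L: "0 < l" "l <= L" "L <= L0 * l"
 shows "hessian_tube L (c / L0) m (M * L0^2)"
proof -
 have *: "0 < c" "0 < m" "0 < M" and h: "!!p. \<bar>fst p - fst pm\<bar> <= c * l ==> \<bar>snd p - snd pm\<bar> <= c ==> p \<in> G &
   (\<forall>x y. m * (x^2 / l^2 + y^2) * u p <= Phi (x, y) u p & Phi (x, y) u p <= M * (x^2 / l^2 + y^2) * u p)"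
  using H by (auto simp: hessian_tube_def)
 have "1 <= L0"
 proof (rule ccontr)
  assume "\<not> 1 <= L0"
  then have "L0 * l < 1 * l" by (intro mult_strict_right_mono) (use L in auto)
  with L show False by linarith
 qed
 then have L': "0 < L" "1 <= L0" using L by linarith+
 show ?thesis unfolding hessian_tube_def
 proof (intro conjI allI impI)
  fix p assume p: "\<bar>fst p - fst pm\<bar> <= c / L0 * L & \<bar>snd p - snd pm\<bar> <= c / L0"
  have "c / L0 * L <= c / L0 * (L0 * l)" using *(1) L L' by (intro mult_left_mono) auto
  then have "c / L0 * L <= c * l" "c / L0 <= c / 1" using *(1) L' by (simp, intro divide_left_mono) auto
  with h[of p] p have hp: "p \<in> G" "!!x y. m * (x^2 / l^2 + y^2) * u p <= Phi (x, y) u p" "!!x y. Phi (x, y) u p <= M * (x^2 / l^2 + y^2) * u p"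
   by (auto dest: order_trans)
  show "p \<in> G" by fact
  fix x y :: real
  have "x^2 / L^2 <= x^2 / l^2" using L L' by (intro divide_left_mono power_mono) auto
  then have "m * (x^2 / L^2 + y^2) * u p <= m * (x^2 / l^2 + y^2) * u p" using * u_nonneg by (intro mult_right_mono mult_left_mono) auto
  with hp(2)[of x y] show "m * (x^2 / L^2 + y^2) * u p <= Phi (x, y) u p" by linarith
  have "L^2 <= (L0 * l)^2" "1 <= L0^2" using L L' by (auto intro: power_mono one_le_power)
  then have "x^2 * L^2 <= x^2 * (L0 * l)^2" "1 * y^2 <= L0^2 * y^2" by (auto intro: mult_left_mono) (metis mult_right_mono mult_1 zero_le_power2)
  moreover from this(1) have "x^2 / l^2 <= L0^2 * (x^2 / L^2)" using L L' by (simp add: divide_simps power_mult_distrib mult_ac)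
  ultimately have "x^2 / l^2 + y^2 <= L0^2 * (x^2 / L^2 + y^2)" by (simp add: distrib_left)
  then have "M * (x^2 / l^2 + y^2) * u p <= M * (L0^2 * (x^2 / L^2 + y^2)) * u p" using * u_nonneg by (intro mult_right_mono mult_left_mono) auto
  with hp(3)[of x y] show "Phi (x, y) u p <= M * L0^2 * (x^2 / L^2 + y^2) * u p" by (simp add: mult.assoc)
 qed (use * L' in auto)
qed

end

section \<open>Barriers in discs and boxes\<close>

lemma strict_supersol_add:
 assumes "supersol k f p" "strict_supersol k S p" and e: "0 < e"
 shows "strict_supersol k (%q. f q + e * S q) p"
proof -
 obtain s a b l where s: "\<forall>\<^sub>F q in nhds p. f q <= s q" "s p = f p" "grad_lap s p a b l" "l <= - k * f p"
  using assms(1) unfolding supersol_def by blast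
 obtain s' a' b' l' where s': "\<forall>\<^sub>F q in nhds p. S q <= s' q" "s' p = S p" "grad_lap s' p a' b' l'" "l' < - k * S p"
  using assms(2) unfolding strict_supersol_def by blast
 have "\<forall>\<^sub>F q in nhds p. f q + e * S q <= s q + e * s' q"
  using s(1) s'(1) by eventually_elim (use e in "intro add_mono mult_left_mono; simp")
 moreover have "l + e * l' < - k * (f p + e * S p)"
  using s(4) mult_strict_left_mono[OF s'(4) e] by (simp add: algebra_simps)
 ultimately show ?thesis unfolding strict_supersol_def
  using s(2) s'(2) grad_lap_add[OF s(3) grad_lap_cmult[OF s'(3), of e]]
  by (intro exI[of _ "%q. s q + e * s' q"]) auto
qed

text \<open>\<open>maximum_principle\<close> asks for a supersolution that is positive and strict. A
  small multiple of \<open>S\<close> supplies both, and is removed in the end.\<close>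

lemma barrier_le:
 fixes b f S :: "real * real => real"
 assumes K: "compact K" "open U" "U \<subseteq> K"
  and cont: "continuous_on K b" "continuous_on K f" "continuous_on K S"
  and f: "!!p. p \<in> K ==> 0 <= f p" and S: "!!p. p \<in> K ==> 0 < S p"
  and bd: "!!p. p \<in> K - U ==> b p <= f p"
  and U: "!!p. p \<in> U ==> subsol k b p" "!!p. p \<in> U ==> supersol k f p" "!!p. p \<in> U ==> strict_supersol k S p"
  and p: "p \<in> K"
 shows "b p <= f p"
proof (rule field_le_epsilon)
 fix e :: real assume e: "0 < e"
 define d where "d = e / S p"
 have d: "0 < d" using e S[OF p] by (simp add: d_def)
 have "b p <= f p + d * S p"
 proof (rule maximum_principle[where K = K and U = U and Z = "%p. f p + d * S p"])
  show "0 < f q + d * S q" if "q \<in> K" for q using f[OF that] S[OF that] d by (simp add: add_nonneg_pos)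
  show "b q <= f q + d * S q" if "q \<in> K - U" for q
  proof -
   have "0 < d * S q" using S[of q] d that by simp
   then show ?thesis using bd[OF that] by linarith
  qed
  show "\<exists>m. subsol m b q & strict_supersol m (%p. f p + d * S p) q" if "q \<in> U" for q
   using U that d by (intro exI[of _ k] conjI strict_supersol_add) auto
 qed (use K cont p in "auto intro!: continuous_intros")
 then show "b p <= f p + e" using S[OF p] by (simp add: d_def)
qed

lemma grad_lap_fst_snd:
 "grad_lap (%p. fst p - c) p 1 0 0" "grad_lap (%p. snd p - c) p 0 1 0"
 using grad_lap_linear[of "(1, 0)" "(c, 0)" 0 p] grad_lap_linear[of "(0, 1)" "(0, c)" 0 p]
 by (simp_all add: inner_prod_def)

text \<open>For \<open>m = 0\<close> a concave parabola in \<open>x\<close>, positive on the compact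
  set, serves as the strict supersolution.\<close>

lemma superharmonic_barrier:
 fixes b f :: "real * real => real"
 assumes K: "compact K" "open U" "U \<subseteq> K" and cont: "continuous_on K b" "continuous_on K f"
  and f: "!!p. p \<in> K ==> 0 <= f p" and bd: "!!p. p \<in> K - U ==> b p <= f p"
  and U: "!!p. p \<in> U ==> subsol 0 b p" "!!p. p \<in> U ==> supersol 0 f p" and p: "p \<in> K"
 shows "b p <= f p"
proof -
 obtain B where B: "0 < B" "!!p. p \<in> K ==> norm p <= B"
  using compact_imp_bounded[OF K(1)] unfolding bounded_pos by blast
 define S where "S = (%p::real\<times>real. (B + 1)\<^sup>2 - (fst p - 0) * (fst p - 0))"
 show ?thesis
 proof (rule barrier_le[OF K cont _ f _ bd U _ p, of S])
  show "continuous_on K S" unfolding S_def by (intro continuous_intros)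
  show "0 < S q" if "q \<in> K" for q
  proof -
   have "\<bar>fst q\<bar> <= norm q" using norm_fst_le[of "fst q" "snd q"] by simp
   then have "\<bar>fst q\<bar> < B + 1" using B(2)[OF that] by linarith
   then have "\<bar>fst q\<bar>\<^sup>2 < (B + 1)^2" by (intro power_strict_mono) auto
   then show ?thesis by (simp add: S_def power2_eq_square)
  qed
  show "strict_supersol 0 S q" for q
   using grad_lap_diff[OF grad_lap_const grad_lap_mult[OF grad_lap_fst_snd(1)[of 0 q] grad_lap_fst_snd(1)[of 0 q]], of "(B + 1)^2"]
   unfolding S_def by (rule strict_supersolI) simp
 qed auto
qed

text \<open>A Hopf-type bound. The factor \<open>snd p - \<beta>\<close> makes the annulus barrier
  vanish on the wall; its cross term with 1 / rho^2 leaves a nonnegative multiple of 4 (snd q -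
  \<beta>) / rho^4 as Laplacian, since the centre lies above the wall. Dividing by
  \<open>snd q - \<beta> + r\<close> normalises the barrier to at most \<open>m\<close> on the inner
  circle.\<close>

lemma half_disc_lower:
 fixes f :: "real * real => real"
 assumes r: "0 < r" "r < R" and q: "\<beta> < snd q" and m: "0 <= m"
  and S: "S = {p. dist q p <= R & \<beta> <= snd p}"
  and cont: "continuous_on S f" and nn: "!!p. p \<in> S ==> 0 <= f p"
  and sup: "!!p. p \<in> S ==> supersol 0 f p"
  and low: "!!p. p \<in> S ==> dist q p <= r ==> m <= f p" and p: "p \<in> S" "r <= dist q p"
 shows "m * r^2 / (snd q - \<beta> + r) * ((snd p - \<beta>) * (1 / (dist q p)^2 - 1 / R^2)) <= f p"
proof -
 define A where "A = m * r^2 / (snd q - \<beta> + r)"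
 have A: "0 <= A" using m r q by (simp add: A_def)
 define b where "b = (%p. A * ((snd p - \<beta>) * (1 / (dist q p)^2 - 1 / R^2)))"
 define K where "K = S - ball q r"
 define U where "U = (ball q R - cball q r) \<inter> {p. \<beta> < snd p}"
 have cS: "compact S"
 proof -
  have "S = cball q R \<inter> {p. \<beta> <= snd p}" unfolding S by auto
  then show ?thesis by (auto intro!: compact_Int_closed closed_Collect_le continuous_intros)
 qed
 have "b p <= f p"
 proof (rule superharmonic_barrier[where K = K and U = U])
  show "compact K" unfolding K_def by (intro compact_diff cS) auto
  show "open U" unfolding U_def by (intro open_Int open_Diff open_Collect_less continuous_intros) auto
  show "U \<subseteq> K" by (auto simp: U_def K_def S)
  show "continuous_on K b" unfolding b_def using r by (intro continuous_intros) (auto simp: K_def)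
  show "continuous_on K f" using continuous_on_subset[OF cont, of K] by (auto simp: K_def)
  show "p \<in> K" using p by (auto simp: K_def)
  show "0 <= f z" if "z \<in> K" for z using nn that by (auto simp: K_def)
  show "supersol 0 f z" if "z \<in> U" for z using sup[of z] that by (auto simp: U_def S)
  show "b z <= f z" if zK: "z \<in> K - U" for z
  proof -
   consider "dist q z = R" | "dist q z = r" | "snd z = \<beta>" using zK by (force simp: K_def U_def S)
   then show ?thesis
   proof cases
    case 2
    have "snd z - snd q <= r" using dist_snd_le[of q z] 2 by (simp add: dist_real_def)
    then have le: "snd z - \<beta> <= snd q - \<beta> + r" by simp
    have z0: "0 <= snd z - \<beta>" using zK by (simp add: K_def S)
    have i: "1 / R^2 <= 1 / r^2" using r by (intro divide_left_mono power_mono) auto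
    have "b z <= A * ((snd q - \<beta> + r) * (1 / r^2))" unfolding b_def using 2 le z0 r A q i
     by (intro mult_left_mono mult_mono) auto
    also have "... = m" using r q by (simp add: A_def)
    finally show ?thesis using low[of z] 2 zK by (simp add: K_def)
   qed (use nn zK in "auto simp: b_def K_def")
  qed
  show "subsol 0 b z" if z: "z \<in> U" for z
  proof -
   define \<rho> where "\<rho> = dist q z"
   have \<rho>: "r < \<rho>" "\<rho> < R" using z by (auto simp: U_def \<rho>_def)
   have zq: "z ~= q" using \<rho> r by (auto simp: \<rho>_def)
   obtain a c where "grad_lap (%p. 1 / (dist q p)^2) z a c (4 / \<rho> ^ 4)" unfolding \<rho>_def using grad_lap_inverse_square[OF zq] by blast
   note gl = this
   \<comment> \<open>\<open>grad_lap_inverse_square\<close> does not name the gradient it provides.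
     The \<open>y\<close>-component enters the product rule, so it is recovered by uniqueness of
     derivatives.\<close>
   have c: "c = - 2 * (snd z - snd q) / \<rho> ^ 4"
   proof -
    have "sd2 (%t. 1 / (dist q (fst z, t))^2) (snd z) (- 2 * (snd z - snd q) / \<rho> ^ 4)
     ((6 * (snd z - snd q)^2 - 2 * (fst z - fst q)^2) / (\<rho>^2) ^ 3)"
    proof -
     have \<rho>2: "\<rho>^2 = (snd z - snd q)^2 + (fst z - fst q)^2" by (simp add: \<rho>_def dist_prod_sq)
     have "sd2 (%s. 1 / (s^2 + (fst z - fst q)^2)) (1 * snd z + - snd q) (- 2 * (snd z - snd q) / ((snd z - snd q)^2 + (fst z - fst q)^2)^2)
       ((6 * (snd z - snd q)^2 - 2 * (fst z - fst q)^2) / ((snd z - snd q)^2 + (fst z - fst q)^2) ^ 3)"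
     proof -
      have "0 < \<rho>^2" using \<rho> r by simp
      then have "0 < (snd z - snd q)^2 + (fst z - fst q)^2" by (simp only: \<rho>2)
      from sd2_inverse_square[OF this] show ?thesis by simp
     qed
     moreover have "\<rho> ^ 4 = (\<rho>^2)^2" by (simp flip: power_mult)
     ultimately show ?thesis using sd2_affine by (fastforce simp: dist_prod_sq add.commute \<rho>2)
    qed
    moreover obtain n where "sd2 (%t. 1 / (dist q (fst z, t))^2) (snd z) c n" using gl unfolding grad_lap_def by auto
    ultimately show ?thesis unfolding sd2_def
     using DERIV_unique eventually_nhds_x_imp_x by metis
   qed
   have "grad_lap b z (A * (0 * (1 / (dist q z)^2 - 1 / R^2) + (snd z - \<beta>) * (a - 0)))
     (A * (1 * (1 / (dist q z)^2 - 1 / R^2) + (snd z - \<beta>) * (c - 0)))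
     (A * (0 * (1 / (dist q z)^2 - 1 / R^2) + 2 * (0 * (a - 0) + 1 * (c - 0)) + (snd z - \<beta>) * (4 / \<rho> ^ 4 - 0)))"
    unfolding b_def by (intro grad_lap_cmult grad_lap_mult grad_lap_fst_snd grad_lap_diff gl grad_lap_const)
   moreover have "2 * c + (snd z - \<beta>) * (4 / \<rho> ^ 4) = 4 * (snd q - \<beta>) / \<rho> ^ 4"
    unfolding c by (simp add: add_divide_distrib[symmetric] algebra_simps)
   then have "0 <= A * (0 * (1 / (dist q z)^2 - 1 / R^2) + 2 * (0 * (a - 0) + 1 * (c - 0)) + (snd z - \<beta>) * (4 / \<rho> ^ 4 - 0))"
    using A q by simp
   then have "- 0 * b z <= A * (0 * (1 / (dist q z)^2 - 1 / R^2) + 2 * (0 * (a - 0) + 1 * (c - 0)) + (snd z - \<beta>) * (4 / \<rho> ^ 4 - 0))"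
    by simp
   ultimately show ?thesis by (rule subsolI)
  qed
 qed
 then show ?thesis by (simp only: b_def A_def)
qed

section \<open>Superharmonic functions between two walls\<close>

lemma supersol_reflect:
 assumes "supersol m f (c - p)"
 shows "supersol m (%q. f (c - q)) p"
proof -
 obtain s a b l where s: "\<forall>\<^sub>F q in nhds (c - p). f q <= s q" "s (c - p) = f (c - p)" "grad_lap s (c - p) a b l"
   "l <= - m * f (c - p)"
  using assms unfolding supersol_def by blast
 have "filterlim (%q. c - q) (nhds (c - p)) (nhds p)"
  by (intro tendsto_intros filterlim_ident)
 then have "\<forall>\<^sub>F q in nhds p. f (c - q) <= s (c - q)" using s(1) unfolding filterlim_iff by blast
 then show ?thesis unfolding supersol_def using s grad_lap_reflect[OF s(3)] by (intro exI[of _ "%q. s (c - q)"]) auto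
qed

definition strip_box :: "real => real => (real * real) set" where
 "strip_box x \<beta> = {x - 1..x + 1} \<times> {\<beta>..1 - \<beta>}"

lemma mem_strip_box: "(s, t) \<in> strip_box x \<beta> \<longleftrightarrow> \<bar>s - x\<bar> <= 1 & \<beta> <= t & t <= 1 - \<beta>"
 by (auto simp: strip_box_def abs_le_iff)

definition sharm :: "real => real => (real * real => real) => bool" where
 "sharm x \<beta> f \<longleftrightarrow> 0 <= \<beta> & \<beta> <= 1 / 64 & continuous_on (strip_box x \<beta>) f & (\<forall>p\<in>strip_box x \<beta>. 0 <= f p & supersol 0 f p)"

lemma sharm_reflect:
 assumes "sharm x \<beta> f"
 shows "sharm x \<beta> (%q. f ((2 * x, 1) - q))"
proof -
 have m: "(2 * x, 1) - p \<in> strip_box x \<beta>" if "p \<in> strip_box x \<beta>" for p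
  using that by (cases p) (auto simp: mem_strip_box abs_minus_commute algebra_simps)
 have "continuous_on (strip_box x \<beta>) (%q. f ((2 * x, 1) - q))"
  by (rule continuous_on_compose2[of "strip_box x \<beta>" f]) (use assms m in "auto simp: sharm_def intro!: continuous_intros")
 then show ?thesis using assms m supersol_reflect unfolding sharm_def by blast
qed

lemma sharm_half_disc:
 assumes f: "sharm x \<beta> f" and r: "0 < r" "r < R" and R: "R <= 1 - \<beta> - y1" "R <= 1" and q: "\<beta> < y1" and m: "0 <= m"
  and low: "!!p. p \<in> cball (x, y1) r ==> \<beta> <= snd p ==> m <= f p" and p: "dist (x, y1) p <= R" "r <= dist (x, y1) p" "\<beta> <= snd p"
 shows "m * r^2 / (y1 - \<beta> + r) * ((snd p - \<beta>) * (1 / (dist (x, y1) p)^2 - 1 / R^2)) <= f p"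
proof -
 define S where "S = {p. dist (x, y1) p <= R & \<beta> <= snd p}"
 have sub: "S \<subseteq> strip_box x \<beta>"
 proof
  fix p assume p: "p \<in> S"
  obtain s t where st: "p = (s, t)" by (cases p)
  have "\<bar>x - s\<bar> <= R" "\<bar>y1 - t\<bar> <= R" using p dist_fst_le[of "(x, y1)" p] dist_snd_le[of "(x, y1)" p] by (auto simp: S_def st dist_real_def)
  then show "p \<in> strip_box x \<beta>" using p R unfolding st mem_strip_box by (auto simp: S_def st)
 qed
 have "m * r^2 / (snd (x, y1) - \<beta> + r) * ((snd p - \<beta>) * (1 / (dist (x, y1) p)^2 - 1 / R^2)) <= f p"
  by (rule half_disc_lower[OF r _ m S_def]) (use sub f q p low in "auto simp: sharm_def S_def intro: continuous_on_subset")
 then show ?thesis by simp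
qed

lemma inverse_square_gap:
 fixes d R :: real
 assumes "0 < d" "17 * d <= 10 * R"
 shows "1 / (2 * d^2) <= 1 / d^2 - 1 / R^2"
proof -
 have "(17 * d)^2 <= (10 * R)^2" using assms by (intro power_mono) auto
 then have "289 * d^2 <= 100 * R^2" by (simp add: power_mult_distrib)
 then have "2 * d^2 <= R^2" using zero_le_power2[of d] by linarith
 moreover have "0 < 2 * d^2" using assms(1) by simp
 ultimately have "1 / R^2 <= 1 / (2 * d^2)" by (intro divide_left_mono mult_pos_pos) linarith+
 then show ?thesis by simp
qed

text \<open>The half disc about \<open>(x, y1)\<close> that reaches to the upper wall covers the
  disc at mid height with room to spare: \<open>17 * d <= 10 * R\<close> keeps half of
  \<open>1 / d^2\<close> in the barrier. The prefactor is \<open>m * r^2 / (5 * r)\<close>, hence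
  the loss of a single factor \<open>y1 - \<beta>\<close>.\<close>

lemma sharm_mid:
 assumes f: "sharm x \<beta> f" and y: "\<beta> < y1" "y1 <= 1 / 2" and m: "0 <= m"
  and low: "!!p. p \<in> cball (x, y1) ((y1 - \<beta>) / 4) ==> m <= f p" and p: "p \<in> cball (x, 1 / 2) (1 / 16)"
 shows "m * (y1 - \<beta>) / 64 <= f p"
proof (cases "dist (x, y1) p <= (y1 - \<beta>) / 4")
 case True
 have "m * ((y1 - \<beta>) / 64) <= m * 1" using y m f by (intro mult_left_mono) (auto simp: sharm_def)
 with low[of p] True show ?thesis by simp
next
 case False
 have b: "0 <= \<beta>" "\<beta> <= 1 / 64" using f by (auto simp: sharm_def)
 define r where "r = (y1 - \<beta>) / 4"
 define d where "d = dist (x, y1) p"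
 define R where "R = 1 - \<beta> - y1"
 have "dist (x, y1) (x, 1 / 2) = 1 / 2 - y1" using y by (simp add: dist_prod_def dist_real_def)
 then have d: "d <= 9 / 16 - y1" using dist_triangle[of "(x, y1)" p "(x, 1/2)"] p by (simp add: d_def)
 have r: "0 < r" "r < d" using y False by (auto simp: r_def d_def)
 have dR: "17 * d <= 10 * R" "d < R" using d y b by (auto simp: R_def)
 have sp: "3 / 8 <= snd p - \<beta>" using dist_snd_le[of "(x, 1 / 2)" p] p b by (auto simp: dist_real_def)
 have R1: "R <= 1" "r < R" using b y r dR by (auto simp: R_def)
 have main: "m * r^2 / (y1 - \<beta> + r) * ((snd p - \<beta>) * (1 / (dist (x, y1) p)^2 - 1 / R^2)) <= f p"
  by (rule sharm_half_disc[OF f r(1) R1(2) _ R1(1) y(1) m]) (use low r dR sp in "auto simp: r_def d_def R_def")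
 have "1 <= 1 / (2 * d^2)"
 proof -
  have "d^2 <= (9 / 16)^2" using d r y b by (intro power_mono) auto
  then show ?thesis using r by (simp add: power2_eq_square field_simps)
 qed
 then have "1 <= 1 / d^2 - 1 / R^2" using inverse_square_gap[OF _ dR(1)] r by linarith
 then have V: "3 / 8 * 1 <= (snd p - \<beta>) * (1 / d^2 - 1 / R^2)" using sp by (intro mult_mono) auto
 have e: "m * r^2 / (y1 - \<beta> + r) = m * (r / 5)"
 proof -
  have "y1 - \<beta> + r = 5 * r" by (simp add: r_def field_simps)
  then show ?thesis using r(1) by (simp add: power2_eq_square)
 qed
 have "0 <= m * (r / 5)" using m r by simp
 then have "m * (r / 5) * (3 / 8 * 1) <= f p"
  by (rule order_trans[OF mult_left_mono[OF V] main[folded d_def, unfolded e]])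
 moreover have "0 <= m * (y1 - \<beta>)" using m y by simp
 ultimately show ?thesis by (simp add: r_def)
qed

text \<open>A half disc about \<open>(x, 1 / 2)\<close> of radius \<open>1 / 2 - \<beta>\<close>
  meets the wall only at its lowest point, where its barrier vanishes to second order. So the bound
  is first moved to a disc about \<open>(x, 1 / 4)\<close>, whose half disc of radius
  \<open>3 / 4 - \<beta>\<close> crosses the wall and yields linear growth.\<close>

lemma sharm_lower_half:
 assumes f: "sharm x \<beta> f" and m: "0 <= m"
  and low: "!!p. p \<in> cball (x, 1 / 2) (1 / 16) ==> m <= f p" and y: "\<beta> <= y" "y <= 1 / 2"
 shows "m / 2048 * (y - \<beta>) <= f (x, y)"
proof -
 have b: "0 <= \<beta>" "\<beta> <= 1 / 64" using f by (auto simp: sharm_def)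
 have quarter: "m / 256 <= f p" if p: "p \<in> cball (x, 1 / 4) (1 / 16)" for p
 proof -
  define d where "d = dist (x, 1 / 2) p"
  define R where "R = 1 / 2 - \<beta>"
  have "dist (x, 1 / 2 :: real) (x, 1 / 4) = 1 / 4" "dist (x, 1 / 4 :: real) (x, 1 / 2) = 1 / 4" by (simp_all add: dist_prod_def dist_real_def)
  then have d: "d <= 5 / 16" "3 / 16 <= d"
   using dist_triangle[of "(x, 1/2)" p "(x, 1/4)"] dist_triangle[of "(x, 1/4)" "(x, 1/2)" p] p by (auto simp: d_def dist_commute)
  have sp: "11 / 64 <= snd p - \<beta>" using dist_snd_le[of "(x, 1 / 4)" p] p b by (auto simp: dist_real_def)
  have *: "m * (1 / 16)^2 / (1 / 2 - \<beta> + 1 / 16) * ((snd p - \<beta>) * (1 / (dist (x, 1 / 2) p)^2 - 1 / R^2)) <= f p"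
   by (rule sharm_half_disc[OF f _ _ _ _ _ m]) (use low d sp b in "auto simp: d_def R_def")
  have g: "1 / d^2 - 1 / R^2 \<ge> 5"
  proof -
   have "1 / (5 / 16)^2 <= 1 / d^2" using d by (intro divide_left_mono power_mono) auto
   moreover have "1 / R^2 <= 1 / (31 / 64)^2" using b by (intro divide_left_mono power_mono) (auto simp: R_def)
   moreover have "1 / (5 / 16)^2 = (256 / 25 :: real)" "1 / (31 / 64)^2 = (4096 / 961 :: real)" by (simp_all add: power_divide)
   ultimately show ?thesis by linarith
  qed
  have V: "11 / 64 * 5 <= (snd p - \<beta>) * (1 / d^2 - 1 / R^2)" using sp g by (intro mult_mono) auto
  have X: "m * (1 / 144) <= m * (1 / 16)^2 / (1 / 2 - \<beta> + 1 / 16)"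
  proof -
   have "1 / 144 <= (1 / 256) / (1 / 2 - \<beta> + 1 / 16)" using b by (simp add: field_simps)
   then show ?thesis using mult_left_mono[OF _ m, of "1 / 144" "(1 / 256) / (1 / 2 - \<beta> + 1 / 16)"] by (simp add: power2_eq_square)
  qed
  have X0: "0 <= m * (1 / 144)" using m by simp
  have "m * (1 / 144) * (11 / 64 * 5) <= f p"
   by (rule order_trans[OF mult_mono[OF X V order_trans[OF X0 X]] *[folded d_def]]) simp
  then show ?thesis using m by simp
 qed
 show ?thesis
 proof (cases "\<bar>y - 1 / 4\<bar> <= 1 / 16")
  case True
  then have "m / 256 <= f (x, y)" by (intro quarter) (auto simp: dist_prod_def dist_real_def abs_minus_commute)
  moreover have "m * (y - \<beta>) <= m * 1" using y b m by (intro mult_left_mono) auto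
  ultimately show ?thesis using m by simp
 next
  case False
  define R where "R = 3 / 4 - \<beta>"
  have d: "dist (x, 1 / 4) (x, y) = \<bar>y - 1 / 4\<bar>" by (simp add: dist_prod_def dist_real_def abs_minus_commute)
  have dd: "\<bar>y - 1 / 4\<bar> <= 1 / 4" using y b by linarith
  have m': "0 <= m / 256" using m by simp
  have *: "m / 256 * (1 / 16)^2 / (1 / 4 - \<beta> + 1 / 16) * ((snd (x, y) - \<beta>) * (1 / (dist (x, 1 / 4) (x, y))^2 - 1 / R^2)) <= f (x, y)"
   by (rule sharm_half_disc[OF f _ _ _ _ _ m']) (use quarter d dd False b y in "auto simp: R_def")
  have g: "1 / (y - 1 / 4)^2 - 1 / R^2 \<ge> 13"
  proof -
   have "(y - 1 / 4)^2 <= (1 / 4)^2" using dd by (metis abs_ge_zero power2_abs power_mono)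
   then have "1 / (1 / 4)^2 <= 1 / (y - 1 / 4)^2" using False by (intro divide_left_mono mult_pos_pos) auto
   moreover have "1 / R^2 <= 1 / (11 / 16)^2" using b by (intro divide_left_mono power_mono) (auto simp: R_def)
   moreover have "1 / (1 / 4)^2 = (16 :: real)" "1 / (11 / 16)^2 = (256 / 121 :: real)" by (simp_all add: power_divide)
   ultimately show ?thesis by linarith
  qed
  have h: "1 / 80 <= (1 / 256) / (1 / 4 - \<beta> + 1 / 16)" using b by (simp add: field_simps)
  have "m / 256 * (1 / 80) * ((y - \<beta>) * 13) <= m / 256 * ((1 / 256) / (1 / 4 - \<beta> + 1 / 16)) * ((y - \<beta>) * (1 / (y - 1 / 4)^2 - 1 / R^2))"
   using h g y m b by (intro mult_mono mult_left_mono mult_nonneg_nonneg) auto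
  also have "... <= f (x, y)" using * unfolding d by (simp add: power2_eq_square)
  also have "m / 256 * (1 / 80) * ((y - \<beta>) * 13) = m * (y - \<beta>) * (13 / 20480)" by simp
  finally have "m * (y - \<beta>) * (13 / 20480) <= f (x, y)" .
  moreover have "0 <= m * (y - \<beta>)" using m y by simp
  ultimately show ?thesis by simp
 qed
qed

lemma sharm_slice_lower:
 assumes f: "sharm x \<beta> f" and m: "0 <= m"
  and low: "!!p. p \<in> cball (x, 1 / 2) (1 / 16) ==> m <= f p" and y: "\<beta> <= y" "y <= 1 - \<beta>"
 shows "m / 2048 * min (y - \<beta>) (1 - \<beta> - y) <= f (x, y)"
proof (cases "y <= 1 / 2")
 case True
 have "m / 2048 * min (y - \<beta>) (1 - \<beta> - y) <= m / 2048 * (y - \<beta>)" using m by (intro mult_left_mono) auto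
 with sharm_lower_half[OF f m low y(1) True] show ?thesis by simp
next
 case False
 have eq: "dist (x, 1 / 2) ((2 * x, 1) - p) = dist (x, 1 / 2) p" for p :: "real * real"
  by (cases p) (simp add: dist_prod_def dist_real_def abs_minus_commute algebra_simps)
 have "m / 2048 * ((1 - y) - \<beta>) <= f ((2 * x, 1) - (x, 1 - y))"
  by (rule sharm_lower_half[OF sharm_reflect[OF f] m]) (use low y False eq in auto)
 moreover have "m / 2048 * min (y - \<beta>) (1 - \<beta> - y) <= m / 2048 * ((1 - y) - \<beta>)" using m by (intro mult_left_mono) auto
 ultimately show ?thesis by simp
qed

text \<open>Harnack on a quarter of the wall distance of \<open>(x, y1)\<close> costs 2^22, and
  \<open>sharm_mid\<close> costs 2^6 together with that distance. For \<open>y1\<close> in the upper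
  half the box is turned over.\<close>

lemma helm_mid:
 assumes w: "helm S k w" and k: "0 <= k" "k <= 64" and S: "strip_box x \<beta> \<subseteq> S" and b: "0 <= \<beta>" "\<beta> <= 1 / 64"
  and nn: "!!p. p \<in> strip_box x \<beta> ==> 0 <= w p" and y: "\<beta> < y1" "y1 < 1 - \<beta>" and p: "p \<in> cball (x, 1 / 2) (1 / 16)"
 shows "sharm x \<beta> w" "w (x, y1) * min (y1 - \<beta>) (1 - \<beta> - y1) / 2 ^ 28 <= w p"
proof -
 show sh: "sharm x \<beta> w" unfolding sharm_def
  using b nn S helm_supersol[OF w _ k(1) nn] continuous_on_subset[OF helmD(10)[OF w] S] by auto
 define t where "t = min (y1 - \<beta>) (1 - \<beta> - y1)"
 have t: "0 < t" "t <= y1 - \<beta>" "t <= 1 - \<beta> - y1" "t <= 1 / 2" using y b by (auto simp: t_def min_def)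
 have sub: "cball (x, y1) (4 * (t / 4)) \<subseteq> strip_box x \<beta>"
 proof
  fix p assume "p \<in> cball (x, y1) (4 * (t / 4))"
  moreover obtain a c where "p = (a, c)" by (cases p)
  ultimately have "dist (x, y1) p <= t" "p = (a, c)" by auto
  then have "\<bar>x - a\<bar> <= t" "\<bar>y1 - c\<bar> <= t" using dist_fst_le[of "(x, y1)" p] dist_snd_le[of "(x, y1)" p] by (auto simp: dist_real_def)
  then show "p \<in> strip_box x \<beta>" using t unfolding \<open>p = (a, c)\<close> mem_strip_box by auto
 qed
 have kt: "k * (t / 4)^2 <= 64"
 proof -
  have "k * (t / 4)^2 <= 64 * 1^2" using k t by (intro mult_mono power_mono) auto
  then show ?thesis by simp
 qed
 have w0: "0 <= w (x, y1)" using nn y by (simp add: mem_strip_box)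
 have low: "w (x, y1) / 2 ^ 22 <= w q" if "q \<in> cball (x, y1) (t / 4)" for q
  by (rule harnack[OF w k(1) kt _ order_trans[OF sub S] _ that]) (use t sub nn in auto)
 have "w (x, y1) / 2 ^ 22 * t / 64 <= w p"
 proof (cases "y1 <= 1 / 2")
  case True
  then have "t = y1 - \<beta>" by (auto simp: t_def)
  with sharm_mid[OF sh y(1) True, of "w (x, y1) / 2 ^ 22" p] low w0 p show ?thesis by simp
 next
  case False
  then have t': "t = (1 - y1) - \<beta>" by (auto simp: t_def)
  have eq: "dist (x, c) ((2 * x, 1) - q) = dist (x, 1 - c) q" for c and q :: "real * real"
   by (cases q) (simp add: dist_prod_def dist_real_def abs_minus_commute algebra_simps)
  have "w (x, y1) / 2 ^ 22 * (1 - y1 - \<beta>) / 64 <= w ((2 * x, 1) - ((2 * x, 1) - p))"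
   by (rule sharm_mid[OF sharm_reflect[OF sh]]) (use low w0 y False p t' eq in auto)
  then show ?thesis by (simp add: t')
 qed
 then show "w (x, y1) * min (y1 - \<beta>) (1 - \<beta> - y1) / 2 ^ 28 <= w p" by (simp add: t_def[symmetric])
qed

lemma ground_affine:
 fixes r1 r2 :: real
 assumes G: "ground G k u pm" and r: "r1^2 = 1" "r2^2 = 1"
  and A: "A = (%q. (r1 * fst q, r2 * snd q) + c)" "!!q. A (A q) = q"
 shows "ground (A -` G) k (%q. u (A q)) (A pm)" "closure (A -` G) = A -` closure G"
proof -
 interpret ground G k u pm by fact
 have d: "dist (A p) (A q) = dist p q" for p q
 proof -
  have "(r1 * fst p - r1 * fst q)^2 = (fst p - fst q)^2" "(r2 * snd p - r2 * snd q)^2 = (snd p - snd q)^2"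
   using r by (simp_all add: right_diff_distrib[symmetric] power_mult_distrib)
  then show ?thesis unfolding A by (simp add: dist_prod_def dist_real_def)
 qed
 have cA: "continuous_on X A" for X unfolding A by (intro continuous_intros)
 note h = helm_affine[OF hu r refl, of c]
 show "ground (A -` G) k (%q. u (A q)) (A pm)"
 proof
  show "open (A -` G)" by (intro open_vimage oG cA)
  show "convex (A -` G)"
  proof (rule convexI)
   fix p q and s t :: real assume *: "p \<in> A -` G" "q \<in> A -` G" "0 <= s" "0 <= t" "s + t = 1"
   have "A (s *\<^sub>R p + t *\<^sub>R q) = s *\<^sub>R A p + t *\<^sub>R A q + (1 - (s + t)) *\<^sub>R c" unfolding A by (simp add: prod_eq_iff algebra_simps)
   then show "s *\<^sub>R p + t *\<^sub>R q \<in> A -` G" using convexD[OF cG, of "A p" "A q" s t] * by simp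
  qed
  obtain x e where "\<forall>y\<in>G. dist x y <= e" using bG unfolding bounded_def by blast
  then have "\<forall>y\<in>A -` G. dist (A x) y <= e" using d A(2) by (metis vimageE)
  then show "bounded (A -` G)" unfolding bounded_def by blast
  show "helm (A -` G) k (%q. u (A q))" using h(1) unfolding A vimage_def .
  show "continuous_on UNIV (%q. u (A q))" by (rule continuous_on_compose2[OF cu cA]) auto
 qed (use pos zero le1 pm A(2) in auto)
 show "closure (A -` G) = A -` closure G"
 proof (intro set_eqI)
  fix z
  have "(\<exists>y\<in>A -` G. dist y z < e) \<longleftrightarrow> (\<exists>y\<in>G. dist y (A z) < e)" for e
  proof
   assume "\<exists>y\<in>A -` G. dist y z < e"
   then obtain y where "A y \<in> G" "dist y z < e" unfolding Bex_def vimage_eq by blast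
   then show "\<exists>y\<in>G. dist y (A z) < e" using d[of y z] by (intro bexI[of _ "A y"]) auto
  next
   assume "\<exists>y\<in>G. dist y (A z) < e"
   then obtain y where "y \<in> G" "dist y (A z) < e" by auto
   then show "\<exists>y\<in>A -` G. dist y z < e" using d[of "A y" z] A(2)[of y] by (intro bexI[of _ "A y"]) auto
  qed
  then show "z \<in> closure (A -` G) \<longleftrightarrow> z \<in> A -` closure G" unfolding closure_approachable vimage_eq by blast
 qed
qed

section \<open>Long domains: exponential decay and lower bounds\<close>

text \<open>What remains of the normalisation for large \<open>L\<close>: the unit strip, a chord of
  full height at \<open>x0\<close>, an upper bound for \<open>k\<close>, and the height lost at
  distance \<open>2 * L\<close> because \<open>L\<close> is maximal. Reflections preserve all of it,
  which permits one-sided arguments.\<close>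

locale long_ground = ground +
 fixes x0 L :: real
 assumes strip: "p \<in> G ==> 0 < snd p" "p \<in> G ==> snd p < 1"
  and seg: "0 <= y ==> y <= 1 ==> (x0, y) \<in> closure G"
  and L: "1000 <= L" and kup: "k <= pi^2 + 100 / L^2"
  and drop: "(x, y) \<in> G ==> (x, y') \<in> G ==> \<bar>x - x0\<bar> = 2 * L ==> y' - y <= 1 - 1 / (4 * L^2)"

lemma long_ground_mirror:
 fixes r1 r2 :: real
 assumes G: "long_ground G k u pm x0 L" and r: "r1 = 1 \<or> r1 = -1" "r2 = 1 \<or> r2 = -1"
  and A: "A = (%q. (r1 * fst q, r2 * snd q + (1 - r2) / 2))"
 shows "long_ground (A -` G) k (%q. u (A q)) (A pm) (r1 * x0) L" "A (A q) = q"
proof -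
 interpret long_ground G k u pm x0 L by fact
 have r': "r1^2 = 1" "r2^2 = 1" using r by auto
 have A': "A = (%q. (r1 * fst q, r2 * snd q) + (0, (1 - r2) / 2))" by (simp add: A)
 have AA: "A (A q) = q" for q using r by (cases q) (auto simp: A algebra_simps)
 note g = ground_affine[OF ground_axioms r' A' AA]
 interpret m: ground "A -` G" k "%q. u (A q)" "A pm" by (rule g(1))
 show "A (A q) = q" by (rule AA)
 show "long_ground (A -` G) k (%q. u (A q)) (A pm) (r1 * x0) L"
 proof
  show "0 < snd p" "snd p < 1" if "p \<in> A -` G" for p using strip[of "A p"] that r(2) by (auto simp: A)
  show "(r1 * x0, y) \<in> closure (A -` G)" if "0 <= y" "y <= 1" for y
   unfolding g(2) using seg[of y] seg[of "1 - y"] that r by (auto simp: A)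
  show "y' - y <= 1 - 1 / (4 * L^2)" if "(x, y) \<in> A -` G" "(x, y') \<in> A -` G" "\<bar>x - r1 * x0\<bar> = 2 * L" for x y y'
  proof -
   have x: "\<bar>r1 * x - x0\<bar> = 2 * L" using that(3) r(1) by auto
   from r(2) show ?thesis
    using drop[OF _ _ x, of y y'] drop[OF _ _ x, of "1 - y'" "1 - y"] that(1,2) by (auto simp: A)
  qed
 qed (use L kup in auto)
qed

context long_ground
begin

lemma k_low: "pi^2 <= k"
 using slab_le_eigenvalue[of 1 0] strip by simp

lemma k_le: "k <= 10" "k * L^2 <= pi^2 * L^2 + 100" "sqrt k <= 33 / 10"
proof -
 have L2: "1000^2 <= L^2" using L by (intro power_mono) auto
 have "100 / L^2 <= 100 / 1000^2" using L2 L by (intro divide_left_mono) auto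
 moreover have "pi^2 <= (3.1416)^2" using pi_approx by (intro power_mono) auto
 ultimately show k: "k <= 10" using kup by (simp add: power2_eq_square)
 show "sqrt k <= 33 / 10" using k by (intro real_le_lsqrt) (auto simp: power2_eq_square)
 show "k * L^2 <= pi^2 * L^2 + 100" using mult_right_mono[OF kup, of "L^2"] L by (simp add: algebra_simps)
qed

lemma toward_x0:
 assumes "(x, y) \<in> G" "x0 < x1 & x1 <= x \<or> x <= x1 & x1 < x0" and y: "0 <= z" "z <= 1"
  and t: "x1 = x0 + t * (x - x0)"
 shows "(x1, z + t * (y - z)) \<in> G"
proof (cases "x1 = x")
 case True
 then have "(t - 1) * (x - x0) = 0" using t by (simp add: algebra_simps)
 then have "t = 1" using assms(2) by auto
 then show ?thesis using assms(1) True by simp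
next
 case False
 have t01: "0 < t" "t < 1"
 proof -
  have "t * (x - x0) = x1 - x0" "(1 - t) * (x - x0) = x - x1" using t by (simp_all add: algebra_simps)
  then have "0 < t * (x - x0) & 0 < (1 - t) * (x - x0) & 0 < x - x0 \<or> t * (x - x0) < 0 & (1 - t) * (x - x0) < 0 & x - x0 < 0"
   using assms(2) False by linarith
  then show "0 < t" "t < 1" by (auto simp: zero_less_mult_iff mult_less_0_iff)
 qed
 have int: "interior G = G" using oG by (simp add: interior_open)
 have "(x1, z + t * (y - z)) = (1 - t) *\<^sub>R (x0, z) + t *\<^sub>R (x, y)" by (simp add: t algebra_simps)
 then have "(x1, z + t * (y - z)) \<in> open_segment (x0, z) (x, y)"
  unfolding in_segment using t01 assms(2) False by (intro conjI exI[of _ t]) auto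
 moreover have "open_segment (x0, z) (x, y) \<subseteq> interior G"
  using in_interior_closure_convex_segment[OF cG, of "(x, y)" "(x0, z)"] assms(1) seg[OF y] int by (simp add: open_segment_commute)
 ultimately show ?thesis using int by auto
qed

text \<open>Slices shrink away from \<open>x0\<close>: the segment from \<open>(x, y)\<close> to the
  point of the full chord at the same height is horizontal.\<close>

lemma nested:
 assumes "(x, y) \<in> G" "x0 < x1 & x1 <= x \<or> x <= x1 & x1 < x0"
 shows "(x1, y) \<in> G"
proof -
 have "x ~= x0" using assms(2) by auto
 then have "x1 = x0 + ((x1 - x0) / (x - x0)) * (x - x0)" by simp
 from toward_x0[OF assms, of y, OF _ _ this] show ?thesis using strip[OF assms(1)] by simp
qed

text \<open>Contract by \<open>1 / m\<close>, the upper point towards the top of the chord and the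
  lower one towards its bottom. The missing height is divided by \<open>m\<close> and must still be
  at least \<open>1 / (4 * L^2)\<close> at distance \<open>2 * L\<close>.\<close>

lemma height:
 assumes G: "(x, y) \<in> G" "(x, y') \<in> G" and m: "1 <= m" "x - x0 = 2 * L * m"
 shows "y' - y <= 1 - m / (4 * L^2)"
proof -
 have x1: "x0 + 2 * L = x0 + (1 / m) * (x - x0)" using m by simp
 have c: "x0 < x0 + 2 * L & x0 + 2 * L <= x \<or> x <= x0 + 2 * L & x0 + 2 * L < x0"
 proof -
  have "2 * L * 1 <= 2 * L * m" using m L by (intro mult_left_mono) auto
  then have "x0 + 2 * L <= x" using m(2) by linarith
  then show ?thesis using L by simp
 qed
 have "(x0 + 2 * L, 1 + (1 / m) * (y' - 1)) \<in> G" "(x0 + 2 * L, 0 + (1 / m) * (y - 0)) \<in> G"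
  by (rule toward_x0[OF G(2) c _ _ x1] toward_x0[OF G(1) c _ _ x1]; simp)+
 from drop[OF this(2,1)] have "1 + (1 / m) * (y' - 1) - (0 + (1 / m) * (y - 0)) <= 1 - 1 / (4 * L^2)" using L by simp
 then have "(y' - y - 1) / m <= - (1 / (4 * L^2))" by (simp add: diff_divide_distrib)
 then have "y' - y - 1 <= - (1 / (4 * L^2)) * m" using m by (simp add: pos_divide_le_eq)
 then show ?thesis by simp
qed

text \<open>Slices beyond \<open>x1\<close> are contained in the slice at \<open>x1\<close>, which
  is open with diameter at most \<open>H\<close>; openness makes the bounds from its infimum
  strict.\<close>

lemma slice_strip:
 assumes x1: "x0 < x1" and H: "0 < H" "!!y y'. (x1, y) \<in> G ==> (x1, y') \<in> G ==> y' - y <= H"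
 obtains \<alpha> where "!!x y. x1 <= x ==> (x, y) \<in> G ==> \<alpha> < y & y < \<alpha> + H"
proof (cases "\<exists>y. (x1, y) \<in> G")
 case False
 then show ?thesis using nested x1 that[of 0] by blast
next
 case True
 define S where "S = {y. (x1, y) \<in> G}"
 have bb: "bdd_below S" using strip(1) by (intro bdd_belowI[of _ 0]) (force simp: S_def)
 have near: "\<exists>e>0. \<forall>z. \<bar>z - y\<bar> < e --> z \<in> S" if "y \<in> S" for y
 proof -
  have "open S" unfolding S_def using open_vimage[OF oG, of "%y. (x1, y)"] by (simp add: vimage_def continuous_on_Pair continuous_on_id)
  then show ?thesis using that unfolding open_dist by (auto simp: dist_real_def)
 qed
 have *: "Inf S < y & y < Inf S + H" if y: "y \<in> S" for y
 proof -
  obtain e where e: "0 < e" "!!z. \<bar>z - y\<bar> < e ==> z \<in> S" using near[OF y] by blast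
  have "Inf S <= y - e / 2" by (rule cInf_lower[OF _ bb]) (use e in auto)
  moreover have "y + e / 2 - H <= Inf S"
   by (rule cInf_greatest) (use y e H(2)[of _ "y + e / 2"] in "force simp: S_def")+
  ultimately show ?thesis using e(1) by linarith
 qed
 show ?thesis
  by (rule that[of "Inf S"]) (use * nested x1 in "force simp: S_def")
qed

end

lemma min_le_2_sin:
 assumes "0 <= x" "x <= pi"
 shows "min x (pi - x) <= 2 * sin x"
proof -
 have c: "concave_on {0..pi/2} sin"
  by (rule f''_le0_imp_concave[where f' = cos and f'' = "%x. - sin x"])
   (auto intro!: derivative_eq_intros sin_ge_zero)
 have half: "x <= 2 * sin x" if x: "0 <= x" "x <= pi / 2" for x
 proof -
  define t where "t = x / (pi / 2)"
  have t: "0 <= t" "t <= 1" using x by (auto simp: t_def)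
  have e: "(1 - t) *\<^sub>R 0 + t *\<^sub>R (pi / 2) = x" by (simp add: t_def)
  have "(1 - t) * sin 0 + t * sin (pi / 2) <= sin ((1 - t) *\<^sub>R 0 + t *\<^sub>R (pi / 2))"
   using concave_onD[OF c t, of 0 "pi / 2"] by simp
  then have "t <= sin x" unfolding e by simp
  moreover have "x * pi <= x * 4" using pi_less_4 x by (intro mult_left_mono) auto
  then have "x <= 2 * t" by (simp add: t_def field_simps)
  ultimately show ?thesis by linarith
 qed
 show ?thesis
 proof (cases "x <= pi / 2")
  case True then show ?thesis using half[OF assms(1)] by (simp add: min_def)
 next
  case False
  then have "pi - x <= 2 * sin (pi - x)" using assms by (intro half) auto
  then show ?thesis by simp
 qed
qed

lemma grad_lap_prod:
 assumes "sd2 g (fst p) b a" "sd2 h (snd p) d c"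
 shows "grad_lap (%p. g (fst p) * h (snd p)) p (b * h (snd p)) (g (fst p) * d) (a * h (snd p) + g (fst p) * c)"
proof -
 have "sd2 (%s. g s * h (snd p)) (fst p) (b * h (snd p)) (a * h (snd p))"
  using sd2_cmult[OF assms(1), of "h (snd p)"] by (simp add: mult.commute)
 with sd2_cmult[OF assms(2), of "g (fst p)"] show ?thesis unfolding grad_lap_def by auto
qed

lemma sd2_sin_affine: "sd2 (%t. sin (c * (t - a))) t (c * cos (c * (t - a))) (- c\<^sup>2 * sin (c * (t - a)))"
 using sd2_affine[of "%t. sin (c * t)" 1 t "- a"] sd2_sin[of c "t - a"] by simp

lemma sd2_cos_affine: "sd2 (%t. cos (c * (t - a))) t (- c * sin (c * (t - a))) (- c\<^sup>2 * cos (c * (t - a)))"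
 by (rule sd2I[where g' = "%t. - c * sin (c * (t - a))"])
   (auto intro!: derivative_eq_intros simp: power2_eq_square algebra_simps)

lemma sd2_exp_affine: "sd2 (%t. exp (c * (t - a))) t (c * exp (c * (t - a))) (c^2 * exp (c * (t - a)))"
 by (rule sd2I[where g' = "%t. c * exp (c * (t - a))"])
   (auto intro!: derivative_eq_intros simp: power2_eq_square algebra_simps)

context ground
begin

lemma ln_concave:
 assumes "p \<in> G" "q \<in> G" "0 <= t" "t <= 1"
 shows "(1 - t) * ln (u p) + t * ln (u q) <= ln (u (p + t *\<^sub>R (q - p)))"
proof -
 have G: "p + s *\<^sub>R (q - p) \<in> G" if "0 <= s" "s <= 1" for s
  using line_in_G[of p 1 "q - p" s] assms that by simp
 have "concave_on {0..1} (%s. ln (u (p + s *\<^sub>R (q - p))))"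
  by (rule f''_le0_imp_concave[OF _ ln_line(1) ln_line(2)]) (use G Phi_nonneg pos in "auto simp: less_imp_le")
 from concave_onD[OF this assms(3,4), of 0 1] show ?thesis by simp
qed

lemma superlevel_segment:
 assumes c: "0 < c" "c <= u p" "c <= u q" and t: "0 <= t" "t <= 1"
 shows "c <= u (p + t *\<^sub>R (q - p))"
proof -
 have G: "p \<in> G" "q \<in> G" using c zero[of p] zero[of q] by linarith+
 have "p + t *\<^sub>R (q - p) \<in> G" using line_in_G[of p 1 "q - p" t] G t by simp
 then have up: "0 < u (p + t *\<^sub>R (q - p))" by (rule pos)
 have "(1 - t) * ln c + t * ln c <= (1 - t) * ln (u p) + t * ln (u q)"
  using c t by (intro add_mono mult_left_mono) auto
 then have "ln c <= ln (u (p + t *\<^sub>R (q - p)))" using ln_concave[OF G t] by (simp add: algebra_simps)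
 then show ?thesis using c(1) up by simp
qed

end

context long_ground
begin

lemma u_le_wall: "0 <= y ==> y <= 1 ==> u (x, y) <= 33 / 10 * min y (1 - y)"
proof -
 assume y: "0 <= y" "y <= 1"
 have "(x, 0) \<notin> G" "(x, 1) \<notin> G" using strip by force+
 then have "u (x, y) <= sqrt k * y" "u (x, y) <= sqrt k * (1 - y)"
  using u_le_dist[of "(x, 0)" "(x, y)"] u_le_dist[of "(x, 1)" "(x, y)"] y by (auto simp: dist_prod_def dist_real_def)
 moreover have "sqrt k * y <= 33 / 10 * y" "sqrt k * (1 - y) <= 33 / 10 * (1 - y)" using k_le(3) y by (intro mult_right_mono; simp)+
 ultimately show ?thesis by linarith
qed

text \<open>Beyond \<open>x1\<close> the domain lies in a strip of height \<open>H\<close>, where a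
  decaying exponential times a sine of frequency \<open>c\<close> with k + \<mu>^2 < c^2 < (pi /
  H)^2 is a strict supersolution. The factor 2 lets it dominate \<open>u\<close> on the slice at
  \<open>x1\<close>: there \<open>u\<close> is at most \<open>c\<close> times the distance to either
  end, and \<open>min_le_2_sin\<close> applies.\<close>

lemma decay:
 assumes x1: "x0 < x1" and H: "0 < H" "!!y y'. (x1, y) \<in> G ==> (x1, y') \<in> G ==> y' - y <= H"
  and \<mu>: "0 <= \<mu>" "k + \<mu>^2 < (pi / H)^2" and x: "x1 <= x"
 shows "u (x, y) <= 2 * exp (- \<mu> * (x - x1))"
proof (cases "(x, y) \<in> G")
 case False then show ?thesis using zero by simp
next
 case inG: True
 obtain \<alpha> where \<alpha>: "!!x y. x1 <= x ==> (x, y) \<in> G ==> \<alpha> < y & y < \<alpha> + H"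
  using slice_strip[OF x1 H] by blast
 have "sqrt (k + \<mu>^2) < pi / H" using \<mu> H by (intro real_less_lsqrt) auto
 then obtain c where c: "sqrt (k + \<mu>^2) < c" "c < pi / H" using dense by blast
 have c0: "0 < c" using c(1) k_nonneg by (meson add_nonneg_nonneg le_less_trans real_sqrt_ge_zero zero_le_power2)
 have "(sqrt (k + \<mu>^2))^2 < c^2" using c k_nonneg by (intro power_strict_mono) auto
 then have ck: "k + \<mu>^2 < c^2" using k_nonneg by simp
 have skc: "sqrt k <= c" using ck c0 by (intro real_le_lsqrt) (auto intro: order_trans[of k "k + \<mu>^2"])
 define \<eta> where "\<eta> = (pi / c - H) / 2"
 have "c * H < pi" using c(2) H by (simp add: field_simps)
 then have \<eta>: "0 < \<eta>" "c * (H + \<eta>) < pi" using c0 by (auto simp: \<eta>_def field_simps)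
 define a where "a = \<alpha> - \<eta>"
 define Z where "Z = (%p::real\<times>real. exp (- \<mu> * (fst p - x1)) * (2 * sin (c * (snd p - a))))"
 define K where "K = closure (G \<inter> {p. x1 <= fst p})"
 define U where "U = G \<inter> {p. x1 < fst p}"
 have KG: "K \<subseteq> {p. x1 <= fst p & \<alpha> <= snd p & snd p <= \<alpha> + H}"
  unfolding K_def by (rule closure_minimal) (use \<alpha> in "force intro!: closed_Collect_conj closed_Collect_le continuous_intros")+
 have rng: "0 < c * (snd p - a)" "c * (snd p - a) < pi" if p: "p \<in> K" for p
 proof -
  have "0 < snd p - a" "snd p - a <= H + \<eta>" using p KG \<eta> by (auto simp: a_def)
  then show "0 < c * (snd p - a)" "c * (snd p - a) < pi" using c0 \<eta>(2) mult_left_mono[of "snd p - a" "H + \<eta>" c]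
   by (auto intro: le_less_trans[OF mult_left_mono])
 qed
 have Zpos: "0 < Z p" if "p \<in> K" for p using rng[OF that] sin_gt_zero by (simp add: Z_def)
 have "u (x, y) <= Z (x, y)"
 proof (rule maximum_principle[where K = K and U = U])
  show "compact K" unfolding K_def using bG by (simp add: compact_closure bounded_Int)
  show "0 < Z p" if "p \<in> K" for p by (rule Zpos[OF that])
  show "continuous_on K u" by (rule cuS)
  show "continuous_on K Z" unfolding Z_def by (intro continuous_intros)
  show "open U" unfolding U_def by (intro open_Int oG open_Collect_less continuous_intros)
  show "U \<subseteq> K" unfolding U_def K_def by (rule order_trans[OF _ closure_subset]) auto
  show "(x, y) \<in> K" unfolding K_def using inG x closure_subset by fastforce
  show "u p <= Z p" if p: "p \<in> K - U" for p
  proof (cases "p \<in> G")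
   case False then show ?thesis using zero[of p] Zpos[of p] p by auto
  next
   case True
   then have x1p: "p = (x1, snd p)" using p KG by (cases p) (force simp: U_def)
   define t where "t = snd p - \<alpha>"
   have t: "0 < t" "t < H" using \<alpha>[of x1 "snd p"] True x1p by (auto simp: t_def)
   have "(x1, \<alpha>) \<notin> G" "(x1, \<alpha> + H) \<notin> G" using \<alpha>[of x1] by force+
   moreover have "dist p (x1, \<alpha>) = t" "dist p (x1, \<alpha> + H) = H - t"
    using t by (subst x1p, simp add: dist_prod_def dist_real_def t_def)+
   ultimately have "u p <= sqrt k * t" "u p <= sqrt k * (H - t)"
    using u_le_dist[of "(x1, \<alpha>)" p] u_le_dist[of "(x1, \<alpha> + H)" p] by simp_all
   moreover have "sqrt k * t <= c * t" "sqrt k * (H - t) <= c * (H - t)" using skc t by (intro mult_right_mono; simp)+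
   moreover have "c * t <= c * (snd p - a)" using \<eta> c0 by (simp add: t_def a_def)
   moreover have "c * (H - t) <= pi - c * (snd p - a)" using \<eta>(2) by (simp add: t_def a_def algebra_simps)
   moreover have "min (c * (snd p - a)) (pi - c * (snd p - a)) <= 2 * sin (c * (snd p - a))"
    using rng[of p] p by (intro min_le_2_sin) auto
   moreover have "Z p = 2 * sin (c * (snd p - a))" unfolding Z_def by (subst x1p) simp
   ultimately show ?thesis by linarith
  qed
  fix p assume pU: "p \<in> U" and "Z p < u p"
  then have p: "p \<in> G" "p \<in> K" using \<open>U \<subseteq> K\<close> by (auto simp: U_def)
  have "subsol k u p" using helm_grad_lap[OF hu p(1)] by (rule subsolI) simp
  moreover have "strict_supersol k Z p"
  proof -
   note gl = grad_lap_prod[OF sd2_exp_affine[of "- \<mu>" x1 "fst p"] sd2_cmult[OF sd2_sin_affine[of c a "snd p"], of 2], folded Z_def]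
   have "(\<mu>^2 - c^2) * Z p < - k * Z p" using ck Zpos[OF p(2)] by (intro mult_strict_right_mono) auto
   also have "(\<mu>^2 - c^2) * Z p = (- \<mu>)^2 * exp (- \<mu> * (fst p - x1)) * (2 * sin (c * (snd p - a))) +
      exp (- \<mu> * (fst p - x1)) * (2 * (- c\<^sup>2 * sin (c * (snd p - a))))" by (simp add: Z_def algebra_simps)
   finally show ?thesis using gl by (intro strict_supersolI)
  qed
  ultimately show "\<exists>m. subsol m u p & strict_supersol m Z p" by blast
 qed
 also have "Z (x, y) <= exp (- \<mu> * (x - x1)) * (2 * 1)" unfolding Z_def fst_conv snd_conv by (intro mult_left_mono) auto
 finally show ?thesis by simp
qed

text \<open>At distance \<open>100 * L\<close> the height is at most 1 - 50 / (4 * L^2), below 1 -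
  12 / L^2. This raises pi^2 / H^2 above pi^2 by at least 18 * 12 / L^2 = 216 / L^2, more than the
  excess 100 / L^2 of \<open>k\<close> and the squared rate 25 / L^2 together.\<close>

lemma far_right:
 assumes "x0 + 100 * L <= x"
 shows "u (x, y) <= 2 * exp (- 5 * (x - x0 - 100 * L) / L)"
proof -
 have L2: "1000^2 <= L^2" using L by (intro power_mono) auto
 define d where "d = 12 / L^2"
 have d: "0 < d" "d < 1" using L2 L by (auto simp: d_def field_simps)
 have "u (x, y) <= 2 * exp (- (5 / L) * (x - (x0 + 100 * L)))"
 proof (rule decay[where H = "1 - d"])
  show "x0 < x0 + 100 * L" using L by simp
  show "y' - y <= 1 - d" if "(x0 + 100 * L, y) \<in> G" "(x0 + 100 * L, y') \<in> G" for y y'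
  proof -
   have "50 / (4 * L^2) \<ge> d" using L by (simp add: d_def field_simps)
   then show ?thesis using height[OF that, of 50] by simp
  qed
  show "k + (5 / L)^2 < (pi / (1 - d))^2"
  proof -
   have "(1 + 2 * d) * (1 - d)^2 <= 1"
   proof -
    have "1 - (1 + 2 * d) * (1 - d)^2 = d^2 * (3 - 2 * d)" by (simp add: power2_eq_square algebra_simps)
    moreover have "0 <= d^2 * (3 - 2 * d)" using d by simp
    ultimately show ?thesis by linarith
   qed
   then have "1 + 2 * d <= 1 / (1 - d)^2" using d by (simp add: pos_le_divide_eq)
   then have "pi^2 * (1 + 2 * d) <= pi^2 * (1 / (1 - d)^2)" by (intro mult_left_mono) auto
   moreover have "9 * (2 * d) <= pi^2 * (2 * d)" using d pi_gt3 power_mono[of 3 pi 2] by (intro mult_right_mono) auto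
   moreover have "100 / L^2 + 25 / L^2 < 18 * d" using L by (simp add: d_def field_simps)
   then have "k + 25 / L^2 < pi^2 + 18 * d" using kup by linarith
   moreover have "pi^2 * (1 + 2 * d) = pi^2 + pi^2 * (2 * d)" by (simp add: distrib_left)
   ultimately have "k + 25 / L^2 < pi^2 * (1 / (1 - d)^2)" by linarith
   then show ?thesis by (simp add: power_divide)
  qed
 qed (use d L assms in auto)
 moreover have "- (5 / L) * (x - (x0 + 100 * L)) = - 5 * (x - x0 - 100 * L) / L"
  by (simp only: diff_diff_eq minus_divide_left[symmetric] times_divide_eq_left mult_minus_left)
 ultimately show ?thesis by (simp only:)
qed

text \<open>\<open>half_square_bound\<close> with the coordinates interchanged. The zero extension
  lets the square protrude from the domain, since the subsolution property is asked only where the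
  function is positive.\<close>

lemma near_wall_aux:
 assumes M: "0 <= M" "!!p. \<bar>fst p - x\<bar> <= 1 / 4 ==> u p <= M" and a: "0 <= a" "a <= 1 / 4"
 shows "u (x, a) <= 16 * M * a" "u (x, 1 - a) <= 16 * M * a"
proof -
 have k16: "k * (1 / 4)^2 <= 1" using k_le by (simp add: power2_eq_square)
 define f where "f = (%q. u ((snd q, fst q) + (x, 0)))"
 have "f (a, 0) <= 4 * M * a / (1 / 4)"
 proof (rule half_square_bound[OF _ k_nonneg k16 M(1)])
  show "continuous_on ({0..1 / 4} \<times> {- (1 / 4)..1 / 4}) f" unfolding f_def
   by (rule continuous_on_compose2[OF cu]) (auto intro!: continuous_intros)
  show "f (0, b) <= 0" for b using zero[of "(b + x, 0)"] strip(1)[of "(b + x, 0)"] by (cases "(b + x, 0) \<in> G") (auto simp: f_def)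
  show "subsol k f p" if "0 < f p" for p
  proof -
   have "(snd p, fst p) + (x, 0) \<in> G" using that zero by (force simp: f_def)
   from grad_lap_swap[OF grad_lap_shift[OF helm_grad_lap[OF hu this]]] show ?thesis
    unfolding f_def by (intro subsolI) auto
  qed
 qed (use a M in "auto simp: f_def")
 then show "u (x, a) <= 16 * M * a" by (simp add: f_def)
 define g where "g = (%q. u ((x, 1) - (snd q, fst q)))"
 have "g (a, 0) <= 4 * M * a / (1 / 4)"
 proof (rule half_square_bound[OF _ k_nonneg k16 M(1)])
  show "continuous_on ({0..1 / 4} \<times> {- (1 / 4)..1 / 4}) g" unfolding g_def
   by (rule continuous_on_compose2[OF cu]) (auto intro!: continuous_intros)
  show "g (0, b) <= 0" for b using zero[of "(x - b, 1)"] strip(2)[of "(x - b, 1)"] by (cases "(x - b, 1) \<in> G") (auto simp: g_def)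
  show "subsol k g p" if "0 < g p" for p
  proof -
   have "(x, 1) - (snd p, fst p) \<in> G" using that zero by (force simp: g_def)
   from grad_lap_swap[OF grad_lap_reflect[OF helm_grad_lap[OF hu this]]] show ?thesis
    unfolding g_def by (intro subsolI) auto
  qed
 qed (use a M in "auto simp: g_def")
 then show "u (x, 1 - a) <= 16 * M * a" by (simp add: g_def)
qed

lemma near_wall:
 assumes M: "0 <= M" "!!p. \<bar>fst p - x\<bar> <= 1 / 4 ==> u p <= M" and y: "0 <= y" "y <= 1"
 shows "u (x, y) <= 16 * M * min y (1 - y)"
proof -
 consider "y <= 1 / 4" | "3 / 4 <= y" | "1 / 4 <= min y (1 - y)" by linarith
 then show ?thesis
 proof cases
  case 1 then show ?thesis using near_wall_aux(1)[OF M y(1)] by (simp add: min_def)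
 next
  case 2 then show ?thesis using near_wall_aux(2)[OF M(1) M(2), where a = "1 - y"] y by (simp add: min_def)
 next
  case 3
  then have "16 * M * (1 / 4) <= 16 * M * min y (1 - y)" using M by (intro mult_left_mono) auto
  then show ?thesis using M(2)[of "(x, y)"] M(1) by simp
 qed
qed

end

section \<open>Persistence of levels and width of slices\<close>

context long_ground
begin

text \<open>Otherwise \<open>u\<close> is at most \<open>\<tau> / 64\<close> everywhere beyond
  \<open>x + s\<close>: a segment from \<open>(x, y)\<close> to a larger value would cross that
  slice at level \<open>\<tau> / 64\<close>, by log-concavity. A barrier that starts from this small
  value and rises by at most \<open>\<tau> / 2\<close> on the way back to \<open>x\<close> then
  contradicts \<open>u (x, y) >= \<tau>\<close>.\<close>

lemma level_persist_right:
 assumes \<tau>: "0 < \<tau>" "\<tau> <= 1" "320 <= \<tau> * L" and u: "\<tau> <= u (x, y)" and s: "0 <= s" "s <= \<tau> * L / 320"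
 shows "\<exists>y'. \<tau> / 64 <= u (x + s, y')"
proof (rule ccontr)
 define de where "de = \<tau> / 64"
 have de: "0 < de" "de <= 1 / 64" using \<tau> by (auto simp: de_def)
 assume "\<nexists>y'. \<tau> / 64 <= u (x + s, y')"
 then have no: "u (x + s, y') < de" for y' by (simp add: de_def not_le)
 have s0: "0 < s" using no[of y] u \<tau> s by (cases "s = 0") (auto simp: de_def)
 have low: "u p <= de" if p: "x + s <= fst p" for p
 proof (rule ccontr)
  assume "\<not> u p <= de"
  then have up: "de <= u p" by simp
  have "de <= \<tau>" using \<tau> by (simp add: de_def)
  then have ux: "de <= u (x, y)" using u by simp
  have px: "0 < fst p - x" using p s0 by simp
  define t where "t = s / (fst p - x)"
  have t: "0 <= t" "t <= 1" using px p s by (auto simp: t_def)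
  have "de <= u ((x, y) + t *\<^sub>R (p - (x, y)))" by (rule superlevel_segment[OF de(1) ux up t])
  moreover have "(x, y) + t *\<^sub>R (p - (x, y)) = (x + s, y + t * (snd p - y))" using px by (simp add: t_def prod_eq_iff)
  ultimately show False using no by (metis not_le)
 qed
 define xr where "xr = x + s + 1"
 define l where "l = L / 20"
 have l: "0 < l" using L by (simp add: l_def)
 \<comment> \<open>At \<open>xr\<close> the value \<open>11 * de\<close> suffices against
   \<open>16 * de * min y (1 - y)\<close>, as sin (pi y) >= 3/2 min y (1 - y); at
   \<open>xr - l\<close> the value is at least 3, which suffices against \<open>u_le_wall\<close>.
   The curvature -2 / l^2 = -800 / L^2 pays for \<open>(k - pi^2) * g\<close>, at most 320 /
   L^2.\<close>
 define g where "g = (%X. 11 * de + 4 * ((xr - X) / l) - ((xr - X) / l)^2)"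
 define f where "f = (%p::real\<times>real. g (fst p) * sin (pi * (snd p - 0)))"
 define c where "c = pi * (1 - 1 / L^2)"
 define \<nu> where "\<nu> = pi / (3 * l)"
 \<comment> \<open>The factor \<open>1 - 1 / L^2\<close> in \<open>c\<close> keeps \<open>S\<close>
   positive up to the walls and costs at most 20 / L^2; \<open>\<nu>^2\<close> is at least 400 /
   L^2, which covers this and the excess 100 / L^2 of \<open>k\<close>.\<close>
 define S where "S = (%p::real\<times>real. cos (\<nu> * (fst p - xr)) * cos (c * (snd p - 1 / 2)))"
 define K where "K = {xr - l..xr} \<times> {0..1::real}"
 define U where "U = G \<inter> ({xr - l<..<xr} \<times> UNIV)"
 have g: "0 <= g X & g X <= 32 / 10" if X: "xr - l <= X" "X <= xr" for X
 proof -
  define t where "t = (xr - X) / l"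
  have t: "0 <= t" "t <= 1" using X l by (auto simp: t_def field_simps)
  have "t^2 <= t" "0 <= (1 - t)^2" using t by (auto simp: power2_eq_square mult_left_le)
  then have "0 <= 4 * t - t^2" "4 * t - t^2 <= 2 * t + 1" using t by (simp_all add: power2_eq_square algebra_simps)
  then show ?thesis using t de unfolding g_def t_def[symmetric] by simp
 qed
 have sin_low: "3 / 2 * min y (1 - y) <= sin (pi * (y - 0))" if "0 <= y" "y <= 1" for y
 proof -
  have "min (pi * y) (pi - pi * y) <= 2 * sin (pi * y)" using that by (intro min_le_2_sin) (auto simp: mult_left_le)
  moreover have "3 * y <= pi * y" "3 * (1 - y) <= pi * (1 - y)" using that pi_gt3 by (intro mult_right_mono; simp)+
  ultimately show ?thesis by (simp add: algebra_simps min_def split: if_splits)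
 qed
 have L2: "1000^2 <= L^2" using L by (intro power_mono) auto
 have main: "u (x, y) <= f (x, y)" if y: "0 <= y" "y <= 1"
 proof (rule barrier_le[where K = K and U = U and S = S and k = k])
  show "compact K" unfolding K_def by (intro compact_Times) auto
  show "open U" unfolding U_def by (intro open_Int oG open_Times) auto
  show UK: "U \<subseteq> K" using strip by (force simp: U_def K_def)
  show "continuous_on K u" by (rule cuS)
  show "continuous_on K f" unfolding f_def g_def using l by (intro continuous_intros) auto
  show "continuous_on K S" unfolding S_def by (intro continuous_intros)
  show f0: "0 <= f p" if "p \<in> K" for p
   using that g[of "fst p"] unfolding f_def K_def by (intro mult_nonneg_nonneg sin_ge_zero) (auto simp: mult_left_le)
  have c: "0 < c" "c < pi" using L2 L by (auto simp: c_def)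
  show Spos: "0 < S p" if p: "p \<in> K" for p
  proof -
   have "\<nu> * l = pi / 3" using l by (simp add: \<nu>_def)
   moreover have "0 < \<nu>" using l by (simp add: \<nu>_def)
   then have "\<nu> * (xr - fst p) <= \<nu> * l" "0 <= \<nu> * (xr - fst p)"
    using p by (intro mult_left_mono mult_nonneg_nonneg; auto simp: K_def)+
   moreover have "\<bar>c * (snd p - 1 / 2)\<bar> <= c * (1 / 2)"
   proof -
    have "\<bar>snd p - 1 / 2\<bar> <= 1 / 2" using p unfolding K_def mem_Times_iff atLeastAtMost_iff by linarith
    then show ?thesis unfolding abs_mult using c by (intro mult_mono) auto
   qed
   moreover have "\<nu> * (xr - fst p) = - (\<nu> * (fst p - xr))" by (simp add: algebra_simps)
   ultimately have "- (pi / 2) < \<nu> * (fst p - xr)" "\<nu> * (fst p - xr) < pi / 2"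
    "- (pi / 2) < c * (snd p - 1 / 2)" "c * (snd p - 1 / 2) < pi / 2" using c pi_gt_zero by linarith+
   then show ?thesis unfolding S_def by (intro mult_pos_pos cos_gt_zero_pi)
  qed
  have "x + 1 + s <= x + l"
  proof -
   have "\<tau> * L / 320 <= 1 * L / 320" using \<tau> L by (intro divide_right_mono mult_right_mono) auto
   then show ?thesis using s L unfolding l_def by linarith
  qed
  then show "(x, y) \<in> K" using s y by (auto simp: K_def xr_def)
  show "u p <= f p" if p: "p \<in> K - U" for p
  proof (cases "p \<in> G")
   case False then show ?thesis using zero f0[of p] p by auto
  next
   case True
   obtain a b where ab: "p = (a, b)" by (cases p)
   have b: "0 <= b" "b <= 1" using p by (auto simp: ab K_def)
   note sb = sin_low[OF b]
   have m: "0 <= min b (1 - b)" using b by simp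
   have "a = xr \<or> a = xr - l" using p True by (auto simp: K_def U_def ab)
   then show ?thesis
   proof
    assume a: "a = xr"
    have "u (a, b) <= 16 * de * min b (1 - b)"
    proof (rule near_wall)
     fix q :: "real * real" assume "\<bar>fst q - a\<bar> <= 1 / 4"
     then have "x + s <= fst q" unfolding a xr_def by linarith
     then show "u q <= de" by (rule low)
    qed (use de b in auto)
    also have "... <= 11 * de * (3 / 2 * min b (1 - b))" using de m by simp
    also have "... <= 11 * de * sin (pi * (b - 0))" using sb de by (intro mult_left_mono) auto
    finally show ?thesis by (simp add: ab f_def g_def a)
   next
    assume a: "a = xr - l"
    have "u (a, b) <= 33 / 10 * min b (1 - b)" by (rule u_le_wall[OF b])
    also have "... <= 3 * (3 / 2 * min b (1 - b))" using m by simp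
    also have "... <= g a * sin (pi * (b - 0))" using sb de m l unfolding g_def a by (intro mult_mono) auto
    finally show ?thesis by (simp add: ab f_def)
   qed
  qed
  fix p assume p: "p \<in> U"
  have pG: "p \<in> G" and pK: "p \<in> K" using p UK by (auto simp: U_def)
  show "subsol k u p" using helm_grad_lap[OF hu pG] by (rule subsolI) simp
  have kk: "k - pi^2 <= 100 / L^2" using kup by simp
  have dg: "sd2 g (fst p) (- 4 / l + 2 * ((xr - fst p) / l) / l) (- 2 / l^2)"
   unfolding g_def by (rule sd2I[where g' = "%X. - 4 / l + 2 * ((xr - X) / l) / l"])
    (use l in "auto intro!: derivative_eq_intros simp: power2_eq_square field_simps")
  have sp: "0 <= sin (pi * (snd p - 0))" using pK by (intro sin_ge_zero) (auto simp: K_def mult_left_le)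
  show "supersol k f p"
  proof (rule supersolI)
   show "grad_lap f p ((- 4 / l + 2 * ((xr - fst p) / l) / l) * sin (pi * (snd p - 0)))
     (g (fst p) * (pi * cos (pi * (snd p - 0))))
     ((- 2 / l^2) * sin (pi * (snd p - 0)) + g (fst p) * (- pi\<^sup>2 * sin (pi * (snd p - 0))))"
    unfolding f_def by (rule grad_lap_prod[OF dg sd2_sin_affine])
   have "(k - pi^2) * g (fst p) <= 100 / L^2 * (32 / 10)" using kk g[of "fst p"] pK k_low by (intro mult_mono) (auto simp: K_def)
   also have "... <= 2 / l^2" using L by (simp add: l_def power_divide divide_right_mono)
   finally have "((k - pi^2) * g (fst p)) * sin (pi * (snd p - 0)) <= 2 / l^2 * sin (pi * (snd p - 0))" using sp by (rule mult_right_mono)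
   then show "(- 2 / l^2) * sin (pi * (snd p - 0)) + g (fst p) * (- pi\<^sup>2 * sin (pi * (snd p - 0))) <= - k * f p"
    by (simp add: f_def algebra_simps)
  qed
  show "strict_supersol k S p"
  proof (rule strict_supersolI)
   show "grad_lap S p (- \<nu> * sin (\<nu> * (fst p - xr)) * cos (c * (snd p - 1 / 2)))
    (cos (\<nu> * (fst p - xr)) * (- c * sin (c * (snd p - 1 / 2))))
    (- \<nu>\<^sup>2 * cos (\<nu> * (fst p - xr)) * cos (c * (snd p - 1 / 2)) + cos (\<nu> * (fst p - xr)) * (- c\<^sup>2 * cos (c * (snd p - 1 / 2))))"
    unfolding S_def by (rule grad_lap_prod[OF sd2_cos_affine sd2_cos_affine])
   have "k < \<nu>^2 + c^2"
   proof -
    have "pi^2 - c^2 = pi^2 * (2 / L^2) - pi^2 * (1 / L^2)^2" by (simp add: c_def power_mult_distrib power2_eq_square algebra_simps)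
    also have "... <= pi^2 * (2 / L^2)" by simp
    also have "pi^2 * (2 / L^2) <= 10 * (2 / L^2)" using order_trans[OF k_low k_le(1)] by (intro mult_right_mono) auto
    finally have 1: "pi^2 - c^2 <= 20 / L^2" by simp
    have "3^2 <= pi^2" using pi_gt3 by (intro power_mono) auto
    then have "9 * (400 / 9) / L^2 <= pi^2 * (400 / 9) / L^2" by (intro divide_right_mono mult_right_mono) auto
    then have 2: "400 / L^2 <= \<nu>^2" by (simp add: \<nu>_def l_def power_divide power_mult_distrib)
    have "100 / L^2 + 20 / L^2 < 400 / L^2" using L by (simp add: field_simps)
    then show ?thesis using 1 2 kk by linarith
   qed
   from mult_strict_right_mono[OF this Spos[OF pK]]
   show "- \<nu>\<^sup>2 * cos (\<nu> * (fst p - xr)) * cos (c * (snd p - 1 / 2)) + cos (\<nu> * (fst p - xr)) * (- c\<^sup>2 * cos (c * (snd p - 1 / 2))) < - k * S p"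
    by (simp add: S_def algebra_simps)
  qed
 qed
 have yr: "0 <= y" "y <= 1" using u \<tau> zero[of "(x, y)"] strip[of "(x, y)"] by (cases "(x, y) \<in> G"; force)+
 have "f (x, y) <= g x * 1" unfolding f_def fst_conv snd_conv
 proof (rule mult_left_mono)
  have "\<tau> * L <= 1 * L" using \<tau> L by (intro mult_right_mono) auto
  then have "s + 1 <= l" using s L unfolding l_def by linarith
  then show "0 <= g x" using g[of x] s by (simp add: xr_def)
 qed simp
 also have "g x * 1 <= 11 * de + 4 * ((s + 1) / l)" by (simp add: g_def xr_def)
 also have "4 * ((s + 1) / l) <= \<tau> / 2"
 proof -
  have "s + 1 <= \<tau> * L / 160" using s \<tau>(3) by simp
  then show ?thesis using L by (simp add: l_def field_simps)
 qed
 also have "11 * de + \<tau> / 2 < \<tau>" using \<tau> by (simp add: de_def)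
 finally show False using main[OF yr] u by linarith
qed

lemma level_persist:
 assumes \<tau>: "0 < \<tau>" "\<tau> <= 1" "320 <= \<tau> * L" and u: "\<tau> <= u (x, y)" and s: "\<bar>s\<bar> <= \<tau> * L / 320"
 shows "\<exists>y'. \<tau> / 64 <= u (x + s, y')"
proof (cases "0 <= s")
 case True then show ?thesis using level_persist_right[OF \<tau> u] s by simp
next
 case False
 define A where "A = (%q::real\<times>real. (-1 * fst q, 1 * snd q + (1 - 1) / 2))"
 interpret m: long_ground "A -` G" k "%q. u (A q)" "A pm" "-1 * x0" L
  by (rule long_ground_mirror(1)[OF long_ground_axioms _ _ A_def]) auto
 show ?thesis using m.level_persist_right[OF \<tau>, of "- x" y "- s"] u s False by (simp add: A_def add.commute)
qed

text \<open>If the slice at \<open>x1\<close> had lost height \<open>d\<close>, then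
  \<open>decay\<close> at rate \<open>\<mu>\<close> over the length \<open>\<tau> * L / 800\<close>
  would have exponent 175 / \<tau>. As exp z > z, this makes \<open>u (x2, y)\<close> less than 2 *
  \<tau> / 175, below \<open>\<tau> / 64\<close>. The constant in \<open>d\<close> is what makes
  pi^2 / (1 - d)^2 exceed k + \<mu>^2.\<close>

lemma wide_slice_right:
 assumes \<tau>: "0 < \<tau>" "\<tau> <= 1" and x1: "x0 < x1" and x2: "x1 + \<tau> * L / 800 <= x2" and u: "\<tau> / 64 <= u (x2, y)"
  and d: "d = 2 * 10 ^ 9 / (\<tau> ^ 4 * L^2)" "d <= 1 / 64" and z: "d <= z" "z <= 1 - d"
 shows "(x1, z) \<in> G"
proof -
 have d0: "0 < d" using \<tau> L by (simp add: d)
 have "\<exists>y y'. (x1, y) \<in> G & (x1, y') \<in> G & 1 - d < y' - y"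
 proof (rule ccontr)
  assume "\<not> ?thesis"
  then have H: "y' - y <= 1 - d" if "(x1, y) \<in> G" "(x1, y') \<in> G" for y y' using that by force
  define \<mu> where "\<mu> = 140000 / (\<tau>^2 * L)"
  have dec: "u (x2, y) <= 2 * exp (- \<mu> * (x2 - x1))"
  proof (rule decay[OF x1 _ H])
   show "0 <= \<mu>" "0 < 1 - d" using L d by (auto simp: \<mu>_def)
   have "(1 + 2 * d) * (1 - d)^2 <= 1"
   proof -
    have "1 - (1 + 2 * d) * (1 - d)^2 = d^2 * (3 - 2 * d)" by (simp add: power2_eq_square algebra_simps)
    moreover have "0 <= d^2 * (3 - 2 * d)" using d by simp
    ultimately show ?thesis by linarith
   qed
   then have "1 + 2 * d <= 1 / (1 - d)^2" using d(2) by (simp add: pos_le_divide_eq)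
   then have "pi^2 * (1 + 2 * d) <= pi^2 * (1 / (1 - d)^2)" by (intro mult_left_mono) auto
   moreover have "9 * (2 * d) <= pi^2 * (2 * d)" using d0 pi_gt3 power_mono[of 3 pi 2] by (intro mult_right_mono) auto
   moreover have "100 / L^2 + \<mu>^2 < 18 * d"
   proof -
    have "\<tau> ^ 4 <= 1 ^ 4" using \<tau> by (intro power_mono) auto
    then have "100 * \<tau> ^ 4 + 140000^2 < 18 * (2 * 10 ^ 9)" by simp
    then have "(100 * \<tau> ^ 4 + 140000^2) / (\<tau> ^ 4 * L^2) < 18 * (2 * 10 ^ 9) / (\<tau> ^ 4 * L^2)" using \<tau> L by (intro divide_strict_right_mono) auto
    moreover have "(100 * \<tau> ^ 4 + 140000^2) / (\<tau> ^ 4 * L^2) = 100 / L^2 + \<mu>^2"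
     using \<tau> by (simp add: \<mu>_def add_divide_distrib power_divide power_mult_distrib flip: power_mult)
    moreover have "18 * (2 * 10 ^ 9) / (\<tau> ^ 4 * L^2) = 18 * d" unfolding d(1) by simp
    ultimately show ?thesis by linarith
   qed
   moreover have "pi^2 * (1 + 2 * d) = pi^2 + pi^2 * (2 * d)" by (simp add: distrib_left)
   ultimately have "k + \<mu>^2 < pi^2 * (1 / (1 - d)^2)" using kup by linarith
   then show "k + \<mu>^2 < (pi / (1 - d))^2" by (simp add: power_divide)
   have "0 <= \<tau> * L" using \<tau> L by simp
   then show "x1 <= x2" using x2 by linarith
  qed
  have "175 / \<tau> <= \<mu> * (x2 - x1)"
  proof -
   have "\<mu> * (\<tau> * L / 800) <= \<mu> * (x2 - x1)" using x2 L by (intro mult_left_mono) (auto simp: \<mu>_def)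
   moreover have "\<mu> * (\<tau> * L / 800) = 175 / \<tau>" using \<tau> L by (simp add: \<mu>_def power2_eq_square)
   ultimately show ?thesis by linarith
  qed
  then have "175 / \<tau> < exp (\<mu> * (x2 - x1))" using exp_ge_add_one_self[of "\<mu> * (x2 - x1)"] by linarith
  then have "inverse (exp (\<mu> * (x2 - x1))) < inverse (175 / \<tau>)" using \<tau> by (intro less_imp_inverse_less) auto
  then have "exp (- \<mu> * (x2 - x1)) < \<tau> / 175" by (simp add: exp_minus[symmetric])
  then show False using dec u \<tau> by linarith
 qed
 then obtain y y' where y: "(x1, y) \<in> G" "(x1, y') \<in> G" "1 - d < y' - y" by blast
 have r: "y < z" "z < y'" using y strip(1)[OF y(1)] strip(2)[OF y(2)] z by auto
 have "(x1, y) + ((z - y) / (y' - y)) *\<^sub>R ((x1, y') - (x1, y)) \<in> G"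
  using line_in_G[of "(x1, y)" 1 "(x1, y') - (x1, y)" "(z - y) / (y' - y)"] y r by simp
 then show ?thesis using r by simp
qed

text \<open>The \<open>d\<close> of \<open>wide_slice_right\<close>: the thickness of the layer
  along each wall that a slice may miss.\<close>

definition margin :: "real => real" where "margin \<tau> = 2 * 10 ^ 9 / (\<tau> ^ 4 * L^2)"

lemma margin:
 assumes "0 < \<tau>" "\<tau> <= 1" "1000000 <= \<tau> ^ 3 * L"
 shows "0 < margin \<tau>" "margin \<tau> <= \<tau> / 500" "1000000 <= \<tau> * L"
proof -
 show "0 < margin \<tau>" using assms L by (simp add: margin_def)
 have "1000000^2 <= (\<tau> ^ 3 * L)^2" using assms by (intro power_mono) auto
 also have "(\<tau> ^ 3 * L)^2 = \<tau> ^ 6 * L^2" by (simp add: power_mult_distrib flip: power_mult)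
 also have "... <= \<tau> ^ 5 * L^2" using assms by (intro mult_right_mono power_decreasing) auto
 also have "... = \<tau> * (\<tau> ^ 4 * L^2)" by (simp add: eval_nat_numeral)
 finally have "1000000^2 <= \<tau> * (\<tau> ^ 4 * L^2)" .
 then show "margin \<tau> <= \<tau> / 500" using assms L by (simp add: margin_def field_simps)
 have "\<tau> ^ 3 * L <= \<tau> ^ 1 * L" using assms L by (intro mult_right_mono power_decreasing) auto
 then show "1000000 <= \<tau> * L" using assms(3) by simp
qed

text \<open>Slices right of \<open>x0\<close> are tested against a level further right, those left
  of it by reflection. The slice at \<open>x0\<close> belongs to neither side and follows by
  convexity from its neighbours at distance 1, which is why \<open>main\<close> allows an extra 1 in
  the range of \<open>s\<close>.\<close>

lemma tube_box:
 assumes \<tau>: "0 < \<tau>" "\<tau> <= 1" "1000000 <= \<tau> ^ 3 * L" and u: "\<tau> <= u (x, y)" and s: "\<bar>s\<bar> <= \<tau> * L / 640"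
  and z: "margin \<tau> <= z" "z <= 1 - margin \<tau>"
 shows "(x + s, z) \<in> G"
proof -
 note m = margin[OF \<tau>]
 have \<tau>L: "320 <= \<tau> * L" using m by simp
 have main: "(x + s, z) \<in> G" if s: "\<bar>s\<bar> <= \<tau> * L / 640 + 1" "x + s ~= x0" for s
 proof (cases "x0 < x + s")
  case True
  define s2 where "s2 = s + \<tau> * L / 800"
  have "\<bar>s2\<bar> <= \<tau> * L / 320" using s m(3) unfolding s2_def by linarith
  then obtain y' where "\<tau> / 64 <= u (x + s2, y')" using level_persist[OF \<tau>(1,2) \<tau>L u] by blast
  from wide_slice_right[OF \<tau>(1,2) True _ this margin_def] show ?thesis using m z \<tau> by (simp add: s2_def)
 next
  case False
  define s2 where "s2 = s - \<tau> * L / 800"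
  have "\<bar>s2\<bar> <= \<tau> * L / 320" using s m(3) unfolding s2_def by linarith
  then obtain y' where y': "\<tau> / 64 <= u (x + s2, y')" using level_persist[OF \<tau>(1,2) \<tau>L u] by blast
  define A where "A = (%q::real\<times>real. (-1 * fst q, 1 * snd q + (1 - 1) / 2))"
  interpret m: long_ground "A -` G" k "%q. u (A q)" "A pm" "-1 * x0" L
   by (rule long_ground_mirror(1)[OF long_ground_axioms _ _ A_def]) auto
  have "(- (x + s), z) \<in> A -` G"
  proof (rule m.wide_slice_right[OF \<tau>(1,2) _ _ _ margin_def])
   show "- (x + s) + \<tau> * L / 800 <= - (x + s2)" by (simp add: s2_def)
   show "\<tau> / 64 <= u (A (- (x + s2), y'))" using y' by (simp add: A_def add.commute)
  qed (use False s m z \<tau> in auto)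
  then show ?thesis by (simp add: A_def add.commute)
 qed
 show ?thesis
 proof (cases "x + s = x0")
  case False then show ?thesis using main[of s] s by simp
 next
  case True
  have "(x + (s - 1), z) \<in> G" "(x + (s + 1), z) \<in> G" using s True by (intro main; linarith)+
  from line_in_G[of "(x + (s - 1), z)" 2 "(1, 0)" 1] this show ?thesis by (simp add: algebra_simps)
 qed
qed

text \<open>A point with \<open>u >= \<tau>\<close> has wall distance at least
  \<open>\<tau> / 4\<close> by \<open>u_le_wall\<close>, so \<open>helm_mid\<close> costs only a
  second factor \<open>\<tau>\<close>; \<open>sharm_slice_lower\<close> then distributes the middle
  value over the slice.\<close>

lemma tube_lower:
 assumes \<tau>: "0 < \<tau>" "\<tau> <= 1" "1000000 <= \<tau> ^ 3 * L" and u: "\<tau> <= u (x, y1)" and y: "margin \<tau> <= y" "y <= 1 - margin \<tau>"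
 shows "\<tau>^2 / 2 ^ 42 * min (y - margin \<tau>) (1 - margin \<tau> - y) <= u (x, y)"
proof -
 note m = margin[OF \<tau>]
 have S: "strip_box x (margin \<tau>) \<subseteq> G"
 proof
  fix p assume p: "p \<in> strip_box x (margin \<tau>)"
  obtain a b where ab: "p = (a, b)" by (cases p)
  have "(x + (a - x), b) \<in> G" by (rule tube_box[OF \<tau> u]) (use p m in "auto simp: ab mem_strip_box")
  then show "p \<in> G" by (simp add: ab)
 qed
 have inG: "(x, y1) \<in> G" using u \<tau> zero by force
 define b where "b = margin \<tau>"
 have y1: "\<tau> / 4 <= min y1 (1 - y1)"
 proof -
  define M where "M = min y1 (1 - y1)"
  have "\<tau> <= 33 / 10 * M" using u_le_wall[of y1 x] strip[OF inG] u by (simp add: M_def)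
  then show ?thesis unfolding M_def[symmetric] using \<tau> by simp
 qed
 have b: "0 < b" "b <= \<tau> / 8" "b <= 1 / 64" using m \<tau> by (auto simp: b_def)
 define t where "t = min (y1 - b) (1 - b - y1)"
 have t: "\<tau> / 8 <= t" using y1 b by (auto simp: t_def min_def)
 have mid: "\<tau>^2 / 2 ^ 31 <= u p" if p: "p \<in> cball (x, 1 / 2) (1 / 16)" for p
 proof -
  have "\<tau> * (\<tau> / 8) / 2 ^ 28 <= u (x, y1) * t / 2 ^ 28" using u t \<tau> by (intro divide_right_mono mult_mono) auto
  also have "... <= u p" unfolding t_def
   by (rule helm_mid(2)[OF hu k_nonneg _ S[folded b_def] _ _ u_nonneg _ _ p]) (use k_le b t \<tau> in "auto simp: t_def")
  finally show ?thesis by (simp add: power2_eq_square)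
 qed
 have sh: "sharm x b u"
  by (rule helm_mid(1)[OF hu k_nonneg _ S[folded b_def] _ _ u_nonneg, of "1/2" "(x, 1/2)"]) (use k_le b in auto)
 have "\<tau>^2 / 2 ^ 31 / 2048 * min (y - b) (1 - b - y) <= u (x, y)"
  by (rule sharm_slice_lower[OF sh _ mid]) (use y in "auto simp: b_def")
 then show ?thesis by (simp add: b_def)
qed

end

section \<open>Derivative bounds in a long tube\<close>

text \<open>In a tube of half-length \<open>l\<close>, these control \<open>px u\<close> relative to
  \<open>u / l\<close>, the function \<open>W\<close> times the wall distance relative to
  \<open>1 / l^2\<close>, and interior derivatives. They depend on \<open>\<kappa>\<close> and
  \<open>\<eta>\<close> alone and can be fixed before the domain is given.\<close>

definition c1 :: "real => real" where "c1 \<kappa> = 14 / \<kappa>"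
definition c3 :: "real => real => real" where "c3 \<kappa> \<eta> = 2 ^ 43 * (4 * c1 \<kappa> / \<eta> + (c1 \<kappa>)^2)"
definition c4 :: "real => real => real" where "c4 \<kappa> \<eta> = 32 * c3 \<kappa> \<eta> + (c1 \<kappa>)^2 + c1 \<kappa> ^ 3"

lemma c_pos:
 assumes "0 < \<kappa>" "0 < \<eta>"
 shows "0 < c1 \<kappa>" "0 < c3 \<kappa> \<eta>" "0 < c4 \<kappa> \<eta>"
proof -
 show 1: "0 < c1 \<kappa>" using assms by (simp add: c1_def)
 show 3: "0 < c3 \<kappa> \<eta>" using 1 assms by (simp add: c3_def add_pos_pos)
 show "0 < c4 \<kappa> \<eta>" using 1 3 by (simp add: c4_def add_pos_pos)
qed

text \<open>A tube of half-length \<open>l\<close> around the maximum where \<open>u\<close> is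
  comparable with the wall distance, up to layers of thickness \<open>b\<close>. The last bound on
  \<open>\<eta>\<close> lets the frequency of the strip narrowed by \<open>2 * b\<close> at each
  wall exceed pi^2 by at most \<open>1 / (\<eta> * l)^2\<close>.\<close>

locale tube = long_ground +
 fixes l b \<kappa> \<eta> :: real
 assumes l: "1000 <= l" "k <= pi^2 + 1 / l^2" and b: "0 < b" "b <= 1 / 1000" and \<kappa>: "0 < \<kappa>" "\<kappa> <= 1"
  and \<eta>: "0 < \<eta>" "\<eta> <= 1 / 8" "100 * b * (\<eta> * l)^2 <= 1"
  and tube: "\<bar>x - fst pm\<bar> <= l ==> b <= y ==> y <= 1 - b ==> (x, y) \<in> G & \<kappa> * min (y - b) (1 - b - y) <= u (x, y)"
begin

lemma dirD_x: "dirD (1, 0) w = px w"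
 by (simp add: dirD_def fun_eq_iff)

lemma tube_G: "\<bar>x - fst pm\<bar> <= l ==> b <= y ==> y <= 1 - b ==> (x, y) \<in> G"
 using tube by blast

lemma u_le_tube: "\<bar>x - fst pm\<bar> <= l ==> 2 * b <= y ==> y <= 1 - 2 * b ==> \<kappa> / 2 * min y (1 - y) <= u (x, y)"
proof -
 assume *: "\<bar>x - fst pm\<bar> <= l" "2 * b <= y" "y <= 1 - 2 * b"
 have "\<kappa> * (1 / 2 * min y (1 - y)) <= \<kappa> * min (y - b) (1 - b - y)" using * b \<kappa> by (intro mult_left_mono) auto
 then show ?thesis using tube[of x y] * b by simp
qed

abbreviation C1 :: real where "C1 \<equiv> c1 \<kappa>"

lemma C1: "14 <= C1" "0 < C1" using \<kappa> by (auto simp: c1_def field_simps)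

text \<open>At a fixed height, \<open>u\<close> lies between \<open>\<kappa> / 2\<close> and 33/10
  times the wall distance throughout the tube, so \<open>ln u\<close> rises by at most
  \<open>7 / \<kappa>\<close> over a length \<open>l / 2\<close>. For a concave function this bounds
  the slope on both sides by \<open>14 / (\<kappa> * l)\<close>.\<close>

lemma ux_bound:
 assumes x: "\<bar>x - fst pm\<bar> <= l / 2" and y: "2 * b <= y" "y <= 1 - 2 * b"
 shows "\<bar>px u (x, y)\<bar> <= C1 * u (x, y) / l" "\<bar>px u (x, y)\<bar> <= C1 / l"
proof -
 define M where "M = min y (1 - y)"
 have M: "0 < M" using y b by (auto simp: M_def)
 have G: "(x', y) \<in> G" if "\<bar>x' - fst pm\<bar> <= l" for x' using tube_G[OF that] y b by simp
 have lnq: "ln (u (x, y)) - ln (u (x', y)) <= 7 / \<kappa>" if x': "\<bar>x' - fst pm\<bar> <= l" for x'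
 proof -
  have up: "0 < u (x, y)" "0 < u (x', y)" using pos G x' x l by auto
  have low: "\<kappa> / 2 * M <= u (x', y)" using u_le_tube[OF x' y] by (simp add: M_def)
  have "u (x, y) <= 33 / 10 * M" using u_le_wall[of y x] y b by (simp add: M_def)
  also have "... <= 7 / \<kappa> * (\<kappa> / 2 * M)" using \<kappa> M by simp
  also have "... <= 7 / \<kappa> * u (x', y)" using low \<kappa> by (intro mult_left_mono) auto
  finally have q: "u (x, y) / u (x', y) <= 7 / \<kappa>" using up by (simp add: pos_divide_le_eq)
  have "ln (u (x, y)) - ln (u (x', y)) = ln (u (x, y) / u (x', y))" using up by (simp add: ln_div)
  also have "... <= u (x, y) / u (x', y) - 1" using up by (intro ln_le_minus_one) simp
  finally show ?thesis using q by linarith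
 qed
 define v where "v = px u (x, y) / u (x, y)"
 have Gx: "(x, y) \<in> G" using G x l by simp
 have xl: "\<bar>x + l / 2 - fst pm\<bar> <= l" "\<bar>x - l / 2 - fst pm\<bar> <= l" using x by linarith+
 have Gr: "(x, y) + (l / 2) *\<^sub>R (1, 0) \<in> G" using G[OF xl(1)] by simp
 have Gl: "(x - l / 2, y) \<in> G" using G[OF xl(2)] .
 have e: "(x - l / 2, y) + (l / 2) *\<^sub>R (1, 0) = (x, y)" by simp
 have 1: "ln (u (x + l / 2, y)) - ln (u (x, y)) <= l / 2 * v"
  using ln_slope(1)[OF Gx Gr] l by (simp add: dirD_x v_def)
 have 2: "l / 2 * v <= ln (u (x, y)) - ln (u (x - l / 2, y))"
  using ln_slope(2)[OF Gl, of "l / 2" "(1, 0)"] Gx l unfolding e by (simp add: dirD_x v_def)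
 have "\<bar>l / 2 * v\<bar> <= 7 / \<kappa>" using 1 2 lnq[OF xl(1)] lnq[OF xl(2)] by (simp only: abs_le_iff) linarith
 then have "\<bar>v\<bar> <= 7 / \<kappa> / (l / 2)" using l by (subst pos_le_divide_eq) (auto simp: abs_mult mult.commute)
 also have "... = C1 / l" by (simp add: c1_def)
 finally have "\<bar>v\<bar> <= C1 / l" .
 moreover have up: "0 < u (x, y)" using pos[OF Gx] .
 ultimately show 3: "\<bar>px u (x, y)\<bar> <= C1 * u (x, y) / l" by (simp add: v_def abs_divide field_simps)
 have "C1 * u (x, y) / l <= C1 * 1 / l" using le1[of "(x, y)"] C1 l by (intro divide_right_mono mult_left_mono) auto
 with 3 show "\<bar>px u (x, y)\<bar> <= C1 / l" by simp
qed

text \<open>The second derivative in \<open>x\<close> has no sign, but log-concavity and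
  \<open>ux_bound\<close> bound it above by \<open>C1^2 / l^2 * u\<close>. The corrected function is
  a nonnegative solution of the same equation, so Harnack and the barriers apply.\<close>

definition W :: "real * real => real" where
 "W = (%p. (-1) * px (px u) p + C1^2 / l^2 * u p)"

lemma helm_W: "helm G k W"
 unfolding W_def by (intro helm_lincomb helm_partial_x hu k_nonneg)

lemma W_nonneg:
 assumes x: "\<bar>x - fst pm\<bar> <= l / 2" and y: "2 * b <= y" "y <= 1 - 2 * b"
 shows "0 <= W (x, y)"
proof -
 have G: "(x, y) \<in> G" using tube_G[of x y] x y l b by simp
 then have up: "0 < u (x, y)" by (rule pos)
 have "(px u (x, y))^2 <= (C1 * u (x, y) / l)^2"
  using ux_bound(1)[OF assms] by (metis abs_ge_zero power2_abs power_mono)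
 then have "(px u (x, y))^2 / u (x, y) <= C1^2 / l^2 * u (x, y)"
  using up by (simp add: power_divide power_mult_distrib power2_eq_square field_simps)
 moreover have "px (px u) (x, y) <= (px u (x, y))^2 / u (x, y)"
  using Phi_nonneg[OF G, of "(1, 0)"] by (simp add: Phi_def dirD_x)
 ultimately show ?thesis by (simp add: W_def)
qed

abbreviation C3 :: real where "C3 \<equiv> c3 \<kappa> \<eta>"

lemmas C3 = c_pos(2)[OF \<kappa>(1) \<eta>(1)]

text \<open>A large value of \<open>W\<close> spreads along the tube over a length of order \<open>l\<close>, against the
 small total variation of \<open>px u\<close>.\<close>

lemma W_spread:
 assumes x1: "\<bar>x1 - fst pm\<bar> <= l / 4" and m: "0 <= m"
  and low: "!!y. 2 * b <= y ==> y <= 1 - 2 * b ==> 4 * m * min (y - 2 * b) (1 - 2 * b - y) <= W (x1, y)"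
  and x: "x1 <= x" "x <= x1 + \<eta> * l / 2"
 shows "m / 4 <= W (x, 1 / 2)"
proof -
 define R where "R = \<eta> * l"
 have "\<eta> * l <= 1 / 8 * l" using \<eta> l by (intro mult_right_mono) auto
 then have R: "0 < R" "R <= l / 8" using \<eta> l by (auto simp: R_def)
 define \<beta> where "\<beta> = pi / (1 - 4 * b)"
 \<comment> \<open>The second derivative \<open>2 * m / R^2\<close> outweighs
   \<open>(\<beta>^2 - k) * g\<close>, and \<open>g\<close> vanishes at the far end, where only the
   sign of \<open>W\<close> is known.\<close>
 define g where "g = (%X. m * (1 - (X - x1) / R)^2)"
 define B where "B = (%p::real\<times>real. g (fst p) * sin (\<beta> * (snd p - 2 * b)))"
 define S where "S = (%p::real\<times>real. cos (1 / R * (fst p - x1)) * sin (pi * (snd p - 0)))"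
 define K where "K = {x1..x1 + R} \<times> {2 * b..1 - 2 * b}"
 define U where "U = {x1<..<x1 + R} \<times> {2 * b<..<1 - 2 * b}"
 have inx: "\<bar>X - fst pm\<bar> <= l / 2" if "x1 <= X" "X <= x1 + R" for X using that R x1 by linarith
 have KG: "p \<in> G & 0 <= W p" if "p \<in> K" for p
  using that inx[of "fst p"] tube_G[of "fst p" "snd p"] W_nonneg[of "fst p" "snd p"] b l by (auto simp: K_def)
 have \<beta>: "0 < \<beta>" "\<beta> <= 4" "\<beta>^2 - pi^2 <= 1 / R^2"
 proof -
  show "0 < \<beta>" using b by (simp add: \<beta>_def)
  have "pi <= 3.15" using pi_approx by simp
  then show "\<beta> <= 4" using b by (simp add: \<beta>_def pos_divide_le_eq)
  have "(1 + 10 * b) * (1 - 4 * b)^2 - 1 = b * (2 - 64 * b + 160 * b^2)" by (simp add: power2_eq_square algebra_simps)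
  moreover have "0 <= b * (2 - 64 * b + 160 * b^2)" using b by (intro mult_nonneg_nonneg) auto
  ultimately have "1 <= (1 + 10 * b) * (1 - 4 * b)^2" by linarith
  then have "1 / (1 - 4 * b)^2 <= 1 + 10 * b" using b by (simp add: pos_divide_le_eq)
  then have "pi^2 * (1 / (1 - 4 * b)^2) <= pi^2 * (1 + 10 * b)" by (intro mult_left_mono) auto
  then have "\<beta>^2 - pi^2 <= pi^2 * (10 * b)" by (simp add: \<beta>_def power_divide distrib_left)
  also have "... <= 10 * (10 * b)" using order_trans[OF k_low k_le(1)] b by (intro mult_right_mono) auto
  also have "... <= 1 / R^2"
  proof -
   have "0 < R^2" "10 * (10 * b) * R^2 <= 1" using R(1) \<eta>(3) by (simp, simp add: R_def)
   then show ?thesis by (simp only: pos_le_divide_eq)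
  qed
  finally show "\<beta>^2 - pi^2 <= 1 / R^2" .
 qed
 have \<beta>y: "0 <= \<beta> * (y - 2 * b) & \<beta> * (y - 2 * b) <= pi & pi - \<beta> * (y - 2 * b) = \<beta> * (1 - 2 * b - y)" if "2 * b <= y" "y <= 1 - 2 * b" for y
 proof -
  have "\<beta> * (1 - 4 * b) = pi" using b by (simp add: \<beta>_def)
  then have "pi - \<beta> * (y - 2 * b) = \<beta> * (1 - 2 * b - y)" by (simp add: algebra_simps)
  moreover have "0 <= \<beta> * (y - 2 * b)" "0 <= \<beta> * (1 - 2 * b - y)" using that \<beta> by simp_all
  ultimately show ?thesis by linarith
 qed
 have main: "B p <= W p" if pK: "p \<in> K" for p
 proof (rule barrier_le[where K = K and U = U and S = S and k = k])
  show "compact K" unfolding K_def by (intro compact_Times) auto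
  show "open U" unfolding U_def by (intro open_Times) auto
  show UK: "U \<subseteq> K" by (auto simp: U_def K_def)
  show "continuous_on K B" unfolding B_def g_def using R by (intro continuous_intros) auto
  show "continuous_on K W" using helmD(10)[OF helm_W] by (rule continuous_on_subset) (use KG in auto)
  show "continuous_on K S" unfolding S_def by (intro continuous_intros)
  show "0 <= W q" if "q \<in> K" for q using KG that by blast
  show Spos: "0 < S q" if q: "q \<in> K" for q
  proof -
   have "1 / R * (fst q - x1) <= 1" "0 <= 1 / R * (fst q - x1)" using q R by (auto simp: K_def)
   moreover have "0 < pi * (snd q - 0)" "pi * (snd q - 0) < pi * 1" using q b by (auto simp: K_def)
   ultimately have "- (pi / 2) < 1 / R * (fst q - x1)" "1 / R * (fst q - x1) < pi / 2" "0 < pi * (snd q - 0)" "pi * (snd q - 0) < pi"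
    using pi_gt3 by linarith+
   then show ?thesis unfolding S_def by (intro mult_pos_pos[of "cos _"] cos_gt_zero_pi sin_gt_zero)
  qed
  show "p \<in> K" by fact
  show "B q <= W q" if q: "q \<in> K - U" for q
  proof -
   have y: "2 * b <= snd q" "snd q <= 1 - 2 * b" using q by (auto simp: K_def)
   note by' = \<beta>y[OF y]
   consider "fst q = x1" | "fst q = x1 + R" | "snd q = 2 * b" | "snd q = 1 - 2 * b" using q by (force simp: K_def U_def)
   then show ?thesis
   proof cases
    case 1
    have "sin (\<beta> * (snd q - 2 * b)) <= \<beta> * (snd q - 2 * b)" "sin (\<beta> * (snd q - 2 * b)) <= \<beta> * (1 - 2 * b - snd q)"
     using sin_x_le_x[of "\<beta> * (snd q - 2 * b)"] sin_x_le_x[of "pi - \<beta> * (snd q - 2 * b)"] by'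
     unfolding sin_pi_minus by linarith+
    moreover have "\<beta> * (snd q - 2 * b) <= 4 * (snd q - 2 * b)" "\<beta> * (1 - 2 * b - snd q) <= 4 * (1 - 2 * b - snd q)"
     using \<beta> y by (intro mult_right_mono; simp)+
    ultimately have "sin (\<beta> * (snd q - 2 * b)) <= 4 * min (snd q - 2 * b) (1 - 2 * b - snd q)" by (simp add: min_def)
    then have "B q <= m * (4 * min (snd q - 2 * b) (1 - 2 * b - snd q))" using m 1 by (simp add: B_def g_def mult_left_mono)
    also have "... <= W q" using low[OF y] by (simp add: 1[symmetric] mult.assoc mult.left_commute)
    finally show ?thesis .
   next
    case 2 then show ?thesis using KG[of q] q R by (simp add: B_def g_def)
   next
    case 3 then show ?thesis using KG[of q] q by (simp add: B_def)
   next
    case 4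
    then have "\<beta> * (snd q - 2 * b) = pi" using by' by simp
    then show ?thesis using KG[of q] q by (simp add: B_def)
   qed
  qed
  fix q assume q: "q \<in> U"
  then have qK: "q \<in> K" using UK by blast
  show "supersol k W q" by (rule supersolI[OF helm_grad_lap[OF helm_W]]) (use KG[OF qK] in auto)
  define t where "t = (fst q - x1) / R"
  have t: "0 <= t" "t <= 1" using qK R by (auto simp: K_def t_def)
  have dg: "sd2 g (fst q) (m * (2 * (1 - (fst q - x1) / R) * (- 1 / R))) (m * (2 / R^2))"
   unfolding g_def by (rule sd2I[where g' = "%X. m * (2 * (1 - (X - x1) / R) * (- 1 / R))"])
    (use R in "auto intro!: derivative_eq_intros simp: power2_eq_square field_simps")
  have sq: "0 <= sin (\<beta> * (snd q - 2 * b))" using \<beta>y[of "snd q"] qK by (intro sin_ge_zero) (auto simp: K_def)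
  show "subsol k B q"
  proof (rule subsolI)
   show "grad_lap B q (m * (2 * (1 - (fst q - x1) / R) * (- 1 / R)) * sin (\<beta> * (snd q - 2 * b)))
    (g (fst q) * (\<beta> * cos (\<beta> * (snd q - 2 * b))))
    (m * (2 / R^2) * sin (\<beta> * (snd q - 2 * b)) + g (fst q) * (- \<beta>\<^sup>2 * sin (\<beta> * (snd q - 2 * b))))"
    unfolding B_def by (rule grad_lap_prod[OF dg sd2_sin_affine])
   have "(\<beta>^2 - k) * (1 - t)^2 <= 1 / R^2 * 1"
   proof -
    have "(\<beta>^2 - k) * (1 - t)^2 <= 1 / R^2 * (1 - t)^2" using \<beta>(3) k_low by (intro mult_right_mono) auto
    also have "... <= 1 / R^2 * 1" using t by (intro mult_left_mono) (auto simp: power_le_one)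
    finally show ?thesis .
   qed
   also have "... <= 2 / R^2" by (simp add: divide_right_mono)
   finally have "(m * sin (\<beta> * (snd q - 2 * b))) * ((\<beta>^2 - k) * (1 - t)^2) <= (m * sin (\<beta> * (snd q - 2 * b))) * (2 / R^2)"
    using m sq by (intro mult_left_mono) auto
   then show "- k * B q <= m * (2 / R^2) * sin (\<beta> * (snd q - 2 * b)) + g (fst q) * (- \<beta>\<^sup>2 * sin (\<beta> * (snd q - 2 * b)))"
    unfolding B_def g_def t_def[symmetric] by (simp add: algebra_simps)
  qed
  show "strict_supersol k S q"
  proof (rule strict_supersolI)
   show "grad_lap S q (- (1 / R) * sin (1 / R * (fst q - x1)) * sin (pi * (snd q - 0)))
    (cos (1 / R * (fst q - x1)) * (pi * cos (pi * (snd q - 0))))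
    (- (1 / R)\<^sup>2 * cos (1 / R * (fst q - x1)) * sin (pi * (snd q - 0)) + cos (1 / R * (fst q - x1)) * (- pi\<^sup>2 * sin (pi * (snd q - 0))))"
    unfolding S_def by (rule grad_lap_prod[OF sd2_cos_affine sd2_sin_affine])
   have "1 / l^2 < 1 / R^2" using R l by (intro divide_strict_left_mono power_strict_mono) auto
   then have "k < (1 / R)^2 + pi^2" using l(2) by (simp add: power_divide)
   from mult_strict_right_mono[OF this Spos[OF qK]]
   show "- (1 / R)\<^sup>2 * cos (1 / R * (fst q - x1)) * sin (pi * (snd q - 0)) + cos (1 / R * (fst q - x1)) * (- pi\<^sup>2 * sin (pi * (snd q - 0))) < - k * S q"
    by (simp add: S_def algebra_simps)
  qed
 qed
 have "\<beta> * (1 / 2 - 2 * b) = pi / 2" using b by (simp add: \<beta>_def field_simps)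
 then have s: "sin (\<beta> * (1 / 2 - 2 * b)) = 1" by (simp only: sin_pi_half)
 have "B (x, 1 / 2) = m * (1 - (x - x1) / R)^2" unfolding B_def g_def fst_conv snd_conv s by simp
 moreover have "(1 / 2)^2 <= (1 - (x - x1) / R)^2" using x R by (intro power_mono) (auto simp: R_def field_simps)
 then have "m * (1 / 2)^2 <= m * (1 - (x - x1) / R)^2" using m by (rule mult_left_mono)
 moreover have "(x, 1 / 2) \<in> K" using x R b by (auto simp: K_def R_def)
 moreover have "m * (1 / 2)^2 = m / 4" by (simp add: power2_eq_square)
 ultimately show ?thesis using main[of "(x, 1 / 2)"] by linarith
qed

text \<open>A large value of \<open>W\<close> at one point makes it large across the slice by
  \<open>helm_mid\<close> and \<open>sharm_slice_lower\<close>, and then along a length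
  \<open>\<eta> * l / 2\<close> of the axis by \<open>W_spread\<close>. By the mean value theorem
  \<open>px u\<close> would change by more than \<open>2 * C1 / l\<close> there.\<close>

lemma W_bound:
 assumes x1: "\<bar>x1 - fst pm\<bar> <= l / 4" and y1: "2 * b < y1" "y1 < 1 - 2 * b"
 shows "W (x1, y1) * min (y1 - 2 * b) (1 - 2 * b - y1) <= C3 / l^2"
proof -
 define t where "t = min (y1 - 2 * b) (1 - 2 * b - y1)"
 define m where "m = W (x1, y1) * t / 2 ^ 28"
 have box: "p \<in> G & 0 <= W p" if "p \<in> strip_box x1 (2 * b)" for p
 proof -
  obtain X Y where p: "p = (X, Y)" by (cases p)
  have X: "\<bar>X - x1\<bar> <= 1" and Y: "2 * b <= Y" "Y <= 1 - 2 * b" using that unfolding p mem_strip_box by auto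
  have "\<bar>X - fst pm\<bar> <= l / 2" using X x1 l by linarith
  then show ?thesis unfolding p using W_nonneg[OF _ Y] tube_G[of X Y] Y b l by simp
 qed
 have hm: "sharm x1 (2 * b) W" "m <= W p" if "p \<in> cball (x1, 1 / 2) (1 / 16)" for p
  unfolding m_def t_def by (rule helm_mid[OF helm_W k_nonneg _ _ _ _ _ y1 that]; use k_le box b in auto)+
 have sh: "sharm x1 (2 * b) W" by (rule hm(1)[of "(x1, 1 / 2)"]) simp
 have m0: "0 <= m" using box[of "(x1, y1)"] y1 by (simp add: m_def t_def mem_strip_box)
 define M where "M = m / 8192"
 have low: "4 * M * min (y - 2 * b) (1 - 2 * b - y) <= W (x1, y)" if "2 * b <= y" "y <= 1 - 2 * b" for y
  using sharm_slice_lower[OF sh m0 hm(2) that] by (simp add: M_def)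
 define h where "h = \<eta> * l / 2"
 have h: "0 < h" "h <= l / 16" using \<eta> l mult_right_mono[of \<eta> "1 / 8" l] by (auto simp: h_def)
 have inx: "\<bar>X - fst pm\<bar> <= l / 2" if "x1 <= X" "X <= x1 + h" for X using that h x1 by linarith
 have y2: "2 * b <= 1 / 2" "1 / 2 <= 1 - 2 * b" using b by auto
 have d: "((%X. px u (X, 1 / 2)) has_real_derivative px (px u) (X, 1 / 2)) (at X)"
  if "x1 <= X" "X <= x1 + h" for X
  by (rule has_grad_x[OF helmD(3)[OF hu]]) (use inx[OF that] b l in "auto intro!: tube_G")
 obtain z where z: "x1 < z" "z < x1 + h" "px u (x1 + h, 1 / 2) - px u (x1, 1 / 2) = (x1 + h - x1) * px (px u) (z, 1 / 2)"
  using MVT2[of x1 "x1 + h", OF _ d] h by auto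
 have "M / 4 <= W (z, 1 / 2)" by (rule W_spread[OF x1 _ low]) (use z m0 in "auto simp: M_def h_def")
 also have "... <= 4 * C1 / (\<eta> * l^2) + C1^2 / l^2"
 proof -
  have "- (h * px (px u) (z, 1 / 2)) <= 2 * (C1 / l)"
   using z(3) ux_bound(2)[OF inx y2, of x1] ux_bound(2)[OF inx y2, of "x1 + h"] h by auto
  moreover have "- px (px u) (z, 1 / 2) * h = - (h * px (px u) (z, 1 / 2))" by simp
  ultimately have "- px (px u) (z, 1 / 2) <= 2 * (C1 / l) / h" unfolding pos_le_divide_eq[OF h(1)] by linarith
  also have "2 * (C1 / l) / h = 4 * C1 / (\<eta> * l^2)" using \<eta> l by (simp add: h_def power2_eq_square field_simps)
  finally have "- px (px u) (z, 1 / 2) <= 4 * C1 / (\<eta> * l^2)" .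
  moreover have "C1^2 / l^2 * u (z, 1 / 2) <= C1^2 / l^2 * 1" by (intro mult_left_mono le1) auto
  ultimately show ?thesis by (simp add: W_def)
 qed
 also have "... = (4 * C1 / \<eta> + C1^2) / l^2" by (simp add: add_divide_distrib)
 finally have "M / 4 <= (4 * C1 / \<eta> + C1^2) / l^2" .
 moreover define Q where "Q = 4 * C1 / \<eta> + C1^2"
 ultimately show ?thesis unfolding c3_def M_def m_def t_def[symmetric] Q_def[symmetric] by (simp add: mult.commute)
qed

end

context tube
begin

abbreviation C4 :: real where "C4 \<equiv> c4 \<kappa> \<eta>"

lemmas C4 = c_pos(3)[OF \<kappa>(1) \<eta>(1)]

lemma square_in_tube:
 assumes d: "0 < d" "16 * b <= d" "d <= 1 / 4" and x: "\<bar>x - fst pm\<bar> <= l / 8" and y: "d <= y" "y <= 1 - d"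
  and q: "q \<in> square (x, y) (d / 4)"
 shows "q \<in> G" "\<bar>px u q\<bar> <= C1 / l" "0 <= W q" "W q <= 2 * C3 / (d * l^2)"
proof -
 obtain X Y where qq: "q = (X, Y)" by (cases q)
 have XY: "\<bar>X - x\<bar> <= d / 4" "\<bar>Y - y\<bar> <= d / 4" using q by (auto simp: qq mem_square)
 have X: "\<bar>X - fst pm\<bar> <= l / 4" "\<bar>X - fst pm\<bar> <= l / 2" using XY x d l by linarith+
 have Y: "3 * d / 4 <= Y" "Y <= 1 - 3 * d / 4" using XY y by linarith+
 have Yb: "2 * b < Y" "Y < 1 - 2 * b" using Y d by linarith+
 show "q \<in> G" unfolding qq by (rule tube_G) (use X Yb b l in auto)
 show "\<bar>px u q\<bar> <= C1 / l" unfolding qq by (rule ux_bound(2)[OF X(2)]) (use Yb in auto)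
 show W0: "0 <= W q" unfolding qq by (rule W_nonneg[OF X(2)]) (use Yb in auto)
 have "d / 2 <= min (Y - 2 * b) (1 - 2 * b - Y)" using Y d by auto
 then have "W q * (d / 2) <= W q * min (Y - 2 * b) (1 - 2 * b - Y)" using W0 by (rule mult_left_mono)
 also have "... <= C3 / l^2" unfolding qq by (rule W_bound[OF X(1) Yb])
 finally have "W q <= C3 / l^2 / (d / 2)" using d by (subst pos_le_divide_eq) auto
 then show "W q <= 2 * C3 / (d * l^2)" by (simp add: mult.commute)
qed

text \<open>The gradient estimates act on \<open>W\<close> and \<open>px u\<close> in squares of
  size comparable with \<open>d\<close>. Bounds for the second and third
  \<open>x\<close>-derivatives of \<open>u\<close> are read off from those for \<open>W\<close>,
  which are better by a factor \<open>1 / l\<close> than estimates started from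
  \<open>px u\<close>.\<close>

lemma interior_derivatives:
 assumes d: "0 < d" "16 * b <= d" "d <= 1 / 4" and x: "\<bar>x - fst pm\<bar> <= l / 8" and y: "d <= y" "y <= 1 - d"
 shows "\<bar>px (px u) (x, y)\<bar> <= C4 / (d * l^2)" "\<bar>py (px u) (x, y)\<bar> <= 16 * C1 / (d * l)"
  "\<bar>px W (x, y)\<bar> <= C4 / (d^2 * l^2)" "\<bar>py W (x, y)\<bar> <= C4 / (d^2 * l^2)"
  "\<bar>px (px (px u)) (x, y)\<bar> <= 2 * C4 / (d^2 * l^2)"
proof -
 note sq = square_in_tube[OF d x y]
 have r: "0 < d / 4" "k * (d / 4)^2 <= 1" "square (x, y) (d / 4) \<subseteq> G"
 proof -
  have "k * (d / 4)^2 <= 10 * (1 / 16)^2" using k_le k_nonneg d by (intro mult_mono power_mono) auto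
  also have "... <= 1" by (simp add: power2_eq_square)
  finally show "k * (d / 4)^2 <= 1" .
 qed (use d sq in auto)
 have C: "0 < C1" "0 < C3" using C1 C3 by auto
 have self: "(x, y) \<in> square (x, y) (d / 4)" using d by (simp add: mem_square)
 have G: "(x, y) \<in> G" by (rule sq(1)[OF self])
 have MW: "\<bar>W q\<bar> <= 2 * C3 / (d * l^2)" if "q \<in> square (x, y) (d / 4)" for q using sq(3,4)[OF that] by simp
 have e: "4 * (2 * C3 / (d * l^2)) / (d / 4) = 32 * C3 / (d^2 * l^2)" by (simp add: power2_eq_square)
 have le: "32 * C3 / (d^2 * l^2) <= C4 / (d^2 * l^2)" using C by (intro divide_right_mono) (auto simp: c4_def)
 show Wx: "\<bar>px W (x, y)\<bar> <= C4 / (d^2 * l^2)"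
  using partial_x_bound[OF helm_W r(1) k_nonneg r(2,3) MW] le unfolding e by linarith
 show "\<bar>py W (x, y)\<bar> <= C4 / (d^2 * l^2)"
  using partial_y_bound[OF helm_W r(1) k_nonneg r(2,3) MW] le unfolding e by linarith
 have "\<bar>py (px u) (x, y)\<bar> <= 4 * (C1 / l) / (d / 4)"
  by (rule partial_y_bound[OF helm_partial_x[OF hu k_nonneg] r(1) k_nonneg r(2,3) sq(2)])
 then show "\<bar>py (px u) (x, y)\<bar> <= 16 * C1 / (d * l)" by (simp add: mult.commute)
 have up: "0 < u (x, y)" "u (x, y) <= 1" using pos[OF G] le1 by auto
 have c: "0 <= C1^2 / l^2 * u (x, y)" "C1^2 / l^2 * u (x, y) <= C1^2 / l^2 * 1" using up by simp (rule mult_left_mono[OF up(2)], simp)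
 have dl: "d * l^2 <= 1 * l^2" "0 < d * l^2" "d^2 * l^2 <= d * l^2" "0 < d^2 * l^2"
  using d l by (auto simp: power2_eq_square intro!: mult_right_mono mult_left_le)
 have "2 * C3 <= C4" "C1^2 <= C4" using C by (simp_all add: c4_def)
 then have "2 * C3 / (d * l^2) <= C4 / (d * l^2)" "C1^2 / l^2 <= C4 / (d * l^2)"
  using dl C4 by (auto intro!: divide_right_mono frac_le)
 then show "\<bar>px (px u) (x, y)\<bar> <= C4 / (d * l^2)"
  using sq(3,4)[OF self] c unfolding W_def by auto
 have "px W (x, y) = (-1) * px (px (px u)) (x, y) + C1^2 / l^2 * px u (x, y)"
  unfolding W_def by (rule has_grad_partials(1)[OF has_grad_lincomb[OF helmD(2)[OF helm_partial_x[OF helm_partial_x[OF hu k_nonneg] k_nonneg] G] helmD(2)[OF hu G]]])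
 moreover have "\<bar>C1\<^sup>2 / l^2 * px u (x, y)\<bar> <= C4 / (d^2 * l^2)"
 proof -
  have "\<bar>C1\<^sup>2 / l^2 * px u (x, y)\<bar> <= C1^2 / l^2 * (C1 / l)"
   using sq(2)[OF self] by (intro abs_mult_le) auto
  also have "... <= C1^2 / l^2 * (C1 / 1)" using C l by (intro mult_left_mono divide_left_mono) auto
  also have "... = C1 ^ 3 / l^2" by (simp add: power2_eq_square power3_eq_cube)
  also have "... <= C4 / (d^2 * l^2)" using C C4 dl by (intro frac_le) (auto simp: c4_def)
  finally show ?thesis .
 qed
 moreover have "2 * C4 / (d^2 * l^2) = C4 / (d^2 * l^2) + C4 / (d^2 * l^2)" by simp
 ultimately show "\<bar>px (px (px u)) (x, y)\<bar> <= 2 * C4 / (d^2 * l^2)" using Wx by linarith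
qed

text \<open>\<open>cross p / (u p)^2\<close> is the mixed second derivative of \<open>ln u\<close>. It is of order \<open>d / l\<close> at some point at
 height between \<open>d\<close> and \<open>2 * d\<close>, and its \<open>y\<close>-derivative is of order \<open>1 / l^2\<close>.\<close>

definition cross :: "real * real => real" where
 "cross p = u p * py (px u) p - px u p * py u p"

lemma DERIV_slope_y:
 assumes G: "(x, y) \<in> G"
 shows "((%y. px u (x, y) / u (x, y)) has_real_derivative cross (x, y) / (u (x, y))^2) (at y)"
 using has_grad_y[OF helmD(2)[OF helm_partial_x[OF hu k_nonneg] G]] has_grad_y[OF helmD(2)[OF hu G]] pos[OF G]
 by (auto intro!: derivative_eq_intros simp: cross_def power2_eq_square field_simps)

lemma cross_bound:
 assumes d: "0 < d" "16 * b <= d" "d <= 1 / 8" and x: "\<bar>x - fst pm\<bar> <= l / 8" and y: "d <= y" "y <= 1 - d"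
 shows "\<bar>cross (x, y)\<bar> <= 98 * C1 * d / l + (C1 + 2) * C4 / (d^2 * l^2)"
proof -
 have d': "d <= 1 / 4" using d by simp
 have xl: "\<bar>x - fst pm\<bar> <= l" "\<bar>x - fst pm\<bar> <= l / 2" using x l by linarith+
 have G: "(x, Y) \<in> G" if "d <= Y" "Y <= 1 - d" for Y using tube_G[OF xl(1)] that d b by simp
 have up: "0 < u (x, Y)" if "d <= Y" "Y <= 1 - d" for Y using pos[OF G[OF that]] .
 have uxb: "\<bar>px u (x, Y)\<bar> <= C1 * u (x, Y) / l" "\<bar>px u (x, Y)\<bar> <= C1 / l" if "d <= Y" "Y <= 1 - d" for Y
  using ux_bound[OF xl(2), of Y] that d b by auto
 have hx: "helm G k (px u)" by (rule helm_partial_x[OF hu k_nonneg])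
 have dv: "((%Y. px u (x, Y) / u (x, Y)) has_real_derivative cross (x, Y) / (u (x, Y))^2) (at Y)" if "d <= Y" "Y <= 1 - d" for Y
  by (rule DERIV_slope_y[OF G[OF that]])
 obtain z where z: "d < z" "z < 2 * d"
  "px u (x, 2 * d) / u (x, 2 * d) - px u (x, d) / u (x, d) = (2 * d - d) * (cross (x, z) / (u (x, z))^2)"
  using MVT2[of d "2 * d", OF _ dv] d by auto
 have zr: "d <= z" "z <= 1 - d" using z d by auto
 have v: "\<bar>px u (x, Y) / u (x, Y)\<bar> <= C1 / l" if "d <= Y" "Y <= 1 - d" for Y
  using uxb(1)[OF that] up[OF that] by (simp add: abs_divide pos_divide_le_eq)
 have e: "2 * d - d = d" by simp
 have "\<bar>px u (x, d) / u (x, d)\<bar> <= C1 / l" "\<bar>px u (x, 2 * d) / u (x, 2 * d)\<bar> <= C1 / l"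
  using d by (intro v; simp)+
 then have "\<bar>d * (cross (x, z) / (u (x, z))^2)\<bar> <= 2 * (C1 / l)" unfolding z(3)[unfolded e, symmetric] by linarith
 then have "\<bar>cross (x, z)\<bar> * d <= 2 * (C1 / l) * (u (x, z))^2" using up[OF zr] d by (simp add: abs_mult field_simps)
 also have "... <= 2 * (C1 / l) * (49 * d^2)"
 proof (rule mult_left_mono)
  have "u (x, z) <= 33 / 10 * min z (1 - z)" using u_le_wall[of z x] zr d by simp
  then have "u (x, z) <= 7 * d" using z d by (simp add: min_def split: if_splits)
  then have "(u (x, z))^2 <= (7 * d)^2" using up[OF zr] by (intro power_mono) auto
  then show "(u (x, z))^2 <= 49 * d^2" by (simp add: power_mult_distrib)
 qed (use C1 l in simp)
 finally have "\<bar>cross (x, z)\<bar> * d <= 2 * (C1 / l) * (49 * d^2)" .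
 then have cz: "\<bar>cross (x, z)\<bar> <= 98 * C1 * d / l" using d l by (simp add: power2_eq_square field_simps)
 \<comment> \<open>The equation trades second \<open>y\<close>-derivatives for
   \<open>x\<close>-derivatives; the terms in \<open>k\<close> and the products of first and mixed
   derivatives cancel. What is left contains only \<open>x\<close>-derivatives.\<close>
 have dc: "((%Y. cross (x, Y)) has_real_derivative
   px u (x, Y) * px (px u) (x, Y) - u (x, Y) * px (px (px u)) (x, Y)) (at Y)"
  if Y: "d <= Y" "Y <= 1 - d" for Y
 proof -
  note GY = G[OF Y]
  have "((%Y. cross (x, Y)) has_real_derivative
    (py u (x, Y) * py (px u) (x, Y) + py (py (px u)) (x, Y) * u (x, Y))
    - (py (px u) (x, Y) * py u (x, Y) + py (py u) (x, Y) * px u (x, Y))) (at Y)"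
   unfolding cross_def
   by (intro DERIV_diff DERIV_mult has_grad_y[OF helmD(2)[OF hu GY]] has_grad_y[OF helmD(2)[OF hx GY]]
     has_grad_y[OF helmD(4)[OF hx GY]] has_grad_y[OF helmD(4)[OF hu GY]])
  moreover have "py (py (px u)) (x, Y) = - k * px u (x, Y) - px (px (px u)) (x, Y)"
   "py (py u) (x, Y) = - k * u (x, Y) - px (px u) (x, Y)"
   using helmD(9)[OF hx GY] helmD(9)[OF hu GY] by linarith+
  ultimately show ?thesis by (simp add: algebra_simps)
 qed
 have dl: "0 < d^2 * l^2" using d l by simp
 have bd: "\<bar>px u (x, Y) * px (px u) (x, Y) - u (x, Y) * px (px (px u)) (x, Y)\<bar>
   <= C1 * C4 / (d * l ^ 3) + 2 * C4 / (d^2 * l^2)" if Y: "d <= Y" "Y <= 1 - d" for Y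
 proof -
  note id = interior_derivatives[OF d(1,2) d' x Y]
  have "\<bar>px u (x, Y) * px (px u) (x, Y)\<bar> <= C1 / l * (C4 / (d * l^2))" by (rule abs_mult_le[OF uxb(2)[OF Y] id(1)])
  moreover have "C1 / l * (C4 / (d * l^2)) = C1 * C4 / (d * l ^ 3)" by (simp add: power2_eq_square power3_eq_cube)
  moreover have "\<bar>u (x, Y)\<bar> <= 1" using le1 up[OF Y] by simp
  from abs_mult_le[OF this id(5)] have "\<bar>u (x, Y) * px (px (px u)) (x, Y)\<bar> <= 2 * C4 / (d^2 * l^2)" by simp
  ultimately show ?thesis by linarith
 qed
 have lip: "\<bar>cross (x, Y) - cross (x, z)\<bar> <= (C1 * C4 / (d * l ^ 3) + 2 * C4 / (d^2 * l^2)) * 1" if Y: "d <= Y" "Y <= 1 - d" for Y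
 proof -
  have *: "\<bar>cross (x, Y) - cross (x, z)\<bar> <= (C1 * C4 / (d * l ^ 3) + 2 * C4 / (d^2 * l^2)) * \<bar>Y - z\<bar>"
   by (rule field_differentiable_bound[of "{d..1 - d}" "%Y. cross (x, Y)", OF _ has_field_derivative_at_within[OF dc], unfolded real_norm_def])
    (use bd Y zr in auto)
  also have "... <= (C1 * C4 / (d * l ^ 3) + 2 * C4 / (d^2 * l^2)) * 1"
   using Y zr d C1 C4 l by (intro mult_left_mono add_nonneg_nonneg divide_nonneg_nonneg) auto
  finally show ?thesis .
 qed
 have "(d * d) * l^2 <= (d * l) * l^2" using d l by (intro mult_right_mono mult_left_mono) auto
 then have "d^2 * l^2 <= d * l ^ 3" by (simp add: power2_eq_square power3_eq_cube mult.assoc)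
 then have "C1 * C4 / (d * l ^ 3) <= C1 * C4 / (d^2 * l^2)" using dl C1 C4 by (intro divide_left_mono) (auto intro!: mult_pos_pos)
 then have "\<bar>cross (x, y) - cross (x, z)\<bar> <= (C1 + 2) * C4 / (d^2 * l^2)" using lip[OF y] by (simp add: distrib_right add_divide_distrib)
 with cz show ?thesis by linarith
qed

end

section \<open>A monotone flux\<close>

lemma DERIV_max_square: "((%t::real. (max 0 t)\<^sup>2) has_real_derivative 2 * max 0 t) (at t)"
proof -
 consider "t < 0" | "t = 0" | "0 < t" by linarith
 then show ?thesis
 proof cases
  case 1
  have "((%t::real. 0) has_real_derivative 0) (at t)" by simp
  moreover have "\<forall>\<^sub>F s in nhds t. 0 = (max 0 s)^2"
   using eventually_nhds_in_open[of "{..<0}" t] 1 by (auto elim!: eventually_mono)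
  ultimately show ?thesis using 1 DERIV_cong_ev[OF refl _ refl, of "%t. 0" "%t. (max 0 t)\<^sup>2" t 0] by simp
 next
  case 2
  have "((%s::real. (max 0 s)\<^sup>2 / s) \<longlongrightarrow> 0) (at 0)"
  proof (rule Lim_null_comparison)
   show "\<forall>\<^sub>F s in at (0::real). norm ((max 0 s)^2 / s) <= \<bar>s\<bar>"
    by (intro always_eventually) (auto simp: max_def power2_eq_square)
   show "((%s::real. \<bar>s\<bar>) \<longlongrightarrow> 0) (at 0)" by (rule tendsto_rabs_zero) simp
  qed
  then show ?thesis using 2 by (simp add: DERIV_def)
 next
  case 3
  have "((%t::real. t\<^sup>2) has_real_derivative 2 * t) (at t)" by (auto intro!: derivative_eq_intros)
  moreover have "\<forall>\<^sub>F s in nhds t. s\<^sup>2 = (max 0 s)^2"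
   using eventually_nhds_in_open[of "{0<..}" t] 3 by (auto elim!: eventually_mono)
  ultimately show ?thesis using 3 DERIV_cong_ev[OF refl _ refl, of "%t. t\<^sup>2" "%t. (max 0 t)\<^sup>2" t "2 * t"] by simp
 qed
qed

text \<open>A \<open>C\<^sup>2\<close> convex truncation \<open>Z0\<close> of the identity below the level \<open>de\<close>, with its derivatives.\<close>

definition Z0 :: "real => real => real" where "Z0 de t = (max 0 (t - de))^2 * (t - de) / t^2"
definition Z1 :: "real => real => real" where "Z1 de t = (max 0 (t - de))^2 * (t + 2 * de) / t ^ 3"
definition Z2 :: "real => real => real" where "Z2 de t = 6 * de^2 * max 0 (t - de) / t ^ 4"

lemma Z_zero: "t <= de ==> Z0 de t = 0 & Z1 de t = 0 & Z2 de t = 0"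
 by (simp add: Z0_def Z1_def Z2_def)

lemma DERIV_Z0:
 assumes "0 < t"
 shows "(Z0 de has_real_derivative Z1 de t) (at t)"
proof -
 define M where "M = max 0 (t - de)"
 have M: "M * (t - de) = M^2" by (simp add: M_def max_def power2_eq_square)
 have "((%t. (max 0 (t - de))\<^sup>2) has_real_derivative 2 * M * 1) (at t)"
  unfolding M_def by (rule DERIV_chain2[OF DERIV_max_square]) (auto intro!: derivative_eq_intros)
 note d = DERIV_divide[OF DERIV_mult[OF this DERIV_diff[OF DERIV_ident DERIV_const]] DERIV_power[OF DERIV_ident]]
 have "(Z0 de has_real_derivative ((2 * M * 1 * (t - de) + (1 - 0) * M^2) * t^2 - M^2 * (t - de) * (of_nat 2 * (1 * t ^ (2 - Suc 0)))) / (t^2 * t^2)) (at t)"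
  unfolding Z0_def[abs_def] by (rule DERIV_cong[OF d]) (use assms in "simp_all add: M_def")
 moreover have "((2 * M * 1 * (t - de) + (1 - 0) * M^2) * t^2 - M^2 * (t - de) * (of_nat 2 * (1 * t ^ (2 - Suc 0)))) / (t^2 * t^2) = Z1 de t"
 proof -
  have "(2 * M * 1 * (t - de) + (1 - 0) * M^2) * t^2 - M^2 * (t - de) * (of_nat 2 * (1 * t ^ (2 - Suc 0))) = t * (M^2 * (t + 2 * de))"
  proof -
   have e: "2 * M * 1 * (t - de) = 2 * M^2" using M by simp
   have "(2 * M * 1 * (t - de) + (1 - 0) * M^2) * t^2 - M^2 * (t - de) * (of_nat 2 * (1 * t ^ (2 - Suc 0)))
    = (2 * M^2 + M^2) * t^2 - M^2 * (t - de) * (2 * t)" unfolding e by simp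
   also have "... = t * (M^2 * (t + 2 * de))" by (simp add: power2_eq_square algebra_simps)
   finally show ?thesis .
  qed
  moreover have "t^2 * t^2 = t * t ^ 3" by (simp add: power2_eq_square power3_eq_cube)
  ultimately show ?thesis using assms by (simp add: Z1_def M_def[symmetric])
 qed
 ultimately show ?thesis by simp
qed

lemma DERIV_Z1:
 assumes "0 < t"
 shows "(Z1 de has_real_derivative Z2 de t) (at t)"
proof -
 define M where "M = max 0 (t - de)"
 have M: "M * (t - de) = M^2" by (simp add: M_def max_def power2_eq_square)
 have "((%t. (max 0 (t - de))\<^sup>2) has_real_derivative 2 * M * 1) (at t)"
  unfolding M_def by (rule DERIV_chain2[OF DERIV_max_square]) (auto intro!: derivative_eq_intros)
 note d = DERIV_divide[OF DERIV_mult[OF this DERIV_add[OF DERIV_ident DERIV_const]] DERIV_power[OF DERIV_ident]]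
 have "(Z1 de has_real_derivative ((2 * M * 1 * (t + 2 * de) + (1 + 0) * M^2) * t ^ 3 - M^2 * (t + 2 * de) * (of_nat 3 * (1 * t ^ (3 - Suc 0)))) / (t ^ 3 * t ^ 3)) (at t)"
  unfolding Z1_def[abs_def] by (rule DERIV_cong[OF d]) (use assms in "simp_all add: M_def")
 moreover have "((2 * M * 1 * (t + 2 * de) + (1 + 0) * M^2) * t ^ 3 - M^2 * (t + 2 * de) * (of_nat 3 * (1 * t ^ (3 - Suc 0)))) / (t ^ 3 * t ^ 3) = Z2 de t"
 proof -
  have "(2 * M * 1 * (t + 2 * de) + (1 + 0) * M^2) * t ^ 3 - M^2 * (t + 2 * de) * (of_nat 3 * (1 * t ^ (3 - Suc 0)))
   = t^2 * (2 * M * (t * (t + 2 * de)) + t * (M * (t - de)) - 3 * (M * (t - de)) * (t + 2 * de))"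
   unfolding M by (simp add: eval_nat_numeral algebra_simps)
  also have "... = t^2 * (6 * de^2 * M)" by (simp add: power2_eq_square algebra_simps)
  finally have "(2 * M * 1 * (t + 2 * de) + (1 + 0) * M^2) * t ^ 3 - M^2 * (t + 2 * de) * (of_nat 3 * (1 * t ^ (3 - Suc 0))) = t^2 * (6 * de^2 * M)" .
  moreover have "t ^ 3 * t ^ 3 = t^2 * t ^ 4" by (simp add: eval_nat_numeral)
  moreover have "t^2 * (6 * de^2 * M) / (t^2 * t ^ 4) = 6 * de^2 * M / t ^ 4"
   by (rule mult_divide_mult_cancel_left) (use assms in simp)
  ultimately show ?thesis by (simp only: Z2_def M_def[symmetric])
 qed
 ultimately show ?thesis by simp
qed

lemma cont_Z2: "0 < t ==> isCont (Z2 de) t"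
 unfolding Z2_def[abs_def] by (intro continuous_intros) auto

text \<open>The combination \<open>t * Z1 de t - Z0 de t\<close> would vanish for a function
  homogeneous of degree one. It multiplies \<open>k\<close> in the divergence of the flux, and the
  bound \<open>3 * de\<close> makes that error disappear with \<open>de\<close>.\<close>

lemma Z_bounds:
 assumes de: "0 < de" and t: "0 < t"
 shows "0 <= Z0 de t" "Z0 de t <= t" "0 <= Z1 de t" "Z1 de t <= 1" "0 <= Z2 de t" "0 <= t * Z1 de t - Z0 de t" "t * Z1 de t - Z0 de t <= 3 * de"
  "2 * de <= t ==> t / 8 <= Z0 de t"
proof -
 define M where "M = max 0 (t - de)"
 have M: "0 <= M" "M <= t" "M * (t - de) = M^2" "M * de = M * t - M^2" using de t by (auto simp: M_def max_def power2_eq_square algebra_simps)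
 have M2: "M^2 <= t^2" "M ^ 3 <= t ^ 3" using M by (auto intro: power_mono)
 have Z0: "Z0 de t = M ^ 3 / t^2"
  unfolding Z0_def M_def[symmetric] using M(3) by (simp add: power2_eq_square power3_eq_cube mult.assoc)
 have e: "M^2 * (t + 2 * de) = 3 * (t * M^2) - 2 * M ^ 3"
 proof -
  have "M^2 * (t + 2 * de) = M^2 * t + 2 * M * (M * de)" by (simp add: power2_eq_square algebra_simps)
  also have "... = 3 * (t * M^2) - 2 * M ^ 3" unfolding M(4) by (simp add: power2_eq_square power3_eq_cube algebra_simps)
  finally show ?thesis .
 qed
 have Z1: "Z1 de t = (3 * (t * M^2) - 2 * M ^ 3) / t ^ 3" unfolding Z1_def M_def[symmetric] e ..
 show "0 <= Z0 de t" using M by (simp add: Z0)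
 show "Z0 de t <= t" using M2 t by (simp add: Z0 pos_divide_le_eq power2_eq_square power3_eq_cube mult.assoc)
 show "0 <= Z1 de t" using de t by (simp add: Z1_def)
 have "t ^ 3 - (3 * (t * M^2) - 2 * M ^ 3) = (t - M)^2 * (t + 2 * M)" by (simp add: power2_eq_square power3_eq_cube algebra_simps)
 moreover have "0 <= (t - M)^2 * (t + 2 * M)" using M t by simp
 ultimately show "Z1 de t <= 1" using t by (simp add: Z1 pos_divide_le_eq)
 show "0 <= Z2 de t" using de t by (simp add: Z2_def)
 have d: "t * Z1 de t - Z0 de t = 3 * de * (M^2 / t^2)"
 proof -
  have "t * Z1 de t = M^2 * (t + 2 * de) / t^2" unfolding Z1_def M_def[symmetric] using t by (simp add: power2_eq_square power3_eq_cube)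
  then have "t * Z1 de t - Z0 de t = (M^2 * (t + 2 * de) - M^2 * (t - de)) / t^2"
   unfolding Z0_def M_def[symmetric] by (simp add: diff_divide_distrib)
  then show ?thesis by (simp add: algebra_simps)
 qed
 then show "0 <= t * Z1 de t - Z0 de t" using de by simp
 have "M^2 / t^2 <= 1" using M2 t by simp
 then show "t * Z1 de t - Z0 de t <= 3 * de" unfolding d using mult_left_mono[of "M^2 / t^2" 1 "3 * de"] de by simp
 assume "2 * de <= t"
 moreover have "t - de <= M" by (simp add: M_def)
 ultimately have "t / 2 <= M" by linarith
 then have "(t / 2) ^ 3 <= M ^ 3" using t by (intro power_mono) auto
 then have "(t / 2) ^ 3 / t^2 <= Z0 de t" unfolding Z0 by (rule divide_right_mono) simp
 then show "t / 8 <= Z0 de t" using t by (simp add: power_divide power2_eq_square power3_eq_cube)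
qed

section \<open>The flux of the truncated Wronskian\<close>

locale flux = long_ground +
 fixes h de :: real
 assumes h: "1 / 2 <= h" "h <= 1" and de: "0 < de"
begin

definition w :: "real * real => real" where "w p = u (p + (h, 0))"

text \<open>With the identity in place of \<open>Z0\<close> this is the \<open>x\<close>-component
  of w grad u - u grad w, and \<open>H\<close> below is the \<open>y\<close>-component; that field
  is divergence-free. The truncation makes it vanish where \<open>w <= de\<close>, so no derivative
  is evaluated at the boundary.\<close>

definition F :: "real * real => real" where
 "F p = Z0 de (w p) * px u p - u p * (Z1 de (w p) * px u (p + (h, 0)))"

definition Fx :: "real * real => real" where
 "Fx p = Z0 de (w p) * px (px u) p
  - u p * (Z2 de (w p) * (px u (p + (h, 0)))^2 + Z1 de (w p) * px (px u) (p + (h, 0)))"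

definition H :: "real * real => real" where
 "H p = Z0 de (w p) * py u p - u p * (Z1 de (w p) * py u (p + (h, 0)))"

definition Hy :: "real * real => real" where
 "Hy p = Z0 de (w p) * py (py u) p
  - u p * (Z2 de (w p) * (py u (p + (h, 0)))^2 + Z1 de (w p) * py (py u) (p + (h, 0)))"

lemma cont_w: "continuous_on S w"
 unfolding w_def by (rule continuous_on_compose2[OF cu]) (auto intro!: continuous_intros)

text \<open>Slices shrink to the right of \<open>x0\<close>, so stepping back from
  \<open>p + (h, 0)\<close> to \<open>p\<close> stays in the domain. This ties the flux to one side
  of \<open>x0\<close>.\<close>

lemma w_pos_in_G:
 assumes "0 < w p" "x0 < fst p"
 shows "p + (h, 0) \<in> G" "p \<in> G"
proof -
 show *: "p + (h, 0) \<in> G" using assms zero[of "p + (h, 0)"] by (force simp: w_def)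
 show "p \<in> G" using nested[of "fst p + h" "snd p" "fst p"] * assms(2) h by (cases p) auto
qed

lemma small_w: "w p <= de ==> F p = 0 & Fx p = 0 & H p = 0 & Hy p = 0"
 by (simp add: F_def Fx_def H_def Hy_def Z_zero)

lemma DERIV_small:
 assumes c: "continuous_on UNIV (%t. w (g t))" and t: "w (g t) < de" and f: "!!p. w p <= de ==> f p = (0::real)"
 shows "((%t. f (g t)) has_real_derivative 0) (at t)"
proof -
 have "open {t. w (g t) < de}" using c by (intro open_Collect_less) auto
 then have "\<forall>\<^sub>F s in nhds t. s \<in> {t. w (g t) < de}" using t by (intro eventually_nhds_in_open) auto
 then have "\<forall>\<^sub>F s in nhds t. 0 = f (g s)" by (rule eventually_mono) (simp add: f less_imp_le)
 then show ?thesis using DERIV_cong_ev[OF refl _ refl, of "%t. 0" "%t. f (g t)" t 0] by simp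
qed

lemma has_grad_shift:
 assumes "has_grad f (p + c) a b"
 shows "has_grad (%q. f (q + c)) p a b"
proof -
 have "((%q. q + c) has_derivative (%h. h)) (at p)" by (auto intro!: derivative_eq_intros)
 from has_derivative_compose[OF this assms] show ?thesis .
qed

lemma DERIV_F:
 assumes x: "x0 < x"
 shows "((%x. F (x, y)) has_real_derivative Fx (x, y)) (at x)" "((%y. H (x, y)) has_real_derivative Hy (x, y)) (at y)"
proof -
 have "((%x. F (x, y)) has_real_derivative Fx (x, y)) (at x) & ((%y. H (x, y)) has_real_derivative Hy (x, y)) (at y)"
 proof (cases "w (x, y) < de")
  case True
  have c: "continuous_on UNIV (%t. w (t, y))" "continuous_on UNIV (%t. w (x, t))"
   by (rule continuous_on_compose2[OF cont_w[of UNIV]]; auto intro!: continuous_intros)+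
  have "((%x. F (x, y)) has_real_derivative 0) (at x)" by (rule DERIV_small[OF c(1) True]) (simp add: small_w)
  moreover have "((%y. H (x, y)) has_real_derivative 0) (at y)" by (rule DERIV_small[OF c(2) True]) (simp add: small_w)
  ultimately show ?thesis using small_w[of "(x, y)"] True by simp
 next
  case False
  then have w0: "0 < w (x, y)" using de by simp
  note G = w_pos_in_G[OF w0, simplified, OF x]
  have G1: "(x, y) + (h, 0) \<in> G" using G(1) by simp
  have gw: "has_grad w (x, y) (px u ((x, y) + (h, 0))) (py u ((x, y) + (h, 0)))"
   unfolding w_def[abs_def] by (rule has_grad_shift[OF helmD(2)[OF hu G1]])
  note gx = has_grad_shift[OF helmD(3)[OF hu G1]] and gy = has_grad_shift[OF helmD(4)[OF hu G1]]
  note zx = DERIV_chain2[OF DERIV_Z0[OF w0] has_grad_x[OF gw]] DERIV_chain2[OF DERIV_Z1[OF w0] has_grad_x[OF gw]]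
  note zy = DERIV_chain2[OF DERIV_Z0[OF w0] has_grad_y[OF gw]] DERIV_chain2[OF DERIV_Z1[OF w0] has_grad_y[OF gw]]
  from DERIV_diff[OF DERIV_mult[OF zx(1) has_grad_x[OF helmD(3)[OF hu G(2)]]]
    DERIV_mult[OF has_grad_x[OF helmD(2)[OF hu G(2)]] DERIV_mult[OF zx(2) has_grad_x[OF gx]]]]
  have 1: "((%x. F (x, y)) has_real_derivative Fx (x, y)) (at x)"
   unfolding F_def Fx_def by (rule DERIV_cong) (simp add: power2_eq_square algebra_simps)
  from DERIV_diff[OF DERIV_mult[OF zy(1) has_grad_y[OF helmD(4)[OF hu G(2)]]]
    DERIV_mult[OF has_grad_y[OF helmD(2)[OF hu G(2)]] DERIV_mult[OF zy(2) has_grad_y[OF gy]]]]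
  have "((%y. H (x, y)) has_real_derivative Hy (x, y)) (at y)"
   unfolding H_def Hy_def by (rule DERIV_cong) (simp add: power2_eq_square algebra_simps)
  with 1 show ?thesis by blast
 qed
 then show "((%x. F (x, y)) has_real_derivative Fx (x, y)) (at x)" "((%y. H (x, y)) has_real_derivative Hy (x, y)) (at y)" by auto
qed

lemma cont_F: "continuous_on {p. x0 < fst p} F" "continuous_on {p. x0 < fst p} Fx"
proof -
 have "isCont F p & isCont Fx p" if p: "x0 < fst p" for p
 proof (cases "w p < de")
  case True
  have "open {p. w p < de}" using cont_w by (intro open_Collect_less) auto
  then have "\<forall>\<^sub>F q in nhds p. w q < de" using eventually_nhds_in_open[of "{p. w p < de}" p] True by simp
  then have "\<forall>\<^sub>F q in nhds p. F q = 0" "\<forall>\<^sub>F q in nhds p. Fx q = 0" by (auto elim!: eventually_mono simp: small_w)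
  then show ?thesis using isCont_cong[of F "%_. 0" p] isCont_cong[of Fx "%_. 0" p] by auto
 next
  case False
  then have w0: "0 < w p" using de by simp
  note G = w_pos_in_G[OF w0 p]
  have sh: "isCont (%q. f (q + (h, 0))) p" if "continuous_on G f" for f :: "real * real => real"
   using that G(1) oG by (intro isCont_o2[where f = "%q. q + (h, 0)" and g = f]) (auto simp: continuous_on_eq_continuous_at intro!: continuous_intros)
  have no: "isCont f p" if "continuous_on G f" for f :: "real * real => real"
   using that G(2) oG by (simp add: continuous_on_eq_continuous_at)
  have cw: "isCont w p" using cont_w[of UNIV] unfolding continuous_on_eq_continuous_at[OF open_UNIV] by blast
  have z: "isCont (%q. Z0 de (w q)) p" "isCont (%q. Z1 de (w q)) p" "isCont (%q. Z2 de (w q)) p"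
   using DERIV_isCont[OF DERIV_Z0[OF w0]] DERIV_isCont[OF DERIV_Z1[OF w0]] cont_Z2[OF w0]
   by (auto intro!: isCont_o2[OF cw])
  note c = z no[OF cuS] no[OF helmD(11)[OF hu]] no[OF helmD(5)[OF hu]] sh[OF helmD(11)[OF hu]] sh[OF helmD(5)[OF hu]]
  show ?thesis unfolding F_def[abs_def] Fx_def[abs_def]
   by (intro conjI isCont_diff isCont_mult isCont_add isCont_power c)
 qed
 then show "continuous_on {p. x0 < fst p} F" "continuous_on {p. x0 < fst p} Fx"
  by (auto intro!: continuous_at_imp_continuous_on)
qed

text \<open>The gradient term carries the second derivative of the convex truncation and has the
  favourable sign; the remaining term is \<open>k * u\<close> times the defect of homogeneity from
  \<open>Z_bounds\<close>.\<close>

lemma Fx_Hy_le: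
 assumes "x0 < fst p"
 shows "Fx p + Hy p <= 3 * k * de"
proof (cases "w p <= de")
 case True then show ?thesis using small_w de k_nonneg by simp
next
 case False
 then have w0: "0 < w p" using de by simp
 note G = w_pos_in_G[OF w0 assms] and Z = Z_bounds[OF de w0]
 define A where "A = (px u (p + (h, 0)))^2 + (py u (p + (h, 0)))^2"
 have "Fx p + Hy p = Z0 de (w p) * (px (px u) p + py (py u) p)
   - u p * (Z2 de (w p) * A + Z1 de (w p) * (px (px u) (p + (h, 0)) + py (py u) (p + (h, 0))))"
  unfolding Fx_def Hy_def A_def by (simp add: algebra_simps)
 also have "... = k * u p * (w p * Z1 de (w p) - Z0 de (w p)) - u p * (Z2 de (w p) * A)"
  unfolding helmD(9)[OF hu G(1)] helmD(9)[OF hu G(2)] w_def[symmetric] by (simp add: algebra_simps)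
 also have "... <= k * u p * (w p * Z1 de (w p) - Z0 de (w p))" using u_nonneg[of p] Z by (simp add: A_def)
 also have "... <= (k * 1) * (3 * de)" using Z u_nonneg[of p] le1[of p] k_nonneg by (intro mult_mono mult_left_mono) auto
 finally show ?thesis by simp
qed

definition P :: "real => real" where "P x = integral {0..1} (%y. F (x, y))"

lemma F_integrable: "x0 < x ==> S \<subseteq> {0..1} ==> S = {s..t} ==> (%y. F (x, y)) integrable_on S"
 by (simp, intro integrable_continuous_interval continuous_on_compose2[OF cont_F(1)]) (auto intro!: continuous_intros)

text \<open>The translate, and with it \<open>H\<close>, vanishes on both walls. Integrating the
  divergence over a slice therefore leaves only the \<open>x\<close>-derivative of
  \<open>P\<close>.\<close>

lemma P_decreasing:
 assumes x: "x0 < x1" "x1 <= x2"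
 shows "P x2 <= P x1 + 3 * k * de * (x2 - x1)"
proof -
 define D where "D = (%x. integral {0..1} (%y. Fx (x, y)))"
 have dP: "(P has_real_derivative D x) (at x)" and D: "D x <= 3 * k * de" if x: "x0 < x" for x
 proof -
  have "((%x. integral (cbox 0 1) (%y. F (x, y))) has_real_derivative integral (cbox 0 1) (%y. Fx (x, y))) (at x within {x0<..})"
  proof (rule leibniz_rule_field_derivative)
   show "((%x. F (x, y)) has_real_derivative Fx (x', y)) (at x' within {x0<..})" if "x' \<in> {x0<..}" for x' y
    using DERIV_F(1)[of x' y] that by (auto intro: has_field_derivative_at_within)
   show "(%y. F (x', y)) integrable_on cbox 0 1" if "x' \<in> {x0<..}" for x' using F_integrable[of x' "{0..1}" 0 1] that by simp
   have "continuous_on ({x0<..} \<times> cbox 0 (1::real)) Fx" by (rule continuous_on_subset[OF cont_F(2)]) auto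
   then show "continuous_on ({x0<..} \<times> cbox 0 1) (%(x, y). Fx (x, y))" by simp
  qed (use x in auto)
  then show "(P has_real_derivative D x) (at x)" using x unfolding P_def[abs_def] D_def
   by (simp add: at_within_open[of x "{x0<..}"])
  have "((%y. Hy (x, y)) has_integral H (x, 1) - H (x, 0)) {0..1}"
   by (rule fundamental_theorem_of_calculus)
    (use DERIV_F(2)[OF x] in "auto simp: has_real_derivative_iff_has_vector_derivative[symmetric] intro: has_field_derivative_at_within")
  moreover have "(x + h, 1) \<notin> G" "(x + h, 0) \<notin> G" using strip(2)[of "(x + h, 1)"] strip(1)[of "(x + h, 0)"] by auto
  then have "w (x, 1) = 0" "w (x, 0) = 0" by (simp_all add: w_def zero)
  then have "H (x, 1) = 0" "H (x, 0) = 0" using small_w[of "(x, 1)"] small_w[of "(x, 0)"] de by simp_all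
  ultimately have hH: "((%y. Hy (x, y)) has_integral 0) {0..1}" by simp
  have "(%y. Fx (x, y)) integrable_on {0..1}" using x
   by (intro integrable_continuous_interval continuous_on_compose2[OF cont_F(2)]) (auto intro!: continuous_intros)
  then have "((%y. Fx (x, y)) has_integral D x) {0..1}" unfolding D_def by (rule integrable_integral)
  from has_integral_add[OF this hH] have "((%y. Fx (x, y) + Hy (x, y)) has_integral D x) {0..1}" by simp
  moreover have "((%y. 3 * k * de) has_integral 3 * k * de) {0..1::real}" using has_integral_const_real[of "3 * k * de" 0 1] by simp
  ultimately show "D x <= 3 * k * de" by (rule has_integral_le) (use Fx_Hy_le x in auto)
 qed
 have "P x2 - 3 * k * de * x2 <= P x1 - 3 * k * de * x1"
 proof (rule DERIV_nonpos_imp_nonincreasing[OF x(2)])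
  fix x' assume "x1 <= x'" "x' <= x2"
  then show "\<exists>y. ((%a. P a - 3 * k * de * a) has_real_derivative y) (at x') & y <= 0"
   using dP[of x'] D[of x'] x by (intro exI[of _ "D x' - 3 * k * de"]) (auto intro!: derivative_eq_intros)
 qed
 then show ?thesis by (simp add: algebra_simps)
qed

end

context flux
begin

definition V :: "real * real => real" where "V p = px u p / u p"

lemma F_slopes:
 assumes x: "x0 < fst p" and w: "de < w p"
 shows "F p = u p * (Z0 de (w p) * (V p - V (p + (h, 0)))) - u p * V (p + (h, 0)) * (w p * Z1 de (w p) - Z0 de (w p))"
  "V (p + (h, 0)) <= V p" "u p * V (p + (h, 0)) <= 2"
proof -
 have w0: "0 < w p" using w de by simp
 note G = w_pos_in_G[OF w0 x]
 have up: "0 < u p" "0 < u (p + (h, 0))" using pos G by auto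
 have e: "p + (h, 0) = p + h *\<^sub>R (1, 0)" by simp
 have D: "dirD (1, 0) u = px u" by (simp add: dirD_def fun_eq_iff)
 show "F p = u p * (Z0 de (w p) * (V p - V (p + (h, 0)))) - u p * V (p + (h, 0)) * (w p * Z1 de (w p) - Z0 de (w p))"
  using up by (simp add: F_def V_def w_def[symmetric] field_simps)
 show "V (p + (h, 0)) <= V p"
  using slope_antimono[OF G(2), of h "(1, 0)"] G(1) h unfolding V_def D e[symmetric] by simp
 have "h * V (p + (h, 0)) <= ln (u (p + (h, 0))) - ln (u p)"
  using ln_slope(2)[OF G(2), of h "(1, 0)"] G(1) h unfolding V_def D e[symmetric] by simp
 also have "... <= u (p + (h, 0)) / u p - 1" using up ln_le_minus_one[of "u (p + (h, 0)) / u p"] by (simp add: ln_div)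
 finally have "h * V (p + (h, 0)) * u p <= u (p + (h, 0)) - u p" using up by (simp add: field_simps)
 also have "... <= 1" using le1[of "p + (h, 0)"] up by simp
 finally have "h * (u p * V (p + (h, 0))) <= 1" by (simp add: algebra_simps)
 show "u p * V (p + (h, 0)) <= 2"
 proof (rule ccontr)
  assume "\<not> u p * V (p + (h, 0)) <= 2"
  then have "1 / 2 * 2 < h * (u p * V (p + (h, 0)))" using h by (intro mult_le_less_imp_less) auto
  with \<open>h * (u p * V (p + (h, 0))) <= 1\<close> show False by simp
 qed
qed

text \<open>The term with the difference of slopes is nonnegative by log-concavity, and the
  correction in \<open>F_slopes\<close> is at most 2 times \<open>3 * de\<close>.\<close>

lemma F_lower:
 assumes x: "x0 < fst p"
 shows "- 6 * de <= F p" "0 < c ==> 2 * de <= c ==> c <= u p ==> c <= w p ==> c^2 / 8 * (V p - V (p + (h, 0))) - 6 * de <= F p"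
proof -
 have main: "u p * (Z0 de (w p) * (V p - V (p + (h, 0)))) - 6 * de <= F p" if w: "de < w p"
 proof -
  note S = F_slopes[OF x w]
  have w0: "0 < w p" using w de by simp
  note Z = Z_bounds[OF de w0]
  define E where "E = w p * Z1 de (w p) - Z0 de (w p)"
  have "u p * V (p + (h, 0)) * E <= 2 * E" using S(3) Z(6) unfolding E_def by (rule mult_right_mono)
  also have "... <= 6 * de" using Z(7) by (simp add: E_def)
  finally show ?thesis unfolding S(1) E_def[symmetric] by linarith
 qed
 show "- 6 * de <= F p"
 proof (cases "de < w p")
  case False then show ?thesis using small_w[of p] de by simp
 next
  case True
  have "0 <= u p * (Z0 de (w p) * (V p - V (p + (h, 0))))"
   using u_nonneg[of p] Z_bounds(1)[OF de, of "w p"] F_slopes(2)[OF x True] True de by simp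
  with main[OF True] show ?thesis by linarith
 qed
 assume c: "0 < c" "2 * de <= c" "c <= u p" "c <= w p"
 then have w: "de < w p" "0 < w p" using de by linarith+
 have V: "0 <= V p - V (p + (h, 0))" using F_slopes(2)[OF x w(1)] by simp
 have "c / 8 <= Z0 de (w p)" using Z_bounds(8)[OF de w(2)] c by linarith
 then have "c * (c / 8 * (V p - V (p + (h, 0)))) <= u p * (Z0 de (w p) * (V p - V (p + (h, 0))))"
  using c V by (intro mult_mono mult_right_mono) auto
 then show "c^2 / 8 * (V p - V (p + (h, 0))) - 6 * de <= F p" using main[OF w(1)] by (simp add: power2_eq_square)
qed

definition I :: "real => real" where "I x = integral {1 / 4..3 / 4} (%y. V (x, y))"

lemma V_integrable:
 assumes c: "0 < c" "!!y. 1 / 4 <= y ==> y <= 3 / 4 ==> c <= u (x, y)"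
 shows "(%y. V (x, y)) integrable_on {1 / 4..3 / 4}"
proof -
 have G: "(x, y) \<in> G" if "y \<in> {1 / 4..3 / 4}" for y using c(2)[of y] c(1) that zero[of "(x, y)"] by force
 then have "continuous_on {1 / 4..3 / 4} (%y. V (x, y))" unfolding V_def
  by (intro continuous_on_divide continuous_on_compose2[OF helmD(11)[OF hu]] continuous_on_compose2[OF cu])
    (use pos in "force intro!: continuous_intros")+
 then show ?thesis by (rule integrable_continuous_interval)
qed

lemma P_lower:
 assumes x: "x0 < x" and c: "0 < c" "2 * de <= c"
  "!!y. 1 / 4 <= y ==> y <= 3 / 4 ==> c <= u (x, y)" "!!y. 1 / 4 <= y ==> y <= 3 / 4 ==> c <= u (x + h, y)"
 shows "c^2 / 8 * (I x - I (x + h)) <= P x + 6 * de"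
proof -
 note i = V_integrable[OF c(1,3)] V_integrable[OF c(1,4)]
 have F: "(%y. F (x, y)) integrable_on {s..t}" if "0 <= s" "t <= 1" for s t
  by (rule F_integrable[OF x _ refl]) (use that in auto)
 have g: "(%y. F (x, y) + 6 * de) integrable_on {s..t}" if "0 <= s" "t <= 1" for s t
  by (intro integrable_add F that integrable_const_ivl)
 have "c^2 / 8 * (I x - I (x + h)) = integral {1 / 4..3 / 4} (%y. c\<^sup>2 / 8 * (V (x, y) - V (x + h, y)))"
  unfolding I_def integral_mult_right by (simp only: integral_diff[OF i])
 also have "... <= integral {1 / 4..3 / 4} (%y. F (x, y) + 6 * de)"
 proof (rule integral_le)
  show "(%y. c\<^sup>2 / 8 * (V (x, y) - V (x + h, y))) integrable_on {1 / 4..3 / 4}"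
   by (intro integrable_on_mult_right integrable_diff i)
  fix y :: real assume "y \<in> {1 / 4..3 / 4}"
  then show "c^2 / 8 * (V (x, y) - V (x + h, y)) <= F (x, y) + 6 * de"
   using F_lower(2)[of "(x, y)" c] x c by (simp add: w_def)
 qed (use g in simp)
 also have "... <= integral {0..1} (%y. F (x, y) + 6 * de)"
 proof (rule integral_subset_le[OF _ g g])
  show "\<forall>y\<in>{0..1}. 0 <= F (x, y) + 6 * de"
  proof
   show "0 <= F (x, y) + 6 * de" for y using F_lower(1)[of "(x, y)"] x by simp
  qed
 qed auto
 also have "... = P x + 6 * de"
  unfolding P_def using F[of 0 1] by (subst integral_add) auto
 finally show ?thesis .
qed

text \<open>The drops of slope over consecutive steps telescope, and each is bounded by the flux at
  its own abscissa, which is at most the flux at \<open>x\<close> plus the truncation error. So a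
  given total drop over \<open>n\<close> steps forces flux of that size divided by \<open>n\<close>
  already at \<open>x\<close>.\<close>

lemma P_sum:
 assumes x: "x0 < x" and c: "0 < c" "2 * de <= c"
  "!!j y. j <= n ==> 1 / 4 <= y ==> y <= 3 / 4 ==> c <= u (x + real j * h, y)"
 shows "c^2 / 8 * (I x - I (x + real n * h)) <= real n * (P x + 3 * k * de * real n + 6 * de)"
proof -
 have "c^2 / 8 * (I x - I (x + real j * h)) <= real j * (P x + 3 * k * de * real n + 6 * de)" if "j <= n" for j using that
 proof (induction j)
  case (Suc j)
  have "real j * h <= real n * 1" using Suc.prems h by (intro mult_mono) auto
  then have jh: "0 <= real j * h" "real j * h <= real n" using h by simp_all
  have e: "x + real j * h + h = x + real (Suc j) * h" by (simp add: algebra_simps)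
  have "c^2 / 8 * (I (x + real j * h) - I (x + real j * h + h)) <= P (x + real j * h) + 6 * de"
   by (rule P_lower) (use x c(1,2) c(3)[of j] c(3)[of "Suc j"] Suc.prems jh e in "auto simp: add.assoc algebra_simps")
  moreover have "P (x + real j * h) <= P x + 3 * k * de * (real j * h)" using P_decreasing[OF x, of "x + real j * h"] jh by simp
  moreover have "3 * k * de * (real j * h) <= 3 * k * de * real n" using jh k_nonneg de by (intro mult_left_mono) auto
  moreover have "c^2 / 8 * (I x - I (x + real j * h)) <= real j * (P x + 3 * k * de * real n + 6 * de)" using Suc by simp
  moreover have "c^2 / 8 * (I x - I (x + real (Suc j) * h)) = c^2 / 8 * (I x - I (x + real j * h)) + c^2 / 8 * (I (x + real j * h) - I (x + real j * h + h))"
   unfolding e by (simp add: right_diff_distrib)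
  moreover have "real (Suc j) * (P x + 3 * k * de * real n + 6 * de) = real j * (P x + 3 * k * de * real n + 6 * de) + (P x + 3 * k * de * real n + 6 * de)"
   by (simp add: algebra_simps)
  ultimately show ?case by linarith
 qed simp
 then show ?thesis by simp
qed

lemma integral_const_bound:
 assumes x: "x0 < x" and st: "0 <= s" "s <= t" "t <= 1" and F: "!!y. s <= y ==> y <= t ==> F (x, y) <= K"
 shows "integral {s..t} (%y. F (x, y)) <= K * (t - s)"
proof -
 have "integral {s..t} (%y. F (x, y)) <= integral {s..t} (%y. K)"
  by (intro integral_le F_integrable[OF x _ refl] integrable_const_ivl) (use st F in auto)
 then show ?thesis using st by (simp add: mult.commute)
qed

lemma P_le_layers:
 assumes x: "x0 < x" and st: "0 <= s" "s <= t" "t <= 1 / 2"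
  and F: "!!y. 0 <= y ==> y <= 1 ==> min y (1 - y) <= s ==> F (x, y) <= K1"
   "!!y. s <= y ==> y <= 1 - s ==> F (x, y) <= K2" "!!y. t <= y ==> y <= 1 - t ==> F (x, y) <= K3" and K: "0 <= K2" "0 <= K3"
 shows "P x <= 2 * s * K1 + 2 * t * K2 + K3"
proof -
 have i: "(%y. F (x, y)) integrable_on {a..c}" if "0 <= a" "c <= 1" for a c
  by (rule F_integrable[OF x _ refl]) (use that in auto)
 have cmb: "integral {a..e} (%y. F (x, y)) = integral {a..c} (%y. F (x, y)) + integral {c..e} (%y. F (x, y))"
  if "0 <= a" "a <= c" "c <= e" "e <= 1" for a c e using Henstock_Kurzweil_Integration.integral_combine[OF that(2,3) i[OF that(1,4)]] by simp
 have "P x = integral {0..s} (%y. F (x, y)) + (integral {s..t} (%y. F (x, y)) + (integral {t..1 - t} (%y. F (x, y))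
   + (integral {1 - t..1 - s} (%y. F (x, y)) + integral {1 - s..1} (%y. F (x, y)))))"
  unfolding P_def using st cmb[of 0 s 1] cmb[of s t 1] cmb[of t "1 - t" 1] cmb[of "1 - t" "1 - s" 1] by simp
 moreover have "integral {0..s} (%y. F (x, y)) <= K1 * (s - 0)" "integral {s..t} (%y. F (x, y)) <= K2 * (t - s)"
   "integral {t..1 - t} (%y. F (x, y)) <= K3 * (1 - t - t)" "integral {1 - t..1 - s} (%y. F (x, y)) <= K2 * (1 - s - (1 - t))"
   "integral {1 - s..1} (%y. F (x, y)) <= K1 * (1 - (1 - s))"
  using st by (intro integral_const_bound[OF x] F; simp)+
 moreover have "0 <= K2 * s" "0 <= K3 * t" using K st by simp_all
 ultimately show ?thesis by (simp add: algebra_simps)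
qed

end

locale flux_tube = tube G k u pm x0 L l b \<kappa> \<eta> + flux G k u pm x0 L h de
 for G k u pm x0 L l b \<kappa> \<eta> h de
begin

text \<open>Three layers. Within \<open>4 * b\<close> of a wall, \<open>u\<close> and its translate
  are at most \<open>14 * b\<close> and their gradients at most 66, whence
  \<open>F <= 2000 * b\<close>. Between there and depth \<open>d\<close>, \<open>W_bound\<close>
  gives order \<open>1 / l^2\<close>. Deeper inside, the hypothesis bounds the change of slope over
  the step by \<open>A\<close>.\<close>

lemma P_upper:
 assumes x: "x0 < x" "\<bar>x - fst pm\<bar> <= l / 8" and d: "0 < d" "16 * b <= d" "d <= 1 / 4" and A: "0 <= A"
  and hyp: "!!s y. 0 <= s ==> s <= 1 ==> d <= y ==> y <= 1 - d ==> Phi (1, 0) u (x + s, y) <= A * u (x + s, y)"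
 shows "P x <= 16000 * b^2 + 2 * d * ((C1^2 + 7 * C3) / l^2) + A + 6 * de * C1"
proof -
 define C7 where "C7 = C1^2 + 7 * C3"
 have C7: "0 <= C7" using C3 by (simp add: C7_def)
 have xs: "\<bar>x + s - fst pm\<bar> <= l / 4" "\<bar>x + s - fst pm\<bar> <= l / 2" "\<bar>x + s - fst pm\<bar> <= l" if "0 <= s" "s <= 1" for s
  using that x l by linarith+
 have deC: "3 * de * (C1 / l) <= 3 * de * C1"
 proof -
  have "C1 / l <= C1 / 1" using C1 l by (intro divide_left_mono) auto
  then show ?thesis using mult_left_mono[of "C1 / l" C1 "3 * de"] de by simp
 qed
 have step: "F (x, y) <= K + 3 * de * C1"
  if y: "2 * b <= y" "y <= 1 - 2 * b" and K: "0 <= K" "u (x, y) * u (x + h, y) * (V (x, y) - V (x + h, y)) <= K" for y K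
 proof (cases "de < w (x, y)")
  case False
  then have "F (x, y) = 0" using small_w[of "(x, y)"] by simp
  then show ?thesis using K de C1 by simp
 next
  case True
  note S = F_slopes[of "(x, y)", simplified, OF x(1) True]
  have w0: "0 < w (x, y)" using True de by simp
  note Z = Z_bounds[OF de w0]
  define E where "E = w (x, y) * Z1 de (w (x, y)) - Z0 de (w (x, y))"
  have E: "0 <= E" "E <= 3 * de" using Z(6,7) by (auto simp: E_def)
  have "u (x, y) * (Z0 de (w (x, y)) * (V (x, y) - V (x + h, y))) <= u (x, y) * (w (x, y) * (V (x, y) - V (x + h, y)))"
   using u_nonneg[of "(x, y)"] Z(2) S(2) by (intro mult_left_mono mult_right_mono) auto
  also have "... <= K" using K(2) by (simp add: w_def mult.assoc)
  finally have 1: "u (x, y) * (Z0 de (w (x, y)) * (V (x, y) - V (x + h, y))) <= K" .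
  have wG: "0 < u (x + h, y)" using w0 by (simp add: w_def)
  have "\<bar>V (x + h, y)\<bar> <= C1 / l"
   using ux_bound(1)[OF xs(2)[of h] y] h wG by (simp add: V_def abs_divide pos_divide_le_eq)
  then have "u (x, y) * (- V (x + h, y)) * E <= 1 * (C1 / l) * E"
   using u_nonneg[of "(x, y)"] le1[of "(x, y)"] E C1 l
   by (intro mult_right_mono order_trans[OF mult_left_mono[of "- V (x + h, y)" "C1 / l"] mult_right_mono]) auto
  also have "... <= 1 * (C1 / l) * (3 * de)" using E C1 l by (intro mult_left_mono) auto
  also have "... = 3 * de * (C1 / l)" by simp
  finally have "u (x, y) * (- V (x + h, y)) * E <= 3 * de * C1" using deC by linarith
  then have "- (u (x, y) * V (x + h, y) * E) <= 3 * de * C1" by simp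
  with 1 show ?thesis unfolding S(1) E_def[symmetric] by linarith
 qed
 have "P x <= 2 * (4 * b) * (2000 * b) + 2 * d * (C7 / l^2 + 3 * de * C1) + (A + 3 * de * C1)"
 proof (rule P_le_layers[OF x(1)])
  show "F (x, y) <= 2000 * b" if y: "0 <= y" "y <= 1" "min y (1 - y) <= 4 * b" for y
  proof (cases "de < w (x, y)")
   case False then show ?thesis using small_w[of "(x, y)"] b by simp
  next
   case True
   then have w0: "0 < w (x, y)" using de by simp
   note Z = Z_bounds[OF de w0] and G = w_pos_in_G[of "(x, y)", OF w0, simplified, OF x(1)]
   have ub: "u (x', y) <= 14 * b" for x'
   proof -
    have "u (x', y) <= 33 / 10 * min y (1 - y)" by (rule u_le_wall[OF y(1,2)])
    also have "... <= 33 / 10 * (4 * b)" using y(3) by (intro mult_left_mono) auto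
    finally show ?thesis using b by simp
   qed
   have pb: "\<bar>px u p\<bar> <= 66" if "p \<in> G" for p using partial_bound(1)[OF that] k_le(3) by linarith
   have "\<bar>Z0 de (w (x, y)) * px u (x, y)\<bar> <= 14 * b * 66"
    using ub[of "x + h"] Z(1,2) by (intro abs_mult_le pb G) (auto simp: w_def)
   moreover have "\<bar>u (x, y) * (Z1 de (w (x, y)) * px u (x + h, y))\<bar> <= 14 * b * (1 * 66)"
    using ub[of x] u_nonneg[of "(x, y)"] Z(3,4) by (intro abs_mult_le pb G) auto
   ultimately have "F (x, y) <= 14 * b * 66 + 14 * b * (1 * 66)" unfolding F_def by (simp add: abs_le_iff)
   then show ?thesis using b by simp
  qed
  show "F (x, y) <= C7 / l^2 + 3 * de * C1" if y: "4 * b <= y" "y <= 1 - 4 * b" for y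
  proof (rule step)
   show y2: "2 * b <= y" "y <= 1 - 2 * b" using y b by auto
   show "0 <= C7 / l^2" using C7 by simp
   have G: "(x + s, y) \<in> G" if "0 <= s" "s <= 1" for s by (rule tube_G[OF xs(3)[OF that]]) (use y b in auto)
   have Gx: "(x, y) \<in> G" using G[of 0] by simp
   \<comment> \<open>The Wronskian is estimated without dividing by \<open>u\<close>: after the mean
     value theorem the factor \<open>u (x, y)\<close>, linear in the wall distance, compensates the
     growth of the bound on \<open>W\<close> near the wall.\<close>
   define D where "D = (%s. u (x + s, y) * px u (x, y) - u (x, y) * px u (x + s, y))"
   have dD: "(D has_real_derivative px u (x + s, y) * px u (x, y) - u (x, y) * px (px u) (x + s, y)) (at s)"
    if "0 <= s" "s <= h" for s
   proof -
    have s1: "s <= 1" using that h by simp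
    have g: "((%t. x + t) has_real_derivative 1) (at s)" by (auto intro!: derivative_eq_intros)
    note d1 = DERIV_chain2[OF has_grad_x[OF helmD(2)[OF hu G[OF that(1) s1]]] g]
     and d2 = DERIV_chain2[OF has_grad_x[OF helmD(3)[OF hu G[OF that(1) s1]]] g]
    show ?thesis unfolding D_def by (rule DERIV_cong[OF DERIV_diff[OF DERIV_cmult_right[OF d1] DERIV_cmult[OF d2]]]) simp
   qed
   obtain s where s: "0 < s" "s < h" "D h - D 0 = (h - 0) * (px u (x + s, y) * px u (x, y) - u (x, y) * px (px u) (x + s, y))"
    using MVT2[of 0 h D, OF _ dD] h by auto
   have s1: "0 <= s" "s <= 1" using s h by auto
   define M where "M = min y (1 - y)"
   have M: "0 <= M" "M / 2 <= min (y - 2 * b) (1 - 2 * b - y)" using y b by (auto simp: M_def)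
   have W0: "0 <= W (x + s, y)" by (rule W_nonneg[OF xs(2)[OF s1] y2])
   have "W (x + s, y) * (M / 2) <= W (x + s, y) * min (y - 2 * b) (1 - 2 * b - y)" using M W0 by (intro mult_left_mono) auto
   also have "... <= C3 / l^2" by (rule W_bound[OF xs(1)[OF s1]]) (use y b in auto)
   finally have WM: "M * W (x + s, y) <= 2 * (C3 / l^2)" by (simp add: mult.commute)
   have "u (x, y) * (- px (px u) (x + s, y)) <= u (x, y) * W (x + s, y)"
    using u_nonneg[of "(x, y)"] u_nonneg[of "(x + s, y)"] by (intro mult_left_mono) (auto simp: W_def)
   also have "... <= 33 / 10 * M * W (x + s, y)" using u_le_wall[of y x] y b W0 by (intro mult_right_mono) (auto simp: M_def)
   also have "... <= 7 * (C3 / l^2)"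
   proof -
    have "0 <= C3 / l^2" using C3 by simp
    moreover have "33 / 10 * M * W (x + s, y) = 33 / 10 * (M * W (x + s, y))" by simp
    ultimately show ?thesis using WM by linarith
   qed
   finally have 1: "- (u (x, y) * px (px u) (x + s, y)) <= 7 * (C3 / l^2)" by simp
   have "\<bar>px u (x + s, y) * px u (x, y)\<bar> <= C1 / l * (C1 / l)"
    using ux_bound(2)[OF xs(2)[OF s1] y2] ux_bound(2)[OF xs(2)[of 0] y2] by (intro abs_mult_le) auto
   then have 2: "px u (x + s, y) * px u (x, y) <= C1^2 / l^2" by (simp add: power2_eq_square abs_le_iff)
   have "D h = h * (px u (x + s, y) * px u (x, y) - u (x, y) * px (px u) (x + s, y))"
    using s(3) by (simp add: D_def)
   also have "... <= h * (C7 / l^2)" using 1 2 h by (intro mult_left_mono) (simp_all add: C7_def add_divide_distrib)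
   also have "... <= 1 * (C7 / l^2)" using h C7 by (intro mult_right_mono) auto
   finally have "D h <= C7 / l^2" by simp
   moreover have "D h = u (x, y) * u (x + h, y) * (V (x, y) - V (x + h, y))"
    using pos[OF Gx] pos[OF G[of h]] h by (simp add: D_def V_def field_simps)
   ultimately show "u (x, y) * u (x + h, y) * (V (x, y) - V (x + h, y)) <= C7 / l^2" by simp
  qed
  show "F (x, y) <= A + 3 * de * C1" if y: "d <= y" "y <= 1 - d" for y
  proof (rule step)
   show "2 * b <= y" "y <= 1 - 2 * b" using y d b by auto
   have G: "(x + s, y) \<in> G" if "0 <= s" "s <= 1" for s by (rule tube_G[OF xs(3)[OF that]]) (use y d b in auto)
   have Gx: "(x, y) \<in> G" using G[of 0] by simp
   have e: "(x, y) + s *\<^sub>R (1, 0) = (x + s, y)" for s by simp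
   have dV: "((%s. V (x + s, y)) has_real_derivative - (Phi (1, 0) u (x + s, y) / u (x + s, y))) (at s)" if "0 <= s" "s <= h" for s
    using ln_line(2)[of "(x, y)" s "(1, 0)"] G[of s] that h unfolding e dirD_x V_def by simp
   obtain s where s: "0 < s" "s < h" "V (x + h, y) - V (x + 0, y) = (h - 0) * - (Phi (1, 0) u (x + s, y) / u (x + s, y))"
    using MVT2[of 0 h "%s. V (x + s, y)", OF _ dV] h by auto
   have "Phi (1, 0) u (x + s, y) / u (x + s, y) <= A" using hyp[of s y] y s h pos[OF G[of s]] by (simp add: pos_divide_le_eq)
   then have "h * (Phi (1, 0) u (x + s, y) / u (x + s, y)) <= 1 * A"
    using h Phi_nonneg[OF G[of s], of "(1, 0)"] u_nonneg[of "(x + s, y)"] s by (intro mult_mono) auto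
   then have VA: "V (x, y) - V (x + h, y) <= A" using s(3) by simp
   have uu: "0 <= u (x, y) * u (x + h, y)" "u (x, y) * u (x + h, y) <= 1"
    using u_nonneg le1 by (auto intro!: mult_le_one)
   have "u (x, y) * u (x + h, y) * (V (x, y) - V (x + h, y)) <= u (x, y) * u (x + h, y) * A" using VA uu by (intro mult_left_mono) auto
   also have "... <= 1 * A" using uu A by (intro mult_right_mono) auto
   finally show "u (x, y) * u (x + h, y) * (V (x, y) - V (x + h, y)) <= A" by simp
  qed (use A in auto)
 qed (use b d A C1 C7 de in auto)
 moreover have "2 * d * (3 * de * C1) <= 1 * (3 * de * C1)" using d de C1 by (intro mult_right_mono) auto
 moreover have "2 * d * (C7 / l^2 + 3 * de * C1) = 2 * d * (C7 / l^2) + 2 * d * (3 * de * C1)" by (simp add: distrib_left)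
 moreover have "2 * (4 * b) * (2000 * b) = 16000 * b^2" by (simp add: power2_eq_square)
 ultimately show ?thesis unfolding C7_def by linarith
qed

end

section \<open>A lower bound for the longitudinal second derivative at one point\<close>

context tube
begin

text \<open>A slope drop of \<open>a / L\<close> on the heights between 1/4 and 3/4, spread over at
  most \<open>600 * L\<close> steps, needs flux c^2 / 8 * (a / (2 * L)) / (600 * L) at
  \<open>x\<close>, which is the right side of \<open>num\<close>. If \<open>Phi (1, 0) u\<close>
  stayed below \<open>A * u\<close> on the whole box, \<open>P_upper\<close> would bound the flux by
  the left side.\<close>

lemma Phi_x_point:
 assumes x: "x0 < x" "\<bar>x - fst pm\<bar> <= l / 8" and d: "0 < d" "16 * b <= d" "d <= 1 / 4" and A: "0 <= A"
  and xm: "x + 2 <= xm" "xm <= x + 300 * L" and c: "0 < c"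
   "!!x' y. x <= x' ==> x' <= xm ==> 1 / 4 <= y ==> y <= 3 / 4 ==> c <= u (x', y)"
  and a: "!!y. 1 / 4 <= y ==> y <= 3 / 4 ==> a / L <= px u (x, y) / u (x, y) - px u (xm, y) / u (xm, y)"
  and num: "16000 * b^2 + 2 * d * ((C1^2 + 7 * C3) / l^2) + A < c^2 * a / (9600 * L^2)"
 shows "\<exists>s y. 0 <= s & s <= 1 & d <= y & y <= 1 - d & A * u (x + s, y) < Phi (1, 0) u (x + s, y)"
proof (rule ccontr)
 assume "\<not> ?thesis"
 then have hyp: "Phi (1, 0) u (x + s, y) <= A * u (x + s, y)" if "0 <= s" "s <= 1" "d <= y" "y <= 1 - d" for s y
  using that by (meson not_le)
 \<comment> \<open>Equal steps with length between 1/2 and 1, so that the last translate lands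
   exactly on \<open>xm\<close>.\<close>
 define n where "n = nat \<lceil>xm - x\<rceil>"
 define h where "h = (xm - x) / real n"
 have n: "xm - x <= real n" "real n <= xm - x + 1" using xm(1) by (auto simp: n_def)
 have n0: "0 < real n" using n xm by linarith
 have h: "1 / 2 <= h" "h <= 1" "real n * h = xm - x" using n n0 xm(1) by (auto simp: h_def field_simps)
 have nL: "real n <= 600 * L" using n xm L by linarith
 \<comment> \<open>\<open>gap\<close> does not depend on \<open>de\<close>, whereas all truncation
   errors together are at most \<open>de * Q\<close>; a small \<open>de\<close> gives the
   contradiction.\<close>
 define gap where "gap = c^2 * a / (9600 * L^2) - (16000 * b^2 + 2 * d * ((C1^2 + 7 * C3) / l^2) + A)"
 define Q where "Q = 6 * C1 + 3 * k * (600 * L) + 6"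
 have Q: "0 < Q" using C1 k_nonneg L by (simp add: Q_def add_pos_nonneg add_nonneg_pos)
 have gap: "0 < gap" using num by (simp add: gap_def)
 have "gap <= de * Q" if de: "0 < de" "2 * de <= c" for de
 proof -
  interpret f: flux_tube G k u pm x0 L l b \<kappa> \<eta> h de by unfold_locales (use h de in auto)
  have "c^2 / 8 * (f.I x - f.I (x + real n * h)) <= real n * (f.P x + 3 * k * de * real n + 6 * de)"
  proof (rule f.P_sum[OF x(1) c(1) de(2)])
   fix j y assume j: "j <= n" and y: "1 / 4 <= y" "y <= (3 / 4 :: real)"
   have "real j * h <= real n * h" "0 <= real j * h" using j h by (intro mult_right_mono mult_nonneg_nonneg; simp)+
   then show "c <= u (x + real j * h, y)" using h(3) y by (intro c(2)) auto
  qed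
  moreover have "f.I x - f.I (x + real n * h) \<ge> a / (2 * L)"
  proof -
   have i: "(%y. f.V (x, y)) integrable_on {1 / 4..3 / 4}" "(%y. f.V (xm, y)) integrable_on {1 / 4..3 / 4}"
    using xm by (auto intro!: f.V_integrable[OF c(1)] c(2))
   have "integral {1 / 4..3 / 4} (%y::real. a / L) <= integral {1 / 4..3 / 4} (%y. f.V (x, y) - f.V (xm, y))"
    by (rule integral_le) (use i a in "auto simp: f.V_def intro!: integrable_diff")
   then show ?thesis using h(3) by (simp add: f.I_def integral_diff[OF i])
  qed
  then have "c^2 / 8 * (a / (2 * L)) <= c^2 / 8 * (f.I x - f.I (x + real n * h))" by (intro mult_left_mono) auto
  ultimately have 1: "c^2 / 8 * (a / (2 * L)) <= real n * (f.P x + 3 * k * de * real n + 6 * de)" by linarith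
  define R where "R = f.P x + 3 * k * de * (600 * L) + 6 * de"
  have "3 * k * de * real n <= 3 * k * de * (600 * L)" using nL k_nonneg de by (intro mult_left_mono) auto
  then have "real n * (f.P x + 3 * k * de * real n + 6 * de) <= real n * R" by (intro mult_left_mono) (auto simp: R_def)
  with 1 have 2: "c^2 / 8 * (a / (2 * L)) <= real n * R" by linarith
  have gapc: "0 <= 16000 * b^2 + 2 * d * ((C1^2 + 7 * C3) / l^2) + A" using d C3 A by simp
  have "0 < c^2 * a / (9600 * L^2)" using gapc num by linarith
  then have a0: "0 < a" using c L by (simp add: zero_less_divide_iff zero_less_mult_iff)
  have "0 < c^2 / 8 * (a / (2 * L))" using a0 c L by simp
  then have "0 < real n * R" using 2 by linarith
  then have "0 <= R" using n0 by (simp add: zero_less_mult_iff)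
  then have "real n * R <= 600 * L * R" using nL by (intro mult_right_mono)
  with 2 have "c^2 / 8 * (a / (2 * L)) <= R * (600 * L)" by (simp only: mult.commute)
  then have "c^2 / 8 * (a / (2 * L)) / (600 * L) <= R" using L by (subst pos_divide_le_eq) auto
  moreover have "c^2 / 8 * (a / (2 * L)) / (600 * L) = c^2 * a / (9600 * L^2)" by (simp add: power2_eq_square)
  moreover have "f.P x <= 16000 * b^2 + 2 * d * ((C1^2 + 7 * C3) / l^2) + A + 6 * de * C1"
   by (rule f.P_upper[OF x d A hyp])
  moreover have "de * Q = 6 * de * C1 + 3 * k * de * (600 * L) + 6 * de" by (simp add: Q_def algebra_simps)
  ultimately show ?thesis unfolding gap_def R_def by linarith
 qed
 from this[of "min (c / 2) (gap / (2 * Q))"] have "gap <= min (c / 2) (gap / (2 * Q)) * Q" using c Q gap by auto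
 also have "... <= gap / (2 * Q) * Q" using Q by (intro mult_right_mono) auto
 also have "... = gap / 2" using Q by simp
 finally show False using gap by simp
qed

end

section \<open>The Hessian of the logarithm\<close>

text \<open>Divided by \<open>l^2\<close>, this bounds the gradient of \<open>Phi (1, 0) u\<close>
  at depth \<open>e\<close>. The denominator holds the square of the lower bound for
  \<open>u\<close> from \<open>u_deep\<close>, and \<open>e^2\<close> from the interior
  estimates.\<close>

definition cQ :: "real => real => real => real" where
 "cQ \<kappa> \<eta> e = (3 * c4 \<kappa> \<eta> + 2 * c1 \<kappa> * c4 \<kappa> \<eta> + c1 \<kappa> ^ 3 + 164 * (c1 \<kappa>)^2) / ((\<kappa> * e / 2)^2 * e^2)"

lemma cQ_pos: "0 < \<kappa> ==> 0 < \<eta> ==> 0 < e ==> 0 < cQ \<kappa> \<eta> e"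
 unfolding cQ_def using c_pos[of \<kappa> \<eta>] by (intro divide_pos_pos add_pos_pos mult_pos_pos) auto

text \<open>Three demands on the discs in \<open>Phi_x_spread\<close>: the zeroth order constant of
  \<open>Phi_supersol\<close> must permit the chain step, tripled discs must stay at depth
  \<open>e\<close>, and the gradient bound \<open>cQ\<close> may cost at most half of the initial
  value.\<close>

definition crad :: "real => real => real => real => real" where
 "crad \<kappa> \<eta> \<alpha> e = min (\<kappa> * e / 2 / 600) (min (e / 3) (\<alpha> * (\<kappa> * e / 2) / (4 * cQ \<kappa> \<eta> e)))"

context tube
begin

lemma u_deep: "\<bar>x - fst pm\<bar> <= l ==> 2 * b <= e ==> e <= 1 / 2 ==> e <= y ==> y <= 1 - e ==> \<kappa> * e / 2 <= u (x, y)"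
proof -
 assume *: "\<bar>x - fst pm\<bar> <= l" "2 * b <= e" "e <= 1 / 2" "e <= y" "y <= 1 - e"
 have "\<kappa> / 2 * e <= \<kappa> / 2 * min y (1 - y)" using * \<kappa> by (intro mult_left_mono) auto
 then show ?thesis using u_le_tube[of x y] * by simp
qed

lemma partials_le: "p \<in> G ==> \<bar>px u p\<bar> <= 66" "p \<in> G ==> \<bar>py u p\<bar> <= 66"
 using partial_bound[of p] k_le(3) by linarith+

lemma Phi_x_le:
 assumes x: "\<bar>x - fst pm\<bar> <= l / 8" and d: "0 < d" "16 * b <= d" "d <= 1 / 4" and y: "d <= y" "y <= 1 - d"
 shows "Phi (1, 0) u (x, y) <= (C1^2 + C4) / (d * l^2)"
proof -
 have G: "(x, y) \<in> G" by (rule tube_G) (use x y d b l in auto)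
 have up: "0 < u (x, y)" "u (x, y) <= 1" using pos[OF G] le1 by auto
 have "\<bar>px u (x, y)\<bar> <= C1 * u (x, y) / l" by (rule ux_bound(1)) (use x y d b l in auto)
 then have "(px u (x, y))^2 <= (C1 * u (x, y) / l)^2" by (metis abs_ge_zero power2_abs power_mono)
 then have "(px u (x, y))^2 / u (x, y) <= C1^2 / l^2 * u (x, y)"
  using up by (simp add: power_divide power_mult_distrib power2_eq_square field_simps)
 also have "... <= C1^2 / l^2 * 1" using up by (intro mult_left_mono) auto
 also have "... <= C1^2 / (d * l^2)" using d l by (simp add: divide_left_mono)
 finally have "(px u (x, y))^2 / u (x, y) <= C1^2 / (d * l^2)" .
 then show ?thesis using interior_derivatives(1)[OF d x y] by (simp add: Phi_def dirD_x add_divide_distrib abs_le_iff)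
qed

abbreviation Q :: "real => real" where "Q \<equiv> cQ \<kappa> \<eta>"

lemmas Q = cQ_pos[OF \<kappa>(1) \<eta>(1)]

lemma grad_Phi_x:
 assumes x: "\<bar>x - fst pm\<bar> <= l / 8" and e: "0 < e" "16 * b <= e" "e <= 1 / 4" and y: "e <= y" "y <= 1 - e"
 obtains gx gy where "has_grad (Phi (1, 0) u) (x, y) gx gy" "\<bar>gx\<bar> <= Q e / l^2" "\<bar>gy\<bar> <= Q e / l^2"
proof -
 define U where "U = \<kappa> * e / 2"
 have G: "(x, y) \<in> G" by (rule tube_G) (use x y e b l in auto)
 have U: "0 < U" "U <= u (x, y)" "U <= 1" using \<kappa> e u_deep[of x e y] x y b l mult_le_one[of \<kappa> e] by (auto simp: U_def)
 note id = interior_derivatives[OF e x y]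
 have C: "0 < C1" "0 < C4" using C1 C4 by auto
 have i: "\<bar>inverse (u (x, y))\<bar> <= inverse U" using U by (simp add: le_imp_inverse_le)
 have ux: "\<bar>px u (x, y)\<bar> <= C1 / l" by (rule ux_bound(2)) (use x y e b l in auto)
 note uy = partials_le(2)[OF G]
 have iU: "1 <= inverse U" using U by (simp add: one_le_inverse)
 define E where "E = inverse U * inverse U / (e^2 * l^2)"
 have El: "1 / l^2 <= E" "inverse U / l^2 <= E" "1 / (e^2 * l^2) <= E" "inverse U / (e * l^2) <= E" "inverse U * inverse U / l^2 <= E" "0 < E"
 proof -
  have iU2: "1 <= inverse U * inverse U" "inverse U <= inverse U * inverse U" "0 < inverse U * inverse U"
   using iU U mult_mono[OF iU iU] mult_left_mono[OF iU, of "inverse U"] by simp_all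
  have el: "0 < e^2 * l^2" "e^2 * l^2 <= l^2" "e^2 * l^2 <= e * l^2"
   using e l by (auto simp: power2_eq_square intro!: mult_left_le_one_le mult_le_one mult_right_mono)
  show "1 / l^2 <= E" "inverse U / l^2 <= E" "1 / (e^2 * l^2) <= E" "inverse U / (e * l^2) <= E" "inverse U * inverse U / l^2 <= E"
   unfolding E_def by (rule frac_le; use iU iU2 el in linarith)+
  show "0 < E" unfolding E_def using iU2(3) el(1) by (rule divide_pos_pos)
 qed
 have QE: "Q e / l^2 = (3 * C4 + 2 * C1 * C4 + C1 ^ 3 + 164 * C1^2) * E"
 proof -
  define N where "N = 3 * C4 + 2 * C1 * C4 + C1 ^ 3 + 164 * C1^2"
  have "Q e = N / (U^2 * e^2)" by (simp only: cQ_def N_def U_def)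
  then have "Q e / l^2 = N * E" by (simp add: E_def divide_inverse power2_eq_square mult_ac)
  then show ?thesis by (simp only: N_def)
 qed
 have pyy: "py (dirD (1, 0) (dirD (1, 0) u)) (x, y) = - py W (x, y) + C1^2 / l^2 * py u (x, y)"
 proof -
  have "py W (x, y) = (-1) * py (px (px u)) (x, y) + C1^2 / l^2 * py u (x, y)"
   unfolding W_def by (rule has_grad_partials(2)[OF has_grad_lincomb[OF helmD(2)[OF helm_partial_x[OF helm_partial_x[OF hu k_nonneg] k_nonneg] G] helmD(2)[OF hu G]]])
  then show ?thesis by (simp add: dirD_x)
 qed
 define r where "r = 1 / l"
 have r: "0 < r" "r <= 1" "r * r = 1 / l^2" using l by (auto simp: r_def power2_eq_square)
 have "has_grad (Phi (1, 0) u) (x, y)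
   (2 * dirD (1, 0) u (x, y) * px (dirD (1, 0) u) (x, y) / u (x, y) - (dirD (1, 0) u (x, y))^2 * px u (x, y) / (u (x, y))^2 - px (dirD (1, 0) (dirD (1, 0) u)) (x, y))
   (2 * dirD (1, 0) u (x, y) * py (dirD (1, 0) u) (x, y) / u (x, y) - (dirD (1, 0) u (x, y))^2 * py u (x, y) / (u (x, y))^2 - py (dirD (1, 0) (dirD (1, 0) u)) (x, y))"
  by (rule has_grad_Phi[OF hu k_nonneg G]) (use U in auto)
 moreover
 have a1: "\<bar>px u (x, y) * px (px u) (x, y) * inverse (u (x, y))\<bar> <= C1 * C4 * E"
 proof -
  have "\<bar>px u (x, y) * px (px u) (x, y) * inverse (u (x, y))\<bar> <= C1 / l * (C4 / (e * l^2)) * inverse U"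
   by (intro abs_mult_le ux id(1) i)
  also have "... = C1 * C4 * (inverse U / (e * l^2) * r)" by (simp add: r_def)
  also have "... <= C1 * C4 * (E * 1)" using El r C by (intro mult_left_mono mult_mono) auto
  finally show ?thesis by simp
 qed
 have a2: "\<bar>px u (x, y) * px u (x, y) * px u (x, y) * (inverse (u (x, y)) * inverse (u (x, y)))\<bar> <= C1 ^ 3 * E"
 proof -
  have "\<bar>px u (x, y) * px u (x, y) * px u (x, y) * (inverse (u (x, y)) * inverse (u (x, y)))\<bar> <= C1 / l * (C1 / l) * (C1 / l) * (inverse U * inverse U)"
   by (intro abs_mult_le ux i)
  also have "... = C1 ^ 3 * (inverse U * inverse U / l^2 * r)" by (simp add: r_def power2_eq_square power3_eq_cube)
  also have "... <= C1 ^ 3 * (E * 1)" using El r C by (intro mult_left_mono mult_mono) auto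
  finally show ?thesis by simp
 qed
 have a3: "\<bar>px (px (px u)) (x, y)\<bar> <= 2 * C4 * E"
 proof -
  have "2 * C4 * (1 / (e^2 * l^2)) <= 2 * C4 * E" using El C by (intro mult_left_mono) auto
  then show ?thesis using id(5) by simp
 qed
 have b1: "\<bar>px u (x, y) * py (px u) (x, y) * inverse (u (x, y))\<bar> <= 16 * C1^2 * E"
 proof -
  have "\<bar>px u (x, y) * py (px u) (x, y) * inverse (u (x, y))\<bar> <= C1 / l * (16 * C1 / (e * l)) * inverse U"
   by (intro abs_mult_le ux id(2) i)
  also have "... = 16 * C1^2 * (inverse U / (e * l^2))" by (simp add: power2_eq_square mult_ac)
  also have "... <= 16 * C1^2 * E" using El C by (intro mult_left_mono) auto
  finally show ?thesis .
 qed
 have b2: "\<bar>px u (x, y) * px u (x, y) * py u (x, y) * (inverse (u (x, y)) * inverse (u (x, y)))\<bar> <= 66 * C1^2 * E"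
 proof -
  have "\<bar>px u (x, y) * px u (x, y) * py u (x, y) * (inverse (u (x, y)) * inverse (u (x, y)))\<bar> <= C1 / l * (C1 / l) * 66 * (inverse U * inverse U)"
   by (intro abs_mult_le ux uy i)
  also have "... = 66 * C1^2 * (inverse U * inverse U / l^2)" by (simp add: power2_eq_square)
  also have "... <= 66 * C1^2 * E" using El C by (intro mult_left_mono) auto
  finally show ?thesis .
 qed
 have b3: "\<bar>py (dirD (1, 0) (dirD (1, 0) u)) (x, y)\<bar> <= C4 * E + 66 * C1^2 * E"
 proof -
  have "\<bar>C1\<^sup>2 / l^2 * py u (x, y)\<bar> <= C1^2 / l^2 * 66" by (intro abs_mult_le uy) simp
  moreover have "66 * C1^2 * (1 / l^2) <= 66 * C1^2 * E" "C4 * (1 / (e^2 * l^2)) <= C4 * E" using El C by (intro mult_left_mono; simp)+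
  moreover have "C1^2 / l^2 * 66 = 66 * C1^2 * (1 / l^2)" "C4 / (e^2 * l^2) = C4 * (1 / (e^2 * l^2))" by simp_all
  ultimately show ?thesis using id(4) unfolding pyy by linarith
 qed
 have nn: "0 <= C1 * C4 * E" "0 <= C1 ^ 3 * E" "0 <= C4 * E" "0 <= C1^2 * E" using C El by auto
 show ?thesis
 proof (rule that)
  show "has_grad (Phi (1, 0) u) (x, y)
   (2 * (px u (x, y) * px (px u) (x, y) * inverse (u (x, y))) - px u (x, y) * px u (x, y) * px u (x, y) * (inverse (u (x, y)) * inverse (u (x, y))) - px (px (px u)) (x, y))
   (2 * (px u (x, y) * py (px u) (x, y) * inverse (u (x, y))) - px u (x, y) * px u (x, y) * py u (x, y) * (inverse (u (x, y)) * inverse (u (x, y))) - py (dirD (1, 0) (dirD (1, 0) u)) (x, y))"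
   using calculation by (simp add: dirD_x divide_inverse power2_eq_square mult.assoc)
  show "\<bar>2 * (px u (x, y) * px (px u) (x, y) * inverse (u (x, y))) - px u (x, y) * px u (x, y) * px u (x, y) * (inverse (u (x, y)) * inverse (u (x, y))) - px (px (px u)) (x, y)\<bar> <= Q e / l^2"
   unfolding QE distrib_right using a1 a2 a3 nn by linarith
  show "\<bar>2 * (px u (x, y) * py (px u) (x, y) * inverse (u (x, y))) - px u (x, y) * px u (x, y) * py u (x, y) * (inverse (u (x, y)) * inverse (u (x, y))) - py (dirD (1, 0) (dirD (1, 0) u)) (x, y)\<bar> <= Q e / l^2"
   unfolding QE distrib_right using b1 b2 b3 nn by linarith
 qed
qed

text \<open>Start and end are at distance at most 3, so the number \<open>n\<close> of discs, and
  the factor \<open>8 ^ n\<close>, do not depend on \<open>l\<close>. All constants of the chain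
  come from the depth \<open>e\<close> alone, because \<open>u\<close> is bounded below
  there.\<close>

lemma Phi_x_spread:
 assumes x2: "\<bar>x2 - fst pm\<bar> <= l / 16" and d: "0 < d" "32 * b <= d" "d <= 1 / 4" and y2: "d <= y2" "y2 <= 1 - d" and \<alpha>: "0 < \<alpha>"
  and low: "\<alpha> / l^2 * u (x2, y2) <= Phi (1, 0) u (x2, y2)" and x: "\<bar>x - x2\<bar> <= 2" and y: "d <= y" "y <= 1 - d"
  and e: "e = d / 2" and n: "n = nat \<lceil>3 / crad \<kappa> \<eta> \<alpha> e\<rceil>"
 shows "\<alpha> * (\<kappa> * e / 2) / (2 * l^2) / 8 ^ n <= Phi (1, 0) u (x, y)"
proof -
 define U where "U = \<kappa> * e / 2"
 define r where "r = crad \<kappa> \<eta> \<alpha> e"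
 have e': "0 < e" "16 * b <= e" "e <= 1 / 4" using d by (auto simp: e)
 have U: "0 < U" "U <= 1" using \<kappa> e' mult_le_one[of \<kappa> e] by (auto simp: U_def)
 have r: "0 < r" "r <= U / 600" "3 * r <= e" "4 * Q e * r <= \<alpha> * U"
 proof -
  have q: "0 < 4 * Q e" using Q[OF e'(1)] by simp
  show "0 < r" "r <= U / 600" "3 * r <= e" using e' U \<alpha> q unfolding r_def crad_def U_def[symmetric] by auto
  have "r <= \<alpha> * U / (4 * Q e)" unfolding r_def crad_def U_def[symmetric] by simp
  then show "4 * Q e * r <= \<alpha> * U" unfolding pos_le_divide_eq[OF q] by (simp add: mult.commute)
 qed
 define S where "S = {fst pm - l / 8..fst pm + l / 8} \<times> {e..1 - e}"
 have Sx: "\<bar>fst p - fst pm\<bar> <= l / 8" "e <= snd p" "snd p <= 1 - e" if "p \<in> S" for p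
  using that unfolding S_def mem_Times_iff atLeastAtMost_iff by linarith+
 have SG: "p \<in> G" if "p \<in> S" for p
  using tube_G[of "fst p" "snd p"] Sx[OF that] e' b l by simp
 have Su: "U <= u p" if "p \<in> S" for p
  using u_deep[of "fst p" e "snd p"] Sx[OF that] e' b l by (simp add: U_def)
 have cS: "convex S" unfolding S_def by (intro convex_Times convex_real_interval)
 define T where "T = {fst pm - l / 8 + 1..fst pm + l / 8 - 1} \<times> {d..1 - d}"
 have cT: "convex T" unfolding T_def by (intro convex_Times convex_real_interval)
 have TS: "cball z e \<subseteq> S" if "z \<in> T" for z
 proof
  fix p assume "p \<in> cball z e"
  then have "\<bar>fst z - fst p\<bar> <= e" "\<bar>snd z - snd p\<bar> <= e" using dist_fst_le[of z p] dist_snd_le[of z p] by (auto simp: dist_real_def)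
  then show "p \<in> S" using that e' unfolding S_def T_def mem_Times_iff atLeastAtMost_iff e by linarith
 qed
 have p2: "(x2, y2) \<in> T" and p: "(x, y) \<in> T"
  using x2 x y y2 l unfolding T_def mem_Times_iff atLeastAtMost_iff fst_conv snd_conv by linarith+
 show ?thesis unfolding U_def[symmetric]
 proof (rule chain_lower[OF r(1), where a = "(x2, y2)" and b = "(x, y)" and G = S and C = "2 * (10 + 8712 / U^2)" and n = n])
  show "0 <= 2 * (10 + 8712 / U^2)" by simp
  have "(3 * r)^2 <= (U / 200)^2" using r by (intro power_mono) auto
  then have "2 * (10 + 8712 / U^2) * (3 * r)^2 <= 2 * (10 + 8712 / U^2) * (U / 200)^2" by (intro mult_left_mono) auto
  also have "... = (20 * U^2 + 17424) / 40000" using U by (simp add: power_divide field_simps)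
  also have "... <= 4"
  proof -
   have "U^2 <= 1" using U by (intro power_le_one) auto
   then show ?thesis by simp
  qed
  finally show "2 * (10 + 8712 / U^2) * (3 * r)^2 <= 4" .
  show "0 <= \<alpha> * U / (2 * l^2)" using \<alpha> U by simp
  show "cball z (3 * r) \<subseteq> S" if "z \<in> closed_segment (x2, y2) (x, y)" for z
   using TS[of z] closed_segment_subset[OF p2 p cT] that subset_cball[OF r(3), of z] by blast
  show "continuous_on S (Phi (1, 0) u)" using SG by (intro continuous_on_subset[OF cont_Phi]) auto
  show "0 <= Phi (1, 0) u q" if "q \<in> S" for q by (rule Phi_nonneg[OF SG[OF that]])
  show "supersol (- (2 * (10 + 8712 / U^2))) (Phi (1, 0) u) q" if q: "q \<in> S" for q
  proof (rule Phi_supersol[OF SG[OF q]])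
   have "(px u q)^2 <= 66^2" "(py u q)^2 <= 66^2" using partials_le[OF SG[OF q]] by (metis abs_ge_zero power2_abs power_mono)+
   then have "((px u q)^2 + (py u q)^2) / (u q)^2 <= 8712 / U^2"
    using U Su[OF q] by (intro frac_le power_mono) auto
   then show "2 * (k + ((px u q)^2 + (py u q)^2) / (u q)^2) <= 2 * (10 + 8712 / U^2)" using k_le(1) by (intro mult_left_mono add_mono) simp_all
  qed
  have "dist (x2, y2) (x, y) <= \<bar>x2 - x\<bar> + \<bar>y2 - y\<bar>"
   using sqrt_sum_squares_le_sum_abs[of "x2 - x" "y2 - y"] by (simp add: dist_prod_def dist_real_def)
  also have "... <= 3" using x y y2 d by linarith
  also have "3 <= real n * r"
  proof -
   have "3 / r <= real n" unfolding n r_def by linarith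
   then show ?thesis using r(1) by (simp add: field_simps)
  qed
  finally show "dist (x2, y2) (x, y) <= real n * r" .
  show "(x, y) \<in> cball (x, y) r" using r by simp
  show "\<alpha> * U / (2 * l^2) <= Phi (1, 0) u q" if q: "q \<in> cball (x2, y2) r" for q
  proof -
   have qS: "closed_segment (x2, y2) q \<subseteq> S"
   proof -
    have "cball (x2, y2) r \<subseteq> S" using TS[OF p2] subset_cball[of r e "(x2, y2)"] r by auto
    moreover have "closed_segment (x2, y2) q \<subseteq> cball (x2, y2) r" using q r by (intro closed_segment_subset) auto
    ultimately show ?thesis by blast
   qed
   define gx where "gx = (%z. px (Phi (1, 0) u) z)"
   define gy where "gy = (%z. py (Phi (1, 0) u) z)"
   have g: "has_grad (Phi (1, 0) u) z (gx z) (gy z) & \<bar>gx z\<bar> <= Q e / l^2 & \<bar>gy z\<bar> <= Q e / l^2" if zS: "z \<in> S" for z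
   proof -
    obtain a c where ac: "has_grad (Phi (1, 0) u) (fst z, snd z) a c" "\<bar>a\<bar> <= Q e / l^2" "\<bar>c\<bar> <= Q e / l^2"
     using grad_Phi_x[OF Sx(1)[OF zS] e' Sx(2,3)[OF zS]] by blast
    then show ?thesis using has_grad_partials[OF ac(1)] by (simp add: gx_def gy_def)
   qed
   have "\<bar>Phi (1, 0) u q - Phi (1, 0) u (x2, y2)\<bar> <= Q e / l^2 * \<bar>fst q - fst (x2, y2)\<bar> + Q e / l^2 * \<bar>snd q - snd (x2, y2)\<bar>"
    by (rule lipschitz_segment[where a = gx and b = gy]) (use g qS in blast)+
   also have "... <= Q e / l^2 * r + Q e / l^2 * r"
    using q Q[OF e'(1)] dist_fst_le[of q "(x2, y2)"] dist_snd_le[of q "(x2, y2)"]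
    by (intro add_mono mult_left_mono) (auto simp: dist_real_def dist_commute)
   also have "... = 4 * Q e * r / (2 * l^2)" by simp
   also have "... <= \<alpha> * U / (2 * l^2)" using r(4) by (intro divide_right_mono) auto
   finally have "Phi (1, 0) u (x2, y2) - \<alpha> * U / (2 * l^2) <= Phi (1, 0) u q" by linarith
   moreover have "\<alpha> / l^2 * U <= \<alpha> / l^2 * u (x2, y2)"
   proof (rule mult_left_mono[OF Su])
    show "(x2, y2) \<in> S" using subsetD[OF TS[OF p2], of "(x2, y2)"] e' by simp
   qed (use \<alpha> in simp)
   moreover have "\<alpha> / l^2 * U = \<alpha> * U / (2 * l^2) + \<alpha> * U / (2 * l^2)" by simp
   ultimately show ?thesis using low by linarith
  qed
 qed
qed

lemma pm_mid: "3 / 10 <= snd pm" "snd pm <= 7 / 10"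
proof -
 have "0 < snd pm" "snd pm < 1" using strip[OF pm(1)] .
 then have "u (fst pm, snd pm) <= 33 / 10 * min (snd pm) (1 - snd pm)" by (intro u_le_wall) auto
 then have *: "1 <= 33 / 10 * min (snd pm) (1 - snd pm)" using pm(2) by simp
 then show "3 / 10 <= snd pm" "snd pm <= 7 / 10" by (auto simp: min_def split: if_splits)
qed

text \<open>The longitudinal entry is of order \<open>1 / l^2\<close> by hypothesis and
  \<open>Phi_x_le\<close>. Since the trace is at least \<open>k * u\<close>, the transverse entry is
  bounded below. The smallness of \<open>\<epsilon>\<close> lets half of the diagonal absorb the
  mixed term; for the upper bound \<open>cross_le\<close> does so.\<close>

lemma hessian_tube_of_Phi_x:
 assumes \<rho>: "0 < \<rho>" "\<rho> <= 1 / 20" "\<rho> <= 1 / 8" and \<alpha>: "0 < \<alpha>"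
  and low: "!!x y. \<bar>x - fst pm\<bar> <= \<rho> * l ==> 1 / 4 <= y ==> y <= 3 / 4 ==> \<alpha> / l^2 <= Phi (1, 0) u (x, y)"
  and cr: "!!x y. \<bar>x - fst pm\<bar> <= \<rho> * l ==> 1 / 4 <= y ==> y <= 3 / 4 ==> \<bar>cross (x, y)\<bar> <= \<epsilon> / l"
  and \<epsilon>: "0 <= \<epsilon>" "\<epsilon>^2 <= \<alpha> * (\<kappa> / 8) ^ 3 / 4" and large: "8 * (C1^2 + C4) <= \<kappa> / 8 * l^2" and bs: "64 * b <= 1"
 shows "hessian_tube l \<rho> (min \<alpha> (\<kappa> / 8) / 2) (2 * (4 * (C1^2 + C4) + 10 + 8712 / (\<kappa> / 8)) / (\<kappa> / 8))"
proof -
 define U where "U = \<kappa> / 8"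
 define X where "X = 4 * (C1^2 + C4)"
 define Y where "Y = 10 + 8712 / U"
 have U: "0 < U" "U <= 1" using \<kappa> by (auto simp: U_def)
 have X: "0 < X" using C4 by (simp add: X_def add_nonneg_pos)
 have Y: "0 < Y" using U by (simp add: Y_def add_pos_pos)
 have l2: "0 < l^2" "1 <= l^2" using l by (auto simp: one_le_power)
 show ?thesis unfolding hessian_tube_def U_def[symmetric] X_def[symmetric] Y_def[symmetric] add.assoc
 proof (intro conjI allI impI)
  fix p assume p: "\<bar>fst p - fst pm\<bar> <= \<rho> * l & \<bar>snd p - snd pm\<bar> <= \<rho>"
  obtain x y where pp: "p = (x, y)" by (cases p)
  have "\<rho> * l <= 1 / 8 * l" using \<rho> l by (intro mult_right_mono) auto
  then have x: "\<bar>x - fst pm\<bar> <= \<rho> * l" "\<bar>x - fst pm\<bar> <= l / 8" "\<bar>x - fst pm\<bar> <= l" using p l unfolding pp fst_conv snd_conv by linarith+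
  have y: "1 / 4 <= y" "y <= 3 / 4" using p pm_mid \<rho> unfolding pp fst_conv snd_conv by linarith+
  show G: "p \<in> G" unfolding pp by (rule tube_G) (use x y b in auto)
  have up: "U <= u p" "u p <= 1" "0 < u p" using u_deep[OF x(3), of "1 / 4" y] y bs le1 pos[OF G] by (auto simp: pp U_def)
  define A where "A = Phi (1, 0) u p"
  define B where "B = px u p * py u p / u p - py (px u) p"
  define D where "D = Phi (0, 1) u p"
  have form: "Phi (s, t) u p = A * s^2 + 2 * B * s * t + D * t^2" for s t
   unfolding A_def B_def D_def by (rule Phi_form[OF G])
  have A: "\<alpha> / l^2 <= A" unfolding A_def pp by (rule low[OF x(1) y])
  have A2: "A <= X / l^2" unfolding A_def pp X_def using Phi_x_le[OF x(2), of "1 / 4" y] y bs by (simp add: mult.commute)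
  have tr: "A + D = k * u p + ((px u p)^2 + (py u p)^2) / u p" unfolding A_def D_def by (rule Phi_trace[OF G])
  have "9 * U <= k * u p" using up U k_low pi_gt3 power_mono[of 3 pi 2] by (intro mult_mono) auto
  moreover have "0 <= ((px u p)^2 + (py u p)^2) / u p" using up by simp
  moreover have "X / l^2 <= U"
  proof -
   have "2 * X <= U * l^2" using large by (simp add: X_def U_def)
   then have "X <= U * l^2" using X by linarith
   then show ?thesis using l2 by (simp add: pos_divide_le_eq)
  qed
  ultimately have D: "U <= D" using tr A2 U by linarith
  have D2: "D <= Y"
  proof -
   have "(px u p)^2 <= 66^2" "(py u p)^2 <= 66^2" using partials_le[OF G] by (metis abs_ge_zero power2_abs power_mono)+
   then have "((px u p)^2 + (py u p)^2) / u p <= 8712 / U" using up U by (intro frac_le) auto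
   moreover have "k * u p <= 10 * 1" using k_le(1) up by (intro mult_mono) auto
   moreover have "0 <= A" using A \<alpha> l2 by (smt (verit) divide_nonneg_nonneg)
   ultimately show ?thesis using tr by (simp add: Y_def)
  qed
  have "B = - (cross p / u p)" using up by (simp add: B_def cross_def field_simps)
  then have "\<bar>B\<bar> = \<bar>cross p\<bar> / u p" using up by (simp add: abs_divide)
  also have "... <= \<epsilon> / l / U" using cr[OF x(1) y] up U \<epsilon> l unfolding pp by (intro frac_le) auto
  finally have B: "\<bar>B\<bar> <= \<epsilon> / l / U" .
  fix s t :: real
  define z where "z = s^2 / l^2 + t^2"
  have z: "0 <= z" by (simp add: z_def)
  have lower: "min \<alpha> U / 2 * z <= Phi (s, t) u p"
  proof -
   have "\<bar>2 * B * s * t\<bar> <= \<alpha> / l^2 * s^2 / 2 + U * t^2 / 2"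
   proof -
    define a where "a = sqrt \<alpha> * (\<bar>s\<bar> / l)"
    define c where "c = sqrt U * \<bar>t\<bar>"
    have "\<epsilon> <= sqrt \<alpha> * sqrt U * U / 2"
    proof (rule power2_le_imp_le)
     have "(sqrt \<alpha> * sqrt U * U / 2)^2 = \<alpha> * U ^ 3 / 4"
      using \<alpha> U by (simp add: power_mult_distrib power_divide) (simp add: power2_eq_square power3_eq_cube)
     then show "\<epsilon>^2 <= (sqrt \<alpha> * sqrt U * U / 2)^2" using \<epsilon> by (simp add: U_def)
    qed (use \<alpha> U in simp)
    then have "\<epsilon> / U <= sqrt \<alpha> * sqrt U / 2" using U by (simp add: field_simps)
    then have "\<epsilon> / U * (\<bar>s\<bar> / l * \<bar>t\<bar>) <= sqrt \<alpha> * sqrt U / 2 * (\<bar>s\<bar> / l * \<bar>t\<bar>)" using l by (intro mult_right_mono) auto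
    also have "... = a * c / 2" by (simp add: a_def c_def mult_ac)
    finally have e1: "\<epsilon> / U * (\<bar>s\<bar> / l * \<bar>t\<bar>) <= a * c / 2" .
    have "\<bar>2 * B * s * t\<bar> = 2 * (\<bar>B\<bar> * (\<bar>s\<bar> * \<bar>t\<bar>))" by (simp add: abs_mult)
    also have "... <= 2 * (\<epsilon> / l / U * (\<bar>s\<bar> * \<bar>t\<bar>))" using B by (intro mult_left_mono mult_right_mono) auto
    also have "... = 2 * (\<epsilon> / U * (\<bar>s\<bar> / l * \<bar>t\<bar>))" by (simp add: mult_ac)
    also have "... <= a * c" using e1 by linarith
    also have "... <= a^2 / 2 + c^2 / 2" using zero_le_power2[of "a - c"] by (simp add: power2_eq_square algebra_simps)
    also have "a^2 = \<alpha> / l^2 * s^2" using \<alpha> by (simp add: a_def power_mult_distrib power_divide)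
    also have "c^2 = U * t^2" using U by (simp add: c_def power_mult_distrib)
    finally show ?thesis .
   qed
   moreover have "\<alpha> / l^2 * s^2 <= A * s^2" "U * t^2 <= D * t^2" by (rule mult_right_mono[OF A] mult_right_mono[OF D], simp)+
   ultimately have "\<alpha> / l^2 * s^2 / 2 + U * t^2 / 2 <= Phi (s, t) u p" unfolding form by (simp only: abs_le_iff) linarith
   moreover have "min \<alpha> U * (s^2 / l^2) <= \<alpha> * (s^2 / l^2)" "min \<alpha> U * t^2 <= U * t^2" by (intro mult_right_mono; simp)+
   ultimately show ?thesis by (simp add: z_def algebra_simps)
  qed
  show "min \<alpha> U / 2 * (s^2 / l^2 + t^2) * u p <= Phi (s, t) u p"
  proof -
   have "min \<alpha> U / 2 * z * u p <= min \<alpha> U / 2 * z * 1" using up z \<alpha> U by (intro mult_left_mono) auto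
   then show ?thesis using lower unfolding z_def by linarith
  qed
  have B2: "B^2 <= A * D" unfolding A_def B_def D_def by (rule cross_le[OF G])
  have AD: "0 <= A" "0 <= D" using Phi_nonneg[OF G] by (auto simp: A_def D_def)
  have upper: "Phi (s, t) u p <= 2 * (X + Y) * z"
  proof -
   have "2 * B * s * t <= A * s^2 + D * t^2"
   proof -
    have "\<bar>B\<bar> <= sqrt A * sqrt D" using real_le_rsqrt[of "\<bar>B\<bar>" "A * D"] B2 by (simp add: real_sqrt_mult)
    then have "\<bar>B\<bar> * (\<bar>s\<bar> * \<bar>t\<bar>) <= sqrt A * sqrt D * (\<bar>s\<bar> * \<bar>t\<bar>)" by (intro mult_right_mono) auto
    moreover have "2 * B * s * t <= 2 * (\<bar>B\<bar> * (\<bar>s\<bar> * \<bar>t\<bar>))" using abs_ge_self[of "2 * B * s * t"] by (simp add: abs_mult)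
    moreover have "0 <= (sqrt A * \<bar>s\<bar> - sqrt D * \<bar>t\<bar>)^2" by simp
    moreover have "(sqrt A * \<bar>s\<bar> - sqrt D * \<bar>t\<bar>)^2 = A * s^2 + D * t^2 - 2 * (sqrt A * sqrt D * (\<bar>s\<bar> * \<bar>t\<bar>))"
     using AD by (simp add: power2_diff power_mult_distrib)
    ultimately show ?thesis by linarith
   qed
   moreover have "A * s^2 <= X / l^2 * s^2" "D * t^2 <= Y * t^2" by (rule mult_right_mono[OF A2] mult_right_mono[OF D2], simp)+
   moreover have "X * (s^2 / l^2) <= (X + Y) * (s^2 / l^2)" "Y * t^2 <= (X + Y) * t^2" using X Y by (intro mult_right_mono; simp)+
   moreover have "2 * (X + Y) * z = 2 * ((X + Y) * (s^2 / l^2)) + 2 * ((X + Y) * t^2)" by (simp add: z_def algebra_simps)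
   moreover have "X / l^2 * s^2 = X * (s^2 / l^2)" by simp
   ultimately show ?thesis unfolding form by linarith
  qed
  also have "... <= 2 * (X + Y) / U * z * u p"
  proof -
   have "2 * (X + Y) * z * 1 <= 2 * (X + Y) * z * (u p / U)" using X Y z up U by (intro mult_left_mono) auto
   then show ?thesis by simp
  qed
  finally show "Phi (s, t) u p <= 2 * (X + Y) / U * (s^2 / l^2 + t^2) * u p" by (simp add: z_def)
 qed (use \<rho> \<alpha> U X Y in auto)
qed

end

context long_ground
begin

lemma far_small:
 assumes "x0 + 112 * L <= x" "2 * exp (- 60) < \<tau>"
 shows "u (x, y) < \<tau>"
proof -
 have "60 * L <= 5 * (x - x0 - 100 * L)" using assms(1) by simp
 then have "60 <= 5 * (x - x0 - 100 * L) / L" using L by (simp add: pos_le_divide_eq)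
 then have "exp (- 5 * (x - x0 - 100 * L) / L) <= exp (- 60)"
  unfolding exp_le_cancel_iff mult_minus_left minus_divide_left[symmetric] by linarith
 moreover have "u (x, y) <= 2 * exp (- 5 * (x - x0 - 100 * L) / L)" by (rule far_right) (use assms(1) L in simp)
 ultimately show ?thesis using assms(2) by linarith
qed

text \<open>\<open>far_small\<close> confines the level set beyond \<open>x\<close> to a compact
  box, so a rightmost point exists. A value above \<open>\<tau>\<close> on its vertical line would
  persist a little further right by continuity.\<close>

lemma last_level:
 assumes \<tau>: "2 * exp (- 60) < \<tau>" and u: "\<tau> <= u (x, y)"
 obtains xm ym where "x <= xm" "xm <= x0 + 112 * L" "\<tau> <= u (xm, ym)" "!!x' y. x <= x' ==> \<tau> <= u (x', y) ==> x' <= xm" "!!y. u (xm, y) <= \<tau>"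
proof -
 have \<tau>0: "0 < \<tau>" using \<tau> by (rule order.strict_trans[rotated]) simp
 have inr: "x' <= x0 + 112 * L & 0 <= y' & y' <= 1" if "\<tau> <= u (x', y')" for x' y'
 proof -
  have "(x', y') \<in> G" using that \<tau>0 zero[of "(x', y')"] by force
  then show ?thesis using strip[of "(x', y')"] far_small[of x', OF _ \<tau>, of y'] that by force
 qed
 define K where "K = ({x..x0 + 112 * L} \<times> {0..1}) \<inter> {p. \<tau> <= u p}"
 have "compact K" unfolding K_def by (intro compact_Int_closed compact_Times closed_Collect_le continuous_intros cuS) auto
 moreover have "(x, y) \<in> K" using inr[OF u] u by (simp add: K_def)
 ultimately obtain q where q: "q \<in> K" "!!p. p \<in> K ==> fst p <= fst q"
  using continuous_attains_sup[of K fst] continuous_on_fst[OF continuous_on_id[of K]] by (metis empty_iff)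
 have max: "x' <= fst q" if "x <= x'" "\<tau> <= u (x', y')" for x' y'
  using q(2)[of "(x', y')"] inr[OF that(2)] that by (simp add: K_def)
 have xq: "x <= fst q" "\<tau> <= u (fst q, snd q)" using q(1) by (auto simp: K_def)
 have "u (fst q, y') <= \<tau>" for y'
 proof (rule ccontr)
  assume "\<not> u (fst q, y') <= \<tau>"
  then have o: "open {t. \<tau> < u (t, y')}" "fst q \<in> {t. \<tau> < u (t, y')}"
   by (auto intro!: open_Collect_less continuous_on_compose2[OF cu] continuous_intros)
  then obtain e where "e > 0" "!!t. \<bar>t - fst q\<bar> < e ==> \<tau> < u (t, y')"
   unfolding open_dist by (auto simp: dist_real_def)
  then show False using max[of "fst q + e / 2" y'] xq by (simp add: less_imp_le)
 qed
 then show ?thesis using xq q(1) max by (intro that[of "fst q" "snd q"]) (auto simp: K_def)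
qed

end

context tube
begin

lemma cross_small:
 assumes \<epsilon>: "0 < \<epsilon>" and d: "d = min (1 / 8) (\<epsilon> / (196 * C1))" "16 * b <= d" "2 * (C1 + 2) * C4 <= \<epsilon> * d^2 * l"
  and x: "\<bar>x - fst pm\<bar> <= l / 8" and y: "1 / 4 <= y" "y <= 3 / 4"
 shows "\<bar>cross (x, y)\<bar> <= \<epsilon> / l"
proof -
 have d0: "0 < d" "d <= 1 / 8" using \<epsilon> C1 by (auto simp: d(1))
 have "d <= \<epsilon> / (196 * C1)" by (simp add: d(1))
 then have "98 * C1 * d <= \<epsilon> / 2" using C1 by (simp add: pos_le_divide_eq algebra_simps)
 then have "98 * C1 * d / l <= \<epsilon> / 2 / l" using l by (intro divide_right_mono) auto
 moreover have "(C1 + 2) * C4 / (d^2 * l^2) <= \<epsilon> / 2 / l"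
  using d(3) d0 l by (simp add: divide_simps) (simp add: power2_eq_square mult_ac)
 moreover have "\<bar>cross (x, y)\<bar> <= 98 * C1 * d / l + (C1 + 2) * C4 / (d^2 * l^2)"
  by (rule cross_bound[OF d0(1) d(2) d0(2) x]) (use y d0 in auto)
 ultimately show ?thesis by simp
qed

text \<open>The slope \<open>px u / u\<close> vanishes at the maximum. It changes vertically at the
  rate \<open>cross / u^2\<close> and decreases to the right at the rate
  \<open>Phi (1, 0) u / u\<close>, both small here; to the left it only grows.\<close>

lemma slope_lower:
 assumes \<epsilon>: "0 <= \<epsilon>" "!!y. 1 / 4 <= y ==> y <= 3 / 4 ==> \<bar>cross (fst pm, y)\<bar> <= \<epsilon> / l" and bs: "64 * b <= 1"
  and \<rho>: "0 <= \<rho>" "x <= fst pm + \<rho> * l" "\<bar>x - fst pm\<bar> <= l / 8" and y: "1 / 4 <= y" "y <= 3 / 4"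
  and num: "64 * \<epsilon> / \<kappa>^2 + \<rho> * (32 * (C1^2 + C4) / \<kappa>) <= 1 / 192000"
 shows "- (1 / (192000 * l)) <= px u (x, y) / u (x, y)"
proof -
 define V where "V = (%x y. px u (x, y) / u (x, y))"
 have G: "(x, y) \<in> G" if "\<bar>x - fst pm\<bar> <= l" "1 / 4 <= y" "y <= 3 / 4" for x y using tube_G[OF that(1)] that b by simp
 have ul: "\<kappa> / 8 <= u (x, y)" if "\<bar>x - fst pm\<bar> <= l" "1 / 4 <= y" "y <= 3 / 4" for x y
  using u_deep[OF that(1), of "1 / 4" y] that bs by simp
 have K: "0 < 32 * (C1^2 + C4) / \<kappa>" using C4 \<kappa> by (simp add: add_nonneg_pos)
 have l0: "\<bar>fst pm - fst pm\<bar> <= l" using l by simp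
 have "V (fst pm) (snd pm) = 0" using grad_pm[of "(1, 0)"] by (simp add: V_def dirD_x)
 moreover have "norm (V (fst pm) y - V (fst pm) (snd pm)) <= 64 * \<epsilon> / \<kappa>^2 / l * norm (y - snd pm)"
 proof (rule field_differentiable_bound[of "{1 / 4..3 / 4}" "V (fst pm)" "%y. cross (fst pm, y) / (u (fst pm, y))^2"])
  fix z :: real assume z: "z \<in> {1 / 4..3 / 4}"
  then have z': "1 / 4 <= z" "z <= 3 / 4" by auto
  show "(V (fst pm) has_field_derivative cross (fst pm, z) / (u (fst pm, z))^2) (at z within {1 / 4..3 / 4})"
   unfolding V_def by (rule has_field_derivative_at_within[OF DERIV_slope_y[OF G[OF l0 z']]])
  have "(\<kappa> / 8)^2 <= (u (fst pm, z))^2" using ul[OF l0 z'] \<kappa> by (intro power_mono) auto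
  then have "\<bar>cross (fst pm, z)\<bar> / (u (fst pm, z))^2 <= \<epsilon> / l / (\<kappa> / 8)^2" using \<epsilon>(1) \<epsilon>(2)[OF z'] \<kappa> l by (intro frac_le) auto
  then show "norm (cross (fst pm, z) / (u (fst pm, z))^2) <= 64 * \<epsilon> / \<kappa>^2 / l" by (simp add: abs_divide power_divide mult.commute)
 qed (use y pm_mid in auto)
 moreover have "64 * \<epsilon> / \<kappa>^2 / l * norm (y - snd pm) <= 64 * \<epsilon> / \<kappa>^2 / l * 1"
  using y pm_mid \<epsilon> l by (intro mult_left_mono) (auto simp: abs_le_iff)
 ultimately have V0: "- (64 * \<epsilon> / \<kappa>^2 / l) <= V (fst pm) y" by (simp add: abs_le_iff)
 have "- (\<rho> * (32 * (C1^2 + C4) / \<kappa>) / l) <= V x y - V (fst pm) y"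
 proof (cases "x <= fst pm")
  case True
  have "V (fst pm) y <= V x y"
   using slope_antimono[of "(x, y)" "fst pm - x" "(1, 0)"] G[of x y] G[OF l0 y] \<rho> y True l by (simp add: V_def dirD_x)
  moreover have "0 <= \<rho> * (32 * (C1^2 + C4) / \<kappa>) / l"
   using mult_nonneg_nonneg[OF \<rho>(1) less_imp_le[OF K]] l by (intro divide_nonneg_nonneg) auto
  ultimately show ?thesis by linarith
 next
  case False
  have xs: "\<bar>z - fst pm\<bar> <= l / 8" "\<bar>z - fst pm\<bar> <= l" if "z \<in> {fst pm..x}" for z using that \<rho>(3) l by auto
  have "norm (V x y - V (fst pm) y) <= 32 * (C1^2 + C4) / \<kappa> / l^2 * norm (x - fst pm)"
  proof (rule field_differentiable_bound[of "{fst pm..x}" "%x. V x y" "%x. - (Phi (1, 0) u (x, y) / u (x, y))"])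
   fix z assume z: "z \<in> {fst pm..x}"
   note Gz = G[OF xs(2)[OF z] y]
   show "((%x. V x y) has_field_derivative - (Phi (1, 0) u (z, y) / u (z, y))) (at z within {fst pm..x})"
    using has_field_derivative_at_within[OF ln_line(2)[of "(0, y)" z "(1, 0)"]] Gz by (simp add: V_def dirD_x)
   have "Phi (1, 0) u (z, y) <= (C1^2 + C4) / (1 / 4 * l^2)" by (rule Phi_x_le[OF xs(1)[OF z]]) (use y bs in auto)
   then have "Phi (1, 0) u (z, y) / u (z, y) <= (C1^2 + C4) / (1 / 4 * l^2) / (\<kappa> / 8)"
    using ul[OF xs(2)[OF z] y] \<kappa> C4 l by (intro frac_le) auto
   then show "norm (- (Phi (1, 0) u (z, y) / u (z, y))) <= 32 * (C1^2 + C4) / \<kappa> / l^2"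
    using Phi_nonneg[OF Gz, of "(1, 0)"] pos[OF Gz] by (simp add: mult_ac)
  qed (use False in auto)
  also have "... <= 32 * (C1^2 + C4) / \<kappa> / l^2 * (\<rho> * l)"
   using \<rho> False by (intro mult_left_mono divide_nonneg_nonneg[OF less_imp_le[OF K]]) auto
  also have "... = \<rho> * (32 * (C1^2 + C4) / \<kappa>) / l" using l by (simp add: power2_eq_square)
  finally show ?thesis by (simp only: real_norm_def abs_le_iff) linarith
 qed
 moreover have "(64 * \<epsilon> / \<kappa>^2 + \<rho> * (32 * (C1^2 + C4) / \<kappa>)) / l <= 1 / 192000 / l" using num l by (intro divide_right_mono) auto
 ultimately show ?thesis using V0 unfolding V_def add_divide_distrib by simp
qed

text \<open>With \<open>\<tau> = \<kappa> / 32\<close>, \<open>u\<close> is at least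
  \<open>4 * \<tau>\<close> in the middle of the slice at \<open>x\<close> and at most
  \<open>\<tau>\<close> on the last slice \<open>xm\<close>. So \<open>ln u\<close> falls by ln 4 >
  1 over at most \<open>300 * L\<close>, and the slope at \<open>xm\<close> is at most -1 / (300 *
  L). At \<open>x\<close> it is at least -1 / (600 * L), as 192000 / 320 = 600; hence
  \<open>a = 1 / 600\<close>.\<close>

lemma Phi_x_right:
 assumes \<tau>: "\<tau> = \<kappa> / 32" "2 * exp (- 60) < \<tau>" "1000000 <= \<tau> ^ 3 * L" and bs: "64 * b <= 1" and lL: "l = L / 320"
  and x: "x0 < x" "\<bar>x - fst pm\<bar> <= l / 8" and d: "0 < d" "16 * b <= d" "d <= 1 / 4" and A: "0 <= A"
  and V: "!!y. 1 / 4 <= y ==> y <= 3 / 4 ==> - (1 / (192000 * l)) <= px u (x, y) / u (x, y)"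
  and num: "16000 * b^2 + 2 * d * ((C1^2 + 7 * C3) / l^2) + A < (\<tau>^2 / 2 ^ 45)^2 * (1 / 600) / (9600 * L^2)"
 shows "\<exists>s y. 0 <= s & s <= 1 & d <= y & y <= 1 - d & A * u (x + s, y) < Phi (1, 0) u (x + s, y)"
proof -
 have t: "0 < \<tau>" "\<tau> <= 1" using \<kappa> \<tau>(1) by auto
 have ul: "4 * \<tau> <= u (x', y)" if "\<bar>x' - fst pm\<bar> <= l" "1 / 4 <= y" "y <= 3 / 4" for x' y
  using u_deep[OF that(1), of "1 / 4" y] that bs \<tau>(1) by simp
 have x2: "\<bar>x + 2 - fst pm\<bar> <= l" "\<bar>x - fst pm\<bar> <= l" using x l by linarith+
 have "\<tau> <= u (x, 1 / 2)" using ul[OF x2(2), of "1 / 2"] t by simp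
 then obtain xm ym where m: "x <= xm" "xm <= x0 + 112 * L" "\<tau> <= u (xm, ym)" "!!x' y. x <= x' ==> \<tau> <= u (x', y) ==> x' <= xm" "!!y. u (xm, y) <= \<tau>"
  by (rule last_level[OF \<tau>(2)]) blast
 have xm2: "x + 2 <= xm" using m(4)[of "x + 2" "1 / 2"] ul[OF x2(1), of "1 / 2"] t by simp
 have xmL: "xm <= x + 300 * L" using m(2) x L by simp
 note mg = margin[OF t \<tau>(3)]
 have low: "\<tau>^2 / 2 ^ 45 <= u (x', y)" if x': "x <= x'" "x' <= xm" and y: "1 / 4 <= y" "y <= 3 / 4" for x' y
 proof -
  define r where "r = (x' - x) / (xm - x)"
  have r: "0 <= r" "r <= 1" using x' xm2 by (auto simp: r_def)
  have "\<tau> <= u ((x, 1 / 2) + r *\<^sub>R ((xm, ym) - (x, 1 / 2)))"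
   by (rule superlevel_segment[OF t(1) \<open>\<tau> <= u (x, 1 / 2)\<close> m(3) r])
  moreover have "(x, 1 / 2) + r *\<^sub>R ((xm, ym) - (x, 1 / 2)) = (x', 1 / 2 + r * (ym - 1 / 2))" using xm2 by (simp add: r_def)
  ultimately have "\<tau> <= u (x', 1 / 2 + r * (ym - 1 / 2))" by simp
  from tube_lower[OF t \<tau>(3) this, of y]
  have "\<tau>^2 / 2 ^ 42 * min (y - margin \<tau>) (1 - margin \<tau> - y) <= u (x', y)" using y mg t by simp
  moreover have "\<tau>^2 / 2 ^ 42 * (1 / 8) <= \<tau>^2 / 2 ^ 42 * min (y - margin \<tau>) (1 - margin \<tau> - y)"
   using y mg t by (intro mult_left_mono) auto
  ultimately show ?thesis by simp
 qed
 show ?thesis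
 proof (rule Phi_x_point[OF x d A xm2 xmL _ low _ num])
  show "0 < \<tau>^2 / 2 ^ 45" using t by simp
  fix y :: real assume y: "1 / 4 <= y" "y <= 3 / 4"
  define q where "q = xm - x"
  have q: "0 < q" "q <= 300 * L" using xm2 xmL by (auto simp: q_def)
  have G: "(x, y) \<in> G" "(xm, y) \<in> G"
   using tube_G[OF x2(2), of y] y b low[of xm y] m(1) zero[of "(xm, y)"] t by (force, force)
  have "q * (px u (xm, y) / u (xm, y)) <= ln (u (xm, y)) - ln (u (x, y))"
   using ln_slope(2)[OF G(1), of q "(1, 0)"] G(2) q by (simp add: q_def dirD_x)
  also have "... <= ln \<tau> - ln (4 * \<tau>)"
   using pos[OF G(1)] pos[OF G(2)] m(5)[of y] ul[OF x2(2) y] t by (intro diff_mono) simp_all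
  also have "... <= - 1"
  proof -
   have "ln (4 * \<tau>) = ln 2 + (ln 2 + ln \<tau>)" using ln_mult[of 2 "2 * \<tau>"] ln_mult[of 2 \<tau>] t by simp
   then show ?thesis using ln2_ge_two_thirds by linarith
  qed
  finally have "q * (px u (xm, y) / u (xm, y)) <= - 1" .
  then have "px u (xm, y) / u (xm, y) <= - 1 / q" unfolding pos_le_divide_eq[OF q(1)] by (simp only: mult.commute)
  also have "... <= - 1 / (300 * L)" using q L by (simp add: frac_le)
  finally have "px u (xm, y) / u (xm, y) <= - (1 / (300 * L))" by simp
  moreover have "- (1 / (600 * L)) <= px u (x, y) / u (x, y)" using V[OF y] by (simp add: lL)
  moreover have "1 / (300 * L) = 1 / (600 * L) + 1 / (600 * L)" by simp
  ultimately have "1 / (600 * L) <= px u (x, y) / u (x, y) - px u (xm, y) / u (xm, y)" by linarith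
  then show "1 / 600 / L <= px u (x, y) / u (x, y) - px u (xm, y) / u (xm, y)" by simp
 qed
qed

end

section \<open>Absolute constants for long domains\<close>

context tube
begin

lemma Phi_x_right_lower:
 assumes \<tau>: "\<tau> = \<kappa> / 32" "2 * exp (- 60) < \<tau>" "1000000 <= \<tau> ^ 3 * L" and bs: "64 * b <= 1" and lL: "l = L / 320"
  and \<epsilon>: "0 < \<epsilon>" "64 * \<epsilon> / \<kappa>^2 <= 1 / 400000" "d = min (1 / 8) (\<epsilon> / (196 * C1))" "16 * b <= d" "2 * (C1 + 2) * C4 <= \<epsilon> * d^2 * l"
  and \<rho>: "0 < \<rho>" "\<rho> <= 1 / 20" "\<rho> * (32 * (C1^2 + C4) / \<kappa>) <= 1 / 400000" "2 <= \<rho> * l"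
  and d': "0 < d'" "32 * b <= d'" "d' <= 1 / 4" and \<alpha>: "0 < \<alpha>"
  and num: "16000 * b^2 + 2 * d' * ((C1^2 + 7 * C3) / l^2) + \<alpha> / l^2 < (\<tau>^2 / 2 ^ 45)^2 * (1 / 600) / (9600 * L^2)"
  and e: "e = d' / 2" and n: "n = nat \<lceil>3 / crad \<kappa> \<eta> \<alpha> e\<rceil>" and x: "x0 <= x" "\<bar>x - fst pm\<bar> <= \<rho> / 2 * l" and y: "1 / 4 <= y" "y <= 3 / 4"
 shows "\<alpha> * (\<kappa> * e / 2) / 2 / 8 ^ n / l^2 <= Phi (1, 0) u (x, y)"
proof -
 have \<rho>l: "\<rho> * l <= 1 / 20 * l" using \<rho> l by (intro mult_right_mono) auto
 have x': "x0 < x + 1 / 2" "\<bar>x + 1 / 2 - fst pm\<bar> <= l / 8" "x + 1 / 2 <= fst pm + \<rho> * l" using x \<rho>(4) \<rho>l l by linarith+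
 have l8: "\<bar>fst pm - fst pm\<bar> <= l / 8" using l by simp
 have sum: "64 * \<epsilon> / \<kappa>^2 + \<rho> * (32 * (C1^2 + C4) / \<kappa>) <= 1 / 192000" using \<epsilon>(2) \<rho>(3) by linarith
 have V: "- (1 / (192000 * l)) <= px u (x + 1 / 2, y) / u (x + 1 / 2, y)" if "1 / 4 <= y" "y <= 3 / 4" for y
  by (rule slope_lower[OF _ cross_small[OF \<epsilon>(1,3,4,5) l8] bs _ x'(3,2) that sum]) (use \<epsilon> \<rho> in auto)
 have d2: "16 * b <= d'" "0 <= \<alpha> / l^2" using d' b \<alpha> by auto
 obtain s y2 where s: "0 <= s" "s <= 1" "d' <= y2" "y2 <= 1 - d'" "\<alpha> / l^2 * u (x + 1 / 2 + s, y2) < Phi (1, 0) u (x + 1 / 2 + s, y2)"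
  using Phi_x_right[OF \<tau> bs lL x'(1,2) d'(1) d2(1) d'(3) d2(2) V num] by blast
 have "\<alpha> * (\<kappa> * e / 2) / (2 * l^2) / 8 ^ n <= Phi (1, 0) u (x, y)"
  by (rule Phi_x_spread[OF _ d' s(3,4) \<alpha> less_imp_le[OF s(5)] _ _ _ e n])
   (use x x' \<rho>l s y d' l in linarith)+
 then show ?thesis by (simp add: mult_ac)
qed

end

context long_ground
begin

text \<open>From \<open>u = 1\<close> at the maximum, \<open>level_persist\<close> gives the level
  1/64 over the half-length L / 320, and \<open>tube_lower\<close> at this level gives \<kappa> =
  64^(-2) * 2^(-42) = 2^(-54). The value 10^(-7) of \<eta> meets the last condition of
  \<open>tube\<close> because b * L^2 = 2 * 10^9 * 64^4.\<close>

lemma tube_instance: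
 assumes "3 * 10 ^ 11 <= L"
 shows "tube G k u pm x0 L (L / 320) (margin (1 / 64)) (1 / 2 ^ 54) (1 / 10 ^ 7)" "margin (1 / 64) = 2 * 10 ^ 9 * 64 ^ 4 / L^2"
  "64 * margin (1 / 64) <= 1"
proof -
 have t: "0 < (1 / 64 :: real)" "(1 / 64 :: real) <= 1" "1000000 <= (1 / 64) ^ 3 * L" using assms by (auto simp: power_divide)
 note m = margin[OF t]
 show me: "margin (1 / 64) = 2 * 10 ^ 9 * 64 ^ 4 / L^2" by (simp add: margin_def power_divide)
 show "64 * margin (1 / 64) <= 1" using m by simp
 show "tube G k u pm x0 L (L / 320) (margin (1 / 64)) (1 / 2 ^ 54) (1 / 10 ^ 7)"
 proof
  show "k <= pi^2 + 1 / (L / 320)^2"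
  proof -
   have "100 / L^2 <= 1 / (L / 320)^2" by (simp add: power_divide divide_right_mono)
   then show ?thesis using kup by linarith
  qed
  show "100 * margin (1 / 64) * (1 / 10 ^ 7 * (L / 320))^2 <= 1"
   unfolding me using L by (simp add: power_mult_distrib power_divide)
  fix x y assume x: "\<bar>x - fst pm\<bar> <= L / 320" and y: "margin (1 / 64) <= y" "y <= 1 - margin (1 / 64)"
  have "\<exists>y'. 1 / 64 <= u (fst pm + (x - fst pm), y')"
   by (rule level_persist[where y = "snd pm"]) (use L x pm in auto)
  then obtain y' where y': "1 / 64 <= u (x, y')" by auto
  have "(x + 0, y) \<in> G" by (rule tube_box[OF t y' _ y]) (use L in auto)
  moreover have "(1 / 64)^2 / 2 ^ 42 * min (y - margin (1 / 64)) (1 - margin (1 / 64) - y) <= u (x, y)"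
   by (rule tube_lower[OF t y' y])
  ultimately show "(x, y) \<in> G & 1 / 2 ^ 54 * min (y - margin (1 / 64)) (1 - margin (1 / 64) - y) <= u (x, y)"
   by (simp add: power_divide)
 qed (use assms m in auto)
qed

end

lemma (in ground) Phi_x_mirror:
 assumes "(- x, y) \<in> G"
 shows "Phi (1, 0) (%q. u (- fst q, snd q)) (x, y) = Phi (1, 0) u (- x, y)"
proof -
 define T where "T = {q. (-1 * fst q, 1 * snd q) + (0, 0) \<in> G}"
 have r: "(-1::real)^2 = 1" "(1::real)^2 = 1" by auto
 have xT: "(x, y) \<in> T" using assms by (simp add: T_def)
 have e: "(-1 * fst q, 1 * snd q) + (0, 0) = (- fst q, snd q)" for q :: "real * real" by (simp add: prod_eq_iff)
 note h = helm_affine[OF hu r T_def, unfolded e] and h' = helm_affine[OF helm_partial_x[OF hu k_nonneg] r T_def, unfolded e]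
 have "has_grad (%q. (-1) * px u (- fst q, snd q) + 0 * px u (- fst q, snd q)) (x, y)
   ((-1) * (- 1 * px (px u) (- x, y)) + 0 * (- 1 * px (px u) (- x, y)))
   ((-1) * (1 * py (px u) (- x, y)) + 0 * (1 * py (px u) (- x, y)))"
  using has_grad_lincomb[OF helmD(2)[OF h'(1) xT] helmD(2)[OF h'(1) xT], of "-1" 0] h'(2,3)[OF xT] by simp
 then have "has_grad (px (%q. u (- fst q, snd q))) (x, y)
   ((-1) * (- 1 * px (px u) (- x, y)) + 0 * (- 1 * px (px u) (- x, y)))
   ((-1) * (1 * py (px u) (- x, y)) + 0 * (1 * py (px u) (- x, y)))"
  by (rule has_grad_cong[OF _ helmD(1)[OF h(1)] xT]) (simp add: h(2))
 from has_grad_partials(1)[OF this]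
 have "px (px (%q. u (- fst q, snd q))) (x, y) = px (px u) (- x, y)" by simp
 moreover have "dirD (1, 0) w = px w" for w by (simp add: dirD_def fun_eq_iff)
 ultimately show ?thesis using h(2)[OF xT] by (simp add: Phi_def)
qed

lemma long_ground_hessian_tube:
 "\<exists>c m M L1. 0 < c & 0 < m & 0 < M & (\<forall>G k u pm x0 L. long_ground G k u pm x0 L --> L1 <= L --> ground.hessian_tube G u pm L c m M)"
proof -
 define \<kappa> where "\<kappa> = 1 / (2::real) ^ 54"
 define \<eta> where "\<eta> = 1 / (10::real) ^ 7"
 have \<kappa>: "0 < \<kappa>" "0 < \<eta>" by (auto simp: \<kappa>_def \<eta>_def)
 define C1 where "C1 = c1 \<kappa>"
 define C3 where "C3 = c3 \<kappa> \<eta>"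
 define C4 where "C4 = c4 \<kappa> \<eta>"
 have C: "0 < C1" "0 < C3" "0 < C4" using c_pos[OF \<kappa>] by (auto simp: C1_def C3_def C4_def)
 \<comment> \<open>The order of choices matters. \<open>\<epsilon>\<close> and \<open>\<rho>\<close>
   are limited by \<open>slope_lower\<close>; \<open>\<alpha>\<close> and \<open>d'\<close> are set
   so that each of their terms takes at most a quarter of the available flux \<open>g / L^2\<close>;
   \<open>m\<close> is the bound for \<open>Phi (1, 0) u\<close> that results; and
   \<open>\<epsilon>'\<close> is then small relative to \<open>m\<close>.\<close>
 define \<epsilon> where "\<epsilon> = \<kappa>^2 / 64 / 400000"
 define d where "d = min (1 / 8) (\<epsilon> / (196 * C1))"
 define H where "H = 32 * (C1^2 + C4) / \<kappa>"
 define \<rho> where "\<rho> = min (1 / 20) (1 / (400000 * H))"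
 define \<tau> where "\<tau> = \<kappa> / 32"
 define g where "g = (\<tau>^2 / 2 ^ 45)^2 * (1 / 600) / 9600"
 define \<alpha> where "\<alpha> = g / (4 * 102400)"
 define C7 where "C7 = C1^2 + 7 * C3"
 define d' where "d' = min (1 / 4) (g / (8 * 102400 * C7))"
 define e where "e = d' / 2"
 define n where "n = nat \<lceil>3 / crad \<kappa> \<eta> \<alpha> e\<rceil>"
 define m where "m = \<alpha> * (\<kappa> * e / 2) / 2 / 8 ^ n"
 define \<epsilon>' where "\<epsilon>' = sqrt (m * (\<kappa> / 8) ^ 3 / 4)"
 define f where "f = min (1 / 8) (\<epsilon>' / (196 * C1))"
 have p: "0 < \<epsilon>" "0 < d" "0 < H" "0 < \<rho>" "0 < \<tau>" "0 < g" "0 < \<alpha>" "0 < C7" "0 < d'" "0 < e" "0 < m" "0 < \<epsilon>'" "0 < f"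
 proof -
  show 1: "0 < \<epsilon>" "0 < H" "0 < \<tau>" "0 < C7" using \<kappa> C by (auto simp: \<epsilon>_def H_def \<tau>_def C7_def add_nonneg_pos)
  then show 2: "0 < d" "0 < \<rho>" "0 < g" using C by (auto simp: d_def \<rho>_def g_def)
  then show 3: "0 < \<alpha>" "0 < d'" using 1 by (auto simp: \<alpha>_def d'_def)
  then show 4: "0 < e" "0 < m" using \<kappa> by (auto simp: e_def m_def)
  then show 5: "0 < \<epsilon>'" using \<kappa> by (auto simp: \<epsilon>'_def)
  then show "0 < f" using C by (auto simp: f_def)
 qed
 define B where "B = (2 * 10 ^ 9 * 64 ^ 4 :: real)"
 \<comment> \<open>Each entry is the length from which on one smallness condition below holds; the
   maximum of the list serves as threshold.\<close>
 define T where "T = [3 * 10 ^ 11, 1000000 / \<tau> ^ 3, 16 * B / d, 640 * (C1 + 2) * C4 / (\<epsilon> * d^2), 640 / \<rho>, 32 * B / d', 64000 * B^2 / g, 16 * B / f,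
   640 * (C1 + 2) * C4 / (\<epsilon>' * f^2), 8 * (C1^2 + C4) * 102400 * 8 / \<kappa>]"
 have right: "m / (L / 320)^2 <= Phi (1, 0) u (x, y)"
  if lg: "long_ground G k u pm x0 L" and hL: "\<forall>t\<in>set T. t <= L" and x: "x0 <= x" "\<bar>x - fst pm\<bar> <= \<rho> / 2 * (L / 320)" "1 / 4 <= y" "y <= 3 / 4"
  for G k u pm x0 L x y
 proof -
  interpret long_ground G k u pm x0 L by fact
  have L11: "3 * 10 ^ 11 <= L" using hL by (simp add: T_def)
  note ti = tube_instance[OF L11, folded \<kappa>_def \<eta>_def]
  interpret tube G k u pm x0 L "L / 320" "margin (1 / 64)" \<kappa> \<eta> by (rule ti(1))
  have L0: "0 < L" "1 <= L" using L11 by auto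
  have mB: "margin (1 / 64) = B / L^2" using ti(2) by (simp add: B_def)
  have bL: "c * (B / L^2) <= t" if "c * B / t <= L" "0 < t" for c t
  proof -
   have "c * B <= L * t" using that by (simp add: pos_divide_le_eq)
   also have "... <= L^2 * t" using L0 that by (simp add: power2_eq_square mult_right_mono)
   finally show ?thesis using L0 by (simp add: pos_divide_le_eq mult.commute)
  qed
  \<comment> \<open>Here \<open>\<tau>\<close> is exactly 2^(-59), and exp 1 > 2.\<close>
  have exp60: "2 * exp (- 60) < \<tau>"
  proof -
   have "(2::real) ^ 60 < exp 1 ^ 60" using exp_lower_Taylor_quadratic[of 1] by (intro power_strict_mono) auto
   also have "exp 1 ^ 60 = exp (60::real)" by (simp add: exp_of_nat_mult[symmetric])
   finally show ?thesis by (simp add: exp_minus \<tau>_def \<kappa>_def field_simps)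
  qed
  show ?thesis unfolding m_def
  proof (rule Phi_x_right_lower[OF \<tau>_def exp60 _ ti(3) refl p(1) _ d_def[unfolded C1_def] _ _ p(4) _ _ _ p(9) _ _ p(7) _ e_def n_def x])
   show "1000000 <= \<tau> ^ 3 * L" using hL p(5) by (simp add: T_def pos_divide_le_eq mult.commute)
   show "64 * \<epsilon> / \<kappa>^2 <= 1 / 400000" using \<kappa> by (simp add: \<epsilon>_def)
   show "16 * margin (1 / 64) <= d" "32 * margin (1 / 64) <= d'" unfolding mB using bL[of 16 d] bL[of 32 d'] hL p by (simp_all add: T_def)
   show "2 * (c1 \<kappa> + 2) * c4 \<kappa> \<eta> <= \<epsilon> * d^2 * (L / 320)"
    using hL p C by (simp add: T_def pos_divide_le_eq C1_def[symmetric] C4_def[symmetric] mult_ac)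
   show "\<rho> <= 1 / 20" "d' <= 1 / 4" by (auto simp: \<rho>_def d'_def)
   have "\<rho> <= 1 / (400000 * H)" by (simp add: \<rho>_def)
   then have "\<rho> * H <= 1 / 400000" using p by (simp add: pos_le_divide_eq mult_ac)
   then show "\<rho> * (32 * ((c1 \<kappa>)^2 + c4 \<kappa> \<eta>) / \<kappa>) <= 1 / 400000" by (simp only: H_def C1_def C4_def)
   show "2 <= \<rho> * (L / 320)" using hL p by (simp add: T_def pos_divide_le_eq mult.commute)
   have "16000 * (B / L^2)^2 <= g / 4 / L^2"
   proof -
    have "64000 * B^2 <= L * g" using hL p by (simp add: T_def pos_divide_le_eq)
    also have "... <= L^2 * g" using L0 p by (simp add: power2_eq_square mult_right_mono)
    finally have "64000 * B^2 / (L^2 * L^2) <= L^2 * g / (L^2 * L^2)" by (intro divide_right_mono) auto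
    moreover have "L^2 * g / (L^2 * L^2) = g / L^2"
     by (rule nonzero_mult_divide_mult_cancel_left) (use L0 in simp)
    moreover have "64000 * B^2 / (L^2 * L^2) = 4 * (16000 * (B / L^2)^2)" by (simp add: power_divide power2_eq_square)
    ultimately show ?thesis by simp
   qed
   moreover have "2 * d' * (C7 / (L / 320)^2) <= g / 4 / L^2"
   proof -
    have "d' <= g / (8 * 102400 * C7)" by (simp add: d'_def)
    then have "2 * 102400 * (d' * C7) <= g / 4" using p by (simp add: pos_le_divide_eq)
    then have "2 * 102400 * (d' * C7) / L^2 <= g / 4 / L^2" by (intro divide_right_mono) auto
    then show ?thesis by (simp add: power_divide mult_ac)
   qed
   moreover have "\<alpha> / (L / 320)^2 = g / 4 / L^2" by (simp add: \<alpha>_def power_divide)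
   moreover have "0 < g / 4 / L^2" using p L0 by simp
   moreover have "g / L^2 = 4 * (g / 4 / L^2)" by simp
   ultimately have "16000 * (B / L^2)^2 + 2 * d' * (C7 / (L / 320)^2) + \<alpha> / (L / 320)^2 < g / L^2" by linarith
   then show "16000 * (margin (1 / 64))^2 + 2 * d' * (((c1 \<kappa>)^2 + 7 * c3 \<kappa> \<eta>) / (L / 320)^2) + \<alpha> / (L / 320)^2
     < (\<tau>^2 / 2 ^ 45)^2 * (1 / 600) / (9600 * L^2)"
    unfolding mB C7_def C1_def C3_def by (simp add: g_def)
  qed
 qed
 have "ground.hessian_tube G u pm L (\<rho> / 2 / 320) (min m (\<kappa> / 8) / 2) (2 * (4 * (C1^2 + C4) + 10 + 8712 / (\<kappa> / 8)) / (\<kappa> / 8) * 320^2)"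
  if lg: "long_ground G k u pm x0 L" and hL: "Max (set T) <= L" for G k u pm x0 L
 proof -
  interpret long_ground G k u pm x0 L by fact
  have LT: "\<forall>t\<in>set T. t <= L" using hL Max_ge[OF finite_set] by (blast intro: order_trans)
  have L11: "3 * 10 ^ 11 <= L" using LT by (simp add: T_def)
  have L0: "0 < L" "1 <= L" using L11 by auto
  note ti = tube_instance[OF L11, folded \<kappa>_def \<eta>_def]
  interpret tube G k u pm x0 L "L / 320" "margin (1 / 64)" \<kappa> \<eta> by (rule ti(1))
  have "hessian_tube (L / 320) (\<rho> / 2) (min m (\<kappa> / 8) / 2) (2 * (4 * ((c1 \<kappa>)^2 + c4 \<kappa> \<eta>) + 10 + 8712 / (\<kappa> / 8)) / (\<kappa> / 8))"
  proof (rule hessian_tube_of_Phi_x[where \<epsilon> = \<epsilon>'])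
   show "0 < \<rho> / 2" "\<rho> / 2 <= 1 / 20" "\<rho> / 2 <= 1 / 8" using p(4) by (auto simp: \<rho>_def)
   show "\<epsilon>'^2 <= m * (\<kappa> / 8) ^ 3 / 4" using p \<kappa> by (simp add: \<epsilon>'_def)
   show "8 * ((c1 \<kappa>)^2 + c4 \<kappa> \<eta>) <= \<kappa> / 8 * (L / 320)^2"
   proof -
    have "8 * (C1^2 + C4) * 102400 * 8 <= L * \<kappa>" using LT \<kappa> by (simp add: T_def pos_divide_le_eq)
    also have "... <= L^2 * \<kappa>" using L0 \<kappa> by (simp add: power2_eq_square mult_right_mono)
    finally show ?thesis by (simp add: C1_def C4_def power_divide mult.commute)
   qed
   fix x y :: real assume x: "\<bar>x - fst pm\<bar> <= \<rho> / 2 * (L / 320)" and y: "1 / 4 <= y" "y <= 3 / 4"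
   have "\<rho> / 2 * (L / 320) <= 1 / 8 * (L / 320)" using L0 by (intro mult_right_mono) (auto simp: \<rho>_def)
   then have x8: "\<bar>x - fst pm\<bar> <= L / 320 / 8" using x by linarith
   show "\<bar>cross (x, y)\<bar> <= \<epsilon>' / (L / 320)"
   proof (rule cross_small[OF p(12) f_def[unfolded C1_def] _ _ x8 y])
    have "16 * B <= L * f" using LT p by (simp add: T_def pos_divide_le_eq)
    also have "... <= L^2 * f" using L0 p by (simp add: power2_eq_square mult_right_mono)
    finally show "16 * margin (1 / 64) <= f" unfolding ti(2) B_def using L0 by (simp add: pos_divide_le_eq mult.commute)
    show "2 * (c1 \<kappa> + 2) * c4 \<kappa> \<eta> <= \<epsilon>' * f^2 * (L / 320)"
     using LT p C by (simp add: T_def pos_divide_le_eq C1_def[symmetric] C4_def[symmetric] mult_ac)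
   qed
   show "m / (L / 320)^2 <= Phi (1, 0) u (x, y)"
   proof (cases "x0 <= x")
    case True then show ?thesis by (rule right[OF lg LT _ x y])
   next
    case False
    define A where "A = (%q::real\<times>real. (-1 * fst q, 1 * snd q + (1 - 1) / 2))"
    have Ae: "A = (%q. (- fst q, snd q))" by (simp add: A_def fun_eq_iff)
    have "long_ground (A -` G) k (%q. u (A q)) (A pm) (-1 * x0) L"
     by (rule long_ground_mirror(1)[OF lg _ _ A_def]) auto
    from right[OF this LT, of "- x" y] have "m / (L / 320)^2 <= Phi (1, 0) (%q. u (A q)) (- x, y)"
     using False x y by (simp add: Ae abs_minus_commute)
    moreover have "(- (- x), y) \<in> G" using tube_G[of x y] x8 y ti(3) L0 by simp
    ultimately show ?thesis using Phi_x_mirror[of "- x" y] by (simp add: Ae)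
   qed
  qed (use p ti in auto)
  from hessian_tube_rescale[OF this, of L 320] show ?thesis using L0 by (simp add: C1_def C4_def)
 qed
 moreover have "0 < \<rho> / 2 / 320" "0 < min m (\<kappa> / 8) / 2" using p \<kappa> by auto
 moreover have "0 < 2 * (4 * (C1^2 + C4) + 10 + 8712 / (\<kappa> / 8)) / (\<kappa> / 8) * 320^2" using C \<kappa> by (simp add: add_pos_pos add_nonneg_pos)
 ultimately show ?thesis by blast
qed

section \<open>Normalised convex domains\<close>

lemma dirichlet_ground:
 assumes c: "convex \<Omega>" and b: "bounded \<Omega>" and n: "normalised_first_eigenfunction \<Omega> u pm"
 obtains k where "ground (interior \<Omega>) k (%p. if p \<in> interior \<Omega> then u p else 0) pm"
proof -
 obtain k where k: "dirichlet_eigenfunction \<Omega> k u" and n': "!!p. p \<in> interior \<Omega> ==> 0 < u p" "pm \<in> \<Omega>" "u pm = 1" "!!p. p \<in> \<Omega> ==> u p <= 1"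
  using n by (auto simp: normalised_first_eigenfunction_def)
 have d: "continuous_on (closure \<Omega>) u" "helm (interior \<Omega>) k u" "!!p. p \<in> frontier \<Omega> ==> u p = 0"
  using k by (auto simp: dirichlet_eigenfunction_def helm_def)
 let ?w = "%p. if p \<in> interior \<Omega> then u p else 0"
 have "ground (interior \<Omega>) k ?w pm"
 proof
  show "open (interior \<Omega>)" "convex (interior \<Omega>)" "bounded (interior \<Omega>)"
   using c b by (auto intro: convex_interior bounded_interior)
  show "helm (interior \<Omega>) k ?w" by (rule helm_cong[OF d(2)]) simp
  have "continuous_on (closure \<Omega> \<union> - interior \<Omega>) ?w"
   by (rule continuous_on_cases) (use d in "auto simp: frontier_def")
  moreover have "closure \<Omega> \<union> - interior \<Omega> = UNIV" using interior_subset closure_subset by blast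
  ultimately show "continuous_on UNIV ?w" by simp
  show "?w p <= 1" for p using n'(4)[of p] interior_subset by auto
  have "pm \<in> closure \<Omega>" using n'(2) closure_subset by blast
  then show i: "pm \<in> interior \<Omega>" using d(3)[of pm] n'(3) by (auto simp: frontier_def)
  then show "?w pm = 1" using n' by simp
 qed (use n' in auto)
 then show ?thesis by (rule that)
qed

lemma measure_subset_Icc:
 fixes S :: "real set"
 assumes "S \<subseteq> {c..d}" "c <= d"
 shows "measure lborel S <= d - c"
proof (cases "S \<in> sets lborel")
 case True
 then have "measure lborel S <= measure lborel {c..d}" using assms by (intro measure_mono_fmeasurable) (auto simp: fmeasurable_def)
 then show ?thesis using assms by simp
qed (use assms in "simp add: measure_notin_sets")

section \<open>Geometry of a normalised domain\<close>

locale normalised =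
 fixes \<Omega> a b f1 f2 L
 assumes dom: "normalised_domain \<Omega> a b f1 f2" and len: "length_scale a b f1 f2 L"
begin

lemma mem_iff: "(x, y) \<in> \<Omega> \<longleftrightarrow> a <= x & x <= b & f1 x <= y & y <= f2 x"
 using dom unfolding normalised_domain_def by auto

lemma ab: "a < b" and f_bounds: "a <= x ==> x <= b ==> 0 <= f1 x & f1 x <= f2 x & f2 x <= 1"
 using dom unfolding normalised_domain_def by auto

lemma unit_height: "p \<in> \<Omega> ==> a <= fst p & fst p <= b & 0 <= snd p & snd p <= 1"
 using mem_iff[of "fst p" "snd p"] f_bounds[of "fst p"] by auto

lemma convex: "convex \<Omega>"
proof (rule convexI)
 fix p q and s t :: real
 assume p: "p \<in> \<Omega>" and q: "q \<in> \<Omega>" and st: "0 <= s" "0 <= t" "s + t = 1"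
 obtain x y x' y' where e: "p = (x, y)" "q = (x', y')" by (cases p, cases q)
 have m: "x \<in> {a..b}" "x' \<in> {a..b}" "f1 x <= y" "y <= f2 x" "f1 x' <= y'" "y' <= f2 x'" using p q by (auto simp: e mem_iff)
 have f: "convex_on {a..b} f1" "convex_on {a..b} (%x. - f2 x)" using dom by (auto simp: normalised_domain_def concave_on_def)
 have s: "s = 1 - t" using st by simp
 have "f1 (s * x + t * x') <= s * f1 x + t * f1 x'" "- f2 (s * x + t * x') <= s * - f2 x + t * - f2 x'"
  using convex_onD[OF f(1), of t x x'] convex_onD[OF f(2), of t x x'] m(1,2) st by (auto simp: s)
 moreover have "s * f1 x <= s * y" "t * f1 x' <= t * y'" "s * y <= s * f2 x" "t * y' <= t * f2 x'" using m st by (auto intro: mult_left_mono)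
 moreover have "s *\<^sub>R x + t *\<^sub>R x' \<in> {a..b}" using convexD[OF _ m(1,2) st] by simp
 ultimately show "s *\<^sub>R p + t *\<^sub>R q \<in> \<Omega>" by (auto simp: e mem_iff)
qed

lemma bounded: "bounded \<Omega>"
proof -
 have "\<Omega> \<subseteq> {a..b} \<times> {0..1}" using unit_height by fastforce
 then show ?thesis using bounded_Times bounded_closed_interval bounded_subset by metis
qed

lemma width: "norm v = 1 ==> 1 <= projection_length v \<Omega>"
proof -
 obtain x x' where x: "x \<in> {a..b}" "f1 x = 0" "x' \<in> {a..b}" "f2 x' = 1" using dom by (auto simp: normalised_domain_def)
 have "(x, 0) \<in> \<Omega>" "(x', 1) \<in> \<Omega>" using x f_bounds[of x] f_bounds[of x'] by (auto simp: mem_iff)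
 have "snd ` \<Omega> = {0..1}"
 proof (intro equalityI subsetI)
  fix y :: real assume y: "y \<in> {0..1}"
  have "(1 - y) *\<^sub>R (x, 0) + y *\<^sub>R (x', 1) \<in> \<Omega>" by (rule convexD[OF convex]) (use \<open>(x, 0) \<in> \<Omega>\<close> \<open>(x', 1) \<in> \<Omega>\<close> y in auto)
  then show "y \<in> snd ` \<Omega>" by force
 qed (use unit_height in auto)
 moreover have "(%p. p \<bullet> (0, 1)) = (snd :: real * real => real)" by (simp add: fun_eq_iff inner_prod_def)
 ultimately have "projection_length (0, 1) \<Omega> = 1" by (simp only: projection_length_def) simp
 moreover have "\<forall>v. norm v = 1 --> projection_length (0, 1) \<Omega> <= projection_length v \<Omega>"
  using dom unfolding normalised_domain_def by blast
 ultimately show "norm v = 1 ==> 1 <= projection_length v \<Omega>" by metis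
qed

lemma width_x: "1 <= b - a"
proof -
 have "1 <= projection_length (1, 0) \<Omega>" by (rule width) simp
 also have "... <= b - a" unfolding projection_length_def by (rule measure_subset_Icc) (use unit_height ab in auto)
 finally show ?thesis .
qed

lemma L_ge1: "1 <= L"
proof -
 have "admissible_length a b f1 f2 1" unfolding admissible_length_def
  by (intro conjI exI[of _ "{a..b}"]) (use width_x f_bounds is_interval_cc in auto)
 then show ?thesis using len by (auto simp: length_scale_def)
qed

text \<open>Otherwise the closure and its translate by (0, 1) are separated by a line, and the projection onto its normal is too short.\<close>

lemma vertical_chord:
 obtains x0 where "(x0, 0) \<in> closure \<Omega>" "(x0, 1) \<in> closure \<Omega>"
proof -
 let ?K = "closure \<Omega>" let ?T = "(%p. (0, 1) + p) ` closure \<Omega>"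
 have K: "compact ?K" "convex ?K" using bounded convex by (auto simp: compact_closure convex_closure)
 have T: "compact ?T" "convex ?T" using K by (auto intro: compact_translation convex_translation)
 have ne: "\<Omega> ~= {}" using width_x f_bounds[of a] mem_iff[of a "f1 a"] by auto
 have "?K \<inter> ?T ~= {}"
 proof
  assume "?K \<inter> ?T = {}"
  then obtain v c where v: "!!p. p \<in> ?K ==> v \<bullet> p < c" "!!p. p \<in> ?T ==> c < v \<bullet> p"
   using separating_hyperplane_compact_closed[OF K(2,1) _ T(2) compact_imp_closed[OF T(1)]] ne unfolding closure_eq_empty by blast
  obtain q where q: "q \<in> \<Omega>" using ne by blast
  have qv: "v \<bullet> q < c" "c < v \<bullet> ((0, 1) + q)" using v q closure_subset by blast+
  then have "v \<bullet> q < v \<bullet> q + snd v" by (simp add: inner_prod_def distrib_left)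
  then have v2: "0 < snd v" "v ~= 0" by auto
  have b: "c - snd v < v \<bullet> p" "v \<bullet> p < c" if "p \<in> ?K" for p
   using v(1)[OF that] v(2)[of "(0, 1) + p"] that by (auto simp: inner_prod_def algebra_simps)
  have cv: "continuous_on ?K (%p. v \<bullet> p)" by (intro continuous_intros)
  obtain p1 where p1: "p1 \<in> ?K" "!!p. p \<in> ?K ==> v \<bullet> p1 <= v \<bullet> p"
   using continuous_attains_inf[OF K(1) _ cv] ne unfolding closure_eq_empty by blast
  obtain p2 where p2: "p2 \<in> ?K" "!!p. p \<in> ?K ==> v \<bullet> p <= v \<bullet> p2"
   using continuous_attains_sup[OF K(1) _ cv] ne unfolding closure_eq_empty by blast
  define n where "n = norm v"
  have n: "0 < n" "snd v <= n" using v2 norm_snd_le[of "snd v" "fst v"] by (auto simp: n_def)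
  have "1 <= projection_length (v /\<^sub>R n) \<Omega>" by (rule width) (use v2 in "simp add: n_def")
  also have "... <= (v \<bullet> p2) / n - (v \<bullet> p1) / n" unfolding projection_length_def
  proof (rule measure_subset_Icc)
   show "(v \<bullet> p1) / n <= (v \<bullet> p2) / n" using p1 p2 n by (simp add: divide_right_mono)
   show "(%p. p \<bullet> (v /\<^sub>R n)) ` \<Omega> \<subseteq> {(v \<bullet> p1) / n..(v \<bullet> p2) / n}"
   proof (intro image_subsetI)
    fix p assume "p \<in> \<Omega>"
    then have "p \<in> ?K" using closure_subset by blast
    then show "p \<bullet> (v /\<^sub>R n) \<in> {(v \<bullet> p1) / n..(v \<bullet> p2) / n}"
     using p1(2)[of p] p2(2)[of p] n by (simp add: inner_commute[of p] divide_inverse mult.commute)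
   qed
  qed
  also have "... < n / n" unfolding diff_divide_distrib[symmetric] by (rule divide_strict_right_mono) (use b[OF p1(1)] b[OF p2(1)] n in auto)
  finally show False using n by simp
 qed
 then obtain p q where p: "p \<in> ?K" "q \<in> ?K" "p = (0, 1) + q" by blast
 have "closure \<Omega> \<subseteq> UNIV \<times> {0..1}" by (rule closure_minimal) (use unit_height in "force simp: closed_Times")+
 with p have "p \<in> UNIV \<times> {0..1}" "q \<in> UNIV \<times> {0..1}" by blast+
 then have "snd p <= 1" "0 <= snd q" by auto
 then have "q = (fst q, 0)" "p = (fst q, 1)" using p(3) by (auto simp: prod_eq_iff)
 then show ?thesis using p(1,2) that[of "fst q"] by metis
qed

lemma interior_segment:
 assumes "p \<in> interior \<Omega>" "q \<in> closure \<Omega>" "0 < t" "t <= 1"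
 shows "(1 - t) *\<^sub>R q + t *\<^sub>R p \<in> interior \<Omega>"
proof -
 have "q - t *\<^sub>R (q - p) = (1 - t) *\<^sub>R q + t *\<^sub>R p" by (simp add: algebra_simps)
 then show ?thesis using mem_interior_closure_convex_shrink[OF convex assms] by simp
qed

lemma strip: "p \<in> interior \<Omega> ==> 0 < snd p & snd p < 1"
proof -
 assume p: "p \<in> interior \<Omega>"
 have "\<Omega> \<subseteq> UNIV \<times> {0..1}" using unit_height by force
 then have "interior \<Omega> \<subseteq> UNIV \<times> {0<..<1}" using interior_mono[of \<Omega> "UNIV \<times> {0..1}"] by (simp add: interior_Times interior_atLeastAtMost_real)
 then show ?thesis using p by auto
qed

text \<open>Otherwise convexity with the full chord keeps every slice between \<open>x0\<close> and
  \<open>x\<close> at least as high, and this interval of length \<open>2 * L\<close> makes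
  \<open>2 * L\<close> admissible, since 1 / (2 * L)^2 = 1 / (4 * L^2).\<close>

lemma drop:
 assumes x0: "(x0, 0) \<in> closure \<Omega>" "(x0, 1) \<in> closure \<Omega>" and y: "(x, y) \<in> interior \<Omega>" "(x, y') \<in> interior \<Omega>" and x: "\<bar>x - x0\<bar> = 2 * L"
 shows "y' - y <= 1 - 1 / (4 * L^2)"
proof (rule ccontr)
 assume "\<not> ?thesis"
 then have h: "1 - 1 / (4 * L^2) < y' - y" by simp
 have y01: "0 < y" "y' < 1" using strip[OF y(1)] strip[OF y(2)] by auto
 \<comment> \<open>The end \<open>x0\<close> is left out: the chord lies only in the closure, and
   \<open>interior_segment\<close> needs \<open>0 < t\<close>. The length is unaffected.\<close>
 define I where "I = (if x0 < x then {x0<..x} else {x..<x0})"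
 have hI: "z \<in> {a..b} & 1 - 1 / (4 * L^2) <= f2 z - f1 z" if z: "z \<in> I" for z
 proof -
  define t where "t = (z - x0) / (x - x0)"
  have t: "0 < t" "t <= 1" "z = (1 - t) * x0 + t * x"
   using z x L_ge1 by (auto simp: t_def I_def field_simps split: if_splits)
  have "(1 - t) *\<^sub>R (x0, 0) + t *\<^sub>R (x, y) \<in> \<Omega>" "(1 - t) *\<^sub>R (x0, 1) + t *\<^sub>R (x, y') \<in> \<Omega>"
   using interior_segment[OF y(1) x0(1) t(1,2)] interior_segment[OF y(2) x0(2) t(1,2)] interior_subset by blast+
  then have m: "a <= z" "z <= b" "f1 z <= t * y" "1 - t + t * y' <= f2 z" using t(3) by (auto simp: mem_iff)
  have "t * (1 - (y' - y)) <= 1 * (1 - (y' - y))" using t y01 by (intro mult_right_mono) auto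
  with m h show ?thesis by (simp add: algebra_simps)
 qed
 have "admissible_length a b f1 f2 (2 * L)" unfolding admissible_length_def
 proof (intro conjI exI[of _ I])
  show "0 < 2 * L" using L_ge1 by simp
  show "is_interval I" by (auto simp: I_def)
  show "I \<subseteq> {a..b}" using hI by blast
  show "2 * L <= measure lborel I" using x L_ge1 by (auto simp: I_def)
  show "\<forall>x\<in>I. 1 - 1 / (2 * L)^2 <= f2 x - f1 x" using hI by (simp add: power_mult_distrib)
 qed
 then have "2 * L <= L" using len by (auto simp: length_scale_def)
 then show False using L_ge1 by simp
qed

text \<open>The triangle over the chord with apex \<open>(x, y)\<close> has a slice of height
  \<open>1 - t\<close> at distance \<open>2 * L\<close>, where t = 2 * L / |x - x0|. By
  \<open>drop\<close> this forces \<open>t >= 1 / (4 * L^2)\<close>.\<close>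

lemma length_le:
 assumes x0: "(x0, 0) \<in> closure \<Omega>" "(x0, 1) \<in> closure \<Omega>" and p: "(x, y) \<in> interior \<Omega>"
 shows "\<bar>x - x0\<bar> <= 8 * L ^ 3"
proof (cases "\<bar>x - x0\<bar> <= 2 * L")
 case True
 have "L * 1 <= L * L^2" using L_ge1 by (intro mult_left_mono) auto
 then have "L <= L ^ 3" by (simp add: power2_eq_square power3_eq_cube)
 then show ?thesis using True L_ge1 by linarith
next
 case False
 define t where "t = 2 * L / \<bar>x - x0\<bar>"
 have t: "0 < t" "t <= 1" "t * \<bar>x - x0\<bar> = 2 * L" using False L_ge1 by (auto simp: t_def)
 have "((1 - t) * x0 + t * x, t * y) \<in> interior \<Omega>" "((1 - t) * x0 + t * x, 1 - t + t * y) \<in> interior \<Omega>"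
  using interior_segment[OF p x0(1) t(1,2)] interior_segment[OF p x0(2) t(1,2)] by auto
 moreover have "\<bar>(1 - t) * x0 + t * x - x0\<bar> = 2 * L"
 proof -
  have "(1 - t) * x0 + t * x - x0 = t * (x - x0)" by (simp add: algebra_simps)
  then show ?thesis using t by (simp add: abs_mult)
 qed
 ultimately have "1 - t + t * y - t * y <= 1 - 1 / (4 * L^2)" by (rule drop[OF x0])
 then have "1 / (4 * L^2) <= t" by simp
 then have "1 / (4 * L^2) * \<bar>x - x0\<bar> <= 2 * L" unfolding t(3)[symmetric] by (intro mult_right_mono) auto
 then show ?thesis using L_ge1 by (simp add: field_simps power2_eq_square power3_eq_cube)
qed

lemma open_box_subset:
 assumes "!!x y. x1 < x ==> x < x2 ==> y1 < y ==> y < y2 ==> (x, y) \<in> closure \<Omega>"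
 shows "{x1<..<x2} \<times> {y1<..<y2} \<subseteq> interior \<Omega>"
proof -
 have "{x1<..<x2} \<times> {y1<..<y2} \<subseteq> interior (closure \<Omega>)" by (rule interior_maximal) (use assms in "auto intro: open_Times")
 then show ?thesis using convex_interior_closure[OF convex] by simp
qed

text \<open>Since \<open>b - a >= 1\<close>, some point lies at horizontal distance at least 1/2
  from the chord. The triangle it spans with the chord contains a box of fixed size next to the
  chord, which bounds the first eigenvalue from above for every \<open>L\<close>.\<close>

lemma unit_triangle_box:
 assumes x0: "(x0, 0) \<in> closure \<Omega>" "(x0, 1) \<in> closure \<Omega>"
 obtains x1 y1 where "{x1<..<x1 + 1 / 4} \<times> {y1<..<y1 + 1 / 2} \<subseteq> interior \<Omega>"
proof -
 obtain x y where q: "(x, y) \<in> \<Omega>" "1 / 2 <= \<bar>x - x0\<bar>"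
 proof (cases "1 / 2 <= \<bar>a - x0\<bar>")
  case True then show ?thesis using that[of a "f1 a"] f_bounds[of a] ab by (simp add: mem_iff)
 next
  case False
  then have "1 / 2 <= \<bar>b - x0\<bar>" using width_x by linarith
  then show ?thesis using that[of b "f1 b"] f_bounds[of b] ab by (simp add: mem_iff)
 qed
 define x1 where "x1 = (if x0 < x then x0 else x0 - 1 / 4)"
 have "(z, w) \<in> closure \<Omega>" if z: "x1 < z" "z < x1 + 1 / 4" "y / 2 < w" "w < y / 2 + 1 / 2" for z w
 proof -
  define t where "t = (z - x0) / (x - x0)"
  have t: "0 < t" "t < 1 / 2" "z = (1 - t) * x0 + t * x"
   using z q by (auto simp: t_def x1_def field_simps split: if_splits)
  define s where "s = (w - t * y) / (1 - t)"
  have y: "0 <= y" "y <= 1" using unit_height[OF q(1)] by auto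
  have ty: "t * y <= 1 / 2 * y" "(1 / 2 - t) * y <= (1 / 2 - t) * 1" using t y by (intro mult_right_mono mult_left_mono; simp)+
  then have s: "0 <= s" "s <= 1" using t z by (auto simp: s_def field_simps)
  have sw: "(1 - t) * s + t * y = w" using t by (simp add: s_def)
  have cl: "convex (closure \<Omega>)" by (rule convex_closure[OF convex])
  have "(1 - s) *\<^sub>R (x0, 0) + s *\<^sub>R (x0, 1) \<in> closure \<Omega>" by (rule convexD[OF cl x0]) (use s in auto)
  then have "(x0, s) \<in> closure \<Omega>" by (simp add: algebra_simps)
  then have "(1 - t) *\<^sub>R (x0, s) + t *\<^sub>R (x, y) \<in> closure \<Omega>"
   by (rule convexD[OF cl]) (use t q closure_subset in auto)
  then show ?thesis using t(3) sw by simp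
 qed
 then show ?thesis by (intro that[of x1 "y / 2"] open_box_subset)
qed

text \<open>On the interval \<open>I\<close> the sum of \<open>f1\<close> and \<open>1 - f2\<close>
  is at most \<open>1 / L^2\<close>, hence so is each of them. The box yields the upper bound for
  \<open>k\<close> when \<open>L\<close> is large.\<close>

lemma long_box:
 obtains c where "{c<..<c + L} \<times> {1 / L^2<..<1 - 1 / L^2} \<subseteq> interior \<Omega>"
proof -
 obtain I where I: "is_interval I" "I \<subseteq> {a..b}" "L <= measure lborel I" "!!x. x \<in> I ==> 1 - 1 / L^2 <= f2 x - f1 x"
  using len by (auto simp: length_scale_def admissible_length_def)
 have ne: "I ~= {}" using I(3) L_ge1 by auto
 have bd: "bdd_below I" "bdd_above I" using I(2) by (meson bdd_below_mono bdd_above_mono bdd_below_Icc bdd_above_Icc)+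
 have "I \<subseteq> {Inf I..Sup I}" using bd by (auto intro: cInf_lower cSup_upper)
 moreover from this have "Inf I <= Sup I" using ne by auto
 ultimately have "measure lborel I <= Sup I - Inf I" by (rule measure_subset_Icc)
 then have S: "Inf I + L <= Sup I" using I(3) by simp
 have "(x, y) \<in> closure \<Omega>" if xy: "Inf I < x" "x < Inf I + L" "1 / L^2 < y" "y < 1 - 1 / L^2" for x y
 proof -
  have "x < Sup I" using xy S by simp
  then obtain i j where ij: "i \<in> I" "i < x" "j \<in> I" "x < j"
   using xy(1) cInf_less_iff[OF ne bd(1)] less_cSup_iff[OF ne bd(2)] by auto
  then have x: "x \<in> I" using I(1) unfolding is_interval_1 by (meson less_imp_le)
  then have "a <= x" "x <= b" using I(2) by auto
  then have "(x, y) \<in> \<Omega>" using I(4)[OF x] f_bounds[of x] xy by (auto simp: mem_iff)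
  then show ?thesis using closure_subset by blast
 qed
 then show ?thesis by (intro that[of "Inf I"] open_box_subset)
qed

end

lemma (in ground) hessian_tube_mono:
 assumes H: "hessian_tube L c m M" and c: "0 < c'" "c' <= c" and m: "0 < m'" "m' <= m" and M: "M <= M'" and L: "0 <= L"
 shows "hessian_tube L c' m' M'"
 unfolding hessian_tube_def
proof (intro conjI allI impI c(1) m(1))
 show "0 < M'" using H M by (simp add: hessian_tube_def)
 fix p assume p: "\<bar>fst p - fst pm\<bar> <= c' * L & \<bar>snd p - snd pm\<bar> <= c'"
 have "c' * L <= c * L" using c L by (intro mult_right_mono)
 then have "\<bar>fst p - fst pm\<bar> <= c * L & \<bar>snd p - snd pm\<bar> <= c" using p c by linarith
 then have h: "p \<in> G & (\<forall>x y. m * (x^2 / L^2 + y^2) * u p <= Phi (x, y) u p & Phi (x, y) u p <= M * (x^2 / L^2 + y^2) * u p)"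
  using H unfolding hessian_tube_def by blast
 then show "p \<in> G" by blast
 fix x y :: real
 have "m' * (x^2 / L^2 + y^2) * u p <= m * (x^2 / L^2 + y^2) * u p" "M * (x^2 / L^2 + y^2) * u p <= M' * (x^2 / L^2 + y^2) * u p"
  using m M u_nonneg by (intro mult_right_mono; simp)+
 then show "m' * (x^2 / L^2 + y^2) * u p <= Phi (x, y) u p" "Phi (x, y) u p <= M' * (x^2 / L^2 + y^2) * u p"
  using h by (blast intro: order_trans)+
qed

section \<open>Hessian bounds for all lengths\<close>

context normalised
begin

lemma bounded_hessian_tube:
 assumes u: "ground (interior \<Omega>) k u pm" and L: "L <= L0" and r: "r = 1 / 4800" and D: "D = 17 * L0 ^ 3"
  and r2: "r2 = min (r / 3) (1 / (8 * D^2 * (50 * (8 / r) ^ 3)))" and n: "n = nat \<lceil>D / r2\<rceil>"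
 shows "ground.hessian_tube (interior \<Omega>) u pm L (r2 / 2 / L0) (1 / (8 * D^2) / 8 ^ n) (20 * (8 / r)^2 * L0^2)"
proof -
 interpret ground "interior \<Omega>" k u pm by fact
 obtain x0 where x0: "(x0, 0) \<in> closure \<Omega>" "(x0, 1) \<in> closure \<Omega>" by (rule vertical_chord)
 obtain x1 y1 where B: "{x1<..<x1 + 1 / 4} \<times> {y1<..<y1 + 1 / 2} \<subseteq> interior \<Omega>" by (rule unit_triangle_box[OF x0])
 have "k <= (pi / (1 / 8))^2 + (pi / (1 / 4))^2"
  by (rule eigenvalue_le_rectangle[of _ _ "x1 + 1 / 16" "y1 + 1 / 8"]) (use B in auto)
 moreover have "pi^2 <= 4^2" using pi_less_4 by (intro power_mono) auto
 ultimately have "k <= 30^2 * 2" by (simp add: power_divide)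
 have "pi^2 <= (3.2)^2" using pi_approx by (intro power_mono) auto
 \<comment> \<open>pi^2 * (64 + 16) is at most 80 * 10.24, below 900. With \<kappa> = 30 the radius
   1 / (160 * \<kappa>) becomes 1 / 4800.\<close>
 then have "k <= 30^2" using \<open>k <= (pi / (1 / 8))^2 + (pi / (1 / 4))^2\<close> by (simp add: power_divide)
 then have k: "sqrt k <= 30" by (intro real_le_lsqrt) (use k_nonneg in auto)
 have "1 <= L0 ^ 3" "L ^ 3 <= L0 ^ 3" using L L_ge1 by (auto intro: one_le_power power_mono)
 have D1: "1 <= D" using \<open>1 <= L0 ^ 3\<close> by (simp add: D)
 \<comment> \<open>Both points are within \<open>8 * L ^ 3\<close> of \<open>x0\<close> horizontally
   and at most 1 apart vertically, hence 17.\<close>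
 have Dp: "dist pm p <= D" if p: "p \<in> interior \<Omega>" for p
 proof -
  have "\<bar>fst p - x0\<bar> <= 8 * L ^ 3" "\<bar>fst pm - x0\<bar> <= 8 * L ^ 3" using length_le[OF x0, of "fst p" "snd p"] length_le[OF x0, of "fst pm" "snd pm"] p pm by auto
  moreover have "\<bar>snd pm - snd p\<bar> <= 1" using strip[OF p] strip[OF pm(1)] by auto
  moreover have "dist pm p <= \<bar>fst pm - fst p\<bar> + \<bar>snd pm - snd p\<bar>"
   unfolding dist_prod_def dist_real_def using sqrt_sum_squares_le_sum_abs by simp
  ultimately show ?thesis using \<open>1 <= L0 ^ 3\<close> \<open>L ^ 3 <= L0 ^ 3\<close> unfolding D by linarith
 qed
 have "hessian_tube 1 (r2 / 2) (1 / (8 * D^2) / 8 ^ n) (20 * (8 / r)^2)"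
  by (rule hessian_tube_bounded[OF _ k Dp D1 _ r2 n]) (simp_all add: r)
 from hessian_tube_rescale[OF this _ L_ge1, of L0] show ?thesis using L by simp
qed

lemma long_ground:
 assumes u: "ground (interior \<Omega>) k u pm" and L: "1000 <= L"
 obtains x0 where "long_ground (interior \<Omega>) k u pm x0 L"
proof -
 interpret ground "interior \<Omega>" k u pm by fact
 obtain x0 where x0: "(x0, 0) \<in> closure \<Omega>" "(x0, 1) \<in> closure \<Omega>" by (rule vertical_chord)
 obtain c where B: "{c<..<c + L} \<times> {1 / L^2<..<1 - 1 / L^2} \<subseteq> interior \<Omega>" by (rule long_box)
 define s where "s = 1 / L^2"
 have "1000^2 <= L^2" using L by (intro power_mono) auto
 then have s: "0 < s" "s <= 1 / 1000000" using L by (auto simp: s_def field_simps)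
 \<comment> \<open>Sides a little shorter than those of the open box put the closed rectangle inside
   it. In units of \<open>s = 1 / L^2\<close> the two terms exceed pi^2 by at most 10 * 100 / 81 +
   70, less than 100.\<close>
 have k: "k <= (pi / (9 / 10 * L))^2 + (pi / (1 - 3 * s))^2"
 proof (rule eigenvalue_le_rectangle[of _ _ "c + L / 20" "3 / 2 * s"])
  show "{c + L / 20..c + L / 20 + 9 / 10 * L} \<times> {3 / 2 * s..3 / 2 * s + (1 - 3 * s)} \<subseteq> interior \<Omega>"
   by (rule order_trans[OF _ B[folded s_def]]) (use L s in auto)
 qed (use L s in auto)
 have p10: "pi^2 <= 10"
 proof -
  have "pi^2 <= (3.15)^2" using pi_approx by (intro power_mono) auto
  then show ?thesis by (simp add: power2_eq_square)
 qed
 have "(pi / (9 / 10 * L))^2 = pi^2 * s * (100 / 81)" by (simp add: s_def power_divide power_mult_distrib)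
 moreover have "pi^2 * s <= 10 * s" using p10 s by (intro mult_right_mono) auto
 moreover have "(pi / (1 - 3 * s))^2 <= pi^2 * (1 + 7 * s)"
 proof -
  have "s * s <= 1 / 1000000 * s" using s by (intro mult_right_mono) auto
  moreover have "0 <= s * (s * s)" using s by simp
  moreover have "(1 + 7 * s) * (1 - 3 * s)^2 = 1 + s - 33 * (s * s) + 63 * (s * (s * s))" by (simp add: power2_eq_square algebra_simps)
  ultimately have "1 <= (1 + 7 * s) * (1 - 3 * s)^2" using s by linarith
  then have "pi^2 * 1 <= pi^2 * ((1 + 7 * s) * (1 - 3 * s)^2)" by (intro mult_left_mono) auto
  then show ?thesis using s by (simp add: power_divide pos_divide_le_eq mult.assoc)
 qed
 moreover have "pi^2 * (1 + 7 * s) = pi^2 + 7 * (pi^2 * s)" by (simp add: algebra_simps)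
 ultimately have "k <= pi^2 + 100 * s" using k s by linarith
 then have kup: "k <= pi^2 + 100 / L^2" by (simp add: s_def)
 have "long_ground (interior \<Omega>) k u pm x0 L"
 proof
  show "0 < snd p" "snd p < 1" if "p \<in> interior \<Omega>" for p using strip[OF that] by auto
  show "(x0, y) \<in> closure (interior \<Omega>)" if "0 <= y" "y <= 1" for y
  proof -
   have "(1 - y) *\<^sub>R (x0, 0) + y *\<^sub>R (x0, 1) \<in> closure \<Omega>"
    by (rule convexD[OF convex_closure[OF convex] x0]) (use that in auto)
   moreover have "closure (interior \<Omega>) = closure \<Omega>" using pm(1) by (intro convex_closure_interior convex) auto
   ultimately show ?thesis by (simp add: algebra_simps)
  qed
  show "y' - y <= 1 - 1 / (4 * L^2)" if "(x, y) \<in> interior \<Omega>" "(x, y') \<in> interior \<Omega>" "\<bar>x - x0\<bar> = 2 * L" for x y y'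
   by (rule drop[OF x0 that])
 qed (use L kup in auto)
 then show ?thesis by (rule that)
qed

end

lemma normalised_hessian_tube:
 "\<exists>c m M. 0 < c & 0 < m & 0 < M & (\<forall>\<Omega> a b f1 f2 L k u pm. normalised \<Omega> a b f1 f2 L --> ground (interior \<Omega>) k u pm -->
   ground.hessian_tube (interior \<Omega>) u pm L c m M)"
proof -
 obtain c1 m1 M1 L1 where long: "0 < c1" "0 < m1" "0 < M1"
  "!!G k u pm x0 L. long_ground G k u pm x0 L ==> L1 <= L ==> ground.hessian_tube G u pm L c1 m1 M1"
  using long_ground_hessian_tube by blast
 define L0 where "L0 = max 1000 L1"
 define r where "r = 1 / (4800::real)"
 define D where "D = 17 * L0 ^ 3"
 define r2 where "r2 = min (r / 3) (1 / (8 * D^2 * (50 * (8 / r) ^ 3)))"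
 define n where "n = nat \<lceil>D / r2\<rceil>"
 define c where "c = min c1 (r2 / 2 / L0)"
 define m where "m = min m1 (1 / (8 * D^2) / 8 ^ n)"
 define M where "M = max M1 (20 * (8 / r)^2 * L0^2)"
 have L0: "0 < L0" by (simp add: L0_def)
 then have "0 < r" "0 < D" by (auto simp: r_def D_def)
 then have "0 < r2" by (simp add: r2_def)
 then have p: "0 < c" "0 < m" "0 < M" using long \<open>0 < D\<close> L0 by (auto simp: c_def m_def M_def)
 have le: "c <= c1" "c <= r2 / 2 / L0" "m <= m1" "m <= 1 / (8 * D^2) / 8 ^ n" "M1 <= M" "20 * (8 / r)^2 * L0^2 <= M"
  by (auto simp: c_def m_def M_def)
 have "ground.hessian_tube (interior \<Omega>) u pm L c m M" if nd: "normalised \<Omega> a b f1 f2 L" and g: "ground (interior \<Omega>) k u pm" for \<Omega> a b f1 f2 L k u pm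
 proof -
  interpret normalised \<Omega> a b f1 f2 L by fact
  show ?thesis
  proof (cases "L <= L0")
   case True
   show ?thesis
    by (rule ground.hessian_tube_mono[OF g bounded_hessian_tube[OF g True r_def D_def r2_def n_def]]) (use p le L_ge1 in auto)
  next
   case False
   then have L: "1000 <= L" "L1 <= L" by (auto simp: L0_def)
   obtain x0 where "long_ground (interior \<Omega>) k u pm x0 L" by (rule long_ground[OF g L(1)])
   from long(4)[OF this L(2)] show ?thesis
    by (rule ground.hessian_tube_mono[OF g]) (use p le L_ge1 in auto)
  qed
 qed
 with p show ?thesis by blast
qed

lemma measure_cbox_projections:
 fixes c :: "real * real"
 assumes "0 < w" "0 < h"
 shows "measure lborel (fst ` cbox (c - (w, h)) (c + (w, h))) = 2 * w" "measure lborel (snd ` cbox (c - (w, h)) (c + (w, h))) = 2 * h"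
proof -
 have "cbox (c - (w, h)) (c + (w, h)) = {fst c - w..fst c + w} \<times> {snd c - h..snd c + h}"
  by (cases c) (simp add: cbox_Pair_eq)
 then show "measure lborel (fst ` cbox (c - (w, h)) (c + (w, h))) = 2 * w" "measure lborel (snd ` cbox (c - (w, h)) (c + (w, h))) = 2 * h"
  using assms by auto
qed

theorem theorem1p2:
  shows "\<exists>C K :: real. 0 < C \<and> 1 \<le> K \<and>
    (\<forall>\<Omega> a b f1 f2 L u xmax ymax.
       normalised_domain \<Omega> a b f1 f2 \<longrightarrow>
       length_scale a b f1 f2 L \<longrightarrow>
       normalised_first_eigenfunction \<Omega> u (xmax, ymax) \<longrightarrow>
       (\<forall>\<epsilon>. 0 < \<epsilon> \<and> \<epsilon> \<le> 1 / 2 \<longrightarrow>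
          (\<exists>R. axis_rectangle (xmax, ymax) R
             \<and> R \<subseteq> superlevel \<Omega> u (1 - \<epsilon>)
             \<and> superlevel \<Omega> u (1 - \<epsilon>) \<subseteq> dilation (xmax, ymax) K R
             \<and> inverse C * sqrt \<epsilon> * L \<le> measure lborel (fst ` R)
             \<and> measure lborel (fst ` R) \<le> C * sqrt \<epsilon> * L
             \<and> inverse C * sqrt \<epsilon> \<le> measure lborel (snd ` R)
             \<and> measure lborel (snd ` R) \<le> C * sqrt \<epsilon>)))"
proof -
 obtain c m M where p: "0 < c" "0 < m" "0 < M" and tube: "!!\<Omega> a b f1 f2 L k u pm. normalised \<Omega> a b f1 f2 L ==>
   ground (interior \<Omega>) k u pm ==> ground.hessian_tube (interior \<Omega>) u pm L c m M"
  using normalised_hessian_tube by blast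
 \<comment> \<open>The half-sides will be \<open>d * sqrt \<epsilon>\<close> times \<open>L\<close>
   and 1; \<open>superlevel_rectangle\<close> needs \<open>M * d^2 <= 1\<close>, which holds as M /
   (1 + M)^2 <= 1. The superlevel set extends at most \<open>A * sqrt \<epsilon>\<close> in the same
   units, so \<open>A / d\<close> suffices as dilation factor.\<close>
 define d where "d = min c (1 / (1 + M))"
 define A where "A = 2 / sqrt m + 4 / (m * c)"
 define C where "C = 2 * d + 1 / (2 * d)"
 define K where "K = max 1 (A / d)"
 have d: "0 < d" "d <= c" "M * d^2 <= 1"
 proof -
  show d: "0 < d" "d <= c" using p by (auto simp: d_def)
  have "d^2 <= (1 / (1 + M))^2" using d by (intro power_mono) (auto simp: d_def)
  then have "M * d^2 <= M * (1 / (1 + M))^2" using p by (intro mult_left_mono) auto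
  also have "... <= 1" using p by (simp add: power_divide power2_eq_square divide_le_eq algebra_simps)
  finally show "M * d^2 <= 1" .
 qed
 have K: "1 <= K" "A <= K * d" using d by (auto simp: K_def max_def field_simps)
 have C: "0 < C" "2 * d <= C" "inverse C <= 2 * d"
 proof -
  show "0 < C" "2 * d <= C" using d by (auto simp: C_def add_pos_pos)
  have "inverse C <= inverse (1 / (2 * d))" using d by (intro le_imp_inverse_le) (auto simp: C_def)
  then show "inverse C <= 2 * d" by simp
 qed
 show ?thesis
 proof (rule exI[of _ C], rule exI[of _ K], intro conjI allI impI C(1) K(1))
  fix \<Omega> a b f1 f2 L u xmax ymax \<epsilon>
  assume nd: "normalised_domain \<Omega> a b f1 f2" and ls: "length_scale a b f1 f2 L"
   and nu: "normalised_first_eigenfunction \<Omega> u (xmax, ymax)" and "0 < \<epsilon> & \<epsilon> <= (1 / 2 :: real)"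
  then have e: "0 < \<epsilon>" "\<epsilon> <= 1 / 2" by auto
  interpret normalised \<Omega> a b f1 f2 L by unfold_locales fact+
  obtain k where g: "ground (interior \<Omega>) k (%p. if p \<in> interior \<Omega> then u p else 0) (xmax, ymax)"
   by (rule dirichlet_ground[OF convex bounded nu])
  interpret ground "interior \<Omega>" k "%p. if p \<in> interior \<Omega> then u p else 0" "(xmax, ymax)" by fact
  note H = tube[OF normalised_axioms g]
  have L0: "0 < L" using L_ge1 by simp
  define w where "w = d * sqrt \<epsilon> * L"
  define h where "h = d * sqrt \<epsilon>"
  have wh: "0 < w" "0 < h" "w = h * L" using d e L0 by (auto simp: w_def h_def)
  define R where "R = cbox ((xmax, ymax) - (w, h)) ((xmax, ymax) + (w, h))"
  have R: "(xmax, ymax) + (s, t) \<in> R" if "\<bar>s\<bar> <= w" "\<bar>t\<bar> <= h" for s t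
   using that by (auto simp: R_def cbox_Pair_eq)
  show "\<exists>R. axis_rectangle (xmax, ymax) R & R \<subseteq> superlevel \<Omega> u (1 - \<epsilon>) & superlevel \<Omega> u (1 - \<epsilon>) \<subseteq> dilation (xmax, ymax) K R
    & inverse C * sqrt \<epsilon> * L <= measure lborel (fst ` R) & measure lborel (fst ` R) <= C * sqrt \<epsilon> * L
    & inverse C * sqrt \<epsilon> <= measure lborel (snd ` R) & measure lborel (snd ` R) <= C * sqrt \<epsilon>"
  proof (intro exI[of _ R] conjI subsetI)
   show "axis_rectangle (xmax, ymax) R" using wh unfolding axis_rectangle_def R_def by blast
   fix p assume "p \<in> R"
   then have "\<bar>fst p - xmax\<bar> <= w" "\<bar>snd p - ymax\<bar> <= h" by (auto simp: R_def cbox_Pair_eq abs_le_iff)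
   from superlevel_rectangle[OF H L0 e d this[unfolded w_def h_def]]
   have "p \<in> interior \<Omega>" "1 - \<epsilon> <= u p" by (auto split: if_splits)
   then show "p \<in> superlevel \<Omega> u (1 - \<epsilon>)" using interior_subset by (auto simp: superlevel_def)
  next
   fix p assume "p \<in> superlevel \<Omega> u (1 - \<epsilon>)"
   then have p: "p \<in> \<Omega>" "1 - \<epsilon> <= u p" by (auto simp: superlevel_def)
   have z: "\<forall>q\<in>frontier \<Omega>. u q = 0" using nu by (auto simp: normalised_first_eigenfunction_def dirichlet_eigenfunction_def)
   have pi: "p \<in> interior \<Omega>"
   proof (rule ccontr)
    assume "p \<notin> interior \<Omega>"
    then have "p \<in> frontier \<Omega>" using p(1) closure_subset by (auto simp: frontier_def)
    then show False using z p e by auto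
   qed
   define s where "s = fst p - xmax"
   define t where "t = snd p - ymax"
   have ps: "(xmax, ymax) + (s, t) = p" by (simp add: s_def t_def)
   have "max (\<bar>s\<bar> / L) \<bar>t\<bar> <= A * sqrt \<epsilon>"
    unfolding A_def by (rule superlevel_near[OF H L0 e]) (use ps pi p in auto)
   also have "... <= K * d * sqrt \<epsilon>" using K e by (intro mult_right_mono) auto
   finally have "\<bar>s\<bar> / L <= K * h" "\<bar>t\<bar> <= K * h" by (auto simp: h_def mult.assoc)
   then have "\<bar>s / K\<bar> <= w" "\<bar>t / K\<bar> <= h" using K L0 by (auto simp: wh(3) field_simps)
   then have "(xmax, ymax) + (s / K, t / K) \<in> R" by (rule R)
   moreover have "p = (xmax, ymax) + K *\<^sub>R ((xmax, ymax) + (s / K, t / K) - (xmax, ymax))"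
    using K by (simp add: s_def t_def prod_eq_iff)
   ultimately show "p \<in> dilation (xmax, ymax) K R" unfolding dilation_def by blast
  next
   have m: "measure lborel (fst ` R) = 2 * d * (sqrt \<epsilon> * L)" "measure lborel (snd ` R) = 2 * d * sqrt \<epsilon>"
    unfolding R_def measure_cbox_projections[OF wh(1,2)] by (auto simp: w_def h_def)
   have "0 <= sqrt \<epsilon> * L" "0 <= sqrt \<epsilon>" using e L0 by auto
   then show "inverse C * sqrt \<epsilon> * L <= measure lborel (fst ` R)" "measure lborel (fst ` R) <= C * sqrt \<epsilon> * L"
    "inverse C * sqrt \<epsilon> <= measure lborel (snd ` R)" "measure lborel (snd ` R) <= C * sqrt \<epsilon>"
    unfolding m mult.assoc[of _ "sqrt \<epsilon>" L] using C by (intro mult_right_mono; simp)+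
  qed
 qed
qed

end
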